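(* Let $\alpha>0$, let $\nu$ be a probability measure on $[\alpha,\infty[\times[\alpha,\infty[$, and let $Q_0^\nu$ be the probability measure on $(\Omega,\mathcal{F}_\infty)$ such that $Q_0^\nu(\Gamma_t)=E_0[1_{\Gamma_t}M_t^\nu]$ for all $t\ge0$, $\Gamma_t\in\mathcal{F}_t$, where $$M_t^\nu=\int_{\mathbb{R}_+^2}\Big(1-\frac{X_t^+}{a}\Big)\Big(1-\frac{X_t^-}{b}\Big)\exp\Big\{\frac12\Big(\frac1a+\frac1b\Big)L_t^0\Big\}1_{\{S_t\le a,\,I_t\le b\}}\,\nu(da,db).$$ 1. Under $Q_0^\nu$, $L_\infty^0$ is infinite, $S_\infty$ and $I_\infty$ are finite random variables, and the distribution of $(S_\infty,I_\infty)$ is $\nu$. 2. We have $$Q_0^\nu(\cdot)=\int_{[0,+\infty[^2}Q_0^{s,i}(\cdot)\,\nu(ds,di).$$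
   Context: $\Omega=\mathcal{C}(\mathbb{R}_+,\mathbb{R})$ is the canonical space, $(X_t)_{t\ge0}$ the coordinate process, $\mathcal{F}_t=\sigma(X_s;0\le s\le t)$, $\mathcal{F}_\infty=\sigma(X_s;s\ge0)$; $P_0$ is the Wiener measure started at $0$, with expectation $E_0$. $x^+=\max(x,0)$, $x^-=\max(-x,0)$, $S_t=\sup_{0\le u\le t}X_u$, $I_t=-\inf_{0\le u\le t}X_u$, $S_\infty=\lim_{t\to\infty}S_t$, $I_\infty=\lim_{t\to\infty}I_t$. $(L_t^0)$ is the local time at $0$ of $(X_t)$, normalized so that $|X_t|-L_t^0$ is a $P_0$-martingale; $L_\infty^0=\lim_{t\to\infty}L_t^0$. The process $(M_t^\nu)$ is a $P_0$-martingale with $M_0^\nu=1$. For $s,i>0$, $Q_0^{s,i}$ is the probability measure on $(\Omega,\mathcal{F}_\infty)$ defined as the law under $P_0$ of the solution $(Y_t^{s,i})$, with values in $]-i,s[$, of $$Y_t=X_t-\int_0^t\frac{1}{s-Y_u}1_{\{Y_u>0\}}\,du+\int_0^t\frac{1}{i+Y_u}1_{\{Y_u<0\}}\,du.$$ *)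

theory Defs
  imports "HOL-Probability.Probability"
begin

text \<open>Paths are functions on all of the reals that are continuous on \<open>[0,\<infinity>[\<close> and
  \<^const>\<open>undefined\<close> on the negative reals, so that two paths are equal as soon as they agree on
  \<open>[0,\<infinity>[\<close>. The coordinate process is \<open>X\<^sub>t(\<omega>) = \<omega> t\<close>.\<close>

definition path_set :: "(real \<Rightarrow> real) set" (\<open>\<Omega>\<close>) where
  "\<Omega> = {\<omega> \<in> extensional {0..}. continuous_on {0..} \<omega>}"

definition coord_sigma :: "real set \<Rightarrow> (real \<Rightarrow> real) measure" where
  "coord_sigma T = sigma \<Omega> {(\<lambda>\<omega>. \<omega> s) -` B \<inter> \<Omega> | s B. s \<in> T \<and> B \<in> sets borel}"

definition coord_filt :: "real \<Rightarrow> (real \<Rightarrow> real) measure" (\<open>\<F>\<close>) where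
  "\<F> t = coord_sigma {0..t}"

definition coord_filt_infty :: "(real \<Rightarrow> real) measure" (\<open>\<F>\<^sub>\<infinity>\<close>) where
  "\<F>\<^sub>\<infinity> = coord_sigma {0..}"

lemma space_coord_sigma [simp]: "space (coord_sigma T) = \<Omega>"
  unfolding coord_sigma_def by (rule space_measure_of) auto

lemma sets_coord_sigma:
  "sets (coord_sigma T) =
    sigma_sets \<Omega> {(\<lambda>\<omega>. \<omega> s) -` B \<inter> \<Omega> | s B. s \<in> T \<and> B \<in> sets borel}"
  unfolding coord_sigma_def by (rule sets_measure_of) auto

lemma sets_coord_sigma_mono: "S \<subseteq> T \<Longrightarrow> sets (coord_sigma S) \<subseteq> sets (coord_sigma T)"
  unfolding sets_coord_sigma by (rule sigma_sets_mono') blast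

lemma filtration_coord_filt: "filtration \<Omega> \<F>"
  by standard (auto simp: coord_filt_def intro: sets_coord_sigma_mono[THEN subsetD, rotated])

lemma subalgebra_coord_filt: "subalgebra \<F>\<^sub>\<infinity> (\<F> t)"
  by (auto simp: subalgebra_def coord_filt_def coord_filt_infty_def
      intro: sets_coord_sigma_mono[THEN subsetD, rotated])

definition wiener_measure :: "real \<Rightarrow> (real \<Rightarrow> real) measure \<Rightarrow> bool" where
  "wiener_measure x P \<longleftrightarrow>
     prob_space P \<and> sets P = sets \<F>\<^sub>\<infinity> \<and>
     (AE \<omega> in P. \<omega> 0 = x) \<and>
     (\<forall>s t. 0 \<le> s \<and> s < t \<longrightarrow>
        distributed P lborel (\<lambda>\<omega>. \<omega> t - \<omega> s)
          (\<lambda>y. ennreal (normal_density 0 (sqrt (t - s)) y)) \<and>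
        prob_space.indep_set P (sets (\<F> s))
          {(\<lambda>\<omega>. \<omega> t - \<omega> s) -` B \<inter> \<Omega> | B. B \<in> sets borel})"

definition adapted :: "(real \<Rightarrow> (real \<Rightarrow> real) \<Rightarrow> real) \<Rightarrow> bool" where
  "adapted Z \<longleftrightarrow> (\<forall>t\<ge>0. Z t \<in> borel_measurable (\<F> t))"

definition martingale ::
    "(real \<Rightarrow> real) measure \<Rightarrow> (real \<Rightarrow> (real \<Rightarrow> real) \<Rightarrow> real) \<Rightarrow> bool" where
  "martingale P Z \<longleftrightarrow>
     adapted Z \<and> (\<forall>t\<ge>0. integrable P (Z t)) \<and>
     (\<forall>s t. 0 \<le> s \<and> s \<le> t \<longrightarrow> (AE \<omega> in P. real_cond_exp P (\<F> s) (Z t) \<omega> = Z s \<omega>))"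

text \<open>Local time at 0 is first described up to a multiplicative constant \<open>c\<close>, as a continuous
  adapted version of the occupation density at 0. The martingale condition then fixes the
  normalization: by Tanaka's formula, it holds for \<open>c = 1/2\<close> only. The paths need only be
  well-behaved almost surely since the filtration is not completed.\<close>

definition local_time_zero ::
    "(real \<Rightarrow> real) measure \<Rightarrow> (real \<Rightarrow> (real \<Rightarrow> real) \<Rightarrow> real) \<Rightarrow> bool" where
  "local_time_zero P L \<longleftrightarrow>
     adapted L \<and>
     (AE \<omega> in P. L 0 \<omega> = 0 \<and> continuous_on {0..} (\<lambda>t. L t \<omega>) \<and> mono_on {0..} (\<lambda>t. L t \<omega>)) \<and>
     (\<exists>c>0. \<forall>t\<ge>0. AE \<omega> in P.
        ((\<lambda>\<epsilon>. c / \<epsilon> * measure lborel {u \<in> {0..t}. \<bar>\<omega> u\<bar> < \<epsilon>}) \<longlongrightarrow> L t \<omega>) (at_right 0)) \<and>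
     martingale P (\<lambda>t \<omega>. \<bar>\<omega> t\<bar> - L t \<omega>)"

definition sup_proc :: "real \<Rightarrow> (real \<Rightarrow> real) \<Rightarrow> real" where
  "sup_proc t \<omega> = (SUP u\<in>{0..t}. \<omega> u)"

definition inf_proc :: "real \<Rightarrow> (real \<Rightarrow> real) \<Rightarrow> real" where
  "inf_proc t \<omega> = - (INF u\<in>{0..t}. \<omega> u)"

definition limit_infty :: "(real \<Rightarrow> (real \<Rightarrow> real) \<Rightarrow> real) \<Rightarrow> (real \<Rightarrow> real) \<Rightarrow> ereal" where
  "limit_infty Z \<omega> = Lim at_top (\<lambda>t. ereal (Z t \<omega>))"

definition M_proc ::
    "(real \<times> real) measure \<Rightarrow> (real \<Rightarrow> (real \<Rightarrow> real) \<Rightarrow> real) \<Rightarrow>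
      real \<Rightarrow> (real \<Rightarrow> real) \<Rightarrow> real" where
  "M_proc \<nu> L t \<omega> =
     (LINT p:{0..} \<times> {0..}|\<nu>. case p of (a, b) \<Rightarrow>
        (1 - max (\<omega> t) 0 / a) * (1 - max (- \<omega> t) 0 / b)
        * exp (1 / 2 * (1 / a + 1 / b) * L t \<omega>)
        * of_bool (sup_proc t \<omega> \<le> a \<and> inf_proc t \<omega> \<le> b))"

text \<open>\<open>Y \<omega>\<close> is the path of the solution driven by the path \<open>\<omega>\<close>. The noise is additive, so that the
  equation makes sense path by path.\<close>

definition sde_solution ::
    "(real \<Rightarrow> real) measure \<Rightarrow> real \<Rightarrow> real \<Rightarrow> ((real \<Rightarrow> real) \<Rightarrow> (real \<Rightarrow> real)) \<Rightarrow> bool" where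
  "sde_solution P s i Y \<longleftrightarrow>
     Y \<in> measurable \<F>\<^sub>\<infinity> \<F>\<^sub>\<infinity> \<and> adapted (\<lambda>t \<omega>. Y \<omega> t) \<and>
     (AE \<omega> in P. \<forall>t\<ge>0.
        - i < Y \<omega> t \<and> Y \<omega> t < s \<and>
        Y \<omega> t = \<omega> t
          - (LINT u:{0..t}|lborel. 1 / (s - Y \<omega> u) * of_bool (Y \<omega> u > 0))
          + (LINT u:{0..t}|lborel. 1 / (i + Y \<omega> u) * of_bool (Y \<omega> u < 0)))"

definition sde_law ::
    "(real \<Rightarrow> real) measure \<Rightarrow> real \<Rightarrow> real \<Rightarrow> (real \<Rightarrow> real) measure \<Rightarrow> bool" where
  "sde_law P s i R \<longleftrightarrow> (\<exists>Y. sde_solution P s i Y \<and> R = distr P \<F>\<^sub>\<infinity> Y)"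

end

theory Submission
  imports Defs
begin

text \<open>For a Lipschitz potential \<open>f\<close> with \<open>f 0 = 0\<close>, consider the Euler scheme whose drift is the derivative of
  a mollification of \<open>f\<close>. Its law has an explicit density, a product of one-step Gaussian ratios, with respect
  to the sampled Wiener path. An Ito-Taylor expansion with summable errors shows that the density tends to
  \<open>exp (f (X\<^sub>T) - 1/2 \<integral> (f'' + f'\<^sup>2) (X\<^sub>u) du)\<close>. The relevant potential is
  \<open>f = ln (1 - x\<^sup>+ / s) + ln (1 - x\<^sup>- / i)\<close>, truncated near \<open>s\<close> and \<open>- i\<close>. It satisfies
  \<open>f'' + f'\<^sup>2 = 0\<close> away from \<open>0\<close>, and its kink at \<open>0\<close> produces the local time through the occupation
  density. The constant \<open>c\<close> in the occupation density must be \<open>1/2\<close>, since the same expansion for the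
  potentials \<open>k |x|\<close> determines the exponential moments of \<open>|X\<^sub>1| - L\<^sub>1 / 2c\<close>, and \<open>|X| - L\<close> has mean \<open>0\<close>.
  Since the drift is decreasing, the scheme converges pathwise to the diffusion. Removing the truncation
  identifies the density of \<open>Q s i\<close> on \<open>\<F> t\<close> with the integrand of \<open>M\<close>, up to the boundary events
  \<open>S\<^sub>t = s\<close> and \<open>I\<^sub>t = i\<close>, which carry no mass because \<open>M\<close> has mean \<open>1\<close>. This is the second part.

  For the first part, the density mass of the paths with \<open>L\<^sub>t \<le> c\<close> tends to \<open>0\<close>, so \<open>L\<close> is unbounded under
  every \<open>Q s i\<close>. If \<open>S\<close> stayed below some \<open>s' < s\<close>, the density for \<open>s\<close> would be smaller than one for a
  smaller endpoint by a factor \<open>exp (- \<delta> L)\<close>, hence \<open>S\<^sub>\<infinity> = s\<close>, and likewise \<open>I\<^sub>\<infinity> = i\<close>, almost surely.\<close>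

text \<open>No stochastic integral is formed: every change of measure is a product of finitely many
  Gaussian shifts, and the limits of densities and of schemes are taken path by path. Three
  obstacles shape the argument. The drift jumps at 0, so it is smoothed, and the Lipschitz constants
  of the smoothed drifts tend to infinity. A Gronwall estimate would lose a factor exploding with
  them, whereas a decreasing drift makes each Euler step nonexpansive, so that errors merely add up.
  The drift is also unbounded at the ends of the interval. Truncation keeps the densities bounded in
  L2, and continuous cutoffs vanish on all paths that could see the truncation. Finally, the
  measures obtained live on paths that are negligible under the Wiener measure on
  \<open>\<F>\<^sub>\<infinity>\<close>. Almost sure properties of \<open>L\<close> can therefore be
  transferred only through the sigma-algebras \<open>\<F> n\<close>, which are not
  completed.\<close>

section \<open>Second differences, Taylor's formula and occupation near 0\<close>

text \<open>If f is the second derivative of h, then \<open>sdiff e h\<close> is f averaged against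
  the tent kernel of half-width e, which is the uniform kernel convolved with itself. A
  mollification and its derivatives are thus plain differences, and no convolution integral has to
  be differentiated.\<close>

definition sdiff :: "real \<Rightarrow> (real \<Rightarrow> real) \<Rightarrow> real \<Rightarrow> real" where
  "sdiff e g x = (g (x + e) + g (x - e) - 2 * g x) / e\<^sup>2"

text \<open>Cauchy's mean value theorem on [0, e] for g (x + u) + g (x - u) against u^2. It asks
  only for a first derivative of g, so it covers functions whose second derivative jumps.\<close>

lemma sdiff_mvt:
  assumes g: "\<And>x. (g has_real_derivative g' x) (at x)" and e: "e > 0"
  shows "\<exists>z. 0 < z \<and> z < e \<and> sdiff e g x = (g' (x + z) - g' (x - z)) / (2 * z)"
proof -
  have d: "((\<lambda>u. g (x + u) + g (x - u)) has_real_derivative g' (x + u) - g' (x - u)) (at u)" for u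
    by (auto intro!: derivative_eq_intros DERIV_chain'[OF _ g])
  have d2: "((\<lambda>u::real. u\<^sup>2) has_real_derivative 2 * u) (at u)" for u
    by (auto intro!: derivative_eq_intros)
  have "\<exists>z. 0 < z \<and> z < e \<and> (g (x + e) + g (x - e) - (g (x + 0) + g (x - 0))) * (2 * z)
      = (e\<^sup>2 - 0\<^sup>2) * (g' (x + z) - g' (x - z))"
    using GMVT'[OF e, of "\<lambda>u. g (x + u) + g (x - u)" "\<lambda>u. u\<^sup>2" "\<lambda>u. 2 * u" "\<lambda>u. g' (x + u) - g' (x - u)"]
      d d2 DERIV_isCont[OF d] DERIV_isCont[OF d2] by simp
  then obtain z where z: "0 < z" "z < e"
    "(g (x + e) + g (x - e) - (g (x + 0) + g (x - 0))) * (2 * z)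
      = (e\<^sup>2 - 0\<^sup>2) * (g' (x + z) - g' (x - z))" by blast
  have "sdiff e g x = (g' (x + z) - g' (x - z)) / (2 * z)"
    using z e unfolding sdiff_def by (simp add: field_simps)
  then show ?thesis using z by blast
qed

lemma sdiff_bound:
  assumes g: "\<And>x. (g has_real_derivative g' x) (at x)" and e: "e > 0"
    and lip: "\<And>x y. \<bar>g' x - g' y\<bar> \<le> B * \<bar>x - y\<bar>"
  shows "\<bar>sdiff e g x\<bar> \<le> B"
proof -
  obtain z where z: "0 < z" "z < e" "sdiff e g x = (g' (x + z) - g' (x - z)) / (2 * z)"
    using sdiff_mvt[OF g e] by blast
  then show ?thesis using lip[of "x + z" "x - z"] by (simp add: divide_le_eq)
qed

lemma sdiff_nonpos:
  assumes g: "\<And>x. (g has_real_derivative g' x) (at x)" and e: "e > 0" and anti: "antimono g'"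
  shows "sdiff e g x \<le> 0"
proof -
  obtain z where z: "0 < z" "z < e" "sdiff e g x = (g' (x + z) - g' (x - z)) / (2 * z)"
    using sdiff_mvt[OF g e] by blast
  have "g' (x + z) \<le> g' (x - z)" using z by (intro antimonoD[OF anti]) auto
  then show ?thesis using z by (simp add: divide_le_0_iff)
qed

text \<open>Differentiability of \<open>g'\<close> at the single point x suffices: the quotient at
  the mean value point z is the average of the difference quotients of \<open>g'\<close> with
  increments z and - z.\<close>

lemma sdiff_tendsto:
  assumes g: "\<And>x. (g has_real_derivative g' x) (at x)"
    and g'': "(g' has_real_derivative d) (at x)"
    and e: "e \<longlonglongrightarrow> 0" "\<And>n. e n > (0::real)"
  shows "(\<lambda>n. sdiff (e n) g x) \<longlonglongrightarrow> d"
proof (rule LIMSEQ_I)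
  fix r :: real assume r: "0 < r"
  have "(\<lambda>h. (g' (x + h) - g' x) / h) \<midarrow>0\<rightarrow> d" using g'' by (simp add: DERIV_def)
  then obtain s where s: "s > 0" "\<And>h. h \<noteq> 0 \<Longrightarrow> \<bar>h\<bar> < s \<Longrightarrow> \<bar>(g' (x + h) - g' x) / h - d\<bar> < r"
    using r unfolding LIM_def by (auto simp: dist_real_def)
  obtain no where no: "\<And>n. n \<ge> no \<Longrightarrow> \<bar>e n\<bar> < s"
    using LIMSEQ_D[OF e(1) s(1)] by auto
  show "\<exists>no. \<forall>n\<ge>no. norm (sdiff (e n) g x - d) < r"
  proof (intro exI allI impI)
    fix n assume n: "n \<ge> no"
    obtain z where z: "0 < z" "z < e n" "sdiff (e n) g x = (g' (x + z) - g' (x - z)) / (2 * z)"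
      using sdiff_mvt[OF g e(2)] by blast
    have "\<bar>(g' (x + z) - g' x) / z - d\<bar> < r" "\<bar>(g' (x + (-z)) - g' x) / (-z) - d\<bar> < r"
      using no[OF n] z by (intro s(2); simp)+
    moreover have "sdiff (e n) g x - d
        = (((g' (x + z) - g' x) / z - d) + ((g' (x + (-z)) - g' x) / (-z) - d)) / 2"
      unfolding z(3) using z(1) by (simp add: field_simps)
    ultimately show "norm (sdiff (e n) g x - d) < r" by (simp add: abs_if split: if_splits)
  qed
qed

text \<open>The growth of order e^-2 here, and of order e^-1 in \<open>sdiff_bound_lip\<close>, is
  the price of mollification that the mesh of the Euler scheme has to beat.\<close>

lemma sdiff_lip:
  assumes "e > 0" and lip: "\<And>x y. \<bar>f x - f y\<bar> \<le> B * \<bar>x - y\<bar>"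
  shows "\<bar>sdiff e f x - sdiff e f y\<bar> \<le> 4 * B / e\<^sup>2 * \<bar>x - y\<bar>"
proof -
  have "\<bar>(f (x + e) - f (y + e)) + (f (x - e) - f (y - e)) - 2 * (f x - f y)\<bar> \<le> 4 * (B * \<bar>x - y\<bar>)"
    using lip[of "x + e" "y + e"] lip[of "x - e" "y - e"] lip[of x y] by simp
  moreover have "sdiff e f x - sdiff e f y =
     ((f (x + e) - f (y + e)) + (f (x - e) - f (y - e)) - 2 * (f x - f y)) / e\<^sup>2"
    unfolding sdiff_def using assms(1) by (simp add: field_simps)
  ultimately show ?thesis using assms(1) by (simp add: divide_right_mono)
qed

lemma sdiff_bound_lip:
  assumes "e > 0" and lip: "\<And>x y. \<bar>f x - f y\<bar> \<le> B * \<bar>x - y\<bar>"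
  shows "\<bar>sdiff e f x\<bar> \<le> 2 * B / e"
proof -
  have "\<bar>(f (x + e) - f x) + (f (x - e) - f x)\<bar> \<le> 2 * (B * e)"
    using lip[of "x + e" x] lip[of "x - e" x] assms(1) by simp
  then have "\<bar>(f (x + e) - f x) + (f (x - e) - f x)\<bar> / e\<^sup>2 \<le> 2 * (B * e) / e\<^sup>2"
    by (intro divide_right_mono) auto
  moreover have "sdiff e f x = ((f (x + e) - f x) + (f (x - e) - f x)) / e\<^sup>2"
    unfolding sdiff_def by simp
  ultimately show ?thesis using assms(1) by (simp add: power2_eq_square)
qed

text \<open>A tent of integral 2: the second derivative of the absolute value is twice a Dirac mass
  at 0. Through this tent the time spent near 0 enters the density.\<close>

lemma sdiff_abs: "e > 0 \<Longrightarrow> sdiff e abs x = 2 / e\<^sup>2 * max 0 (e - \<bar>x\<bar>)"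
  unfolding sdiff_def by (auto simp: abs_if max_def)

lemma sdiff_deriv:
  assumes "\<And>x. (g has_real_derivative g' x) (at x)"
  shows "(sdiff e g has_real_derivative sdiff e g' x) (at x)"
proof -
  have "((\<lambda>x. g (x + e) + g (x - e) - 2 * g x) has_real_derivative g' (x + e) + g' (x - e) - 2 * g' x) (at x)"
    by (auto intro!: derivative_eq_intros DERIV_chain'[OF _ assms])
  from DERIV_cdivide[OF this, of "e\<^sup>2"] show ?thesis unfolding sdiff_def[abs_def] .
qed

lemma sdiff_linear: "sdiff e (\<lambda>x. a * f x + g x) x = a * sdiff e f x + sdiff e g x"
  unfolding sdiff_def by (simp add: add_divide_distrib[symmetric] algebra_simps)

text \<open>The mean value inequality is used twice, first for the first-order remainder of
  \<open>f'\<close>, then for the second-order remainder of f. The constant K / 6 would be sharp;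
  only the cubic order matters.\<close>

lemma taylor_cubic:
  assumes f: "\<And>x. (f has_real_derivative f' x) (at x)" "\<And>x. (f' has_real_derivative f'' x) (at x)"
    and lip: "\<And>x y. \<bar>f'' x - f'' y\<bar> \<le> K * \<bar>x - y\<bar>"
  shows "\<bar>f y - f x - f' x * (y - x) - f'' x * (y - x)\<^sup>2 / 2\<bar> \<le> K * \<bar>y - x\<bar> ^ 3"
proof -
  have K: "K \<ge> 0" using lip[of 1 0] by simp
  have 1: "\<bar>f' z - f' x - f'' x * (z - x)\<bar> \<le> (K * \<bar>z - x\<bar>) * \<bar>z - x\<bar>" for z
  proof -
    have "norm ((\<lambda>w. f' w - f' x - f'' x * (w - x)) z - (\<lambda>w. f' w - f' x - f'' x * (w - x)) x)
        \<le> (K * \<bar>z - x\<bar>) * norm (z - x)"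
    proof (rule field_differentiable_bound[where S = "closed_segment x z" and f' = "\<lambda>w. f'' w - f'' x"])
      fix w assume w: "w \<in> closed_segment x z"
      show "((\<lambda>w. f' w - f' x - f'' x * (w - x)) has_field_derivative f'' w - f'' x) (at w within closed_segment x z)"
        by (auto intro!: derivative_eq_intros has_field_derivative_at_within[OF f(2)])
      have "\<bar>w - x\<bar> \<le> \<bar>z - x\<bar>" using segment_bound(1)[OF w] by (simp add: abs_minus_commute)
      then have "K * \<bar>w - x\<bar> \<le> K * \<bar>z - x\<bar>" using K by (rule mult_left_mono)
      then show "norm (f'' w - f'' x) \<le> K * \<bar>z - x\<bar>" using lip[of w x] by simp
    qed auto
    then show ?thesis by simp
  qed
  have "norm ((\<lambda>w. f w - f x - f' x * (w - x) - f'' x * (w - x)\<^sup>2 / 2) y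
      - (\<lambda>w. f w - f x - f' x * (w - x) - f'' x * (w - x)\<^sup>2 / 2) x) \<le> (K * \<bar>y - x\<bar> * \<bar>y - x\<bar>) * norm (y - x)"
  proof (rule field_differentiable_bound[where S = "closed_segment x y" and f' = "\<lambda>w. f' w - f' x - f'' x * (w - x)"])
    fix w assume w: "w \<in> closed_segment x y"
    show "((\<lambda>w. f w - f x - f' x * (w - x) - f'' x * (w - x)\<^sup>2 / 2) has_field_derivative
        f' w - f' x - f'' x * (w - x)) (at w within closed_segment x y)"
      by (auto intro!: derivative_eq_intros has_field_derivative_at_within[OF f(1)])
    have "\<bar>w - x\<bar> \<le> \<bar>y - x\<bar>" using segment_bound(1)[OF w] by (simp add: abs_minus_commute)
    then have "(K * \<bar>w - x\<bar>) * \<bar>w - x\<bar> \<le> (K * \<bar>y - x\<bar>) * \<bar>y - x\<bar>"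
      using K by (intro mult_mono) auto
    then show "norm (f' w - f' x - f'' x * (w - x)) \<le> K * \<bar>y - x\<bar> * \<bar>y - x\<bar>"
      using 1[of w] by simp
  qed auto
  then show ?thesis by (simp add: power3_eq_cube mult.assoc)
qed

lemma nn_integral_linear_0:
  assumes "a \<ge> 0" "e > 0"
  shows "(\<integral>\<^sup>+r. ennreal (a * r) * indicator {0<..<e} r \<partial>lborel) = ennreal (a * e\<^sup>2 / 2)"
proof -
  have "(\<integral>\<^sup>+r. ennreal (a * r) * indicator {0<..<e} r \<partial>lborel)
      = (\<integral>\<^sup>+r. ennreal (a * r) * indicator {0..e} r \<partial>lborel)"
  proof (rule nn_integral_cong_AE)
    show "AE r in lborel. ennreal (a * r) * indicator {0<..<e} r = ennreal (a * r) * indicator {0..e} r"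
      using AE_lborel_singleton[of 0] AE_lborel_singleton[of e]
      by eventually_elim (auto simp: indicator_def)
  qed
  also have "\<dots> = ennreal ((\<lambda>r. a * r\<^sup>2 / 2) e - (\<lambda>r. a * r\<^sup>2 / 2) 0)"
  proof (rule nn_integral_FTC_Icc)
    show "((\<lambda>r. a * r\<^sup>2 / 2) has_real_derivative a * x) (at x)" if "x \<in> {0..e}" for x
      by (auto intro!: derivative_eq_intros)
    show "0 \<le> a * x" if "x \<in> {0..e}" for x using assms that by simp
    show "(\<lambda>x. a * x) \<in> borel_measurable borel" by simp
    show "0 \<le> e" using assms by simp
  qed
  finally show ?thesis by simp
qed

text \<open>A tent is a superposition of indicators: e - |x u| is the length of the interval of
  radii r between |x u| and e. Fubini's theorem then exchanges time and radius.\<close>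

lemma layer_cake_tent:
  fixes x :: "real \<Rightarrow> real" and T :: real
  assumes x: "continuous_on {0..T} x" and e: "e > 0"
  shows "(\<integral>\<^sup>+u. ennreal (max 0 (e - \<bar>x u\<bar>)) * indicator {0..T} u \<partial>lborel)
    = (\<integral>\<^sup>+r. ennreal (measure lborel {u \<in> {0..T}. \<bar>x u\<bar> < r}) * indicator {0<..<e} r \<partial>lborel)"
proof -
  \<comment> \<open>Extension by 0 makes the integrand Borel on the whole line; only times in [0, T]
    are tested.\<close>
  define z where "z = (\<lambda>u. indicator {0..T} u *\<^sub>R x u)"
  have z[measurable]: "z \<in> borel_measurable borel"
    unfolding z_def by (rule borel_measurable_continuous_on_indicator) (use x in auto)
  have 1: "(\<integral>\<^sup>+r. indicator {\<bar>z u\<bar><..<e} r \<partial>lborel) = ennreal (max 0 (e - \<bar>z u\<bar>))" for u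
    by (cases "\<bar>z u\<bar> \<le> e") (auto simp: max_def)
  have "(\<integral>\<^sup>+u. ennreal (max 0 (e - \<bar>x u\<bar>)) * indicator {0..T} u \<partial>lborel)
      = (\<integral>\<^sup>+u. ennreal (max 0 (e - \<bar>z u\<bar>)) * indicator {0..T} u \<partial>lborel)"
    by (intro nn_integral_cong) (auto simp: z_def indicator_def)
  also have "\<dots> = (\<integral>\<^sup>+u. (\<integral>\<^sup>+r. indicator {\<bar>z u\<bar><..<e} r * indicator {0..T} u \<partial>lborel) \<partial>lborel)"
    by (intro nn_integral_cong, subst nn_integral_multc) (auto simp: 1)
  also have "\<dots> = (\<integral>\<^sup>+u. (\<integral>\<^sup>+r. indicator {p. \<bar>z (fst p)\<bar> < snd p \<and> snd p < e \<and> fst p \<in> {0..T}} (u, r) \<partial>lborel) \<partial>lborel)"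
    by (intro nn_integral_cong) (auto simp: indicator_def)
  also have "\<dots> = (\<integral>\<^sup>+r. (\<integral>\<^sup>+u. indicator {p. \<bar>z (fst p)\<bar> < snd p \<and> snd p < e \<and> fst p \<in> {0..T}} (u, r) \<partial>lborel) \<partial>lborel)"
    by (rule lborel_pair.Fubini') measurable
  also have "\<dots> = (\<integral>\<^sup>+r. ennreal (measure lborel {u \<in> {0..T}. \<bar>x u\<bar> < r}) * indicator {0<..<e} r \<partial>lborel)"
  proof (intro nn_integral_cong)
    fix r :: real
    have s: "{u \<in> {0..T}. \<bar>z u\<bar> < r} \<in> sets lborel" by measurable
    have f: "emeasure lborel {u \<in> {0..T}. \<bar>z u\<bar> < r} < \<infinity>"
      by (rule le_less_trans[OF emeasure_mono[of _ "{0..T}"]]) (auto simp: emeasure_lborel_Icc_eq)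
    have eq: "{u \<in> {0..T}. \<bar>x u\<bar> < r} = {u \<in> {0..T}. \<bar>z u\<bar> < r}" by (auto simp: z_def)
    have "(\<integral>\<^sup>+u. indicator {p. \<bar>z (fst p)\<bar> < snd p \<and> snd p < e \<and> fst p \<in> {0..T}} (u, r) \<partial>lborel)
        = (\<integral>\<^sup>+u. indicator {u \<in> {0..T}. \<bar>z u\<bar> < r} u * indicator {0<..<e} r \<partial>lborel)"
      by (intro nn_integral_cong) (auto simp: indicator_def)
    also have "\<dots> = emeasure lborel {u \<in> {0..T}. \<bar>z u\<bar> < r} * indicator {0<..<e} r"
      using s by (subst nn_integral_multc) auto
    finally show "(\<integral>\<^sup>+u. indicator {p. \<bar>z (fst p)\<bar> < snd p \<and> snd p < e \<and> fst p \<in> {0..T}} (u, r) \<partial>lborel)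
        = ennreal (measure lborel {u \<in> {0..T}. \<bar>x u\<bar> < r}) * indicator {0<..<e} r"
      using f unfolding eq by (simp add: emeasure_eq_ennreal_measure)
  qed
  finally show ?thesis .
qed

text \<open>The density at 0 is given for indicators of small intervals but is needed for tents. If
  the time spent within radius r is about l r / c, then integration over r < e gives l e^2 / (2 c),
  and the factor 2 / e^2 of the tent leaves l / c.\<close>

lemma occupation_tent:
  fixes x :: "real \<Rightarrow> real" and T :: real
  assumes x: "continuous_on {0..T} x" and c: "c > 0"
    and lim: "((\<lambda>e. c / e * measure lborel {u \<in> {0..T}. \<bar>x u\<bar> < e}) \<longlongrightarrow> l) (at_right 0)"
    and e: "e \<longlonglongrightarrow> 0" "\<And>n. e n > (0::real)"
  shows "(\<lambda>n. LINT u:{0..T}|lborel. sdiff (e n) abs (x u)) \<longlonglongrightarrow> l / c"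
proof (rule LIMSEQ_I)
  fix r :: real assume r: "0 < r"
  \<comment> \<open>Scaled so that the error is r / 2 after division by c.\<close>
  define r' where "r' = c * r / 2"
  have r': "r' > 0" using r c by (simp add: r'_def)
  let ?m = "\<lambda>e. measure lborel {u \<in> {0..T}. \<bar>x u\<bar> < e}"
  have l0: "l \<ge> 0"
    by (rule tendsto_lowerbound[OF lim]) (auto intro!: eventually_at_right_less[THEN eventually_mono] simp: c less_imp_le)
  have "eventually (\<lambda>e. dist (c / e * ?m e) l < r') (at_right 0)" by (rule tendstoD[OF lim r'])
  then obtain s where s: "s > 0" "\<And>e. 0 < e \<Longrightarrow> e < s \<Longrightarrow> \<bar>c / e * ?m e - l\<bar> < r'"
    unfolding eventually_at_right_field dist_real_def by auto
  obtain no where no: "\<And>n. n \<ge> no \<Longrightarrow> \<bar>e n\<bar> < s" using LIMSEQ_D[OF e(1) s(1)] by auto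
  show "\<exists>no. \<forall>n\<ge>no. norm ((LINT u:{0..T}|lborel. sdiff (e n) abs (x u)) - l / c) < r"
  proof (intro exI allI impI)
    fix n assume n: "n \<ge> no"
    let ?e = "e n"
    have e0: "?e > 0" by (rule e)
    define A where "A = (LINT u:{0..T}|lborel. max 0 (?e - \<bar>x u\<bar>))"
    have int: "set_integrable lborel {0..T} (\<lambda>u. max 0 (?e - \<bar>x u\<bar>))"
      by (intro borel_integrable_atLeastAtMost' continuous_intros x)
    have A0: "A \<ge> 0" unfolding A_def set_lebesgue_integral_def by (intro integral_nonneg_AE) (auto simp: indicator_def)
    have "ennreal A = (\<integral>\<^sup>+u. ennreal (indicator {0..T} u *\<^sub>R max 0 (?e - \<bar>x u\<bar>)) \<partial>lborel)"
      unfolding A_def set_lebesgue_integral_def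
      by (rule nn_integral_eq_integral[symmetric]) (use int in \<open>auto simp: set_integrable_def indicator_def\<close>)
    also have "\<dots> = (\<integral>\<^sup>+u. ennreal (max 0 (?e - \<bar>x u\<bar>)) * indicator {0..T} u \<partial>lborel)"
      by (intro nn_integral_cong) (auto simp: indicator_def)
    also have "\<dots> = (\<integral>\<^sup>+r. ennreal (?m r) * indicator {0<..<?e} r \<partial>lborel)"
      by (rule layer_cake_tent[OF x e0])
    finally have A: "ennreal A = (\<integral>\<^sup>+r. ennreal (?m r) * indicator {0<..<?e} r \<partial>lborel)" .
    have b: "?m q \<le> (l + r') / c * q \<and> (l - r') / c * q \<le> ?m q" if q: "0 < q" "q < ?e" for q
    proof -
      have "\<bar>c / q * ?m q - l\<bar> < r'" using s(2)[of q] no[OF n] q by auto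
      then have "l - r' < c / q * ?m q" "c / q * ?m q < l + r'"
        by (simp_all only: abs_less_iff) linarith+
      then show ?thesis using q c by (auto simp: field_simps)
    qed
    have "ennreal A \<le> (\<integral>\<^sup>+q. ennreal ((l + r') / c * q) * indicator {0<..<?e} q \<partial>lborel)"
      unfolding A by (intro nn_integral_mono) (use b in \<open>auto simp: indicator_def intro!: ennreal_leI\<close>)
    also have "\<dots> = ennreal ((l + r') / c * ?e\<^sup>2 / 2)"
      using l0 r' c e0 by (intro nn_integral_linear_0) auto
    finally have up: "A \<le> (l + r') / c * ?e\<^sup>2 / 2" using l0 r' c by (subst (asm) ennreal_le_iff) auto
    have lo: "(l - r') / c * ?e\<^sup>2 / 2 \<le> A"
    \<comment> \<open>The comparison integral needs a nonnegative slope; for a negative slope the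
      lower bound lies below 0 anyway.\<close>
    proof (cases "l - r' \<ge> 0")
      case True
      have "ennreal ((l - r') / c * ?e\<^sup>2 / 2) = (\<integral>\<^sup>+q. ennreal ((l - r') / c * q) * indicator {0<..<?e} q \<partial>lborel)"
        using True c e0 by (intro nn_integral_linear_0[symmetric]) auto
      also have "\<dots> \<le> ennreal A"
        unfolding A by (intro nn_integral_mono) (use b in \<open>auto simp: indicator_def intro!: ennreal_leI\<close>)
      finally show ?thesis using A0 by (simp add: ennreal_le_iff)
    next
      case False
      then have "(l - r') / c * ?e\<^sup>2 / 2 \<le> 0" using c by (simp add: divide_le_0_iff mult_le_0_iff)
      then show ?thesis using A0 by linarith
    qed
    have eq: "(LINT u:{0..T}|lborel. sdiff ?e abs (x u)) = 2 / ?e\<^sup>2 * A"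
      unfolding A_def sdiff_abs[OF e0] by simp
    have cancel: "2 / ?e\<^sup>2 * (q * ?e\<^sup>2 / 2) = q" for q using e0 by simp
    have 1: "2 / ?e\<^sup>2 * A \<le> (l + r') / c"
      using mult_left_mono[OF up, of "2 / ?e\<^sup>2"] unfolding cancel by simp
    have 2: "(l - r') / c \<le> 2 / ?e\<^sup>2 * A"
      using mult_left_mono[OF lo, of "2 / ?e\<^sup>2"] unfolding cancel by simp
    have 3: "(l + r') / c = l / c + r / 2" and 4: "(l - r') / c = l / c - r / 2"
      using c by (auto simp: r'_def add_divide_distrib diff_divide_distrib)
    show "norm ((LINT u:{0..T}|lborel. sdiff ?e abs (x u)) - l / c) < r"
      using 1 2 r unfolding eq real_norm_def 3 4 by (simp only: abs_less_iff) linarith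
  qed
qed

subsection \<open>Gaussian increments\<close>

definition gauss :: "real \<Rightarrow> real measure" where
  "gauss h = density lborel (\<lambda>y. ennreal (normal_density 0 (sqrt h) y))"

lemma sets_gauss [measurable_cong, simp]: "sets (gauss h) = sets borel"
  and space_gauss [simp]: "space (gauss h) = UNIV"
  by (simp_all add: gauss_def)

lemma prob_space_gauss: "h > 0 \<Longrightarrow> prob_space (gauss h)"
  unfolding gauss_def by (rule prob_space_normal_density) simp

lemma nn_integral_gauss:
  "f \<in> borel_measurable borel \<Longrightarrow>
    (\<integral>\<^sup>+y. f y \<partial>gauss h) = (\<integral>\<^sup>+y. ennreal (normal_density 0 (sqrt h) y) * f y \<partial>lborel)"
  unfolding gauss_def by (subst nn_integral_density) auto

lemma nn_integral_gauss_bochner: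
  assumes "has_bochner_integral lborel (\<lambda>y. normal_density 0 (sqrt h) y * f y) c"
    and [measurable]: "f \<in> borel_measurable borel" and "\<And>y. f y \<ge> 0"
  shows "(\<integral>\<^sup>+y. ennreal (f y) \<partial>gauss h) = ennreal c"
proof -
  have "(\<integral>\<^sup>+y. ennreal (f y) \<partial>gauss h) = (\<integral>\<^sup>+y. ennreal (normal_density 0 (sqrt h) y * f y) \<partial>lborel)"
    by (subst nn_integral_gauss) (auto simp: ennreal_mult' assms)
  also have "\<dots> = ennreal (\<integral>y. normal_density 0 (sqrt h) y * f y \<partial>lborel)"
    by (rule nn_integral_eq_integral) (use assms in \<open>auto simp: has_bochner_integral_iff\<close>)
  also have "\<dots> = ennreal c" using assms by (simp add: has_bochner_integral_iff)
  finally show ?thesis .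
qed

lemma gauss_square: "h > 0 \<Longrightarrow> (\<integral>\<^sup>+y. ennreal (y\<^sup>2) \<partial>gauss h) = ennreal h"
  using normal_moment_even[of "sqrt h" 0 1]
  by (intro nn_integral_gauss_bochner) (auto simp: fact_numeral)

lemma gauss_fourth: "h > 0 \<Longrightarrow> (\<integral>\<^sup>+y. ennreal (y ^ 4) \<partial>gauss h) = ennreal (3 * h\<^sup>2)"
  using normal_moment_even[of "sqrt h" 0 2]
  by (intro nn_integral_gauss_bochner) (auto simp: fact_numeral power2_eq_square)

text \<open>y^2 - h is centred with variance 2 h^2, so the cross term drops out. This orthogonality
  is what makes the variances of the quadratic variation terms add up.\<close>

lemma gauss_quadratic:
  assumes "h > 0"
  shows "(\<integral>\<^sup>+y. ennreal ((a + z * (y\<^sup>2 - h))\<^sup>2) \<partial>gauss h) = ennreal (a\<^sup>2 + 2 * z\<^sup>2 * h\<^sup>2)"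
proof (rule nn_integral_gauss_bochner)
  let ?n = "normal_density 0 (sqrt h)"
  have s: "sqrt h > 0" using assms by simp
  have 0: "has_bochner_integral lborel (\<lambda>y. ?n y * (y - 0) ^ (2 * 0)) 1"
    using normal_moment_even[OF s, of 0 0] by simp
  have 1: "has_bochner_integral lborel (\<lambda>y. ?n y * (y - 0) ^ (2 * 1)) h"
    using normal_moment_even[OF s, of 0 1] assms by (simp add: fact_numeral)
  have 2: "has_bochner_integral lborel (\<lambda>y. ?n y * (y - 0) ^ (2 * 2)) (3 * h\<^sup>2)"
    using normal_moment_even[OF s, of 0 2] assms by (simp add: fact_numeral power2_eq_square)
  have "has_bochner_integral lborel (\<lambda>y. (a - z * h)\<^sup>2 * (?n y * (y - 0) ^ (2 * 0))
      + 2 * (a - z * h) * z * (?n y * (y - 0) ^ (2 * 1)) + z\<^sup>2 * (?n y * (y - 0) ^ (2 * 2)))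
      ((a - z * h)\<^sup>2 * 1 + 2 * (a - z * h) * z * h + z\<^sup>2 * (3 * h\<^sup>2))"
    by (intro has_bochner_integral_add has_bochner_integral_mult_right 0 1 2)
  moreover have "(\<lambda>y. (a - z * h)\<^sup>2 * (?n y * (y - 0) ^ (2 * 0))
      + 2 * (a - z * h) * z * (?n y * (y - 0) ^ (2 * 1)) + z\<^sup>2 * (?n y * (y - 0) ^ (2 * 2)))
      = (\<lambda>y. ?n y * (a + z * (y\<^sup>2 - h))\<^sup>2)"
    by (simp add: fun_eq_iff power2_eq_square power4_eq_xxxx algebra_simps)
  moreover have "(a - z * h)\<^sup>2 * 1 + 2 * (a - z * h) * z * h + z\<^sup>2 * (3 * h\<^sup>2) = a\<^sup>2 + 2 * z\<^sup>2 * h\<^sup>2"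
    by (simp add: power2_eq_square algebra_simps)
  ultimately show "has_bochner_integral lborel (\<lambda>y. ?n y * (a + z * (y\<^sup>2 - h))\<^sup>2) (a\<^sup>2 + 2 * z\<^sup>2 * h\<^sup>2)"
    by (simp only:)
qed auto

lemma ennreal_affine_eq:
  assumes "q \<ge> 0" "w \<ge> 0" "b \<ge> 0" "y \<ge> (0::real)"
  shows "ennreal q * ennreal w + ennreal b * ennreal y = ennreal (q * w + b * y)"
  using assms by (simp add: ennreal_mult)

lemma ennreal_affine_le:
  assumes "x \<le> q * w + b * y" "q \<ge> 0" "w \<ge> 0" "b \<ge> 0" "y \<ge> (0::real)"
  shows "ennreal x \<le> ennreal q * ennreal w + ennreal b * ennreal y"
  using ennreal_leI[OF assms(1)] ennreal_affine_eq[OF assms(2-5)] by simp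

text \<open>Trades odd absolute moments for even ones, which are explicit for Gaussian variables.
  The value of q is later the standard deviation.\<close>

lemma abs_amgm:
  fixes q y :: real
  assumes "q > 0"
  shows "\<bar>y\<bar> \<le> q / 2 + 1 / (2 * q) * y\<^sup>2"
proof -
  have "0 \<le> (q - \<bar>y\<bar>)\<^sup>2" by simp
  then have "\<bar>y\<bar> * (2 * q) \<le> q * q + y\<^sup>2" by (simp add: power2_diff power2_eq_square[of q] algebra_simps)
  then have "\<bar>y\<bar> \<le> (q * q + y\<^sup>2) / (2 * q)" using assms by (simp only: pos_le_divide_eq)
  also have "\<dots> = q / 2 + 1 / (2 * q) * y\<^sup>2" using assms by (simp add: add_divide_distrib)
  finally show ?thesis .
qed

lemma gauss_abs:
  assumes "h > 0"
  shows "(\<integral>\<^sup>+y. ennreal \<bar>y\<bar> \<partial>gauss h) \<le> ennreal (sqrt h)"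
proof -
  interpret G: prob_space "gauss h" by (rule prob_space_gauss[OF assms])
  have "(\<integral>\<^sup>+y. ennreal \<bar>y\<bar> \<partial>gauss h) \<le> (\<integral>\<^sup>+y. ennreal (sqrt h / 2) + ennreal (1 / (2 * sqrt h)) * ennreal (y\<^sup>2) \<partial>gauss h)"
  proof (intro nn_integral_mono)
    fix y
    have "\<bar>y\<bar> \<le> sqrt h / 2 + 1 / (2 * sqrt h) * y\<^sup>2"
      using assms by (intro abs_amgm) simp
    then show "ennreal \<bar>y\<bar> \<le> ennreal (sqrt h / 2) + ennreal (1 / (2 * sqrt h)) * ennreal (y\<^sup>2)"
      using assms ennreal_affine_le[of "\<bar>y\<bar>" "sqrt h / 2" 1 "1 / (2 * sqrt h)" "y\<^sup>2"] by simp
  qed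
  also have "\<dots> = ennreal (sqrt h / 2) + ennreal (1 / (2 * sqrt h)) * ennreal h"
    using assms by (subst nn_integral_add) (auto simp: nn_integral_cmult gauss_square G.emeasure_space_1[simplified])
  also have "\<dots> = ennreal (sqrt h / 2 + 1 / (2 * sqrt h) * h)"
    using assms ennreal_affine_eq[of "sqrt h / 2" 1 "1 / (2 * sqrt h)" h] by simp
  also have "sqrt h / 2 + 1 / (2 * sqrt h) * h = sqrt h"
  proof -
    have "1 / (2 * sqrt h) * h = h / sqrt h / 2" by simp
    then show ?thesis using assms by (simp only: real_div_sqrt less_imp_le[OF assms] field_sum_of_halves)
  qed
  finally show ?thesis .
qed

lemma gauss_abs_cube:
  assumes "h > 0"
  shows "(\<integral>\<^sup>+y. ennreal (\<bar>y\<bar> ^ 3) \<partial>gauss h) \<le> ennreal (2 * h * sqrt h)"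
proof -
  have "(\<integral>\<^sup>+y. ennreal (\<bar>y\<bar> ^ 3) \<partial>gauss h)
      \<le> (\<integral>\<^sup>+y. ennreal (sqrt h / 2) * ennreal (y\<^sup>2) + ennreal (1 / (2 * sqrt h)) * ennreal (y ^ 4) \<partial>gauss h)"
  proof (intro nn_integral_mono)
    fix y
    have "\<bar>y\<bar> \<le> sqrt h / 2 + 1 / (2 * sqrt h) * y\<^sup>2"
      using assms by (intro abs_amgm) simp
    then have "\<bar>y\<bar> * y\<^sup>2 \<le> (sqrt h / 2 + 1 / (2 * sqrt h) * y\<^sup>2) * y\<^sup>2" by (rule mult_right_mono) simp
    then have "\<bar>y\<bar> ^ 3 \<le> sqrt h / 2 * y\<^sup>2 + 1 / (2 * sqrt h) * y ^ 4"
      by (simp add: power3_eq_cube power4_eq_xxxx power2_eq_square algebra_simps abs_mult_self_eq)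
    then show "ennreal (\<bar>y\<bar> ^ 3) \<le> ennreal (sqrt h / 2) * ennreal (y\<^sup>2) + ennreal (1 / (2 * sqrt h)) * ennreal (y ^ 4)"
      using assms by (intro ennreal_affine_le) auto
  qed
  also have "\<dots> = ennreal (sqrt h / 2) * ennreal h + ennreal (1 / (2 * sqrt h)) * ennreal (3 * h\<^sup>2)"
    using assms by (subst nn_integral_add) (auto simp: nn_integral_cmult gauss_square gauss_fourth)
  also have "\<dots> = ennreal (sqrt h / 2 * h + 1 / (2 * sqrt h) * (3 * h\<^sup>2))"
    using assms by (intro ennreal_affine_eq) auto
  also have "sqrt h / 2 * h + 1 / (2 * sqrt h) * (3 * h\<^sup>2) = 2 * h * sqrt h"
  proof -
    have "1 / (2 * sqrt h) * (3 * h\<^sup>2) = 3 * h * (h / sqrt h) / 2" by (simp add: power2_eq_square)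
    then show ?thesis using assms by (simp only: real_div_sqrt) simp
  qed
  finally show ?thesis .
qed

text \<open>The Cameron-Martin formula in one dimension: the exponential is the quotient of the
  densities of N(c h, h) and N(0, h).\<close>

lemma gauss_shift:
  assumes "h > 0" and [measurable]: "f \<in> borel_measurable borel"
  shows "(\<integral>\<^sup>+y. f (c * h + y) \<partial>gauss h) = (\<integral>\<^sup>+y. f y * ennreal (exp (c * y - c\<^sup>2 * h / 2)) \<partial>gauss h)"
proof -
  let ?n = "normal_density 0 (sqrt h)"
  have eq: "?n (y - c * h) = ?n y * exp (c * y - c\<^sup>2 * h / 2)" for y
  proof -
    have "- ((y - c * h)\<^sup>2) / (2 * h) = - (y\<^sup>2) / (2 * h) + (c * y - c\<^sup>2 * h / 2)"
      using assms(1) by (simp add: field_simps power2_eq_square)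
    then show ?thesis using assms(1) by (simp add: normal_density_def exp_add[symmetric])
  qed
  have "(\<integral>\<^sup>+y. f (c * h + y) \<partial>gauss h) = (\<integral>\<^sup>+y. ennreal (?n y) * f (c * h + y) \<partial>lborel)"
    by (rule nn_integral_gauss) measurable
  also have "\<dots> = (\<integral>\<^sup>+y. ennreal (?n (y - c * h)) * f y \<partial>lborel)"
    by (subst nn_integral_real_affine[where c = 1 and t = "c * h"]) auto
  also have "\<dots> = (\<integral>\<^sup>+y. ennreal (?n y) * (f y * ennreal (exp (c * y - c\<^sup>2 * h / 2))) \<partial>lborel)"
    by (intro nn_integral_cong) (simp add: eq ennreal_mult' mult_ac)
  also have "\<dots> = (\<integral>\<^sup>+y. f y * ennreal (exp (c * y - c\<^sup>2 * h / 2)) \<partial>gauss h)"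
    by (rule nn_integral_gauss[symmetric]) measurable
  finally show ?thesis .
qed

text \<open>The density is at most 1 / sqrt (2 pi h), hence at most 1 / (2 sqrt h), and the set is
  an interval of length 2 r. The bound is uniform in the centre a, so it survives conditioning on
  the past.\<close>

lemma gauss_small_ball:
  assumes "h > 0" "r \<ge> 0"
  shows "emeasure (gauss h) {y. \<bar>a + y\<bar> \<le> r} \<le> ennreal (r / sqrt h)"
proof -
  have "emeasure (gauss h) {y. \<bar>a + y\<bar> \<le> r} = emeasure (gauss h) {- r - a .. r - a}"
    by (intro arg_cong[where f = "emeasure _"]) auto
  also have "\<dots> = (\<integral>\<^sup>+y. ennreal (normal_density 0 (sqrt h) y) * indicator {- r - a .. r - a} y \<partial>lborel)"
    unfolding gauss_def by (subst emeasure_density) auto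
  also have "\<dots> \<le> (\<integral>\<^sup>+y. ennreal (1 / (2 * sqrt h)) * indicator {- r - a .. r - a} y \<partial>lborel)"
  proof (intro nn_integral_mono mult_right_mono ennreal_leI)
    fix y
    have "2 = sqrt (2\<^sup>2)" by simp
    also have "\<dots> \<le> sqrt (2 * pi)" unfolding real_sqrt_le_iff using pi_gt3 by simp
    finally have "1 / (sqrt (2 * pi) * sqrt h) \<le> 1 / (2 * sqrt h)" using assms by (intro divide_left_mono mult_right_mono) auto
    moreover have "exp (- (y\<^sup>2) / (2 * h)) \<le> 1" using assms by simp
    ultimately have "1 / (sqrt (2 * pi) * sqrt h) * exp (- (y\<^sup>2) / (2 * h)) \<le> 1 / (2 * sqrt h) * 1"
      using assms by (intro mult_mono) auto
    then show "normal_density 0 (sqrt h) y \<le> 1 / (2 * sqrt h)"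
      using assms by (simp add: normal_density_def real_sqrt_mult)
  qed simp
  also have "\<dots> = ennreal (1 / (2 * sqrt h)) * ennreal (2 * r)"
    using assms by (simp add: nn_integral_cmult emeasure_lborel_Icc_eq)
  also have "\<dots> = ennreal (r / sqrt h)"
    using assms by (subst ennreal_mult'[symmetric]) auto
  finally show ?thesis .
qed

subsection \<open>Paths\<close>

lemma path_continuous: "\<omega> \<in> \<Omega> \<Longrightarrow> continuous_on {0..T} \<omega>"
  unfolding path_set_def by (auto intro: continuous_on_subset)

lemma coord_measurable: "t \<in> T \<Longrightarrow> (\<lambda>\<omega>. \<omega> t) \<in> borel_measurable (coord_sigma T)"
  by (rule measurableI) (auto simp: sets_coord_sigma intro!: sigma_sets.Basic)

lemma F_coord [measurable]: "0 \<le> s \<Longrightarrow> s \<le> t \<Longrightarrow> (\<lambda>\<omega>. \<omega> s) \<in> borel_measurable (\<F> t)"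
  unfolding coord_filt_def by (rule coord_measurable) auto

lemma F_infty_coord [measurable]: "0 \<le> s \<Longrightarrow> (\<lambda>\<omega>. \<omega> s) \<in> borel_measurable \<F>\<^sub>\<infinity>"
  unfolding coord_filt_infty_def by (rule coord_measurable) auto

lemma space_F [simp]: "space (\<F> t) = \<Omega>" "space \<F>\<^sub>\<infinity> = \<Omega>"
  by (simp_all add: coord_filt_def coord_filt_infty_def)

lemma F_sub_infty: "sets (\<F> t) \<subseteq> sets \<F>\<^sub>\<infinity>"
  unfolding coord_filt_def coord_filt_infty_def by (rule sets_coord_sigma_mono) auto

lemma measurable_coord_sigmaI:
  assumes "\<And>x. x \<in> space M \<Longrightarrow> f x \<in> \<Omega>" and "\<And>s. s \<in> T \<Longrightarrow> (\<lambda>x. f x s) \<in> borel_measurable M"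
  shows "f \<in> measurable M (coord_sigma T)"
  unfolding coord_sigma_def
proof (rule measurable_measure_of)
  fix y assume "y \<in> {(\<lambda>\<omega>. \<omega> s) -` B \<inter> \<Omega> | s B. s \<in> T \<and> B \<in> sets borel}"
  then obtain s B where y: "y = (\<lambda>\<omega>. \<omega> s) -` B \<inter> \<Omega>" "s \<in> T" "B \<in> sets borel" by auto
  have "f -` y \<inter> space M = (\<lambda>x. f x s) -` B \<inter> space M" using assms(1) y by auto
  then show "f -` y \<inter> space M \<in> sets M" using assms(2)[OF y(2)] y(3) by (auto dest: measurable_sets)
qed (use assms(1) in auto)

text \<open>A pair in J consists of a time and a level. These closed lower orthants form an
  intersection-stable generator whose indicators are limits of continuous cutoffs of coordinates;
  identities for continuous functionals reach all events through it.\<close>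

definition cyl :: "real set \<Rightarrow> (real \<Rightarrow> real) set set" where
  "cyl T = {{\<omega> \<in> \<Omega>. \<forall>p\<in>J. \<omega> (fst p) \<le> snd p} | J. finite J \<and> fst ` J \<subseteq> T}"

lemma Int_stable_cyl: "Int_stable (cyl T)"
proof (rule Int_stableI)
  fix a b assume "a \<in> cyl T" "b \<in> cyl T"
  then obtain J K where J: "a = {\<omega> \<in> \<Omega>. \<forall>p\<in>J. \<omega> (fst p) \<le> snd p}" "finite J" "fst ` J \<subseteq> T"
    and K: "b = {\<omega> \<in> \<Omega>. \<forall>p\<in>K. \<omega> (fst p) \<le> snd p}" "finite K" "fst ` K \<subseteq> T"
    unfolding cyl_def by auto
  show "a \<inter> b \<in> cyl T"
    unfolding cyl_def using J K by (intro CollectI exI[of _ "J \<union> K"]) auto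
qed

lemma sets_coord_sigma_cyl: "sets (coord_sigma T) = sigma_sets \<Omega> (cyl T)"
proof (rule equalityI)
  let ?M = "sigma \<Omega> (cyl T)"
  have c: "cyl T \<subseteq> Pow \<Omega>" by (auto simp: cyl_def)
  then have M: "sets ?M = sigma_sets \<Omega> (cyl T)" "space ?M = \<Omega>"
    by (auto simp: sets_measure_of space_measure_of)
  have coord: "(\<lambda>\<omega>. \<omega> s) \<in> borel_measurable ?M" if s: "s \<in> T" for s
  proof (rule borel_measurable_iff_le[THEN iffD2], intro allI)
    fix a :: real
    have "{w \<in> \<Omega>. w s \<le> a} \<in> cyl T"
      unfolding cyl_def using s by (intro CollectI exI[of _ "{(s, a)}"]) auto
    then show "{w \<in> space ?M. w s \<le> a} \<in> sets ?M" unfolding M by auto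
  qed
  show "sets (coord_sigma T) \<subseteq> sigma_sets \<Omega> (cyl T)"
    unfolding sets_coord_sigma M(1)[symmetric]
  proof (rule sigma_algebra.sigma_sets_subset[of \<Omega>])
    show "sigma_algebra \<Omega> (sets ?M)" using sets.sigma_algebra_axioms[of ?M] unfolding M(2) .
    show "{(\<lambda>\<omega>. \<omega> s) -` B \<inter> \<Omega> | s B. s \<in> T \<and> B \<in> sets borel} \<subseteq> sets ?M"
      using measurable_sets[OF coord] unfolding M(2) by auto
  qed
  show "sigma_sets \<Omega> (cyl T) \<subseteq> sets (coord_sigma T)"
  proof (rule sigma_algebra.sigma_sets_subset[of \<Omega>])
    show "sigma_algebra \<Omega> (sets (coord_sigma T))"
      using sets.sigma_algebra_axioms[of "coord_sigma T"] by simp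
    show "cyl T \<subseteq> sets (coord_sigma T)"
    proof
      fix a assume "a \<in> cyl T"
      then obtain J where J: "a = {\<omega> \<in> \<Omega>. \<forall>p\<in>J. \<omega> (fst p) \<le> snd p}" "finite J" "fst ` J \<subseteq> T"
        unfolding cyl_def by auto
      have "{\<omega> \<in> space (coord_sigma T). \<forall>p\<in>J. \<omega> (fst p) \<le> snd p} \<in> sets (coord_sigma T)"
      proof (rule sets.sets_Collect_finite_All)
        fix p assume "p \<in> J"
        then have [measurable]: "(\<lambda>\<omega>. \<omega> (fst p)) \<in> borel_measurable (coord_sigma T)"
          using J by (intro coord_measurable) auto
        show "{x \<in> space (coord_sigma T). x (fst p) \<le> snd p} \<in> sets (coord_sigma T)" by measurable
      qed fact
      then show "a \<in> sets (coord_sigma T)" using J(1) by simp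
    qed
  qed
qed

subsection \<open>Grids\<close>

definition gidx :: "nat \<Rightarrow> real \<Rightarrow> real \<Rightarrow> nat" where
  "gidx N T u = nat \<lfloor>u * real N / T\<rfloor>"

lemma gidx:
  assumes "T > 0" "N > 0" "0 \<le> u"
  shows "real (gidx N T u) * T / N \<le> u" "u < (real (gidx N T u) + 1) * T / N"
    "u \<le> T \<Longrightarrow> gidx N T u \<le> N" "real (gidx N T u) * T / N \<ge> 0"
    "\<bar>real (gidx N T u) * T / N - u\<bar> \<le> T / N"
proof -
  have n: "u * real N / T \<ge> 0" using assms by simp
  then have g: "real (gidx N T u) \<le> u * real N / T" "u * real N / T < real (gidx N T u) + 1"
    unfolding gidx_def by (auto simp: of_nat_nat)
  show 1: "real (gidx N T u) * T / N \<le> u" using g(1) assms by (simp add: field_simps)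
  show 2: "u < (real (gidx N T u) + 1) * T / N" using g(2) assms by (simp add: field_simps)
  show "gidx N T u \<le> N" if "u \<le> T"
  proof -
    have "u * real N / T \<le> real N" using that assms by (simp add: field_simps)
    then have "real (gidx N T u) \<le> real N" using g(1) by linarith
    then show ?thesis by simp
  qed
  show "real (gidx N T u) * T / N \<ge> 0" using assms by simp
  show "\<bar>real (gidx N T u) * T / N - u\<bar> \<le> T / N"
    using 1 2 by (simp add: distrib_right add_divide_distrib)
qed

lemma gidx_tendsto:
  assumes "T > 0" "0 \<le> u" and N: "filterlim N at_top sequentially" "\<And>n. N n > 0"
  shows "(\<lambda>n. real (gidx (N n) T u) * T / real (N n)) \<longlonglongrightarrow> u"
proof -
  have "filterlim (\<lambda>n. real (N n)) at_top sequentially"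
    by (rule filterlim_compose[OF filterlim_real_sequentially N(1)])
  then have "(\<lambda>n. T / real (N n)) \<longlonglongrightarrow> 0"
    by (rule real_tendsto_divide_at_top[OF tendsto_const])
  then have "(\<lambda>n. real (gidx (N n) T u) * T / real (N n) - u) \<longlonglongrightarrow> 0"
    by (rule Lim_null_comparison[rotated]) (use gidx(5)[OF assms(1) N(2) assms(2)] in auto)
  then show ?thesis by (rule LIM_zero_cancel)
qed

lemma path_gidx_tendsto:
  assumes x: "continuous_on {0..T} x" and "T > 0" "0 \<le> u" "u \<le> T"
    and N: "filterlim N at_top sequentially" "\<And>n. N n > 0"
  shows "(\<lambda>n. x (real (gidx (N n) T u) * T / real (N n))) \<longlonglongrightarrow> x u"
proof -
  have "real (gidx (N n) T u) * T / real (N n) \<in> {0..T}" for n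
    using gidx(1,4)[OF assms(2) N(2) assms(3), of n] assms(4) by auto
  then show ?thesis
    using x assms gidx_tendsto[OF assms(2,3) N] unfolding continuous_on_sequentially
    by (auto simp: comp_def)
qed

lemma sup_proc_le_iff:
  assumes "continuous_on {0..T} x" "T \<ge> 0"
  shows "sup_proc T x \<le> c \<longleftrightarrow> (\<forall>u\<in>{0..T}. x u \<le> c)"
proof -
  have "bdd_above (x ` {0..T})"
    using compact_continuous_image[OF assms(1)] by (auto intro: bounded_imp_bdd_above compact_imp_bounded)
  then show ?thesis unfolding sup_proc_def using assms by (intro cSUP_le_iff) auto
qed

lemma inf_proc_eq: "inf_proc T x = sup_proc T (\<lambda>u. - x u)"
  unfolding inf_proc_def sup_proc_def by (simp add: Inf_real_def image_image)

lemma sup_proc_attained: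
  assumes "continuous_on {0..T} x" "T \<ge> 0"
  shows "\<exists>u\<in>{0..T}. sup_proc T x = x u"
proof -
  obtain u where u: "u \<in> {0..T}" "\<And>v. v \<in> {0..T} \<Longrightarrow> x v \<le> x u"
    using continuous_attains_sup[OF _ _ assms(1)] assms(2) by auto
  have "sup_proc T x \<le> x u" using u by (subst sup_proc_le_iff[OF assms]) auto
  moreover have "x u \<le> sup_proc T x" using sup_proc_le_iff[OF assms, of "sup_proc T x"] u by auto
  ultimately show ?thesis using u by force
qed

lemma sup_proc_ge: "continuous_on {0..T} x \<Longrightarrow> u \<in> {0..T} \<Longrightarrow> x u \<le> sup_proc T x"
  using sup_proc_le_iff[of T x "sup_proc T x"] by auto

text \<open>By continuity it is enough to test the points of all grids, a countable set of times.
  Running suprema are measurable for this reason.\<close>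

lemma grid_le_iff:
  assumes "continuous_on {0..T} x" "T > (0::real)"
  shows "(\<forall>u\<in>{0..T}. x u \<le> (c::real)) \<longleftrightarrow> (\<forall>N. \<forall>k\<le>Suc N. x (real k * T / real (Suc N)) \<le> c)"
proof
  assume L: "\<forall>u\<in>{0..T}. x u \<le> c"
  show "\<forall>N. \<forall>k\<le>Suc N. x (real k * T / real (Suc N)) \<le> c"
  proof (intro allI impI)
    fix N k assume "k \<le> Suc N"
    then have "real k * T / real (Suc N) \<in> {0..T}"
      using assms(2) by (auto simp: field_simps simp del: of_nat_Suc)
    then show "x (real k * T / real (Suc N)) \<le> c" using L by blast
  qed
next
  assume R: "\<forall>N. \<forall>k\<le>Suc N. x (real k * T / real (Suc N)) \<le> c"
  show "\<forall>u\<in>{0..T}. x u \<le> c"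
  proof
    fix u assume u: "u \<in> {0..T}"
    have "(\<lambda>n. x (real (gidx (Suc n) T u) * T / real (Suc n))) \<longlonglongrightarrow> x u"
      using u assms by (intro path_gidx_tendsto filterlim_Suc) auto
    then show "x u \<le> c"
      by (rule LIMSEQ_le_const2) (use R gidx(3)[of T "Suc _" u] assms u in auto)
  qed
qed

lemma sup_proc_measurable [measurable]:
  assumes "T \<ge> 0"
  shows "sup_proc T \<in> borel_measurable (\<F> T)" "inf_proc T \<in> borel_measurable (\<F> T)"
proof -
  \<comment> \<open>The factor r treats both processes at once: r = 1 gives the supremum, and r = -
    1 gives the supremum of the reflected path, which is \<open>inf_proc\<close>.\<close>
  have *: "(\<lambda>\<omega>. sup_proc T (\<lambda>u. r * \<omega> u)) \<in> borel_measurable (\<F> T)" for r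
  proof (cases "T = 0")
    case True
    then have "sup_proc T (\<lambda>u. r * \<omega> u) = r * \<omega> 0" for \<omega> by (simp add: sup_proc_def)
    then show ?thesis using True by simp
  next
    case False
    with assms have T: "T > 0" by simp
    have gp: "0 \<le> real k * T / real (Suc N)" "real k * T / real (Suc N) \<le> T" if "k \<le> Suc N" for k N
      using that T by (auto simp: field_simps simp del: of_nat_Suc)
    show ?thesis
    proof (rule borel_measurable_iff_le[THEN iffD2], intro allI)
      fix a
      have "{w \<in> space (\<F> T). sup_proc T (\<lambda>u. r * w u) \<le> a}
          = {w \<in> space (\<F> T). \<forall>N. \<forall>k\<in>{..Suc N}. r * w (real k * T / real (Suc N)) \<le> a}"
      proof (intro Collect_cong conj_cong refl)
        fix w assume "w \<in> space (\<F> T)"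
        then have c: "continuous_on {0..T} (\<lambda>u. r * w u)" by (intro continuous_intros path_continuous) simp
        show "sup_proc T (\<lambda>u. r * w u) \<le> a \<longleftrightarrow> (\<forall>N. \<forall>k\<in>{..Suc N}. r * w (real k * T / real (Suc N)) \<le> a)"
          unfolding sup_proc_le_iff[OF c assms] grid_le_iff[OF c T] by auto
      qed
      also have "\<dots> \<in> sets (\<F> T)"
      proof (intro sets.sets_Collect_countable_All sets.sets_Collect_finite_All)
        fix N k assume "k \<in> {..Suc N}"
        then have [measurable]: "(\<lambda>w. w (real k * T / real (Suc N))) \<in> borel_measurable (\<F> T)"
          using gp[of k N] by (intro F_coord) auto
        show "{w \<in> space (\<F> T). r * w (real k * T / real (Suc N)) \<le> a} \<in> sets (\<F> T)" by measurable
      qed simp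
      finally show "{w \<in> space (\<F> T). sup_proc T (\<lambda>u. r * w u) \<le> a} \<in> sets (\<F> T)" .
    qed
  qed
  show "sup_proc T \<in> borel_measurable (\<F> T)" using *[of 1] by simp
  show "inf_proc T \<in> borel_measurable (\<F> T)" using *[of "-1"] unfolding inf_proc_eq[abs_def] by simp
qed

text \<open>Continuous paths are limits of step functions along finer and finer grids, and each step
  function selects a coordinate by a countably valued index. Negative times are clipped to 0 because
  paths carry no information there.\<close>

lemma joint_measurable:
  "(\<lambda>p. snd p (max 0 (fst p))) \<in> borel_measurable (borel \<Otimes>\<^sub>M \<F>\<^sub>\<infinity>)"
proof (rule borel_measurable_LIMSEQ_real)
  let ?g = "\<lambda>m p. snd p (real (gidx (Suc m) 1 (max 0 (fst p))) * 1 / real (Suc m))"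
  show "?g m \<in> borel_measurable (borel \<Otimes>\<^sub>M \<F>\<^sub>\<infinity>)" for m
  proof (rule measurable_compose_countable[where g = "\<lambda>p. gidx (Suc m) 1 (max 0 (fst p))"])
    show "(\<lambda>p. snd p (real k * 1 / real (Suc m))) \<in> borel_measurable (borel \<Otimes>\<^sub>M \<F>\<^sub>\<infinity>)" for k
      by (rule measurable_compose[OF measurable_snd F_infty_coord]) simp
    show "(\<lambda>p. gidx (Suc m) 1 (max 0 (fst p))) \<in> measurable (borel \<Otimes>\<^sub>M \<F>\<^sub>\<infinity>) (count_space UNIV)"
      unfolding gidx_def by measurable
  qed
  fix p :: "real \<times> (real \<Rightarrow> real)" assume "p \<in> space (borel \<Otimes>\<^sub>M \<F>\<^sub>\<infinity>)"
  then have w: "snd p \<in> \<Omega>" by (auto simp: space_pair_measure)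
  have "(\<lambda>n. real (gidx (Suc n) 1 (max 0 (fst p))) * 1 / real (Suc n)) \<longlonglongrightarrow> max 0 (fst p)"
    by (intro gidx_tendsto filterlim_Suc) auto
  moreover have "continuous_on {0..} (snd p)" using w by (simp add: path_set_def)
  ultimately show "(\<lambda>m. ?g m p) \<longlonglongrightarrow> snd p (max 0 (fst p))"
    unfolding continuous_on_sequentially by (auto simp: comp_def)
qed

section \<open>Sampled paths, the Euler scheme, its weights and pasted paths\<close>

abbreviation seqM :: "(nat \<Rightarrow> real) measure" where
  "seqM \<equiv> Pi\<^sub>M UNIV (\<lambda>_. borel)"

lemma measurable_gauss: "measurable (gauss h) N = measurable borel N"
  by (rule measurable_cong_sets) simp_all

text \<open>Samples are infinite sequences frozen after index k. Functionals of samples of different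
  lengths thus share one measurable space, while the sample up to k remains measurable at time
  \<open>t k\<close>.\<close>

definition gseq :: "(nat \<Rightarrow> real) \<Rightarrow> nat \<Rightarrow> (real \<Rightarrow> real) \<Rightarrow> nat \<Rightarrow> real" where
  "gseq t k \<omega> = (\<lambda>j. \<omega> (t (min j k)))"

definition ext :: "nat \<Rightarrow> (nat \<Rightarrow> real) \<Rightarrow> real \<Rightarrow> nat \<Rightarrow> real" where
  "ext k x v = (\<lambda>j. if j \<le> k then x j else v)"

fun euler :: "(real \<Rightarrow> real) \<Rightarrow> real \<Rightarrow> (real \<Rightarrow> real) \<Rightarrow> nat \<Rightarrow> real" where
  "euler b h \<omega> 0 = \<omega> 0"
| "euler b h \<omega> (Suc k) = euler b h \<omega> k + b (euler b h \<omega> k) * h + (\<omega> (real (Suc k) * h) - \<omega> (real k * h))"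

definition eseq :: "(real \<Rightarrow> real) \<Rightarrow> real \<Rightarrow> nat \<Rightarrow> (real \<Rightarrow> real) \<Rightarrow> nat \<Rightarrow> real" where
  "eseq b h k \<omega> = (\<lambda>j. euler b h \<omega> (min j k))"

text \<open>A discrete Doleans exponential: the density of k Euler steps with drift b with respect
  to the sampled Wiener path.\<close>

definition wt :: "(real \<Rightarrow> real) \<Rightarrow> real \<Rightarrow> nat \<Rightarrow> (real \<Rightarrow> real) \<Rightarrow> real" where
  "wt b h k \<omega> = exp (\<Sum>j<k. b (\<omega> (real j * h)) * (\<omega> (real (Suc j) * h) - \<omega> (real j * h))
     - (b (\<omega> (real j * h)))\<^sup>2 * h / 2)"

text \<open>Two independent Wiener paths pasted at a fixed time give a Wiener path again. The value
  at negative times follows the convention for \<Omega>.\<close>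

definition glue :: "real \<Rightarrow> (real \<Rightarrow> real) \<Rightarrow> (real \<Rightarrow> real) \<Rightarrow> real \<Rightarrow> real" where
  "glue n \<omega> \<omega>' = (\<lambda>u. if u < 0 then undefined else if u \<le> n then \<omega> u else \<omega> n + (\<omega>' u - \<omega>' n))"

lemma measurable_seqI:
  assumes "\<And>j. (\<lambda>x. f x j) \<in> borel_measurable M"
  shows "f \<in> measurable M seqM"
  by (rule measurable_PiM_single') (use assms in auto)

lemma seq_coord [measurable]: "(\<lambda>x. x j) \<in> borel_measurable seqM"
  by (rule measurable_component_singleton) simp

lemma ext_measurable [measurable]:
  assumes [measurable]: "f \<in> measurable M seqM" "g \<in> borel_measurable M"
  shows "(\<lambda>x. ext k (f x) (g x)) \<in> measurable M seqM"
proof (rule measurable_seqI)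
  have [measurable]: "(\<lambda>x. f x j) \<in> borel_measurable M" for j
    by (rule measurable_compose[OF _ seq_coord]) measurable
  show "(\<lambda>x. ext k (f x) (g x) j) \<in> borel_measurable M" for j
    unfolding ext_def by (cases "j \<le> k") simp_all
qed

lemma gseq_measurable:
  assumes "mono t" "t 0 \<ge> 0" "t k \<le> s"
  shows "gseq t k \<in> measurable (\<F> s) seqM"
proof (rule measurable_seqI)
  fix j
  have "t 0 \<le> t (min j k)" "t (min j k) \<le> t k" using assms(1) by (auto intro: monoD)
  then show "(\<lambda>\<omega>. gseq t k \<omega> j) \<in> borel_measurable (\<F> s)"
    unfolding gseq_def using assms by (intro F_coord) auto
qed

lemma gseq_Suc: "gseq t (Suc k) \<omega> = ext k (gseq t k \<omega>) (gseq t k \<omega> k + (\<omega> (t (Suc k)) - \<omega> (t k)))"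
  by (auto simp: gseq_def ext_def fun_eq_iff min_def not_less_eq_eq le_Suc_eq)

lemma eseq_Suc: "eseq b h (Suc k) \<omega> = ext k (eseq b h k \<omega>)
    (eseq b h k \<omega> k + (b (eseq b h k \<omega> k) * h + (\<omega> (real (Suc k) * h) - \<omega> (real k * h))))"
  by (auto simp: eseq_def ext_def fun_eq_iff min_def not_less_eq_eq le_Suc_eq)

lemma wt_Suc: "wt b h (Suc k) \<omega> = wt b h k \<omega> *
    exp (b (\<omega> (real k * h)) * (\<omega> (real (Suc k) * h) - \<omega> (real k * h)) - (b (\<omega> (real k * h)))\<^sup>2 * h / 2)"
  by (simp add: wt_def exp_add)

lemma euler_measurable:
  assumes [measurable]: "b \<in> borel_measurable borel" and h: "h \<ge> 0" and "real k * h \<le> s"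
  shows "(\<lambda>\<omega>. euler b h \<omega> k) \<in> borel_measurable (\<F> s)"
  using assms(3)
proof (induction k)
  case 0
  then show ?case by (auto intro!: F_coord)
next
  case (Suc k)
  have k: "real k * h \<le> s"
    by (rule order_trans[OF _ Suc.prems]) (use h in \<open>auto intro: mult_right_mono\<close>)
  note [measurable] = Suc.IH[OF k]
  have [measurable]: "(\<lambda>\<omega>. \<omega> (real k * h)) \<in> borel_measurable (\<F> s)"
    "(\<lambda>\<omega>. \<omega> (real (Suc k) * h)) \<in> borel_measurable (\<F> s)"
    using k Suc.prems h by (auto intro!: F_coord simp del: of_nat_Suc)
  show ?case unfolding euler.simps by measurable
qed

lemma eseq_measurable:
  assumes "b \<in> borel_measurable borel" and h: "h \<ge> 0" and "real k * h \<le> s"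
  shows "eseq b h k \<in> measurable (\<F> s) seqM"
proof (rule measurable_seqI)
  fix j
  have "real (min j k) * h \<le> real k * h" using h by (intro mult_right_mono) auto
  then show "(\<lambda>\<omega>. eseq b h k \<omega> j) \<in> borel_measurable (\<F> s)"
    unfolding eseq_def using assms by (intro euler_measurable) auto
qed

lemma wt_measurable:
  assumes [measurable]: "b \<in> borel_measurable borel" and h: "h \<ge> 0" and k: "real k * h \<le> s"
  shows "wt b h k \<in> borel_measurable (\<F> s)"
proof -
  have [measurable]: "(\<lambda>\<omega>. \<omega> (real j * h)) \<in> borel_measurable (\<F> s)" if "j \<le> k" for j
  proof -
    have "real j * h \<le> real k * h" using that h by (intro mult_right_mono) auto
    then show ?thesis using h k by (intro F_coord) auto
  qed
  show ?thesis unfolding wt_def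
    by (intro measurable_compose[OF _ borel_measurable_exp] borel_measurable_sum borel_measurable_diff
        borel_measurable_times borel_measurable_divide borel_measurable_power borel_measurable_const
        measurable_compose[OF _ assms(1)]) (auto simp del: of_nat_Suc)
qed

lemma glue_path: "n \<ge> 0 \<Longrightarrow> \<omega> \<in> \<Omega> \<Longrightarrow> \<omega>' \<in> \<Omega> \<Longrightarrow> glue n \<omega> \<omega>' \<in> \<Omega>"
proof -
  assume n: "n \<ge> 0" and w: "\<omega> \<in> \<Omega>" "\<omega>' \<in> \<Omega>"
  have ivl: "{0..n} \<union> {n..} = {0..}" using n by auto
  have "continuous_on ({0..n} \<union> {n..}) (\<lambda>u. if u \<le> n then \<omega> u else \<omega> n + (\<omega>' u - \<omega>' n))"
    using w n by (intro continuous_on_cases_le continuous_intros)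
      (auto simp: path_set_def intro: continuous_on_subset)
  then have "continuous_on {0..} (\<lambda>u. if u \<le> n then \<omega> u else \<omega> n + (\<omega>' u - \<omega>' n))"
    using n by (simp add: ivl)
  then have "continuous_on {0..} (glue n \<omega> \<omega>')"
    by (rule continuous_on_eq) (auto simp: glue_def)
  then show ?thesis by (auto simp: path_set_def extensional_def glue_def)
qed

lemma finite_times_grid:
  assumes "finite U" "0 \<in> U" "U \<subseteq> {0..}"
  shows "\<exists>t :: nat \<Rightarrow> real. strict_mono t \<and> t 0 = 0 \<and> (\<exists>k. U = t ` {..k})"
proof -
  let ?xs = "sorted_list_of_set U"
  have xs: "set ?xs = U" "sorted_wrt (<) ?xs" "length ?xs = card U" using assms by auto
  have c: "card U > 0" using assms by (auto simp: card_gt_0_iff)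
  \<comment> \<open>Beyond the times of U the sequence continues in an arbitrary increasing way,
    because samples are taken along an infinite grid.\<close>
  define t where "t j = (if j < card U then ?xs ! j else Max U + 1 + real j)" for j
  have nth: "j < card U \<Longrightarrow> ?xs ! j \<in> U" for j using xs by (metis nth_mem)
  have "strict_mono t"
  proof (rule strict_monoI)
    fix i j :: nat assume ij: "i < j"
    show "t i < t j"
    proof (cases "j < card U")
      case True
      then show ?thesis using ij xs by (auto simp: t_def sorted_wrt_nth_less)
    next
      case False
      have "?xs ! i \<le> Max U" if "i < card U" using nth[OF that] assms by auto
      then show ?thesis using False ij by (fastforce simp: t_def)
    qed
  qed
  moreover have im: "U = t ` {..card U - 1}"
  proof -
    have "{..card U - 1} = {..<card U}" using c by auto
    moreover have "t ` {..<card U} = (!) ?xs ` {0..<length ?xs}" using xs(3) by (auto simp: t_def)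
    moreover have "(!) ?xs ` {0..<length ?xs} = U" using nth_image[of "length ?xs" ?xs] xs(1) by simp
    ultimately show ?thesis by simp
  qed
  moreover have "t 0 = 0"
  proof -
    have "0 \<in> t ` {..card U - 1}" using assms(2) by (subst (asm) im)
    then obtain j where j: "0 = t j" by (rule imageE)
    have "t 0 \<in> U" using im by auto
    then have "t 0 \<ge> 0" using assms(3) by auto
    moreover have "t 0 \<le> t j" using \<open>strict_mono t\<close> by (simp add: strict_mono_less_eq)
    ultimately show ?thesis using j by simp
  qed
  ultimately show ?thesis by blast
qed

text \<open>For a decreasing drift and h \<Lambda> at most 1, the map x + h b x is nonexpansive, so
  the local defects r j of a perturbed recursion only add up. The bound is free of \<Lambda>, which
  is essential because \<Lambda> tends to infinity along the mollification.\<close>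

lemma euler_comparison:
  assumes anti: "antimono b" and lip: "\<And>x y. \<bar>b x - b y\<bar> \<le> \<Lambda> * \<bar>x - y\<bar>" and h: "h \<ge> 0" "h * \<Lambda> \<le> 1"
    and y: "y 0 = \<omega> 0"
      "\<And>k. k < m \<Longrightarrow> y (Suc k) = y k + b (y k) * h + r k + (\<omega> (real (Suc k) * h) - \<omega> (real k * h))"
    and k: "k \<le> m"
  shows "\<bar>euler b h \<omega> k - y k\<bar> \<le> (\<Sum>j<k. \<bar>r j\<bar>)"
  using k
proof (induction k)
  case (Suc k)
  define e where "e = euler b h \<omega> k"
  \<comment> \<open>The error and the difference of drifts have opposite signs, and h times the
    latter is no larger than the former, so adding it cannot increase the error.\<close>
  have 1: "\<bar>(e - y k) + h * (b e - b (y k))\<bar> \<le> \<bar>e - y k\<bar>"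
  proof -
    have l: "h * \<bar>b e - b (y k)\<bar> \<le> \<bar>e - y k\<bar>"
    proof -
      have "h * \<bar>b e - b (y k)\<bar> \<le> h * (\<Lambda> * \<bar>e - y k\<bar>)" by (rule mult_left_mono[OF lip h(1)])
      also have "\<dots> = (h * \<Lambda>) * \<bar>e - y k\<bar>" by simp
      also have "\<dots> \<le> 1 * \<bar>e - y k\<bar>" by (rule mult_right_mono[OF h(2)]) simp
      finally show ?thesis by simp
    qed
    show ?thesis
    proof (cases "e \<ge> y k")
      case True
      then have "h * (b e - b (y k)) \<le> 0"
        using antimonoD[OF anti, of "y k" e] h(1) by (auto simp: mult_le_0_iff)
      moreover have "- (h * (b e - b (y k))) \<le> e - y k"
        using l True antimonoD[OF anti, of "y k" e] by (simp add: abs_if algebra_simps split: if_splits)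
      ultimately show ?thesis using True by linarith
    next
      case False
      then have "h * (b e - b (y k)) \<ge> 0"
        using antimonoD[OF anti, of e "y k"] h(1) by auto
      moreover have "h * (b e - b (y k)) \<le> y k - e"
        using l False antimonoD[OF anti, of e "y k"] by simp
      ultimately show ?thesis using False by linarith
    qed
  qed
  have "euler b h \<omega> (Suc k) - y (Suc k) = ((e - y k) + h * (b e - b (y k))) - r k"
    using Suc.prems by (simp add: y(2) e_def algebra_simps)
  then have "\<bar>euler b h \<omega> (Suc k) - y (Suc k)\<bar> \<le> \<bar>e - y k\<bar> + \<bar>r k\<bar>" using 1 by linarith
  also have "\<dots> \<le> (\<Sum>j<Suc k. \<bar>r j\<bar>)" using Suc by (simp add: e_def)
  finally show ?case .
qed (use y in simp)

section \<open>Consequences of independent Gaussian increments\<close>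

locale wiener = prob_space P for P :: "(real \<Rightarrow> real) measure" +
  assumes W: "wiener_measure 0 P"
begin

lemma sets_P [measurable_cong, simp]: "sets P = sets \<F>\<^sub>\<infinity>"
  using W by (simp add: wiener_measure_def)

lemma space_P [simp]: "space P = \<Omega>"
  using sets_eq_imp_space_eq[OF sets_P] by simp

lemma emeasure_P [simp]: "emeasure P \<Omega> = 1"
  using emeasure_space_1 by simp

lemma meas_F: "f \<in> measurable (\<F> t) N \<Longrightarrow> f \<in> measurable P N"
  using F_sub_infty[of t] by (auto simp: measurable_def)

lemma coord_measurable_P [measurable]: "0 \<le> t \<Longrightarrow> (\<lambda>\<omega>. \<omega> t) \<in> borel_measurable P"
  unfolding measurable_cong_sets[OF sets_P refl] by (rule F_infty_coord)

lemma AE_start: "AE \<omega> in P. \<omega> 0 = 0"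
  using W by (simp add: wiener_measure_def)

text \<open>Conditioning on the past at time s: the past and the increment are independent, so their
  joint law is a product, and Tonelli's theorem integrates the increment out first.\<close>

lemma step:
  assumes st: "0 \<le> s" "s < t" and H[measurable]: "H \<in> borel_measurable (\<F> s \<Otimes>\<^sub>M borel)"
  shows "(\<integral>\<^sup>+\<omega>. H (\<omega>, \<omega> t - \<omega> s) \<partial>P) = (\<integral>\<^sup>+\<omega>. (\<integral>\<^sup>+y. H (\<omega>, y) \<partial>gauss (t - s)) \<partial>P)"
proof -
  let ?x = "\<lambda>\<omega>. \<omega> t - \<omega> s"
  interpret G: prob_space "gauss (t - s)" using st by (intro prob_space_gauss) simp
  have DI: "distributed P lborel ?x (\<lambda>y. ennreal (normal_density 0 (sqrt (t - s)) y)) \<and>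
      indep_set (sets (\<F> s)) {?x -` B \<inter> \<Omega> | B. B \<in> sets borel}"
    using W st unfolding wiener_measure_def by blast
  note D = DI[THEN conjunct1] and I = DI[THEN conjunct2]
  have xm[measurable]: "?x \<in> borel_measurable P"
    by (intro borel_measurable_diff coord_measurable_P) (use st in auto)
  have dx: "distr P borel ?x = gauss (t - s)"
  proof -
    have "distr P borel ?x = distr P lborel ?x" by (rule distr_cong) auto
    then show ?thesis using distributed_distr_eq_density[OF D] unfolding gauss_def by simp
  qed
  have idm[measurable]: "(\<lambda>\<omega>. \<omega>) \<in> measurable P (\<F> s)"
    by (rule meas_F[of _ s]) simp
  have pm: "(\<lambda>\<omega>. (\<omega>, ?x \<omega>)) \<in> measurable P (\<F> s \<Otimes>\<^sub>M borel)" by measurable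
  interpret I: prob_space "distr P (\<F> s) (\<lambda>\<omega>. \<omega>)" by (rule prob_space_distr) measurable
  have prod: "distr P (\<F> s) (\<lambda>\<omega>. \<omega>) \<Otimes>\<^sub>M gauss (t - s) = distr P (\<F> s \<Otimes>\<^sub>M borel) (\<lambda>\<omega>. (\<omega>, ?x \<omega>))"
  proof (rule pair_measure_eqI)
    show "sigma_finite_measure (distr P (\<F> s) (\<lambda>\<omega>. \<omega>))" "sigma_finite_measure (gauss (t - s))" by unfold_locales
    show "sets (distr P (\<F> s) (\<lambda>\<omega>. \<omega>) \<Otimes>\<^sub>M gauss (t - s)) = sets (distr P (\<F> s \<Otimes>\<^sub>M borel) (\<lambda>\<omega>. (\<omega>, ?x \<omega>)))"
      unfolding sets_distr by (rule sets_pair_measure_cong) simp_all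
    fix A B assume "A \<in> sets (distr P (\<F> s) (\<lambda>\<omega>. \<omega>))" "B \<in> sets (gauss (t - s))"
    then have A: "A \<in> sets (\<F> s)" and B: "B \<in> sets borel" by simp_all
    have A\<Omega>: "A \<subseteq> \<Omega>" using sets.sets_into_space[OF A] by simp
    have "emeasure (distr P (\<F> s \<Otimes>\<^sub>M borel) (\<lambda>\<omega>. (\<omega>, ?x \<omega>))) (A \<times> B)
        = emeasure P ((\<lambda>\<omega>. (\<omega>, ?x \<omega>)) -` (A \<times> B) \<inter> space P)"
      by (rule emeasure_distr[OF pm]) (use A B in auto)
    also have "(\<lambda>\<omega>. (\<omega>, ?x \<omega>)) -` (A \<times> B) \<inter> space P = A \<inter> (?x -` B \<inter> \<Omega>)" using A\<Omega> by auto
    also have "emeasure P (A \<inter> (?x -` B \<inter> \<Omega>)) = emeasure P A * emeasure P (?x -` B \<inter> \<Omega>)"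
    proof -
      have "?x -` B \<inter> \<Omega> \<in> {?x -` B \<inter> \<Omega> | B. B \<in> sets borel}" using B by blast
      from indep_setD[OF I A this] show ?thesis
        unfolding emeasure_eq_measure by (simp add: ennreal_mult)
    qed
    also have "emeasure P (?x -` B \<inter> \<Omega>) = emeasure (gauss (t - s)) B"
      unfolding dx[symmetric] using B by (subst emeasure_distr[OF xm]) simp_all
    also have "emeasure P A = emeasure (distr P (\<F> s) (\<lambda>\<omega>. \<omega>)) A"
      using A A\<Omega> by (subst emeasure_distr[OF idm]) (auto simp: Int_absorb2 vimage_def)
    finally show "emeasure (distr P (\<F> s) (\<lambda>\<omega>. \<omega>)) A * emeasure (gauss (t - s)) B
        = emeasure (distr P (\<F> s \<Otimes>\<^sub>M borel) (\<lambda>\<omega>. (\<omega>, ?x \<omega>))) (A \<times> B)" by simp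
  qed
  have "sets (distr P (\<F> s) (\<lambda>\<omega>. \<omega>) \<Otimes>\<^sub>M gauss (t - s)) = sets (\<F> s \<Otimes>\<^sub>M borel)"
    by (rule sets_pair_measure_cong) simp_all
  then have Hm: "H \<in> borel_measurable (distr P (\<F> s) (\<lambda>\<omega>. \<omega>) \<Otimes>\<^sub>M gauss (t - s))"
    using H measurable_cong_sets[of _ _ borel borel] by blast
  have "(\<integral>\<^sup>+\<omega>. H (\<omega>, ?x \<omega>) \<partial>P) = (\<integral>\<^sup>+p. H p \<partial>distr P (\<F> s \<Otimes>\<^sub>M borel) (\<lambda>\<omega>. (\<omega>, ?x \<omega>)))"
    by (subst nn_integral_distr) auto
  also have "\<dots> = (\<integral>\<^sup>+\<omega>. (\<integral>\<^sup>+y. H (\<omega>, y) \<partial>gauss (t - s)) \<partial>distr P (\<F> s) (\<lambda>\<omega>. \<omega>))"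
    unfolding prod[symmetric] by (rule G.nn_integral_fst[OF Hm, symmetric])
  also have "\<dots> = (\<integral>\<^sup>+\<omega>. (\<integral>\<^sup>+y. H (\<omega>, y) \<partial>gauss (t - s)) \<partial>P)"
    by (rule nn_integral_distr[OF idm]) (use G.borel_measurable_nn_integral_fst[OF Hm] in simp)
  finally show ?thesis .
qed

lemma step_increment:
  assumes "0 \<le> s" "s < t" and [measurable]: "f \<in> borel_measurable borel"
  shows "(\<integral>\<^sup>+\<omega>. f (\<omega> t - \<omega> s) \<partial>P) = (\<integral>\<^sup>+y. f y \<partial>gauss (t - s))"
  using step[of s t "\<lambda>p. f (snd p)"] assms by (simp add: emeasure_space_1)

text \<open>Conditioning on the past turns the last step of the scheme into a Gaussian integral,
  which is a functional of the shorter sequence; hence G is arbitrary in the induction. Once the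
  shorter scheme has been replaced by the Wiener sample, \<open>gauss_shift\<close> removes the
  drift of the last step at the cost of one more factor of the weight.\<close>

lemma girsanov_discrete:
  assumes h: "h > 0" and [measurable]: "b \<in> borel_measurable borel" and "G \<in> borel_measurable seqM"
  shows "(\<integral>\<^sup>+\<omega>. G (eseq b h k \<omega>) \<partial>P) = (\<integral>\<^sup>+\<omega>. G (gseq (\<lambda>j. real j * h) k \<omega>) * ennreal (wt b h k \<omega>) \<partial>P)"
  using assms(3)
proof (induction k arbitrary: G)
  case 0
  then show ?case by (simp add: eseq_def gseq_def wt_def)
next
  case (Suc k)
  note [measurable] = Suc.prems
  let ?t = "\<lambda>j. real j * h" and ?g = "gauss h"
  let ?X = "gseq ?t k" and ?E = "eseq b h k"
  interpret G: prob_space ?g using h by (rule prob_space_gauss)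
  have s: "0 \<le> ?t k" "?t k < ?t (Suc k)" "?t (Suc k) - ?t k = h" using h by (auto simp: algebra_simps)
  have mt: "mono ?t" using h by (auto intro!: monoI mult_right_mono)
  have [measurable]: "?E \<in> measurable (\<F> (?t k)) seqM" using h by (intro eseq_measurable) auto
  have [measurable]: "?X \<in> measurable (\<F> (?t k)) seqM" using mt by (intro gseq_measurable) auto
  have [measurable]: "wt b h k \<in> borel_measurable (\<F> (?t k))" using h by (intro wt_measurable) auto
  have Xk: "?X \<omega> k = \<omega> (?t k)" for \<omega> by (simp add: gseq_def)
  have G1[measurable]: "(\<lambda>x. \<integral>\<^sup>+y. G (ext k x (x k + (b (x k) * h + y))) \<partial>?g) \<in> borel_measurable seqM"
    by measurable
  have shift: "(\<integral>\<^sup>+y. G (ext k x (x k + (b (x k) * h + y))) \<partial>?g)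
      = (\<integral>\<^sup>+y. G (ext k x (x k + y)) * ennreal (exp (b (x k) * y - (b (x k))\<^sup>2 * h / 2)) \<partial>?g)" for x
    by (rule gauss_shift[OF h, of "\<lambda>y. G (ext k x (x k + y))" "b (x k)"])
      (rule measurable_compose[OF _ Suc.prems], rule ext_measurable, auto simp: space_PiM)
  have Gm: "(\<lambda>y. G (ext k x (x k + y)) * ennreal (exp (b (x k) * y - (b (x k))\<^sup>2 * h / 2))) \<in> borel_measurable borel" for x
  proof (rule borel_measurable_times_ennreal)
    show "(\<lambda>y. G (ext k x (x k + y))) \<in> borel_measurable borel"
      by (rule measurable_compose[OF _ Suc.prems], rule ext_measurable) (auto simp: space_PiM)
  qed measurable
  have "(\<integral>\<^sup>+\<omega>. G (eseq b h (Suc k) \<omega>) \<partial>P)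
      = (\<integral>\<^sup>+\<omega>. (\<integral>\<^sup>+y. G (ext k (?E \<omega>) (?E \<omega> k + (b (?E \<omega> k) * h + y))) \<partial>?g) \<partial>P)"
    unfolding eseq_Suc
    using step[OF s(1,2), of "\<lambda>p. G (ext k (?E (fst p)) (?E (fst p) k + (b (?E (fst p) k) * h + snd p)))"]
    unfolding s(3) by simp
  also have "\<dots> = (\<integral>\<^sup>+\<omega>. (\<integral>\<^sup>+y. G (ext k (?X \<omega>) (?X \<omega> k + (b (?X \<omega> k) * h + y))) \<partial>?g) * ennreal (wt b h k \<omega>) \<partial>P)"
    by (rule Suc.IH[OF G1])
  also have "\<dots> = (\<integral>\<^sup>+\<omega>. (\<integral>\<^sup>+y. G (ext k (?X \<omega>) (?X \<omega> k + y)) *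
       ennreal (exp (b (?X \<omega> k) * y - (b (?X \<omega> k))\<^sup>2 * h / 2)) * ennreal (wt b h k \<omega>) \<partial>?g) \<partial>P)"
    unfolding shift by (intro nn_integral_cong nn_integral_multc[symmetric]) (unfold measurable_gauss, rule Gm)
  also have "\<dots> = (\<integral>\<^sup>+\<omega>. G (ext k (?X \<omega>) (?X \<omega> k + (\<omega> (?t (Suc k)) - \<omega> (?t k)))) *
       ennreal (exp (b (?X \<omega> k) * (\<omega> (?t (Suc k)) - \<omega> (?t k)) - (b (?X \<omega> k))\<^sup>2 * h / 2)) * ennreal (wt b h k \<omega>) \<partial>P)"
    using step[OF s(1,2), of "\<lambda>p. G (ext k (?X (fst p)) (?X (fst p) k + snd p)) *
       ennreal (exp (b (?X (fst p) k) * snd p - (b (?X (fst p) k))\<^sup>2 * h / 2)) * ennreal (wt b h k (fst p))"]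
    unfolding s(3) by simp
  also have "\<dots> = (\<integral>\<^sup>+\<omega>. G (gseq ?t (Suc k) \<omega>) * ennreal (wt b h (Suc k) \<omega>) \<partial>P)"
    unfolding gseq_Suc wt_Suc Xk by (simp add: ennreal_mult' wt_def mult_ac)
  finally show ?case .
qed

text \<open>The square of the weight for b is the weight for 2 b times the exponential of the
  accumulated b^2 h, and every weight has mean 1. The bound depends on the total time but not on the
  mesh, which makes the densities uniformly integrable.\<close>

lemma wt_square:
  assumes h: "h > 0" and [measurable]: "b \<in> borel_measurable borel" and B: "\<And>x. \<bar>b x\<bar> \<le> B"
  shows "(\<integral>\<^sup>+\<omega>. ennreal ((wt b h k \<omega>)\<^sup>2) \<partial>P) \<le> ennreal (exp (B\<^sup>2 * (real k * h)))"
proof -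
  have 1: "(wt b h k \<omega>)\<^sup>2 \<le> exp (B\<^sup>2 * (real k * h)) * wt (\<lambda>x. 2 * b x) h k \<omega>" for \<omega>
  proof -
    let ?d = "\<lambda>j. \<omega> (real (Suc j) * h) - \<omega> (real j * h)" and ?b = "\<lambda>j. b (\<omega> (real j * h))"
    have "2 * (\<Sum>j<k. ?b j * ?d j - (?b j)\<^sup>2 * h / 2)
        = (\<Sum>j<k. 2 * ?b j * ?d j - (2 * ?b j)\<^sup>2 * h / 2) + (\<Sum>j<k. (?b j)\<^sup>2 * h)"
      by (simp add: sum_distrib_left sum.distrib[symmetric] algebra_simps power2_eq_square)
    also have "(\<Sum>j<k. (?b j)\<^sup>2 * h) \<le> (\<Sum>j<k. B\<^sup>2 * h)"
      using B h by (intro sum_mono mult_right_mono) (auto intro!: power2_le_iff_abs_le[THEN iffD2] order_trans[OF abs_ge_zero B])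
    finally have "2 * (\<Sum>j<k. ?b j * ?d j - (?b j)\<^sup>2 * h / 2)
        \<le> (\<Sum>j<k. 2 * ?b j * ?d j - (2 * ?b j)\<^sup>2 * h / 2) + B\<^sup>2 * (real k * h)" by (simp add: mult_ac)
    then show ?thesis unfolding wt_def exp_double[symmetric] exp_add[symmetric]
      by (simp add: add.commute)
  qed
  have [measurable]: "wt (\<lambda>x. 2 * b x) h k \<in> borel_measurable P"
    by (rule meas_F, rule wt_measurable[where s = "real k * h"]) (use h in auto)
  have "(\<integral>\<^sup>+\<omega>. ennreal ((wt b h k \<omega>)\<^sup>2) \<partial>P) \<le> (\<integral>\<^sup>+\<omega>. ennreal (exp (B\<^sup>2 * (real k * h))) * ennreal (wt (\<lambda>x. 2 * b x) h k \<omega>) \<partial>P)"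
    by (intro nn_integral_mono) (auto simp: ennreal_mult'[symmetric] intro!: ennreal_leI 1)
  also have "\<dots> = ennreal (exp (B\<^sup>2 * (real k * h))) * (\<integral>\<^sup>+\<omega>. ennreal (wt (\<lambda>x. 2 * b x) h k \<omega>) \<partial>P)"
    by (rule nn_integral_cmult) measurable
  also have "(\<integral>\<^sup>+\<omega>. ennreal (wt (\<lambda>x. 2 * b x) h k \<omega>) \<partial>P) = 1"
    using girsanov_discrete[OF h, of "\<lambda>x. 2 * b x" "\<lambda>_. 1" k] by (simp add: emeasure_space_1)
  finally show ?thesis by simp
qed

lemma increment_abs:
  assumes "0 \<le> s" "s \<le> t"
  shows "(\<integral>\<^sup>+\<omega>. ennreal \<bar>\<omega> t - \<omega> s\<bar> \<partial>P) \<le> ennreal (sqrt (t - s))"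
proof (cases "s = t")
  case False
  then have "s < t" using assms by simp
  then show ?thesis
    using step_increment[OF assms(1), of t "\<lambda>y. ennreal \<bar>y\<bar>"] gauss_abs[of "t - s"] by simp
qed simp

lemma increments_cube:
  assumes h: "h > 0"
  shows "(\<integral>\<^sup>+\<omega>. (\<Sum>j<k. ennreal (\<bar>\<omega> (real (Suc j) * h) - \<omega> (real j * h)\<bar> ^ 3)) \<partial>P) \<le> ennreal (real k * (2 * h * sqrt h))"
proof -
  have [measurable]: "(\<lambda>\<omega>. \<omega> (real j * h)) \<in> borel_measurable P" for j
    using h by (intro coord_measurable_P) simp
  have "(\<integral>\<^sup>+\<omega>. (\<Sum>j<k. ennreal (\<bar>\<omega> (real (Suc j) * h) - \<omega> (real j * h)\<bar> ^ 3)) \<partial>P)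
      = (\<Sum>j<k. \<integral>\<^sup>+\<omega>. ennreal (\<bar>\<omega> (real (Suc j) * h) - \<omega> (real j * h)\<bar> ^ 3) \<partial>P)"
    by (rule nn_integral_sum) (auto simp del: of_nat_Suc)
  also have "\<dots> \<le> (\<Sum>j<k. ennreal (2 * h * sqrt h))"
  proof (rule sum_mono)
    fix j
    have s: "0 \<le> real j * h" "real j * h < real (Suc j) * h" "real (Suc j) * h - real j * h = h"
      using h by (auto simp: algebra_simps)
    show "(\<integral>\<^sup>+\<omega>. ennreal (\<bar>\<omega> (real (Suc j) * h) - \<omega> (real j * h)\<bar> ^ 3) \<partial>P) \<le> ennreal (2 * h * sqrt h)"
      using step_increment[OF s(1,2), of "\<lambda>y. ennreal (\<bar>y\<bar> ^ 3)"] gauss_abs_cube[OF h] unfolding s(3) by simp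
  qed
  also have "\<dots> = ennreal (real k * (2 * h * sqrt h))"
    using h by (simp add: ennreal_mult ennreal_of_nat_eq_real_of_nat)
  finally show ?thesis .
qed

text \<open>The summands are martingale differences, so second moments add; by
  \<open>gauss_quadratic\<close> each step contributes at most 2 K^2 h^2.\<close>

lemma quadratic_variation:
  assumes h: "h > 0" and [measurable]: "c \<in> borel_measurable borel" and K: "\<And>x. \<bar>c x\<bar> \<le> K"
  shows "(\<integral>\<^sup>+\<omega>. ennreal ((\<Sum>j<k. c (\<omega> (real j * h)) * ((\<omega> (real (Suc j) * h) - \<omega> (real j * h))\<^sup>2 - h))\<^sup>2) \<partial>P)
    \<le> ennreal (real k * (2 * K\<^sup>2 * h\<^sup>2))"
proof (induction k)
  case (Suc k)
  define S where "S = (\<lambda>\<omega>. \<Sum>j<k. c (\<omega> (real j * h)) * ((\<omega> (real (Suc j) * h) - \<omega> (real j * h))\<^sup>2 - h))"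
  have s: "0 \<le> real k * h" "real k * h < real (Suc k) * h" "real (Suc k) * h - real k * h = h"
    using h by (auto simp: algebra_simps)
  have X: "(\<lambda>\<omega>. \<omega> (real j * h)) \<in> borel_measurable (\<F> (real k * h))" if "j \<le> k" for j
  proof -
    have "real j * h \<le> real k * h" using that h by (intro mult_right_mono) auto
    then show ?thesis using h by (intro F_coord) auto
  qed
  have [measurable]: "S \<in> borel_measurable (\<F> (real k * h))"
    unfolding S_def by (intro borel_measurable_sum borel_measurable_diff borel_measurable_times borel_measurable_power
        borel_measurable_const measurable_compose[OF _ assms(2)] X) (auto simp del: of_nat_Suc)
  have [measurable]: "(\<lambda>\<omega>. \<omega> (real k * h)) \<in> borel_measurable (\<F> (real k * h))" by (rule X) simp
  have [measurable]: "S \<in> borel_measurable P" by (rule meas_F) measurable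
  have "(\<integral>\<^sup>+\<omega>. ennreal ((\<Sum>j<Suc k. c (\<omega> (real j * h)) * ((\<omega> (real (Suc j) * h) - \<omega> (real j * h))\<^sup>2 - h))\<^sup>2) \<partial>P)
      = (\<integral>\<^sup>+\<omega>. (\<integral>\<^sup>+y. ennreal ((S \<omega> + c (\<omega> (real k * h)) * (y\<^sup>2 - h))\<^sup>2) \<partial>gauss h) \<partial>P)"
    using step[OF s(1,2), of "\<lambda>p. ennreal ((S (fst p) + c (fst p (real k * h)) * ((snd p)\<^sup>2 - h))\<^sup>2)"]
    unfolding s(3) sum.lessThan_Suc S_def[THEN fun_cong, symmetric] by simp
  also have "\<dots> = (\<integral>\<^sup>+\<omega>. ennreal ((S \<omega>)\<^sup>2 + 2 * (c (\<omega> (real k * h)))\<^sup>2 * h\<^sup>2) \<partial>P)"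
    by (simp only: gauss_quadratic[OF h])
  also have "\<dots> \<le> (\<integral>\<^sup>+\<omega>. ennreal ((S \<omega>)\<^sup>2) + ennreal (2 * K\<^sup>2 * h\<^sup>2) \<partial>P)"
  proof (intro nn_integral_mono)
    fix \<omega>
    have "(c (\<omega> (real k * h)))\<^sup>2 \<le> K\<^sup>2"
      using K by (auto intro!: power2_le_iff_abs_le[THEN iffD2] order_trans[OF abs_ge_zero K])
    then have "2 * (c (\<omega> (real k * h)))\<^sup>2 * h\<^sup>2 \<le> 2 * K\<^sup>2 * h\<^sup>2" by (intro mult_right_mono) auto
    then show "ennreal ((S \<omega>)\<^sup>2 + 2 * (c (\<omega> (real k * h)))\<^sup>2 * h\<^sup>2) \<le> ennreal ((S \<omega>)\<^sup>2) + ennreal (2 * K\<^sup>2 * h\<^sup>2)"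
      by (subst ennreal_plus[symmetric]) (auto intro!: ennreal_leI)
  qed
  also have "\<dots> = (\<integral>\<^sup>+\<omega>. ennreal ((S \<omega>)\<^sup>2) \<partial>P) + ennreal (2 * K\<^sup>2 * h\<^sup>2)"
    by (subst nn_integral_add) (auto simp: emeasure_space_1[simplified])
  also have "\<dots> \<le> ennreal (real k * (2 * K\<^sup>2 * h\<^sup>2)) + ennreal (2 * K\<^sup>2 * h\<^sup>2)"
    unfolding S_def by (rule add_right_mono[OF Suc.IH])
  also have "\<dots> = ennreal (real (Suc k) * (2 * K\<^sup>2 * h\<^sup>2))"
    by (subst ennreal_plus[symmetric]) (auto simp: algebra_simps)
  finally show ?case .
qed simp

lemma small_ball:
  assumes "t > 0" "r \<ge> 0"
  shows "emeasure P {\<omega> \<in> \<Omega>. \<bar>\<omega> t\<bar> \<le> r} \<le> ennreal (r / sqrt t)"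
proof -
  have [measurable]: "(\<lambda>\<omega>. \<omega> t) \<in> borel_measurable P" using assms by (intro coord_measurable_P) simp
  have m: "{\<omega> \<in> space P. \<bar>\<omega> t\<bar> \<le> r} \<in> sets P" by measurable
  have "emeasure P {\<omega> \<in> \<Omega>. \<bar>\<omega> t\<bar> \<le> r} = (\<integral>\<^sup>+\<omega>. indicator {\<omega> \<in> space P. \<bar>\<omega> t\<bar> \<le> r} \<omega> \<partial>P)"
    using m by (subst nn_integral_indicator) simp_all
  also have "\<dots> = (\<integral>\<^sup>+\<omega>. indicator {y. \<bar>0 + y\<bar> \<le> r} (\<omega> t - \<omega> 0) \<partial>P)"
  proof (rule nn_integral_cong_AE)
    show "AE \<omega> in P. indicator {\<omega> \<in> space P. \<bar>\<omega> t\<bar> \<le> r} \<omega> = (indicator {y. \<bar>0 + y\<bar> \<le> r} (\<omega> t - \<omega> 0) :: ennreal)"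
      using AE_start AE_space by eventually_elim (auto simp: indicator_def)
  qed
  also have "\<dots> = emeasure (gauss (t - 0)) {y. \<bar>0 + y\<bar> \<le> r}"
    using assms by (subst step_increment) auto
  also have "\<dots> \<le> ennreal (r / sqrt t)" using gauss_small_ball[of "t - 0" r 0] assms by simp
  finally show ?thesis .
qed

end

subsection \<open>Integrals over grid cells\<close>

lemma set_integral_cells:
  fixes f :: "real \<Rightarrow> real"
  assumes h: "h \<ge> 0" and f: "set_integrable lborel {0..real k * h} f"
  shows "(LINT u:{0..real k * h}|lborel. f u) = (\<Sum>j<k. LINT u:{real j * h..real (Suc j) * h}|lborel. f u)"
  using f
proof (induction k)
  case 0
  have "AE u in lborel. indicator {0..0} u *\<^sub>R f u = 0"
    using AE_lborel_singleton[of "0::real"] by eventually_elim auto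
  then have "(LINT u:{0..0}|lborel. f u) = 0"
    unfolding set_lebesgue_integral_def by (rule integral_eq_zero_AE)
  then show ?case by simp
next
  case (Suc k)
  let ?A = "{0..real k * h}" and ?B = "{real k * h..real (Suc k) * h}"
  have un: "{0..real (Suc k) * h} = ?A \<union> ?B"
    using h by (intro ivl_disj_un_two_touch(4)[symmetric]) (auto intro: mult_right_mono)
  have i: "set_integrable lborel ?A f"
    by (rule set_integrable_subset[OF Suc.prems[unfolded un]]) auto
  have i': "set_integrable lborel ?B f"
    by (rule set_integrable_subset[OF Suc.prems[unfolded un]]) auto
  have "AE u in lborel. \<not> (u \<in> ?A \<and> u \<in> ?B)"
    using AE_lborel_singleton[of "real k * h"] by eventually_elim auto
  then have "(LINT u:?A \<union> ?B|lborel. f u) = (LINT u:?A|lborel. f u) + (LINT u:?B|lborel. f u)"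
    by (rule set_integral_Un_AE) (auto intro: i i' simp del: of_nat_Suc)
  then show ?case unfolding un using Suc.IH[OF i] by simp
qed

lemma LINT_const_Icc: "a \<le> b \<Longrightarrow> (LINT u:{a..b}|lborel. c) = c * (b - (a::real))" for c :: real
  unfolding set_lebesgue_integral_def by simp

lemma set_integrable_const_Icc: "set_integrable lborel {a..b::real} (\<lambda>_. c::real)"
  by (rule borel_integrable_atLeastAtMost') (rule continuous_on_const)

lemma set_integrable_continuous: "continuous_on {a..b::real} f \<Longrightarrow> set_integrable lborel {a..b} f" for f :: "real \<Rightarrow> real"
  by (rule borel_integrable_atLeastAtMost')

lemma set_integral_abs_le:
  fixes f :: "real \<Rightarrow> real"
  assumes "set_integrable M A f"
  shows "\<bar>LINT u:A|M. f u\<bar> \<le> (LINT u:A|M. \<bar>f u\<bar>)"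
  using set_integral_norm_bound[OF assms] by simp

text \<open>The L1 oscillation of a path inside the cells: the total error of freezing it at the
  left end of each cell.\<close>

definition cerr :: "real \<Rightarrow> nat \<Rightarrow> (real \<Rightarrow> real) \<Rightarrow> real" where
  "cerr h k x = (\<Sum>j<k. LINT u:{real j * h..real (Suc j) * h}|lborel. \<bar>x u - x (real j * h)\<bar>)"

text \<open>The form of \<open>cerr\<close> to which joint measurability and Tonelli's theorem
  apply. The clipping of times matches \<open>joint_measurable\<close>.\<close>

definition cerr_nn :: "real \<Rightarrow> nat \<Rightarrow> (real \<Rightarrow> real) \<Rightarrow> ennreal" where
  "cerr_nn h k x = (\<Sum>j<k. \<integral>\<^sup>+u. ennreal \<bar>x (max 0 u) - x (real j * h)\<bar> * indicator {real j * h..real (Suc j) * h} u \<partial>lborel)"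

lemma cerr_nonneg: "cerr h k x \<ge> 0"
  unfolding cerr_def set_lebesgue_integral_def by (intro sum_nonneg integral_nonneg_AE) auto

lemma cerr_mono: "k \<le> m \<Longrightarrow> cerr h k x \<le> cerr h m x"
  unfolding cerr_def set_lebesgue_integral_def by (intro sum_mono2 integral_nonneg_AE) auto

lemma path_cell:
  assumes "\<omega> \<in> \<Omega>" "h \<ge> 0"
  shows "continuous_on {real j * h..real (Suc j) * h} \<omega>"
  using assms by (auto simp: path_set_def elim!: continuous_on_subset intro: order_trans[rotated])

lemma cerr_nn_eq:
  assumes x: "\<omega> \<in> \<Omega>" and h: "h \<ge> 0"
  shows "cerr_nn h k \<omega> = ennreal (cerr h k \<omega>)"
proof -
  have "(\<integral>\<^sup>+u. ennreal \<bar>\<omega> (max 0 u) - \<omega> (real j * h)\<bar> * indicator {real j * h..real (Suc j) * h} u \<partial>lborel)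
      = ennreal (LINT u:{real j * h..real (Suc j) * h}|lborel. \<bar>\<omega> u - \<omega> (real j * h)\<bar>)" for j
  proof -
    have i: "set_integrable lborel {real j * h..real (Suc j) * h} (\<lambda>u. \<bar>\<omega> u - \<omega> (real j * h)\<bar>)"
      by (intro set_integrable_continuous continuous_intros path_cell x h)
    have m: "max 0 u = u" if "u \<in> {real j * h..real (Suc j) * h}" for u
      using that h by (auto intro!: max_absorb2 order_trans[of 0 "real j * h" u])
    have "(\<integral>\<^sup>+u. ennreal \<bar>\<omega> (max 0 u) - \<omega> (real j * h)\<bar> * indicator {real j * h..real (Suc j) * h} u \<partial>lborel)
        = (\<integral>\<^sup>+u. ennreal (indicator {real j * h..real (Suc j) * h} u *\<^sub>R \<bar>\<omega> u - \<omega> (real j * h)\<bar>) \<partial>lborel)"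
      using m by (intro nn_integral_cong) (auto simp: indicator_def)
    also have "\<dots> = ennreal (LINT u:{real j * h..real (Suc j) * h}|lborel. \<bar>\<omega> u - \<omega> (real j * h)\<bar>)"
      unfolding set_lebesgue_integral_def
      by (rule nn_integral_eq_integral) (use i in \<open>auto simp: set_integrable_def\<close>)
    finally show ?thesis .
  qed
  then show ?thesis unfolding cerr_nn_def cerr_def
    by (simp add: sum_ennreal set_lebesgue_integral_def integral_nonneg_AE)
qed

lemma riemann_cell:
  fixes \<phi> :: "real \<Rightarrow> real"
  assumes lip: "\<And>x y. \<bar>\<phi> x - \<phi> y\<bar> \<le> C * \<bar>x - y\<bar>" and x: "continuous_on {a..b} x" and ab: "a \<le> b"
  shows "\<bar>\<phi> (x a) * (b - a) - (LINT u:{a..b}|lborel. \<phi> (x u))\<bar> \<le> C * (LINT u:{a..b}|lborel. \<bar>x u - x a\<bar>)"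
proof -
  have C: "C \<ge> 0" using lip[of 1 0] by simp
  have \<phi>: "continuous_on UNIV \<phi>"
    by (rule lipschitz_on_continuous_on[of C]) (use lip C in \<open>auto simp: lipschitz_on_def dist_real_def\<close>)
  have c: "continuous_on {a..b} (\<lambda>u. \<phi> (x u))" by (rule continuous_on_compose2[OF \<phi> x]) auto
  have i: "set_integrable lborel {a..b} (\<lambda>u. \<phi> (x a) - \<phi> (x u))"
    by (intro set_integrable_continuous continuous_intros c)
  have "\<phi> (x a) * (b - a) - (LINT u:{a..b}|lborel. \<phi> (x u)) = (LINT u:{a..b}|lborel. \<phi> (x a) - \<phi> (x u))"
    using ab by (subst set_integral_diff) (auto simp: LINT_const_Icc set_integrable_const_Icc intro: set_integrable_continuous c)
  also have "\<bar>\<dots>\<bar> \<le> (LINT u:{a..b}|lborel. \<bar>\<phi> (x a) - \<phi> (x u)\<bar>)" by (rule set_integral_abs_le[OF i])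
  also have "\<dots> \<le> (LINT u:{a..b}|lborel. C * \<bar>x u - x a\<bar>)"
    by (intro set_integral_mono set_integrable_continuous continuous_intros c x)
      (subst abs_minus_commute, rule lip)
  also have "\<dots> = C * (LINT u:{a..b}|lborel. \<bar>x u - x a\<bar>)" by simp
  finally show ?thesis .
qed

subsection \<open>Almost sure convergence from summable means\<close>

text \<open>Summable means make the sum of the f n finite almost surely, so its terms tend to 0.
  Measurability is carried by the dominating f n, and q may be any pathwise error.\<close>

lemma AE_tendsto_zero:
  fixes q :: "nat \<Rightarrow> 'a \<Rightarrow> real"
  assumes f[measurable]: "\<And>n. f n \<in> borel_measurable M"
    and int: "\<And>n. (\<integral>\<^sup>+x. f n x \<partial>M) \<le> ennreal (c n)" and c: "summable c" "\<And>n. c n \<ge> 0"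
    and q: "\<And>n. AE x in M. ennreal (q n x) \<le> f n x" "\<And>n x. q n x \<ge> 0"
  shows "AE x in M. (\<lambda>n. q n x) \<longlonglongrightarrow> 0"
proof -
  have "(\<integral>\<^sup>+x. (\<Sum>n. f n x) \<partial>M) = (\<Sum>n. \<integral>\<^sup>+x. f n x \<partial>M)" by (rule nn_integral_suminf) simp
  also have "\<dots> \<le> (\<Sum>n. ennreal (c n))" by (intro suminf_le int) auto
  also have "\<dots> < \<infinity>" using c by (simp add: suminf_ennreal_eq[of c "suminf c"] summable_sums less_top[symmetric])
  finally have "AE x in M. (\<Sum>n. f n x) \<noteq> \<infinity>" by (intro nn_integral_PInf_AE) auto
  moreover have "AE x in M. \<forall>n. ennreal (q n x) \<le> f n x" using q(1) by (simp add: AE_all_countable)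
  ultimately show ?thesis
  proof eventually_elim
    case (elim x)
    have "(\<Sum>n. ennreal (q n x)) \<le> (\<Sum>n. f n x)" using elim by (intro suminf_le) auto
    then have "(\<Sum>n. ennreal (q n x)) \<noteq> top" using elim(1) by (auto simp: top_unique)
    then have "summable (\<lambda>n. q n x)" using q(2) by (intro summable_suminf_not_top) auto
    then show ?case by (rule summable_LIMSEQ_zero)
  qed
qed

text \<open>Fatou's lemma gives one inequality. For the other, Z is at most min Z R + Z^2 / R, so
  truncation at level R costs at most C / R uniformly in n, and bounded convergence handles the
  truncated functions.\<close>

lemma nn_integral_tendsto_L2_bounded:
  assumes Z[measurable]: "\<And>n. Z n \<in> borel_measurable M" and H[measurable]: "H \<in> borel_measurable M"
    and M: "prob_space M"
    and Z0: "\<And>n x. Z n x \<ge> (0::real)" and H0: "\<And>x. H x \<ge> (0::real)"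
    and sq: "\<And>n. (\<integral>\<^sup>+x. ennreal ((Z n x)\<^sup>2) \<partial>M) \<le> ennreal C" and C: "C \<ge> 0"
    and lim: "AE x in M. (\<lambda>n. Z n x) \<longlonglongrightarrow> H x"
    and int: "(\<lambda>n. \<integral>\<^sup>+x. ennreal (Z n x) \<partial>M) \<longlonglongrightarrow> l"
  shows "(\<integral>\<^sup>+x. ennreal (H x) \<partial>M) = l"
proof (rule antisym)
  interpret prob_space M by (rule M)
  have "(\<integral>\<^sup>+x. ennreal (H x) \<partial>M) = (\<integral>\<^sup>+x. liminf (\<lambda>n. ennreal (Z n x)) \<partial>M)"
  proof (rule nn_integral_cong_AE)
    show "AE x in M. ennreal (H x) = liminf (\<lambda>n. ennreal (Z n x))"
      using lim
    proof eventually_elim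
      case (elim x)
      then have "(\<lambda>n. ennreal (Z n x)) \<longlonglongrightarrow> ennreal (H x)" by (rule tendsto_ennrealI)
      then show ?case by (simp add: lim_imp_Liminf)
    qed
  qed
  also have "\<dots> \<le> liminf (\<lambda>n. \<integral>\<^sup>+x. ennreal (Z n x) \<partial>M)" by (rule nn_integral_liminf) simp
  also have "\<dots> = l" using int by (simp add: lim_imp_Liminf)
  finally show "(\<integral>\<^sup>+x. ennreal (H x) \<partial>M) \<le> l" .
next
  interpret prob_space M by (rule M)
  have bound: "(\<integral>\<^sup>+x. ennreal (Z n x) \<partial>M) \<le> (\<integral>\<^sup>+x. ennreal (min (Z n x) R) \<partial>M) + ennreal (C / R)"
    if R: "R > 0" for n and R :: real
  proof -
    have "(\<integral>\<^sup>+x. ennreal (Z n x) \<partial>M) \<le> (\<integral>\<^sup>+x. ennreal (min (Z n x) R) + ennreal (1 / R) * ennreal ((Z n x)\<^sup>2) \<partial>M)"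
    proof (intro nn_integral_mono)
      fix x
      have "Z n x \<le> min (Z n x) R + 1 / R * (Z n x)\<^sup>2"
      proof (cases "Z n x \<le> R")
        case False
        then have "Z n x * R \<le> Z n x * Z n x" using Z0[of n x] by (intro mult_left_mono) auto
        then have "Z n x \<le> (Z n x)\<^sup>2 / R" using R by (simp add: pos_le_divide_eq power2_eq_square)
        then show ?thesis using False R by simp
      qed (use R in simp)
      then have "ennreal (Z n x) \<le> ennreal (min (Z n x) R + 1 / R * (Z n x)\<^sup>2)" by (rule ennreal_leI)
      also have "\<dots> = ennreal (min (Z n x) R) + ennreal (1 / R * (Z n x)\<^sup>2)"
        using Z0[of n x] R by (intro ennreal_plus) auto
      also have "ennreal (1 / R * (Z n x)\<^sup>2) = ennreal (1 / R) * ennreal ((Z n x)\<^sup>2)"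
        using R by (intro ennreal_mult) auto
      finally show "ennreal (Z n x) \<le> ennreal (min (Z n x) R) + ennreal (1 / R) * ennreal ((Z n x)\<^sup>2)" .
    qed
    also have "\<dots> = (\<integral>\<^sup>+x. ennreal (min (Z n x) R) \<partial>M) + ennreal (1 / R) * (\<integral>\<^sup>+x. ennreal ((Z n x)\<^sup>2) \<partial>M)"
      by (subst nn_integral_add) (auto simp: nn_integral_cmult)
    also have "\<dots> \<le> (\<integral>\<^sup>+x. ennreal (min (Z n x) R) \<partial>M) + ennreal (1 / R) * ennreal C"
      by (intro add_left_mono mult_left_mono sq) simp
    also have "ennreal (1 / R) * ennreal C = ennreal (C / R)"
      using C R by (simp add: ennreal_mult[symmetric])
    finally show ?thesis .
  qed
  have *: "l \<le> (\<integral>\<^sup>+x. ennreal (H x) \<partial>M) + ennreal (C / R)" if R: "R > 0" for R :: real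
  proof -
    have "(\<lambda>n. \<integral>\<^sup>+x. ennreal (min (Z n x) R) \<partial>M) \<longlonglongrightarrow> (\<integral>\<^sup>+x. ennreal (min (H x) R) \<partial>M)"
    proof (rule nn_integral_dominated_convergence[where w = "\<lambda>_. ennreal R"])
      show "AE x in M. (\<lambda>n. ennreal (min (Z n x) R)) \<longlonglongrightarrow> ennreal (min (H x) R)"
        using lim by eventually_elim (intro tendsto_ennrealI tendsto_min tendsto_const)
    qed (auto simp: emeasure_space_1 ennreal_leI less_top[symmetric])
    then have "(\<lambda>n. (\<integral>\<^sup>+x. ennreal (min (Z n x) R) \<partial>M) + ennreal (C / R))
        \<longlonglongrightarrow> (\<integral>\<^sup>+x. ennreal (min (H x) R) \<partial>M) + ennreal (C / R)"
      by (intro tendsto_add tendsto_const)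
    from LIMSEQ_le[OF int this] have "l \<le> (\<integral>\<^sup>+x. ennreal (min (H x) R) \<partial>M) + ennreal (C / R)"
      using bound[OF R] by blast
    also have "\<dots> \<le> (\<integral>\<^sup>+x. ennreal (H x) \<partial>M) + ennreal (C / R)"
      by (intro add_right_mono nn_integral_mono ennreal_leI) simp
    finally show ?thesis .
  qed
  show "l \<le> (\<integral>\<^sup>+x. ennreal (H x) \<partial>M)"
  proof (rule ennreal_le_epsilon)
    fix e :: real assume e: "0 < e"
    \<comment> \<open>The level R = (C + 1) / e makes the cost of truncation at most e and is
      positive even for C = 0.\<close>
    have "C / ((C + 1) / e) \<le> e"
    proof -
      have "C / ((C + 1) / e) = C / (C + 1) * e" by simp
      also have "\<dots> \<le> 1 * e" using e C by (intro mult_right_mono) auto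
      finally show ?thesis by simp
    qed
    then have "(\<integral>\<^sup>+x. ennreal (H x) \<partial>M) + ennreal (C / ((C + 1) / e)) \<le> (\<integral>\<^sup>+x. ennreal (H x) \<partial>M) + ennreal e"
      by (intro add_left_mono ennreal_leI)
    then show "l \<le> (\<integral>\<^sup>+x. ennreal (H x) \<partial>M) + ennreal e"
      using *[of "(C + 1) / e"] e C by (auto intro: order_trans)
  qed
qed

context wiener
begin

text \<open>For the mean, Tonelli's theorem moves the expectation inside the time integral, where an
  increment over a time of at most h has mean absolute value at most sqrt h. Each cell has length
  h.\<close>

lemma cerr_nn_measurable:
  assumes h: "h \<ge> 0"
  shows "cerr_nn h k \<in> borel_measurable P"
    and "(\<integral>\<^sup>+\<omega>. cerr_nn h k \<omega> \<partial>P) \<le> ennreal (real k * (h * sqrt h))"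
proof -
  have jm[measurable]: "(\<lambda>p. snd p (max 0 (fst p))) \<in> borel_measurable (lborel \<Otimes>\<^sub>M P)"
    using joint_measurable by (subst measurable_cong_sets[OF sets_pair_measure_cong refl]) auto
  let ?f = "\<lambda>j p. ennreal \<bar>snd p (max 0 (fst p)) - snd p (real j * h)\<bar> * indicator {real j * h..real (Suc j) * h} (fst p)"
  have cm[measurable]: "(\<lambda>p. snd p (real j * h)) \<in> borel_measurable (lborel \<Otimes>\<^sub>M P)" for j
    by (rule measurable_compose[OF measurable_snd coord_measurable_P]) (use h in simp)
  have fm[measurable]: "?f j \<in> borel_measurable (lborel \<Otimes>\<^sub>M P)" for j by measurable
  have sf: "pair_sigma_finite lborel P" by unfold_locales
  have 1: "(\<lambda>\<omega>. \<integral>\<^sup>+u. ?f j (u, \<omega>) \<partial>lborel) \<in> borel_measurable P" for j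
  proof -
    from lborel.borel_measurable_nn_integral_fst[OF measurable_pair_swap[OF fm]] show ?thesis by simp
  qed
  then show "cerr_nn h k \<in> borel_measurable P"
    unfolding cerr_nn_def by (intro borel_measurable_sum) simp
  have 2: "(\<integral>\<^sup>+\<omega>. (\<integral>\<^sup>+u. ?f j (u, \<omega>) \<partial>lborel) \<partial>P) \<le> ennreal (h * sqrt h)" for j
  proof -
    have "(\<integral>\<^sup>+\<omega>. (\<integral>\<^sup>+u. ?f j (u, \<omega>) \<partial>lborel) \<partial>P) = (\<integral>\<^sup>+u. (\<integral>\<^sup>+\<omega>. ?f j (u, \<omega>) \<partial>P) \<partial>lborel)"
      by (rule pair_sigma_finite.Fubini[OF sf fm])
    also have "\<dots> \<le> (\<integral>\<^sup>+u. ennreal (sqrt h) * indicator {real j * h..real (Suc j) * h} u \<partial>lborel)"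
    proof (intro nn_integral_mono)
      fix u :: real
      show "(\<integral>\<^sup>+\<omega>. ?f j (u, \<omega>) \<partial>P) \<le> ennreal (sqrt h) * indicator {real j * h..real (Suc j) * h} u"
      proof (cases "u \<in> {real j * h..real (Suc j) * h}")
        case True
        then have u: "0 \<le> real j * h" "real j * h \<le> u" "u - real j * h \<le> h" using h by (auto simp: algebra_simps)
        have "(\<integral>\<^sup>+\<omega>. ennreal \<bar>\<omega> u - \<omega> (real j * h)\<bar> \<partial>P) \<le> ennreal (sqrt (u - real j * h))"
          by (rule increment_abs[OF u(1,2)])
        also have "\<dots> \<le> ennreal (sqrt h)" using u by (intro ennreal_leI real_sqrt_le_mono)
        finally show ?thesis using True max_absorb2[OF order_trans[OF u(1,2)]] by simp
      qed simp
    qed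
    also have "\<dots> = ennreal (sqrt h) * ennreal h"
      using h by (subst nn_integral_cmult) (auto simp: emeasure_lborel_Icc_eq algebra_simps)
    also have "\<dots> = ennreal (h * sqrt h)" using h by (simp add: ennreal_mult mult.commute)
    finally show ?thesis .
  qed
  have "(\<integral>\<^sup>+\<omega>. cerr_nn h k \<omega> \<partial>P) = (\<Sum>j<k. \<integral>\<^sup>+\<omega>. (\<integral>\<^sup>+u. ?f j (u, \<omega>) \<partial>lborel) \<partial>P)"
    unfolding cerr_nn_def using 1 by (subst nn_integral_sum) auto
  also have "\<dots> \<le> (\<Sum>j<k. ennreal (h * sqrt h))" by (intro sum_mono 2)
  also have "\<dots> = ennreal (real k * (h * sqrt h))"
    using h by (simp add: ennreal_mult ennreal_of_nat_eq_real_of_nat)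
  finally show "(\<integral>\<^sup>+\<omega>. cerr_nn h k \<omega> \<partial>P) \<le> ennreal (real k * (h * sqrt h))" .
qed

end

text \<open>Mollified drift: \<open>f\<close> is convolved twice with the uniform kernel, so that the second
  derivative is a plain second difference of \<open>f\<close>. The mesh is chosen so fine that all
  discretization errors are summable.\<close>

locale euler_limit = wiener +
  fixes f F \<Phi> :: "real \<Rightarrow> real" and B T :: real
  assumes T: "T > 0" and B: "B \<ge> 0"
    and f_lip: "\<And>x y. \<bar>f x - f y\<bar> \<le> B * \<bar>x - y\<bar>"
    and f0: "f 0 = 0"
    and F': "\<And>x. (F has_real_derivative f x) (at x)"
    and \<Phi>': "\<And>x. (\<Phi> has_real_derivative F x) (at x)"
begin

definition eps :: "nat \<Rightarrow> real" where "eps n = 1 / real (Suc n)"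
text \<open>Lipschitz constants of the mollified functions cost a factor (n + 1)^2, while sqrt (hh
  n) is of order (n + 1)^-4. The power 8 therefore leaves mean errors of order (n + 1)^-2.\<close>

definition mesh :: "nat \<Rightarrow> nat" where "mesh n = Suc n ^ 8"
definition hh :: "nat \<Rightarrow> real" where "hh n = T / real (mesh n)"
text \<open>Second differences of the second antiderivative of f, of the first one, and of f itself:
  these are the mollified potential and its first and second derivatives.\<close>

definition fn :: "nat \<Rightarrow> real \<Rightarrow> real" where "fn n = sdiff (eps n) \<Phi>"
definition bn :: "nat \<Rightarrow> real \<Rightarrow> real" where "bn n = sdiff (eps n) F"
definition dn :: "nat \<Rightarrow> real \<Rightarrow> real" where "dn n = sdiff (eps n) f"
definition \<phi>n :: "nat \<Rightarrow> real \<Rightarrow> real" where "\<phi>n n x = dn n x + (bn n x)\<^sup>2"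
definition J :: "nat \<Rightarrow> (real \<Rightarrow> real) \<Rightarrow> real" where "J n \<omega> = (LINT u:{0..T}|lborel. \<phi>n n (\<omega> u))"
definition dens :: "nat \<Rightarrow> (real \<Rightarrow> real) \<Rightarrow> real" where "dens n = wt (bn n) (hh n) (mesh n)"

lemma eps_pos [simp]: "eps n > 0" by (simp add: eps_def)
lemma eps_lim: "eps \<longlonglongrightarrow> 0" unfolding eps_def using LIMSEQ_inverse_real_of_nat by (simp add: inverse_eq_divide)
lemma mesh_pos [simp]: "mesh n > 0" by (simp add: mesh_def)
lemma hh_pos [simp]: "hh n > 0" using T by (simp add: hh_def)
lemma hh_nonneg [simp]: "hh n \<ge> 0" using hh_pos[of n] by linarith
lemma mesh_hh: "real (mesh n) * hh n = T" by (simp add: hh_def)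
lemma hh_eq: "hh n = T / real (Suc n) ^ 8" by (simp add: hh_def mesh_def)

lemma sqrt_hh: "sqrt (hh n) = sqrt T / real (Suc n) ^ 4"
proof -
  have "sqrt (real (Suc n) ^ 8) = real (Suc n) ^ 4"
    by (rule real_sqrt_unique) (auto simp: power_mult[symmetric])
  then show ?thesis unfolding hh_eq by (simp add: real_sqrt_divide)
qed

lemma mesh_top: "filterlim mesh at_top sequentially"
proof (rule filterlim_at_top_mono[OF filterlim_Suc])
  show "\<forall>\<^sub>F n in sequentially. Suc n \<le> mesh n" unfolding mesh_def by (intro always_eventually allI self_le_power) auto
qed

lemma fn': "(fn n has_real_derivative bn n x) (at x)"
  unfolding fn_def bn_def by (rule sdiff_deriv[OF \<Phi>'])

lemma bn': "(bn n has_real_derivative dn n x) (at x)"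
  unfolding bn_def dn_def by (rule sdiff_deriv[OF F'])

lemma bn_bound: "\<bar>bn n x\<bar> \<le> B"
  unfolding bn_def by (rule sdiff_bound[OF F' _ f_lip]) simp

lemma dn_bound: "\<bar>dn n x\<bar> \<le> 2 * B * real (Suc n)"
  using sdiff_bound_lip[OF eps_pos f_lip, of n x] unfolding dn_def eps_def by simp

lemma dn_lip: "\<bar>dn n x - dn n y\<bar> \<le> 4 * B * (real (Suc n))\<^sup>2 * \<bar>x - y\<bar>"
  using sdiff_lip[OF eps_pos f_lip, of n x y] unfolding dn_def eps_def by (simp add: power_divide)

lemma bn_lip: "\<bar>bn n x - bn n y\<bar> \<le> 2 * B * real (Suc n) * \<bar>x - y\<bar>"
  using field_differentiable_bound[of UNIV "bn n" "dn n" "2 * B * real (Suc n)" x y] bn' dn_bound by simp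

lemma bn_measurable [measurable]: "bn n \<in> borel_measurable borel"
  by (intro borel_measurable_continuous_onI) (auto intro!: DERIV_isCont[OF bn'] continuous_at_imp_continuous_on)

lemma dn_measurable [measurable]: "dn n \<in> borel_measurable borel"
proof -
  have "continuous_on UNIV f" by (auto intro!: lipschitz_on_continuous_on[of B] simp: lipschitz_on_def dist_real_def f_lip B)
  then have [measurable]: "f \<in> borel_measurable borel" by (rule borel_measurable_continuous_onI)
  show ?thesis unfolding dn_def sdiff_def[abs_def] by measurable
qed

definition Lp :: "nat \<Rightarrow> real" where "Lp n = (4 * B + 4 * B\<^sup>2) * (real (Suc n))\<^sup>2"

lemma Lp_nonneg: "Lp n \<ge> 0" using B by (simp add: Lp_def)

lemma \<phi>n_lip: "\<bar>\<phi>n n x - \<phi>n n y\<bar> \<le> Lp n * \<bar>x - y\<bar>"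
proof -
  have "\<bar>(bn n x)\<^sup>2 - (bn n y)\<^sup>2\<bar> = \<bar>bn n x + bn n y\<bar> * \<bar>bn n x - bn n y\<bar>"
    by (simp add: abs_mult[symmetric] power2_eq_square algebra_simps)
  also have "\<dots> \<le> (2 * B) * (2 * B * real (Suc n) * \<bar>x - y\<bar>)"
    using bn_bound[of n x] bn_bound[of n y] by (intro mult_mono bn_lip mult_nonneg_nonneg B abs_ge_zero zero_le_numeral of_nat_0_le_iff) linarith
  also have "\<dots> = 4 * B\<^sup>2 * \<bar>x - y\<bar> * real (Suc n)" by (simp add: power2_eq_square algebra_simps)
  also have "\<dots> \<le> 4 * B\<^sup>2 * \<bar>x - y\<bar> * (real (Suc n))\<^sup>2"
    by (intro mult_left_mono mult_nonneg_nonneg abs_ge_zero zero_le_power2 zero_le_numeral) (simp add: power2_eq_square)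
  finally show ?thesis using dn_lip[of n x y] unfolding \<phi>n_def Lp_def by (simp add: algebra_simps)
qed

lemma dens_nonneg: "dens n \<omega> \<ge> 0" by (simp add: dens_def wt_def)

text \<open>In each cell with increment d and length h, Taylor's formula writes b d - b^2 h / 2 as
  the increment of \<open>fn n\<close>, minus half of \<open>\<phi>n n\<close> times h, minus the
  centred term dn (d^2 - h) / 2, up to a cubic remainder. The increments telescope and the second
  part is a Riemann sum for \<open>J n\<close>. The three errors are thus the cubic variation, the
  fluctuation of the quadratic variation and the oscillation inside cells.\<close>

lemma log_dens_bound:
  assumes w: "\<omega> \<in> \<Omega>"
  shows "\<bar>ln (dens n \<omega>) - (fn n (\<omega> T) - fn n (\<omega> 0) - J n \<omega> / 2)\<bar>
    \<le> 4 * B * (real (Suc n))\<^sup>2 * (\<Sum>j<mesh n. \<bar>\<omega> (real (Suc j) * hh n) - \<omega> (real j * hh n)\<bar> ^ 3)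
    + \<bar>\<Sum>j<mesh n. dn n (\<omega> (real j * hh n)) * ((\<omega> (real (Suc j) * hh n) - \<omega> (real j * hh n))\<^sup>2 - hh n)\<bar>
    + Lp n * cerr (hh n) (mesh n) \<omega>"
proof -
  let ?h = "hh n" and ?N = "mesh n"
  let ?x = "\<lambda>j. \<omega> (real j * ?h)"
  let ?d = "\<lambda>j. \<omega> (real (Suc j) * ?h) - \<omega> (real j * ?h)"
  let ?K = "4 * B * (real (Suc n))\<^sup>2"
  let ?I = "\<lambda>j. LINT u:{real j * ?h..real (Suc j) * ?h}|lborel. \<phi>n n (\<omega> u)"
  let ?C = "\<lambda>j. LINT u:{real j * ?h..real (Suc j) * ?h}|lborel. \<bar>\<omega> u - \<omega> (real j * ?h)\<bar>"
  have h: "?h \<ge> 0" using hh_pos[of n] by linarith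
  have \<phi>c: "continuous_on UNIV (\<phi>n n)"
    using \<phi>n_lip Lp_nonneg by (auto intro!: lipschitz_on_continuous_on[of "Lp n"] simp: lipschitz_on_def dist_real_def)
  have Jeq: "J n \<omega> = (\<Sum>j<?N. ?I j)"
  proof -
    have "(LINT u:{0..real ?N * ?h}|lborel. \<phi>n n (\<omega> u)) = (\<Sum>j<?N. ?I j)"
      by (intro set_integral_cells h set_integrable_continuous continuous_on_compose2[OF \<phi>c path_continuous[OF w]]) auto
    then show ?thesis unfolding J_def mesh_hh .
  qed
  have ln: "ln (dens n \<omega>) = (\<Sum>j<?N. bn n (?x j) * ?d j - (bn n (?x j))\<^sup>2 * ?h / 2)"
    unfolding dens_def wt_def by (simp only: ln_exp)
  have tel: "fn n (\<omega> T) - fn n (\<omega> 0) = (\<Sum>j<?N. fn n (?x (Suc j)) - fn n (?x j))"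
    by (subst sum_lessThan_telescope) (simp add: mesh_hh)
  let ?e = "\<lambda>j. (bn n (?x j) * ?d j - (bn n (?x j))\<^sup>2 * ?h / 2) - (fn n (?x (Suc j)) - fn n (?x j)) + ?I j / 2 + dn n (?x j) * ((?d j)\<^sup>2 - ?h) / 2"
  have tri: "p = - r - s / 2 \<Longrightarrow> \<bar>r\<bar> \<le> a \<Longrightarrow> \<bar>s\<bar> \<le> b \<Longrightarrow> \<bar>p\<bar> \<le> a + b" for p r s a b :: real
    by linarith
  have e: "\<bar>?e j\<bar> \<le> ?K * \<bar>?d j\<bar> ^ 3 + Lp n * ?C j" for j
  proof -
    define dd where "dd = \<omega> (real (Suc j) * ?h) - \<omega> (real j * ?h)"
    have t: "\<bar>fn n (?x (Suc j)) - fn n (?x j) - bn n (?x j) * dd - dn n (?x j) * dd\<^sup>2 / 2\<bar> \<le> ?K * \<bar>dd\<bar> ^ 3"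
      unfolding dd_def by (rule taylor_cubic[OF fn' bn' dn_lip])
    have "\<bar>\<phi>n n (?x j) * (real (Suc j) * ?h - real j * ?h) - ?I j\<bar> \<le> Lp n * ?C j"
      by (rule riemann_cell[OF \<phi>n_lip path_cell[OF w h]]) (use h in \<open>auto intro: mult_right_mono\<close>)
    moreover have "real (Suc j) * ?h - real j * ?h = ?h" by (simp add: algebra_simps)
    ultimately have r: "\<bar>\<phi>n n (?x j) * ?h - ?I j\<bar> \<le> Lp n * ?C j" by simp
    have "(bn n (?x j) * dd - (bn n (?x j))\<^sup>2 * ?h / 2) - (fn n (?x (Suc j)) - fn n (?x j)) + ?I j / 2 + dn n (?x j) * (dd\<^sup>2 - ?h) / 2
      = - (fn n (?x (Suc j)) - fn n (?x j) - bn n (?x j) * dd - dn n (?x j) * dd\<^sup>2 / 2)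
        - (\<phi>n n (?x j) * ?h - ?I j) / 2"
      unfolding \<phi>n_def by (simp add: field_simps)
    from tri[OF this t r] show ?thesis unfolding dd_def[symmetric] .
  qed
  have "ln (dens n \<omega>) - (fn n (\<omega> T) - fn n (\<omega> 0) - J n \<omega> / 2)
      = (\<Sum>j<?N. ?e j) - (\<Sum>j<?N. dn n (?x j) * ((?d j)\<^sup>2 - ?h)) / 2"
    unfolding ln tel Jeq by (simp add: sum.distrib sum_subtractf sum_divide_distrib)
  moreover have "\<bar>\<Sum>j<?N. ?e j\<bar> \<le> (\<Sum>j<?N. ?K * \<bar>?d j\<bar> ^ 3 + Lp n * ?C j)"
    by (rule order_trans[OF sum_abs sum_mono[OF e]])
  moreover have "(\<Sum>j<?N. ?K * \<bar>?d j\<bar> ^ 3 + Lp n * ?C j) = ?K * (\<Sum>j<?N. \<bar>?d j\<bar> ^ 3) + Lp n * cerr ?h ?N \<omega>"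
    unfolding cerr_def by (simp only: sum.distrib sum_distrib_left)
  ultimately show ?thesis by linarith
qed

lemma summable_inverse_squares: "summable (\<lambda>n. C / (real (Suc n))\<^sup>2)"
proof -
  have "summable (\<lambda>n. inverse (real (Suc n) ^ 2))"
    using inverse_power_summable[of 2, where 'a = real] by (subst summable_Suc_iff) auto
  then show ?thesis by (auto simp: divide_inverse intro: summable_mult)
qed

lemma cube_err:
  "AE \<omega> in P. (\<lambda>n. 4 * B * (real (Suc n))\<^sup>2 * (\<Sum>j<mesh n. \<bar>\<omega> (real (Suc j) * hh n) - \<omega> (real j * hh n)\<bar> ^ 3)) \<longlonglongrightarrow> 0"
proof (rule AE_tendsto_zero)
  let ?S = "\<lambda>n \<omega>. (\<Sum>j<mesh n. ennreal (\<bar>\<omega> (real (Suc j) * hh n) - \<omega> (real j * hh n)\<bar> ^ 3))"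
  have cm[measurable]: "(\<lambda>\<omega>. \<omega> (real j * hh n)) \<in> borel_measurable P" for j n
    using hh_pos[of n] by (intro coord_measurable_P mult_nonneg_nonneg) auto
  have m: "?S n \<in> borel_measurable P" for n
    by (intro borel_measurable_sum measurable_compose[OF _ measurable_ennreal] borel_measurable_power
        borel_measurable_abs borel_measurable_diff cm)
  show "(\<lambda>\<omega>. ennreal (4 * B * (real (Suc n))\<^sup>2) * ?S n \<omega>) \<in> borel_measurable P" for n
    using m by (rule borel_measurable_times_ennreal[OF borel_measurable_const])
  show "(\<integral>\<^sup>+\<omega>. ennreal (4 * B * (real (Suc n))\<^sup>2) * ?S n \<omega> \<partial>P) \<le> ennreal (8 * B * T * sqrt T / (real (Suc n))\<^sup>2)" for n
  proof -
    have "(\<integral>\<^sup>+\<omega>. ennreal (4 * B * (real (Suc n))\<^sup>2) * ?S n \<omega> \<partial>P)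
        = ennreal (4 * B * (real (Suc n))\<^sup>2) * (\<integral>\<^sup>+\<omega>. ?S n \<omega> \<partial>P)" by (rule nn_integral_cmult[OF m])
    also have "\<dots> \<le> ennreal (4 * B * (real (Suc n))\<^sup>2) * ennreal (real (mesh n) * (2 * hh n * sqrt (hh n)))"
      by (rule mult_left_mono[OF increments_cube[OF hh_pos]]) simp
    also have "\<dots> = ennreal (4 * B * (real (Suc n))\<^sup>2 * (real (mesh n) * (2 * hh n * sqrt (hh n))))"
      using B by (intro ennreal_mult[symmetric] mult_nonneg_nonneg) auto
    also have "4 * B * (real (Suc n))\<^sup>2 * (real (mesh n) * (2 * hh n * sqrt (hh n)))
        = 8 * B * (real (mesh n) * hh n) * sqrt (hh n) * (real (Suc n))\<^sup>2" by (simp add: algebra_simps)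
    also have "\<dots> = 8 * B * T * sqrt T / (real (Suc n))\<^sup>2"
      unfolding mesh_hh sqrt_hh by (simp add: power4_eq_xxxx power2_eq_square)
    finally show ?thesis .
  qed
  show "summable (\<lambda>n. 8 * B * T * sqrt T / (real (Suc n))\<^sup>2)" by (rule summable_inverse_squares)
  show "8 * B * T * sqrt T / (real (Suc n))\<^sup>2 \<ge> 0" for n using B T by simp
  show "AE \<omega> in P. ennreal (4 * B * (real (Suc n))\<^sup>2 * (\<Sum>j<mesh n. \<bar>\<omega> (real (Suc j) * hh n) - \<omega> (real j * hh n)\<bar> ^ 3))
      \<le> ennreal (4 * B * (real (Suc n))\<^sup>2) * ?S n \<omega>" for n
    using B by (intro AE_I2) (simp add: ennreal_mult sum_nonneg del: of_nat_Suc)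
  show "4 * B * (real (Suc n))\<^sup>2 * (\<Sum>j<mesh n. \<bar>\<omega> (real (Suc j) * hh n) - \<omega> (real j * hh n)\<bar> ^ 3) \<ge> 0" for n \<omega>
    using B by (simp add: sum_nonneg)
qed

text \<open>Here second moments are summed over n, because the cancellation between the centred
  terms is visible only in mean square.\<close>

lemma square_err:
  "AE \<omega> in P. (\<lambda>n. \<bar>\<Sum>j<mesh n. dn n (\<omega> (real j * hh n)) * ((\<omega> (real (Suc j) * hh n) - \<omega> (real j * hh n))\<^sup>2 - hh n)\<bar>) \<longlonglongrightarrow> 0"
proof -
  let ?q = "\<lambda>n \<omega>. (\<Sum>j<mesh n. dn n (\<omega> (real j * hh n)) * ((\<omega> (real (Suc j) * hh n) - \<omega> (real j * hh n))\<^sup>2 - hh n))"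
  have "AE \<omega> in P. (\<lambda>n. (?q n \<omega>)\<^sup>2) \<longlonglongrightarrow> 0"
  proof (rule AE_tendsto_zero)
    have cm: "(\<lambda>\<omega>. \<omega> (real j * hh n)) \<in> borel_measurable P" for j n
      using hh_pos[of n] by (intro coord_measurable_P mult_nonneg_nonneg) auto
    show "(\<lambda>\<omega>. ennreal ((?q n \<omega>)\<^sup>2)) \<in> borel_measurable P" for n
      by (intro measurable_compose[OF _ measurable_ennreal] borel_measurable_power borel_measurable_sum
          borel_measurable_times borel_measurable_diff borel_measurable_const measurable_compose[OF cm dn_measurable] cm)
    show "(\<integral>\<^sup>+\<omega>. ennreal ((?q n \<omega>)\<^sup>2) \<partial>P) \<le> ennreal (8 * B\<^sup>2 * T\<^sup>2 / (real (Suc n))\<^sup>2)" for n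
    proof -
      have "(\<integral>\<^sup>+\<omega>. ennreal ((?q n \<omega>)\<^sup>2) \<partial>P) \<le> ennreal (real (mesh n) * (2 * (2 * B * real (Suc n))\<^sup>2 * (hh n)\<^sup>2))"
        by (rule quadratic_variation[OF hh_pos dn_measurable dn_bound])
      also have "real (mesh n) * (2 * (2 * B * real (Suc n))\<^sup>2 * (hh n)\<^sup>2) = 8 * B\<^sup>2 * (real (Suc n))\<^sup>2 * (real (mesh n) * hh n) * hh n"
        by (simp add: power_mult_distrib) (simp add: power2_eq_square algebra_simps)
      also have "\<dots> = 8 * B\<^sup>2 * T\<^sup>2 * ((real (Suc n))\<^sup>2 / real (Suc n) ^ 8)"
        unfolding mesh_hh unfolding hh_eq by (simp add: power2_eq_square)
      also have "\<dots> \<le> 8 * B\<^sup>2 * T\<^sup>2 * (1 / (real (Suc n))\<^sup>2)"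
      proof (rule mult_left_mono)
        have "real (Suc n) ^ 4 \<le> real (Suc n) ^ 8" by (rule power_increasing) auto
        then show "(real (Suc n))\<^sup>2 / real (Suc n) ^ 8 \<le> 1 / (real (Suc n))\<^sup>2"
          by (subst frac_le_eq) (auto simp: divide_le_0_iff power_add[symmetric] simp del: of_nat_Suc)
      qed simp
      finally show ?thesis by (simp add: ennreal_leI)
    qed
    show "summable (\<lambda>n. 8 * B\<^sup>2 * T\<^sup>2 / (real (Suc n))\<^sup>2)" by (rule summable_inverse_squares)
  qed auto
  then show ?thesis
  proof eventually_elim
    case (elim \<omega>)
    then have "(\<lambda>n. sqrt ((?q n \<omega>)\<^sup>2)) \<longlonglongrightarrow> sqrt 0" by (rule tendsto_real_sqrt)
    then show ?case by simp
  qed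
qed

text \<open>The constant C is free because this error occurs twice: in the expansion of the density
  and in the comparison of the scheme with the diffusion.\<close>

lemma cell_err: "AE \<omega> in P. (\<lambda>n. C * (real (Suc n))\<^sup>2 * cerr (hh n) (mesh n) \<omega>) \<longlonglongrightarrow> 0" if C: "C \<ge> 0"
proof (rule AE_tendsto_zero)
  have h: "hh n \<ge> 0" for n using hh_pos[of n] by linarith
  show "(\<lambda>\<omega>. ennreal (C * (real (Suc n))\<^sup>2) * cerr_nn (hh n) (mesh n) \<omega>) \<in> borel_measurable P" for n
    using cerr_nn_measurable(1)[OF h] by (rule borel_measurable_times_ennreal[OF borel_measurable_const])
  show "(\<integral>\<^sup>+\<omega>. ennreal (C * (real (Suc n))\<^sup>2) * cerr_nn (hh n) (mesh n) \<omega> \<partial>P) \<le> ennreal (C * T * sqrt T / (real (Suc n))\<^sup>2)" for n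
  proof -
    have "(\<integral>\<^sup>+\<omega>. ennreal (C * (real (Suc n))\<^sup>2) * cerr_nn (hh n) (mesh n) \<omega> \<partial>P)
        = ennreal (C * (real (Suc n))\<^sup>2) * (\<integral>\<^sup>+\<omega>. cerr_nn (hh n) (mesh n) \<omega> \<partial>P)"
      by (rule nn_integral_cmult[OF cerr_nn_measurable(1)[OF h]])
    also have "\<dots> \<le> ennreal (C * (real (Suc n))\<^sup>2) * ennreal (real (mesh n) * (hh n * sqrt (hh n)))"
      by (rule mult_left_mono[OF cerr_nn_measurable(2)[OF h]]) simp
    also have "\<dots> = ennreal (C * (real (Suc n))\<^sup>2 * (real (mesh n) * (hh n * sqrt (hh n))))"
      using C by (intro ennreal_mult[symmetric] mult_nonneg_nonneg) auto
    also have "C * (real (Suc n))\<^sup>2 * (real (mesh n) * (hh n * sqrt (hh n)))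
        = C * (real (mesh n) * hh n) * sqrt (hh n) * (real (Suc n))\<^sup>2" by (simp add: algebra_simps)
    also have "\<dots> = C * T * sqrt T / (real (Suc n))\<^sup>2"
      unfolding mesh_hh sqrt_hh by (simp add: power4_eq_xxxx power2_eq_square)
    finally show ?thesis .
  qed
  show "summable (\<lambda>n. C * T * sqrt T / (real (Suc n))\<^sup>2)" by (rule summable_inverse_squares)
  show "C * T * sqrt T / (real (Suc n))\<^sup>2 \<ge> 0" for n using C T by simp
  show "AE \<omega> in P. ennreal (C * (real (Suc n))\<^sup>2 * cerr (hh n) (mesh n) \<omega>)
      \<le> ennreal (C * (real (Suc n))\<^sup>2) * cerr_nn (hh n) (mesh n) \<omega>" for n
  proof (rule AE_mp[OF AE_space AE_I2], rule impI)
    fix \<omega> assume "\<omega> \<in> space P"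
    then show "ennreal (C * (real (Suc n))\<^sup>2 * cerr (hh n) (mesh n) \<omega>)
      \<le> ennreal (C * (real (Suc n))\<^sup>2) * cerr_nn (hh n) (mesh n) \<omega>"
      using C by (simp add: cerr_nn_eq[OF _ h] ennreal_mult cerr_nonneg del: of_nat_Suc)
  qed
  show "C * (real (Suc n))\<^sup>2 * cerr (hh n) (mesh n) \<omega> \<ge> 0" for n \<omega> using C by (simp add: cerr_nonneg)
qed

lemma fn_lim: "(\<lambda>n. fn n x) \<longlonglongrightarrow> f x"
  unfolding fn_def by (rule sdiff_tendsto[OF \<Phi>' F' eps_lim eps_pos])

lemma bn_lim: "(f has_real_derivative b) (at x) \<Longrightarrow> (\<lambda>n. bn n x) \<longlonglongrightarrow> b"
  unfolding bn_def by (rule sdiff_tendsto[OF F' _ eps_lim eps_pos])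

text \<open>The limit of \<open>J n\<close> depends on the path, so it is quantified inside the
  almost sure statement: one null set serves every possible limit j.\<close>

lemma dens_lim:
  "AE \<omega> in P. \<forall>j. (\<lambda>n. J n \<omega>) \<longlonglongrightarrow> j \<longrightarrow> (\<lambda>n. dens n \<omega>) \<longlonglongrightarrow> exp (f (\<omega> T) - j / 2)"
proof -
  have C0: "4 * B + 4 * B\<^sup>2 \<ge> 0" using B by simp
  show ?thesis
    using cube_err square_err cell_err[OF C0] AE_start AE_space
  proof eventually_elim
    case (elim \<omega>)
    show ?case
    proof (intro allI impI)
      fix j assume j: "(\<lambda>n. J n \<omega>) \<longlonglongrightarrow> j"
      have w: "\<omega> \<in> \<Omega>" using elim(5) by simp
      have "(\<lambda>n. (4 * B + 4 * B\<^sup>2) * (real (Suc n))\<^sup>2 * cerr (hh n) (mesh n) \<omega>) \<longlonglongrightarrow> 0" using elim(3) .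
      then have 3: "(\<lambda>n. Lp n * cerr (hh n) (mesh n) \<omega>) \<longlonglongrightarrow> 0" by (simp add: Lp_def)
      have "(\<lambda>n. ln (dens n \<omega>) - (fn n (\<omega> T) - fn n (\<omega> 0) - J n \<omega> / 2)) \<longlonglongrightarrow> 0"
        by (rule Lim_null_comparison[OF _ tendsto_add_zero[OF tendsto_add_zero[OF elim(1,2)] 3]])
          (use log_dens_bound[OF w] in simp)
      moreover have "(\<lambda>n. fn n (\<omega> T) - fn n (\<omega> 0) - J n \<omega> / 2) \<longlonglongrightarrow> f (\<omega> T) - f (\<omega> 0) - j / 2"
        by (intro tendsto_intros fn_lim j) simp
      ultimately have "(\<lambda>n. (ln (dens n \<omega>) - (fn n (\<omega> T) - fn n (\<omega> 0) - J n \<omega> / 2)) + (fn n (\<omega> T) - fn n (\<omega> 0) - J n \<omega> / 2))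
          \<longlonglongrightarrow> 0 + (f (\<omega> T) - f (\<omega> 0) - j / 2)" by (rule tendsto_add)
      then have "(\<lambda>n. ln (dens n \<omega>)) \<longlonglongrightarrow> f (\<omega> T) - j / 2" using elim(4) f0 by simp
      then have "(\<lambda>n. exp (ln (dens n \<omega>))) \<longlonglongrightarrow> exp (f (\<omega> T) - j / 2)" by (rule tendsto_exp)
      then show "(\<lambda>n. dens n \<omega>) \<longlonglongrightarrow> exp (f (\<omega> T) - j / 2)" by (simp add: dens_def wt_def)
    qed
  qed
qed

text \<open>Passes to the limit on both sides of \<open>girsanov_discrete\<close>. On the Wiener
  side the products are bounded in L2 by \<open>wt_square\<close>; on the side of the scheme the
  functionals are bounded by 1.\<close>

theorem girsanov_limit:
  assumes G[measurable]: "\<And>n. G n \<in> borel_measurable seqM" and G01: "\<And>n x. 0 \<le> G n x" "\<And>n x. G n x \<le> (1::real)"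
    and H[measurable]: "H \<in> borel_measurable P" "\<And>\<omega>. H \<omega> \<ge> 0" and K[measurable]: "K \<in> borel_measurable P"
    and limH: "AE \<omega> in P. (\<lambda>n. G n (gseq (\<lambda>j. real j * hh n) (mesh n) \<omega>) * dens n \<omega>) \<longlonglongrightarrow> H \<omega>"
    and limK: "AE \<omega> in P. (\<lambda>n. G n (eseq (bn n) (hh n) (mesh n) \<omega>)) \<longlonglongrightarrow> K \<omega>"
  shows "(\<integral>\<^sup>+\<omega>. ennreal (H \<omega>) \<partial>P) = (\<integral>\<^sup>+\<omega>. ennreal (K \<omega>) \<partial>P)"
proof (rule nn_integral_tendsto_L2_bounded)
  let ?X = "\<lambda>n. gseq (\<lambda>j. real j * hh n) (mesh n)" and ?E = "\<lambda>n. eseq (bn n) (hh n) (mesh n)"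
  have h: "hh n \<ge> 0" for n using hh_pos[of n] by linarith
  have [measurable]: "?E n \<in> measurable P seqM" for n
    by (rule meas_F, rule eseq_measurable[where s = T]) (auto simp: h mesh_hh)
  have [measurable]: "?X n \<in> measurable P seqM" for n
    by (rule meas_F, rule gseq_measurable[where s = T]) (auto simp: mesh_hh intro!: monoI mult_right_mono h)
  have [measurable]: "dens n \<in> borel_measurable P" for n
    unfolding dens_def by (rule meas_F, rule wt_measurable[where s = T]) (auto simp: h mesh_hh)
  show "(\<lambda>\<omega>. G n (?X n \<omega>) * dens n \<omega>) \<in> borel_measurable P" for n by measurable
  show "prob_space P" by unfold_locales
  show "G n (?X n \<omega>) * dens n \<omega> \<ge> 0" for n \<omega> using G01 dens_nonneg by simp
  show "(\<integral>\<^sup>+\<omega>. ennreal ((G n (?X n \<omega>) * dens n \<omega>)\<^sup>2) \<partial>P) \<le> ennreal (exp (B\<^sup>2 * T))" for n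
  proof -
    have "(G n (?X n \<omega>) * dens n \<omega>)\<^sup>2 \<le> (dens n \<omega>)\<^sup>2" for \<omega>
      using mult_right_mono[OF G01(2) dens_nonneg] G01(1) dens_nonneg by (intro power_mono) auto
    then have "(\<integral>\<^sup>+\<omega>. ennreal ((G n (?X n \<omega>) * dens n \<omega>)\<^sup>2) \<partial>P) \<le> (\<integral>\<^sup>+\<omega>. ennreal ((dens n \<omega>)\<^sup>2) \<partial>P)"
      by (intro nn_integral_mono ennreal_leI)
    also have "\<dots> \<le> ennreal (exp (B\<^sup>2 * (real (mesh n) * hh n)))"
      unfolding dens_def by (rule wt_square[OF hh_pos bn_measurable bn_bound])
    finally show ?thesis unfolding mesh_hh .
  qed
  have "(\<lambda>n. \<integral>\<^sup>+\<omega>. ennreal (G n (?E n \<omega>)) \<partial>P) \<longlonglongrightarrow> (\<integral>\<^sup>+\<omega>. ennreal (K \<omega>) \<partial>P)"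
  proof (rule nn_integral_dominated_convergence[where w = "\<lambda>_. 1"])
    show "AE \<omega> in P. (\<lambda>n. ennreal (G n (?E n \<omega>))) \<longlonglongrightarrow> ennreal (K \<omega>)"
      using limK by eventually_elim (rule tendsto_ennrealI)
  qed (auto simp: G01)
  moreover have "(\<integral>\<^sup>+\<omega>. ennreal (G n (?E n \<omega>)) \<partial>P) = (\<integral>\<^sup>+\<omega>. ennreal (G n (?X n \<omega>) * dens n \<omega>) \<partial>P)" for n
    unfolding dens_def using girsanov_discrete[OF hh_pos bn_measurable, of "\<lambda>x. ennreal (G n x)" n n "mesh n"] G01(1)
    by (simp add: ennreal_mult')
  ultimately show "(\<lambda>n. \<integral>\<^sup>+\<omega>. ennreal (G n (?X n \<omega>) * dens n \<omega>) \<partial>P) \<longlonglongrightarrow> (\<integral>\<^sup>+\<omega>. ennreal (K \<omega>) \<partial>P)"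
    by simp
qed (use H limH in auto)

end

section \<open>Existence of the mollified potentials, zeros of paths, and the limit of the
  exponent\<close>

lemma antiderivative_exists:
  fixes f :: "real \<Rightarrow> real"
  assumes "continuous_on UNIV f"
  shows "\<exists>F. \<forall>x. (F has_real_derivative f x) (at x)"
proof -
  have "\<exists>F. \<forall>x::real. -\<infinity> < ereal x \<longrightarrow> ereal x < \<infinity> \<longrightarrow> (F has_vector_derivative f x) (at x)"
    by (rule einterval_antiderivative) (use assms in \<open>auto simp: continuous_on_eq_continuous_at\<close>)
  then show ?thesis by (auto simp: has_real_derivative_iff_has_vector_derivative)
qed

lemma DERIV_abs_nonzero:
  assumes "x \<noteq> (0::real)"
  shows "(abs has_real_derivative sgn x) (at x)"
proof (cases "x > 0")
  case True
  have "((\<lambda>x. x) has_real_derivative sgn x) (at x)" using True by simp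
  then show ?thesis
    by (rule has_field_derivative_transform_within_open[where S = "{0<..}"]) (use True in auto)
next
  case False
  have "((\<lambda>x. - x) has_real_derivative sgn x) (at x)" using False assms by (auto intro!: derivative_eq_intros)
  then show ?thesis
    by (rule has_field_derivative_transform_within_open[where S = "{..<0}"]) (use False assms in auto)
qed

lemma lipschitz_continuous:
  fixes f :: "real \<Rightarrow> real"
  assumes "\<And>x y. \<bar>f x - f y\<bar> \<le> B * \<bar>x - y\<bar>"
  shows "continuous_on UNIV f"
proof -
  have "B \<ge> 0" using assms[of 1 0] by simp
  then show ?thesis by (auto intro!: lipschitz_on_continuous_on[of B] simp: lipschitz_on_def dist_real_def assms)
qed

context wiener
begin

lemma euler_limit_exists:
  assumes "T > 0" "\<And>x y. \<bar>f x - f y\<bar> \<le> B * \<bar>x - y\<bar>" "f 0 = 0"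
  shows "\<exists>F \<Phi>. euler_limit P f F \<Phi> B T"
proof -
  obtain F where F: "\<And>x. (F has_real_derivative f x) (at x)"
    using antiderivative_exists[OF lipschitz_continuous[OF assms(2)]] by blast
  have "continuous_on UNIV F" by (auto intro!: DERIV_isCont[OF F] continuous_at_imp_continuous_on)
  then obtain \<Phi> where \<Phi>: "\<And>x. (\<Phi> has_real_derivative F x) (at x)" using antiderivative_exists by blast
  have "B \<ge> 0" using assms(2)[of 1 0] by simp
  then have "euler_limit P f F \<Phi> B T" using assms F \<Phi> by unfold_locales auto
  then show ?thesis by blast
qed

text \<open>By Fubini's theorem it suffices that each fixed positive time misses 0 almost surely.
  The potentials are differentiable only off 0, so this makes pointwise limits along a path
  available at almost every time.\<close>

lemma AE_nonzero_path:
  assumes Z: "Z \<in> measurable P \<F>\<^sub>\<infinity>" and nz: "\<And>u. u > 0 \<Longrightarrow> AE \<omega> in P. Z \<omega> u \<noteq> 0"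
  shows "AE \<omega> in P. AE u in lborel. u \<ge> 0 \<longrightarrow> Z \<omega> u \<noteq> 0"
proof -
  interpret pp: pair_sigma_finite lborel P by unfold_locales
  have [measurable]: "(\<lambda>p. Z (snd p) (max 0 (fst p))) \<in> borel_measurable (lborel \<Otimes>\<^sub>M P)"
  proof -
    have "(\<lambda>p. (fst p, Z (snd p))) \<in> measurable (lborel \<Otimes>\<^sub>M P) (borel \<Otimes>\<^sub>M \<F>\<^sub>\<infinity>)"
      by (intro measurable_Pair measurable_compose[OF measurable_snd Z]) simp
    from measurable_compose[OF this joint_measurable] show ?thesis by simp
  qed
  have "{p \<in> space (lborel \<Otimes>\<^sub>M P). fst p \<ge> 0 \<longrightarrow> Z (snd p) (max 0 (fst p)) \<noteq> 0} \<in> sets (lborel \<Otimes>\<^sub>M P)"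
    by measurable
  note comm = pp.AE_commute[OF this]
  have "AE u in lborel. AE \<omega> in P. u \<ge> 0 \<longrightarrow> Z \<omega> (max 0 u) \<noteq> 0"
    using AE_lborel_singleton[of 0]
  proof eventually_elim
    case (elim u)
    show ?case
    proof (cases "u > 0")
      case True
      then show ?thesis using nz[of u] by simp
    qed (use elim in simp)
  qed
  then have "AE \<omega> in P. AE u in lborel. u \<ge> 0 \<longrightarrow> Z \<omega> (max 0 u) \<noteq> 0" unfolding comm .
  then show ?thesis
    by eventually_elim (elim AE_mp, auto simp: max_def)
qed

lemma AE_nonzero_coord:
  assumes "u > 0"
  shows "AE \<omega> in P. \<omega> u \<noteq> 0"
proof -
  have [measurable]: "(\<lambda>\<omega>. \<omega> u) \<in> borel_measurable P" using assms by (intro coord_measurable_P) simp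
  have m: "{\<omega> \<in> space P. \<not> \<omega> u \<noteq> 0} \<in> sets P" by measurable
  have "emeasure P {\<omega> \<in> space P. \<not> \<omega> u \<noteq> 0} = 0" using small_ball[OF assms, of 0] by simp
  then show ?thesis by (intro AE_I[OF order_refl _ m])
qed

lemma AE_nonzero: "AE \<omega> in P. AE u in lborel. u \<ge> 0 \<longrightarrow> \<omega> u \<noteq> 0"
  by (rule AE_nonzero_path) (auto simp: AE_nonzero_coord intro: measurable_ident_sets)

end

context euler_limit
begin

lemma eps_nonzero: "eps n \<noteq> 0"
  by (simp add: eps_def)

text \<open>Second differences are linear, so the kink k |x| separates from the differentiable part
  g. The kink yields the occupation density at 0. The remaining integrand is bounded and converges
  to the constant r at almost every time. For f = k |x| this constant is k^2; for the truncated
  potential it is 0.\<close>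

lemma J_lim:
  assumes w: "\<omega> \<in> \<Omega>" and nz: "AE u in lborel. u \<ge> 0 \<longrightarrow> \<omega> u \<noteq> 0"
    and f: "\<And>x. f x = k * \<bar>x\<bar> + g x"
    and g: "\<And>x. (g has_real_derivative g' x) (at x)" and lip: "\<And>x y. \<bar>g' x - g' y\<bar> \<le> \<Lambda> * \<bar>x - y\<bar>"
    and r: "\<And>u. u \<in> {0..T} \<Longrightarrow> \<omega> u \<noteq> 0 \<Longrightarrow> \<exists>d b. (g' has_real_derivative d) (at (\<omega> u)) \<and>
       (f has_real_derivative b) (at (\<omega> u)) \<and> d + b\<^sup>2 = r"
    and c: "c > 0"
    and occ: "((\<lambda>e. c / e * measure lborel {u \<in> {0..T}. \<bar>\<omega> u\<bar> < e}) \<longlongrightarrow> l) (at_right 0)"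
  shows "(\<lambda>n. J n \<omega>) \<longlonglongrightarrow> k * (l / c) + r * T"
proof -
  have \<omega>c: "continuous_on {0..T} \<omega>" by (rule path_continuous[OF w])
  let ?\<psi> = "\<lambda>n x. sdiff (eps n) g x + (bn n x)\<^sup>2"
  have gc: "continuous_on UNIV g" by (auto intro!: DERIV_isCont[OF g] continuous_at_imp_continuous_on)
  have c1: "continuous_on {0..T} (\<lambda>u. sdiff (eps n) abs (\<omega> u))" for n
    unfolding sdiff_def by (intro continuous_intros \<omega>c) (use eps_nonzero in auto)
  have c2: "continuous_on {0..T} (\<lambda>u. ?\<psi> n (\<omega> u))" for n
  proof -
    have "continuous_on UNIV (bn n)" by (auto intro!: DERIV_isCont[OF bn'] continuous_at_imp_continuous_on)
    moreover have "continuous_on UNIV (sdiff (eps n) g)"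
      unfolding sdiff_def[abs_def] by (intro continuous_intros continuous_on_compose2[OF gc]) (use eps_nonzero in auto)
    ultimately have "continuous_on UNIV (?\<psi> n)" by (intro continuous_intros)
    then show ?thesis by (rule continuous_on_compose2[OF _ \<omega>c]) simp
  qed
  have feq: "f = (\<lambda>x. k * \<bar>x\<bar> + g x)" by (rule ext) (rule f)
  have \<phi>: "\<phi>n n x = k * sdiff (eps n) abs x + ?\<psi> n x" for n x
    unfolding \<phi>n_def dn_def by (subst feq) (simp add: sdiff_linear)
  have Jeq: "J n \<omega> = k * (LINT u:{0..T}|lborel. sdiff (eps n) abs (\<omega> u)) + (LINT u:{0..T}|lborel. ?\<psi> n (\<omega> u))" for n
    unfolding J_def \<phi> by (subst set_integral_add) (auto intro!: set_integrable_continuous continuous_intros c1 c2)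
  have 1: "(\<lambda>n. LINT u:{0..T}|lborel. sdiff (eps n) abs (\<omega> u)) \<longlonglongrightarrow> l / c"
    by (rule occupation_tent[OF \<omega>c c occ eps_lim eps_pos])
  have 2: "(\<lambda>n. LINT u:{0..T}|lborel. ?\<psi> n (\<omega> u)) \<longlonglongrightarrow> (LINT u:{0..T}|lborel. r)"
    unfolding set_lebesgue_integral_def
  proof (rule integral_dominated_convergence[where w = "\<lambda>u. indicator {0..T} u *\<^sub>R (\<Lambda> + B\<^sup>2)"])
    show "integrable lborel (\<lambda>u. indicator {0..T} u *\<^sub>R (\<Lambda> + B\<^sup>2))"
      using set_integrable_const_Icc[of 0 T] by (simp add: set_integrable_def)
    show "(\<lambda>u. indicator {0..T} u *\<^sub>R ?\<psi> n (\<omega> u)) \<in> borel_measurable lborel" for n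
      using set_integrable_continuous[OF c2, of n] unfolding set_integrable_def by (rule borel_measurable_integrable)
    show "(\<lambda>u. indicator {0..T} u *\<^sub>R r) \<in> borel_measurable lborel" by measurable
    show "AE u in lborel. norm (indicator {0..T} u *\<^sub>R ?\<psi> n (\<omega> u)) \<le> indicator {0..T} u *\<^sub>R (\<Lambda> + B\<^sup>2)" for n
    proof (rule AE_I2)
      fix u
      have "\<bar>sdiff (eps n) g (\<omega> u)\<bar> \<le> \<Lambda>" by (rule sdiff_bound[OF g eps_pos lip])
      moreover have "(bn n (\<omega> u))\<^sup>2 \<le> B\<^sup>2"
        using bn_bound[of n "\<omega> u"] B by (intro power2_le_iff_abs_le[THEN iffD2]) auto
      ultimately have "\<bar>?\<psi> n (\<omega> u)\<bar> \<le> \<Lambda> + B\<^sup>2" using zero_le_power2[of "bn n (\<omega> u)"] by linarith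
      then show "norm (indicator {0..T} u *\<^sub>R ?\<psi> n (\<omega> u)) \<le> indicator {0..T} u *\<^sub>R (\<Lambda> + B\<^sup>2)"
        by (auto simp: indicator_def)
    qed
    show "AE u in lborel. (\<lambda>n. indicator {0..T} u *\<^sub>R ?\<psi> n (\<omega> u)) \<longlonglongrightarrow> indicator {0..T} u *\<^sub>R r"
      using nz
    proof eventually_elim
      case (elim u)
      show ?case
      proof (cases "u \<in> {0..T}")
        case True
        then obtain d b where db: "(g' has_real_derivative d) (at (\<omega> u))" "(f has_real_derivative b) (at (\<omega> u))" "d + b\<^sup>2 = r"
          using r[of u] elim by auto
        have "(\<lambda>n. ?\<psi> n (\<omega> u)) \<longlonglongrightarrow> d + b\<^sup>2"
          by (intro tendsto_intros sdiff_tendsto[OF g db(1) eps_lim eps_pos] bn_lim db(2))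
        then show ?thesis using True db by simp
      qed simp
    qed
  qed
  have "(LINT u:{0..T}|lborel. r) = r * T" using T by (simp add: LINT_const_Icc)
  then show ?thesis unfolding Jeq using 2 by (intro tendsto_intros 1) simp
qed

end

subsection \<open>Normalization of the local time\<close>

locale wiener_local_time = wiener +
  fixes L :: "real \<Rightarrow> (real \<Rightarrow> real) \<Rightarrow> real"
  assumes L: "local_time_zero P L"
begin

lemma L_measurable: "t \<ge> 0 \<Longrightarrow> L t \<in> borel_measurable (\<F> t)"
  using L by (simp add: local_time_zero_def adapted_def)

lemma L_measurable_P [measurable]: "t \<ge> 0 \<Longrightarrow> L t \<in> borel_measurable P"
  using meas_F[OF L_measurable] by simp

lemma L_zero: "AE \<omega> in P. L 0 \<omega> = 0"
  using L unfolding local_time_zero_def by (auto elim: AE_mp)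

lemma coord_integrable: "integrable P (\<lambda>\<omega>. \<bar>\<omega> 1\<bar>)"
proof (rule integrableI_bounded)
  show "(\<lambda>\<omega>. \<bar>\<omega> 1\<bar>) \<in> borel_measurable P" by measurable
  have "(\<integral>\<^sup>+\<omega>. ennreal (norm \<bar>\<omega> 1\<bar>) \<partial>P) = (\<integral>\<^sup>+\<omega>. ennreal \<bar>\<omega> 1 - \<omega> 0\<bar> \<partial>P)"
    by (rule nn_integral_cong_AE) (use AE_start in \<open>eventually_elim, simp\<close>)
  also have "\<dots> < \<infinity>" using increment_abs[of 0 1] by (auto intro: le_less_trans)
  finally show "(\<integral>\<^sup>+\<omega>. ennreal (norm \<bar>\<omega> 1\<bar>) \<partial>P) < \<infinity>" .
qed

lemma martingale_L: "martingale P (\<lambda>t \<omega>. \<bar>\<omega> t\<bar> - L t \<omega>)"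
  using L by (simp add: local_time_zero_def)

lemma L_integrable: "integrable P (L 1)"
proof -
  have "integrable P (\<lambda>\<omega>. \<bar>\<omega> 1\<bar> - L 1 \<omega>)" using martingale_L by (simp add: martingale_def)
  from Bochner_Integration.integrable_diff[OF coord_integrable this] show ?thesis by simp
qed

text \<open>The martingale |X| - L starts from 0 almost surely, and conditional expectation
  preserves the mean.\<close>

lemma expectation_L: "expectation (L 1) = expectation (\<lambda>\<omega>. \<bar>\<omega> 1\<bar>)"
proof -
  let ?Z = "\<lambda>t \<omega>. \<bar>\<omega> t\<bar> - L t \<omega>"
  have sub: "subalgebra P (\<F> 0)" using F_sub_infty[of 0] by (simp add: subalgebra_def)
  interpret S: finite_measure_subalgebra P "\<F> 0" by unfold_locales (rule sub)
  have i: "integrable P (?Z 1)" using martingale_L by (simp add: martingale_def)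
  have "AE \<omega> in P. real_cond_exp P (\<F> 0) (?Z 1) \<omega> = ?Z 0 \<omega>"
    using martingale_L unfolding martingale_def by auto
  then have "AE \<omega> in P. real_cond_exp P (\<F> 0) (?Z 1) \<omega> = 0"
    using AE_start L_zero by eventually_elim simp
  then have "expectation (real_cond_exp P (\<F> 0) (?Z 1)) = 0" by (rule integral_eq_zero_AE)
  then have "expectation (?Z 1) = 0" using S.real_cond_exp_int(2)[OF i] by simp
  then show ?thesis using coord_integrable L_integrable by simp
qed

lemma expectation_abs_pos: "expectation (\<lambda>\<omega>. \<bar>\<omega> 1\<bar>) > 0"
proof (rule ccontr)
  assume "\<not> ?thesis"
  moreover have "expectation (\<lambda>\<omega>. \<bar>\<omega> 1\<bar>) \<ge> 0" by (rule integral_nonneg_AE) auto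
  ultimately have "expectation (\<lambda>\<omega>. \<bar>\<omega> 1\<bar>) = 0" by linarith
  then have "AE \<omega> in P. \<bar>\<omega> 1\<bar> = 0"
    using integral_nonneg_eq_0_iff_AE[OF coord_integrable] by simp
  then have "AE \<omega> in P. False" using AE_nonzero_coord[of 1, simplified] by eventually_elim simp
  then show False by simp
qed

text \<open>The total mass of the limiting density for the potential k |x|, obtained from the
  constant functional 1. The kink contributes k L / c to the limit of \<open>J\<close>, and the
  exponent takes half of it, hence L / (2 c).\<close>

lemma exponential_moment:
  assumes c: "c > 0"
    and occ: "AE \<omega> in P. ((\<lambda>e. c / e * measure lborel {u \<in> {0..1}. \<bar>\<omega> u\<bar> < e}) \<longlongrightarrow> L 1 \<omega>) (at_right 0)"
  shows "(\<integral>\<^sup>+\<omega>. ennreal (exp (k * (\<bar>\<omega> 1\<bar> - L 1 \<omega> / (2 * c)) - k\<^sup>2 / 2)) \<partial>P) = 1"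
proof -
  let ?f = "\<lambda>x::real. k * \<bar>x\<bar>"
  have lip: "\<bar>?f x - ?f y\<bar> \<le> \<bar>k\<bar> * \<bar>x - y\<bar>" for x y
    by (simp add: abs_mult[symmetric] right_diff_distrib[symmetric]) (simp add: abs_mult mult_left_mono)
  obtain F \<Phi> where "euler_limit P ?f F \<Phi> \<bar>k\<bar> 1" using euler_limit_exists[of 1, OF _ lip] by (auto simp del: mult_zero_left)
  then interpret E: euler_limit P ?f F \<Phi> "\<bar>k\<bar>" 1 .
  have der: "\<exists>d b. ((\<lambda>_. 0) has_real_derivative d) (at x) \<and> (?f has_real_derivative b) (at x) \<and> d + b\<^sup>2 = k\<^sup>2" if "x \<noteq> 0" for x
  proof (rule exI[of _ 0], rule exI[of _ "k * sgn x"], intro conjI)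
    show "(?f has_real_derivative k * sgn x) (at x)"
      by (rule DERIV_cmult) (rule DERIV_abs_nonzero[OF that])
    show "0 + (k * sgn x)\<^sup>2 = k\<^sup>2" using that by (simp add: power_mult_distrib sgn_if)
  qed simp
  have "(\<integral>\<^sup>+\<omega>. ennreal (exp (k * (\<bar>\<omega> 1\<bar> - L 1 \<omega> / (2 * c)) - k\<^sup>2 / 2)) \<partial>P) = (\<integral>\<^sup>+\<omega>. ennreal 1 \<partial>P)"
  proof (rule E.girsanov_limit[where G = "\<lambda>_ _. 1"])
    show "AE \<omega> in P. (\<lambda>n. 1 * E.dens n \<omega>) \<longlonglongrightarrow> exp (k * (\<bar>\<omega> 1\<bar> - L 1 \<omega> / (2 * c)) - k\<^sup>2 / 2)"
      using E.dens_lim occ AE_nonzero AE_space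
    proof eventually_elim
      case (elim \<omega>)
      have "(\<lambda>n. E.J n \<omega>) \<longlonglongrightarrow> k * (L 1 \<omega> / c) + k\<^sup>2 * 1"
        by (rule E.J_lim[where g = "\<lambda>_. 0" and g' = "\<lambda>_. 0" and \<Lambda> = 0]) (use elim c der in auto)
      then have "(\<lambda>n. E.dens n \<omega>) \<longlonglongrightarrow> exp (?f (\<omega> 1) - (k * (L 1 \<omega> / c) + k\<^sup>2 * 1) / 2)" using elim(1) by blast
      moreover have "?f (\<omega> 1) - (k * (L 1 \<omega> / c) + k\<^sup>2 * 1) / 2 = k * (\<bar>\<omega> 1\<bar> - L 1 \<omega> / (2 * c)) - k\<^sup>2 / 2"
        using c by (simp add: field_simps)
      ultimately show ?case by simp
    qed
  qed auto
  then show ?thesis by (simp add: emeasure_space_1)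
qed

text \<open>The exponential moments are used only to first order at k = 0: since exp y is at least 1
  + y, the product k m is at most k^2 / 2 for small k of either sign, which forces the mean m to
  vanish. Comparison with \<open>expectation_L\<close> then determines c because the mean of |X| at
  time 1 is positive.\<close>

lemma occupation:
  assumes "t \<ge> 0"
  shows "AE \<omega> in P. ((\<lambda>e. (1 / 2) / e * measure lborel {u \<in> {0..t}. \<bar>\<omega> u\<bar> < e}) \<longlongrightarrow> L t \<omega>) (at_right 0)"
proof -
  obtain c where c: "c > 0" and occ: "\<And>t. t \<ge> 0 \<Longrightarrow> AE \<omega> in P.
      ((\<lambda>e. c / e * measure lborel {u \<in> {0..t}. \<bar>\<omega> u\<bar> < e}) \<longlongrightarrow> L t \<omega>) (at_right 0)"
    using L unfolding local_time_zero_def by auto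
  let ?Z = "\<lambda>\<omega>. \<bar>\<omega> 1\<bar> - L 1 \<omega> / (2 * c)"
  have Zi: "integrable P ?Z" using coord_integrable L_integrable by (intro Bochner_Integration.integrable_diff integrable_divide) auto
  define m where "m = expectation ?Z"
  have mb: "k * m \<le> k\<^sup>2" if k: "\<bar>k\<bar> \<le> 1" for k
  proof -
    have k1: "k\<^sup>2 \<le> 1" using k by (simp add: abs_square_le_1)
    have em: "(\<integral>\<^sup>+\<omega>. ennreal (exp (k * ?Z \<omega> - k\<^sup>2 / 2)) \<partial>P) = 1"
      by (rule exponential_moment[OF c occ]) simp
    have ei: "integrable P (\<lambda>\<omega>. exp (k * ?Z \<omega> - k\<^sup>2 / 2))"
      by (rule integrableI_nonneg) (auto simp: em)
    have "expectation (\<lambda>\<omega>. exp (k * ?Z \<omega> - k\<^sup>2 / 2)) = 1"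
      using em by (subst integral_eq_nn_integral) auto
    moreover have "expectation (\<lambda>\<omega>. 1 + (k * ?Z \<omega> - k\<^sup>2 / 2)) \<le> expectation (\<lambda>\<omega>. exp (k * ?Z \<omega> - k\<^sup>2 / 2))"
      using Zi by (intro integral_mono ei) (auto intro: exp_ge_add_one_self)
    moreover have "expectation (\<lambda>\<omega>. 1 + (k * ?Z \<omega> - k\<^sup>2 / 2)) = 1 + (k * m - k\<^sup>2 / 2)"
      unfolding m_def using Zi prob_space by simp
    ultimately have "2 * (k * m) \<le> k\<^sup>2" by simp
    then show ?thesis using zero_le_power2[of k] by linarith
  qed
  have "m = 0"
  proof (rule ccontr)
    assume m: "m \<noteq> 0"
    \<comment> \<open>The test value k = t m has the sign of m and absolute value at most 1, while t
      < 1 makes k^2 smaller than k m.\<close>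
    define t where "t = 1 / (2 * (1 + \<bar>m\<bar>))"
    have t: "0 < t" "t < 1" "\<bar>t * m\<bar> \<le> 1" by (auto simp: t_def abs_mult divide_simps)
    have "t * m * m \<le> (t * m)\<^sup>2" by (rule mb[OF t(3)])
    then have "t * m\<^sup>2 \<le> t * (t * m\<^sup>2)" by (simp add: power2_eq_square mult_ac)
    then have "m\<^sup>2 \<le> t * m\<^sup>2" using t by simp
    also have "\<dots> < 1 * m\<^sup>2" using t m by (intro mult_strict_right_mono) auto
    finally show False by simp
  qed
  then have "expectation (\<lambda>\<omega>. \<bar>\<omega> 1\<bar>) = expectation (L 1) / (2 * c)"
    unfolding m_def using coord_integrable L_integrable by simp
  then have "c = 1 / 2" using expectation_L expectation_abs_pos c by (simp add: field_simps)
  then show ?thesis using occ[OF assms] by (simp only:)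
qed

end

subsection \<open>The truncated potential\<close>

text \<open>At c the values and the derivatives of the two branches agree, so the left and right
  difference quotients have the same limit.\<close>

lemma DERIV_If_le:
  fixes p q :: "real \<Rightarrow> real"
  assumes p: "\<And>x. x \<le> c \<Longrightarrow> (p has_real_derivative p' x) (at x)"
    and q: "\<And>x. x \<ge> c \<Longrightarrow> (q has_real_derivative q' x) (at x)"
    and c: "p c = q c" "p' c = q' c"
  shows "((\<lambda>x. if x \<le> c then p x else q x) has_real_derivative (if x \<le> c then p' x else q' x)) (at x)"
proof (cases x c rule: linorder_cases)
  case less
  have "(p has_real_derivative p' x) (at x)" using less by (intro p) simp
  then have "((\<lambda>x. if x \<le> c then p x else q x) has_real_derivative p' x) (at x)"
    by (rule has_field_derivative_transform_within_open[where S = "{..<c}"]) (use less in auto)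
  then show ?thesis using less by simp
next
  case greater
  have "(q has_real_derivative q' x) (at x)" using greater by (intro q) simp
  then have "((\<lambda>x. if x \<le> c then p x else q x) has_real_derivative q' x) (at x)"
    by (rule has_field_derivative_transform_within_open[where S = "{c<..}"]) (use greater in auto)
  then show ?thesis using greater by simp
next
  case equal
  let ?f = "\<lambda>x. if x \<le> c then p x else q x"
  have "((\<lambda>y. (?f y - ?f c) / (y - c)) \<longlongrightarrow> p' c) (at c)"
  proof (rule filterlim_split_at)
    have "((\<lambda>y. (p y - p c) / (y - c)) \<longlongrightarrow> p' c) (at_left c)"
      using p[of c] by (auto simp: has_field_derivative_iff intro: tendsto_mono[OF at_le])
    then show "((\<lambda>y. (?f y - ?f c) / (y - c)) \<longlongrightarrow> p' c) (at_left c)"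
      by (rule Lim_transform_eventually) (auto simp: eventually_at_filter)
    have "((\<lambda>y. (q y - q c) / (y - c)) \<longlongrightarrow> p' c) (at_right c)"
      using q[of c] c by (auto simp: has_field_derivative_iff intro: tendsto_mono[OF at_le])
    then show "((\<lambda>y. (?f y - ?f c) / (y - c)) \<longlongrightarrow> p' c) (at_right c)"
      by (rule Lim_transform_eventually) (auto simp: eventually_at_filter c)
  qed
  then show ?thesis using equal by (simp add: has_field_derivative_iff)
qed

lemma lipschitz_If_le:
  fixes p q :: "real \<Rightarrow> real"
  assumes p: "\<And>x y. \<bar>p x - p y\<bar> \<le> K * \<bar>x - y\<bar>" and q: "\<And>x y. \<bar>q x - q y\<bar> \<le> K * \<bar>x - y\<bar>" and c: "p c = q c"
  shows "\<bar>(if x \<le> c then p x else q x) - (if y \<le> c then p y else q y)\<bar> \<le> K * \<bar>x - y\<bar>"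
proof -
  have *: "\<bar>p x - q y\<bar> \<le> K * \<bar>x - y\<bar>" if "x \<le> c" "c < y" for x y
  proof -
    have "\<bar>p x - q y\<bar> \<le> \<bar>p x - p c\<bar> + \<bar>q c - q y\<bar>" using c by simp
    also have "\<dots> \<le> K * \<bar>x - c\<bar> + K * \<bar>c - y\<bar>" by (intro add_mono p q)
    also have "\<dots> = K * \<bar>x - y\<bar>" using that by (simp add: algebra_simps)
    finally show ?thesis .
  qed
  show ?thesis using p q *[of x y] *[of y x] by (auto simp: abs_minus_commute)
qed

lemma antimono_If_le:
  fixes p q :: "real \<Rightarrow> real"
  assumes p: "antimono p" and q: "antimono q" and c: "p c = q c"
  shows "antimono (\<lambda>x. if x \<le> c then p x else q x)"
proof (rule antimonoI)
  fix x y :: real assume xy: "x \<le> y"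
  have "q y \<le> p x" if "x \<le> c" "c \<le> y" using antimonoD[OF p that(1)] antimonoD[OF q that(2)] c by simp
  then show "(if y \<le> c then p y else q y) \<le> (if x \<le> c then p x else q x)"
    using xy antimonoD[OF p xy] antimonoD[OF q xy] by auto
qed

text \<open>The derivative of ln (1 - x / a), frozen once the distance to a falls below d.\<close>

definition vpot :: "real \<Rightarrow> real \<Rightarrow> real \<Rightarrow> real" where
  "vpot d a x = - 1 / max (a - x) d"

text \<open>The logarithm is continued by its tangent line at a - d. The result is Lipschitz on the
  whole line with constant 1 / d and keeps a decreasing derivative.\<close>

definition upot :: "real \<Rightarrow> real \<Rightarrow> real \<Rightarrow> real" where
  "upot d a x = (if x \<le> a - d then ln (1 - x / a) else ln (d / a) - (x - (a - d)) / d)"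

lemma upot_deriv:
  assumes "0 < d" "d < a"
  shows "(upot d a has_real_derivative vpot d a x) (at x)"
proof -
  have "((\<lambda>x. if x \<le> a - d then ln (1 - x / a) else ln (d / a) - (x - (a - d)) / d)
      has_real_derivative (if x \<le> a - d then - 1 / (a - x) else - 1 / d)) (at x)"
  proof (rule DERIV_If_le)
    show "((\<lambda>x. ln (1 - x / a)) has_real_derivative - 1 / (a - x)) (at x)" if "x \<le> a - d" for x
      using that assms by (auto intro!: derivative_eq_intros simp: field_simps)
    show "((\<lambda>x. ln (d / a) - (x - (a - d)) / d) has_real_derivative - 1 / d) (at x)" for x
      using assms by (auto intro!: derivative_eq_intros)
    have "1 - (a - d) / a = d / a" using assms by (simp add: field_simps)
    then show "ln (1 - (a - d) / a) = ln (d / a) - (a - d - (a - d)) / d" by simp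
  qed simp
  moreover have "(if x \<le> a - d then - 1 / (a - x) else - 1 / d) = vpot d a x" by (auto simp: vpot_def max_def)
  ultimately show ?thesis unfolding upot_def[abs_def] by simp
qed

lemma vpot_abs: "0 < d \<Longrightarrow> \<bar>vpot d a x\<bar> \<le> 1 / d"
  unfolding vpot_def by (auto simp: abs_divide intro!: divide_left_mono)

lemma vpot_lip:
  assumes "0 < d"
  shows "\<bar>vpot d a x - vpot d a y\<bar> \<le> 1 / d\<^sup>2 * \<bar>x - y\<bar>"
proof -
  let ?p = "max (a - x) d" and ?q = "max (a - y) d"
  have pos: "?p > 0" "?q > 0" "?p \<ge> d" "?q \<ge> d" using assms by auto
  have "vpot d a x - vpot d a y = (?p - ?q) / (?p * ?q)"
    unfolding vpot_def using pos by (simp add: field_simps)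
  then have "\<bar>vpot d a x - vpot d a y\<bar> = \<bar>?p - ?q\<bar> / (?p * ?q)" using pos by (simp add: abs_divide abs_mult)
  also have "\<dots> \<le> \<bar>?p - ?q\<bar> / (d * d)" using pos assms by (intro divide_left_mono mult_mono mult_pos_pos) auto
  also have "\<dots> \<le> \<bar>x - y\<bar> / (d * d)" by (intro divide_right_mono) (auto simp: max_def)
  finally show ?thesis by (simp add: power2_eq_square)
qed

lemma vpot_anti: "0 < d \<Longrightarrow> antimono (vpot d a)"
  unfolding vpot_def by (intro antimonoI) (auto intro!: divide_left_mono mult_pos_pos simp: less_max_iff_disj)

lemma upot_lip:
  assumes "0 < d" "d < a"
  shows "\<bar>upot d a x - upot d a y\<bar> \<le> 1 / d * \<bar>x - y\<bar>"
  using field_differentiable_bound[of UNIV "upot d a" "vpot d a" "1 / d" x y] upot_deriv[OF assms] vpot_abs[OF assms(1)] by simp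

text \<open>The truncation distance d is small enough for the starting point 0 to lie well inside
  the interval on which the truncated potential is exact.\<close>

locale potential =
  fixes s i d :: real
  assumes d: "0 < d" "2 * d < s" "2 * d < i"
begin

lemma ds: "d < s" "d < i" "s > 0" "i > 0" using d by auto

text \<open>Half the drop of the slope of the potential at 0, which is 1 / i on the left and - 1 / s
  on the right. Splitting off - \<kappa> |x| therefore leaves the differentiable function
  \<open>gp\<close>, and \<kappa> becomes the coefficient of the local time in the density.\<close>

definition \<kappa> :: real where "\<kappa> = (1 / s + 1 / i) / 2"
definition pot :: "real \<Rightarrow> real" where "pot x = (if x \<le> 0 then upot d i (- x) else upot d s x)"
definition gp :: "real \<Rightarrow> real" where "gp x = (if x \<le> 0 then upot d i (- x) - \<kappa> * x else upot d s x + \<kappa> * x)"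
definition gp' :: "real \<Rightarrow> real" where "gp' x = (if x \<le> 0 then - vpot d i (- x) - \<kappa> else vpot d s x + \<kappa>)"

lemma upot_0: "upot d s 0 = 0" "upot d i 0 = 0" using ds by (auto simp: upot_def)
lemma vpot_0: "- vpot d i 0 - \<kappa> = vpot d s 0 + \<kappa>"
  using ds by (simp add: vpot_def \<kappa>_def max_absorb1 less_imp_le field_simps)

lemma pot_0: "pot 0 = 0" by (simp add: pot_def upot_0)
lemma pot_eq: "pot x = - \<kappa> * \<bar>x\<bar> + gp x" by (simp add: pot_def gp_def)

lemma upot_neg_deriv: "((\<lambda>x. upot d i (- x)) has_real_derivative - vpot d i (- x)) (at x)"
proof -
  have "(uminus has_real_derivative - 1) (at x)" by (auto intro!: derivative_eq_intros)
  from DERIV_chain2[OF upot_deriv[OF d(1) ds(2)] this] show ?thesis by simp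
qed

lemma gp_deriv: "(gp has_real_derivative gp' x) (at x)"
  unfolding gp_def[abs_def] gp'_def
proof (rule DERIV_If_le)
  show "((\<lambda>x. upot d i (- x) - \<kappa> * x) has_real_derivative - vpot d i (- x) - \<kappa>) (at x)" for x
    by (auto intro!: derivative_eq_intros upot_neg_deriv)
  show "((\<lambda>x. upot d s x + \<kappa> * x) has_real_derivative vpot d s x + \<kappa>) (at x)" for x
    by (auto intro!: derivative_eq_intros upot_deriv simp: ds d)
qed (auto simp: upot_0 vpot_0)

lemma gp'_lip: "\<bar>gp' x - gp' y\<bar> \<le> 1 / d\<^sup>2 * \<bar>x - y\<bar>"
  unfolding gp'_def
proof (rule lipschitz_If_le)
  show "\<bar>- vpot d i (- x) - \<kappa> - (- vpot d i (- y) - \<kappa>)\<bar> \<le> 1 / d\<^sup>2 * \<bar>x - y\<bar>" for x y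
    using vpot_lip[OF d(1), of i "- y" "- x"] by simp
  show "\<bar>vpot d s x + \<kappa> - (vpot d s y + \<kappa>)\<bar> \<le> 1 / d\<^sup>2 * \<bar>x - y\<bar>" for x y
    using vpot_lip[OF d(1), of s x y] by simp
qed (simp add: vpot_0)

lemma gp'_anti: "antimono gp'"
  unfolding gp'_def[abs_def]
proof (rule antimono_If_le)
  show "antimono (\<lambda>x. - vpot d i (- x) - \<kappa>)"
    using antimonoD[OF vpot_anti[OF d(1)]] by (intro antimonoI) auto
  show "antimono (\<lambda>x. vpot d s x + \<kappa>)"
    using antimonoD[OF vpot_anti[OF d(1)]] by (intro antimonoI) auto
qed (simp add: vpot_0)

lemma pot_lip: "\<bar>pot x - pot y\<bar> \<le> 1 / d * \<bar>x - y\<bar>"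
  unfolding pot_def
proof (rule lipschitz_If_le)
  show "\<bar>upot d i (- x) - upot d i (- y)\<bar> \<le> 1 / d * \<bar>x - y\<bar>" for x y
    using upot_lip[OF d(1) ds(2), of "- x" "- y"] by (simp add: abs_minus_commute)
  show "\<bar>upot d s x - upot d s y\<bar> \<le> 1 / d * \<bar>x - y\<bar>" for x y by (rule upot_lip[OF d(1) ds(1)])
qed (simp add: upot_0)

definition drift :: "real \<Rightarrow> real" where
  "drift x = - (1 / (s - x) * of_bool (x > 0)) + 1 / (i + x) * of_bool (x < 0)"

lemma pot_deriv:
  assumes "x \<noteq> 0" "- (i - d) \<le> x" "x \<le> s - d"
  shows "(pot has_real_derivative drift x) (at x)"
proof (cases "x > 0")
  case True
  have "(upot d s has_real_derivative vpot d s x) (at x)" by (rule upot_deriv[OF d(1) ds(1)])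
  then have "(pot has_real_derivative vpot d s x) (at x)"
    by (rule has_field_derivative_transform_within_open[where S = "{0<..}"]) (use True in \<open>auto simp: pot_def\<close>)
  then show ?thesis using True assms by (simp add: drift_def vpot_def max_absorb1)
next
  case False
  have "((\<lambda>x. upot d i (- x)) has_real_derivative - vpot d i (- x)) (at x)"
    by (rule upot_neg_deriv)
  then have "(pot has_real_derivative - vpot d i (- x)) (at x)"
    by (rule has_field_derivative_transform_within_open[where S = "{..<0}"]) (use False assms in \<open>auto simp: pot_def\<close>)
  then show ?thesis using False assms by (simp add: drift_def vpot_def max_absorb1)
qed

text \<open>The exponential of the potential is affine on each side of 0 inside the truncation
  range, which is why the second derivative is minus the square of the first.\<close>

lemma gp'_deriv:
  assumes "x \<noteq> 0" "- (i - d) < x" "x < s - d"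
  shows "(gp' has_real_derivative - (drift x)\<^sup>2) (at x)"
proof (cases "x > 0")
  case True
  have "((\<lambda>x. - 1 / (s - x) + \<kappa>) has_real_derivative - (drift x)\<^sup>2) (at x)"
    using True assms d by (auto intro!: derivative_eq_intros simp: drift_def power2_eq_square field_simps)
  then show ?thesis
    by (rule has_field_derivative_transform_within_open[where S = "{0<..<s - d}"])
      (use True assms in \<open>auto simp: gp'_def vpot_def max_absorb1\<close>)
next
  case False
  have "((\<lambda>x. 1 / (i + x) - \<kappa>) has_real_derivative - (drift x)\<^sup>2) (at x)"
    using False assms d by (auto intro!: derivative_eq_intros simp: drift_def power2_eq_square field_simps)
  then show ?thesis
    by (rule has_field_derivative_transform_within_open[where S = "{- (i - d)<..<0}"])
      (use False assms in \<open>auto simp: gp'_def vpot_def max_absorb1\<close>)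
qed

lemma drift_abs: "- (i - d) \<le> x \<Longrightarrow> x \<le> s - d \<Longrightarrow> \<bar>drift x\<bar> \<le> 1 / d"
  using d by (auto simp: drift_def abs_divide intro!: divide_left_mono mult_pos_pos)

lemma exp_pot:
  assumes "- (i - d) \<le> x" "x \<le> s - d"
  shows "exp (pot x) = (1 - max x 0 / s) * (1 - max (- x) 0 / i)"
proof (cases "x \<le> 0")
  case True
  have "1 + x / i > 0" using assms d by (simp add: field_simps)
  then show ?thesis using True assms by (simp add: pot_def upot_def max_absorb1 max_absorb2)
next
  case False
  have "1 - x / s > 0" using assms d by (simp add: field_simps)
  then show ?thesis using False assms by (simp add: pot_def upot_def max_absorb1 max_absorb2)
qed

end

subsection \<open>Comparison of the Euler scheme with the diffusion\<close>

lemma set_integral_Icc_split: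
  fixes f :: "real \<Rightarrow> real"
  assumes "0 \<le> a" "a \<le> b" and f: "set_integrable lborel {0..b} f"
  shows "(LINT u:{0..b}|lborel. f u) = (LINT u:{0..a}|lborel. f u) + (LINT u:{a..b}|lborel. f u)"
proof -
  have un: "{0..b} = {0..a} \<union> {a..b}" using assms by auto
  have "AE u in lborel. \<not> (u \<in> {0..a} \<and> u \<in> {a..b})"
    using AE_lborel_singleton[of a] by eventually_elim auto
  then show ?thesis unfolding un
    by (rule set_integral_Un_AE) (use assms in \<open>auto intro: set_integrable_subset[OF f]\<close>)
qed

context euler_limit
begin

text \<open>The solution sampled on the grid satisfies the Euler recursion up to a local defect: the
  drift integral over a cell minus its frozen mollified value. \<open>euler_comparison\<close> adds
  up these defects. Each is bounded by the mollification error along y plus the oscillation of y in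
  the cell, which is that of \<omega> plus at most B h. The drift is bounded by B only up to time
  \<tau>, so the comparison stops there.\<close>

lemma comparison:
  assumes w: "\<omega> \<in> \<Omega>" and y: "continuous_on {0..T} y" "y 0 = \<omega> 0" and \<beta>: "set_integrable lborel {0..T} \<beta>"
    and eq: "\<And>t. 0 \<le> t \<Longrightarrow> t \<le> T \<Longrightarrow> y t = \<omega> t + (LINT u:{0..t}|lborel. \<beta> u)"
    and \<tau>: "0 \<le> \<tau>" "\<tau> \<le> T" and \<beta>b: "\<And>u. 0 \<le> u \<Longrightarrow> u \<le> \<tau> \<Longrightarrow> \<bar>\<beta> u\<bar> \<le> B"
    and anti: "antimono (bn n)" and small: "hh n * (2 * B * real (Suc n)) \<le> 1" and k: "real k * hh n \<le> \<tau>"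
  shows "\<bar>euler (bn n) (hh n) \<omega> k - y (real k * hh n)\<bar>
    \<le> (LINT u:{0..\<tau>}|lborel. \<bar>\<beta> u - bn n (y u)\<bar>)
      + 2 * B * real (Suc n) * (cerr (hh n) (mesh n) \<omega> + B * hh n * T)"
proof -
  let ?h = "hh n" and ?L = "2 * B * real (Suc n)"
  let ?cell = "\<lambda>j. {real j * ?h..real (Suc j) * ?h}"
  let ?r = "\<lambda>j. (LINT u:?cell j|lborel. \<beta> u) - bn n (y (real j * ?h)) * ?h"
  let ?C = "\<lambda>j. LINT u:?cell j|lborel. \<bar>\<omega> u - \<omega> (real j * ?h)\<bar>"
  have h: "?h \<ge> 0" by simp
  have L: "?L \<ge> 0" using B by simp
  have kT: "real k * ?h \<le> T" using k \<tau> by simp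
  have km: "k \<le> mesh n"
  proof -
    have "real k * ?h \<le> real (mesh n) * ?h" using kT mesh_hh by simp
    then show ?thesis using hh_pos[of n] by simp
  qed
  have cellT: "real (Suc j) * ?h \<le> real k * ?h" "0 \<le> real j * ?h" "real j * ?h \<le> real (Suc j) * ?h" if "j < k" for j
    using that h by (auto intro!: mult_right_mono)
  have bc: "continuous_on UNIV (bn n)" by (auto intro!: DERIV_isCont[OF bn'] continuous_at_imp_continuous_on)
  have byc: "continuous_on {0..T} (\<lambda>u. bn n (y u))" by (rule continuous_on_compose2[OF bc y(1)]) simp
  have int: "set_integrable lborel {0..T} (\<lambda>u. \<bar>\<beta> u - bn n (y u)\<bar>)"
    by (intro set_integrable_abs set_integral_diff(1) \<beta> set_integrable_continuous byc)
  have sub: "?cell j \<subseteq> {0..T}" if "j < k" for j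
    unfolding atLeastatMost_subset_iff using cellT[OF that] kT by linarith
  have step: "y (real (Suc j) * ?h) = y (real j * ?h) + bn n (y (real j * ?h)) * ?h + ?r j
      + (\<omega> (real (Suc j) * ?h) - \<omega> (real j * ?h))" if j: "j < k" for j
  proof -
    note c = cellT[OF j]
    have "(LINT u:{0..real (Suc j) * ?h}|lborel. \<beta> u) = (LINT u:{0..real j * ?h}|lborel. \<beta> u) + (LINT u:?cell j|lborel. \<beta> u)"
    proof (rule set_integral_Icc_split[OF c(2,3) set_integrable_subset[OF \<beta>]])
      show "{0..real (Suc j) * ?h} \<subseteq> {0..T}" unfolding atLeastatMost_subset_iff using c kT by linarith
    qed simp
    moreover have "real (Suc j) * ?h \<le> T" "0 \<le> real (Suc j) * ?h" "real j * ?h \<le> T" using c kT by linarith+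
    ultimately show ?thesis using eq[of "real (Suc j) * ?h"] eq[of "real j * ?h"] c(2) by linarith
  qed
  have inc: "\<bar>y u - y (real j * ?h)\<bar> \<le> \<bar>\<omega> u - \<omega> (real j * ?h)\<bar> + B * ?h" if j: "j < k" and u: "u \<in> ?cell j" for j u
  proof -
    note c = cellT[OF j]
    have u': "real j * ?h \<le> u" "u \<le> real k * ?h" "u - real j * ?h \<le> ?h" using u c by (auto simp: algebra_simps)
    have "(LINT v:{0..u}|lborel. \<beta> v) = (LINT v:{0..real j * ?h}|lborel. \<beta> v) + (LINT v:{real j * ?h..u}|lborel. \<beta> v)"
      using c u' kT by (intro set_integral_Icc_split set_integrable_subset[OF \<beta>]) auto
    then have e: "y u - y (real j * ?h) = (\<omega> u - \<omega> (real j * ?h)) + (LINT v:{real j * ?h..u}|lborel. \<beta> v)"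
      using eq[of u] eq[of "real j * ?h"] c u' kT by simp
    have i: "set_integrable lborel {real j * ?h..u} \<beta>"
      by (rule set_integrable_subset[OF \<beta>]) (use c u' kT in auto)
    have "\<bar>LINT v:{real j * ?h..u}|lborel. \<beta> v\<bar> \<le> (LINT v:{real j * ?h..u}|lborel. \<bar>\<beta> v\<bar>)"
      by (rule set_integral_abs_le[OF i])
    also have "\<dots> \<le> (LINT v:{real j * ?h..u}|lborel. B)"
    proof (rule set_integral_mono)
      fix v assume "v \<in> {real j * ?h..u}"
      then have "0 \<le> v" "v \<le> \<tau>" using c(2) u'(2) k by (simp_all only: atLeastAtMost_iff) linarith+
      then show "\<bar>\<beta> v\<bar> \<le> B" by (rule \<beta>b)
    qed (intro set_integrable_abs i set_integrable_const_Icc)+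
    also have "\<dots> = B * (u - real j * ?h)" using u' by (simp add: LINT_const_Icc)
    also have "\<dots> \<le> B * ?h" using u' B by (intro mult_left_mono) auto
    finally show ?thesis unfolding e by linarith
  qed
  have r: "\<bar>?r j\<bar> \<le> (LINT u:?cell j|lborel. \<bar>\<beta> u - bn n (y u)\<bar>) + ?L * (?C j + B * ?h * ?h)" if j: "j < k" for j
  proof -
    note c = cellT[OF j]
    have i\<beta>: "set_integrable lborel (?cell j) \<beta>" by (rule set_integrable_subset[OF \<beta> _ sub[OF j]]) simp
    have cb: "continuous_on (?cell j) (\<lambda>u. bn n (y u))" by (rule continuous_on_subset[OF byc sub[OF j]])
    have ib: "set_integrable lborel (?cell j) (\<lambda>u. bn n (y u))" by (rule set_integrable_continuous[OF cb])
    have cw: "continuous_on (?cell j) \<omega>" by (rule path_cell[OF w h])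
    have w1: "(LINT u:?cell j|lborel. bn n (y (real j * ?h))) = bn n (y (real j * ?h)) * ?h"
      using c(3) by (subst LINT_const_Icc) (auto simp: algebra_simps)
    have "?r j = (LINT u:?cell j|lborel. \<beta> u - bn n (y u)) + (LINT u:?cell j|lborel. bn n (y u) - bn n (y (real j * ?h)))"
      by (subst set_integral_diff(2)[OF i\<beta> ib], subst set_integral_diff(2)[OF ib set_integrable_const_Icc], subst w1) simp
    then have "\<bar>?r j\<bar> \<le> \<bar>LINT u:?cell j|lborel. \<beta> u - bn n (y u)\<bar> + \<bar>LINT u:?cell j|lborel. bn n (y u) - bn n (y (real j * ?h))\<bar>"
      by (simp only: abs_triangle_ineq)
    also have "\<dots> \<le> (LINT u:?cell j|lborel. \<bar>\<beta> u - bn n (y u)\<bar>) + (LINT u:?cell j|lborel. \<bar>bn n (y u) - bn n (y (real j * ?h))\<bar>)"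
      by (intro add_mono set_integral_abs_le set_integral_diff(1) i\<beta> ib set_integrable_const_Icc)
    also have "(LINT u:?cell j|lborel. \<bar>bn n (y u) - bn n (y (real j * ?h))\<bar>)
        \<le> (LINT u:?cell j|lborel. ?L * (\<bar>\<omega> u - \<omega> (real j * ?h)\<bar> + B * ?h))"
    proof (rule set_integral_mono)
      show "set_integrable lborel (?cell j) (\<lambda>u. \<bar>bn n (y u) - bn n (y (real j * ?h))\<bar>)"
        by (intro set_integrable_continuous continuous_intros cb)
      show "set_integrable lborel (?cell j) (\<lambda>u. ?L * (\<bar>\<omega> u - \<omega> (real j * ?h)\<bar> + B * ?h))"
        by (intro set_integrable_continuous continuous_intros cw)
      fix u assume u: "u \<in> ?cell j"
      have "\<bar>bn n (y u) - bn n (y (real j * ?h))\<bar> \<le> ?L * \<bar>y u - y (real j * ?h)\<bar>" by (rule bn_lip)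
      also have "\<dots> \<le> ?L * (\<bar>\<omega> u - \<omega> (real j * ?h)\<bar> + B * ?h)" by (rule mult_left_mono[OF inc[OF j u] L])
      finally show "\<bar>bn n (y u) - bn n (y (real j * ?h))\<bar> \<le> ?L * (\<bar>\<omega> u - \<omega> (real j * ?h)\<bar> + B * ?h)" .
    qed
    also have "(LINT u:?cell j|lborel. ?L * (\<bar>\<omega> u - \<omega> (real j * ?h)\<bar> + B * ?h)) = ?L * (LINT u:?cell j|lborel. \<bar>\<omega> u - \<omega> (real j * ?h)\<bar> + B * ?h)"
      by (rule set_integral_mult_right)
    also have "(LINT u:?cell j|lborel. \<bar>\<omega> u - \<omega> (real j * ?h)\<bar> + B * ?h) = ?C j + (LINT u:?cell j|lborel. B * ?h)"
      by (intro set_integral_add set_integrable_continuous continuous_intros cw)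
    also have "(LINT u:?cell j|lborel. B * ?h) = B * ?h * ?h"
      using c(3) by (subst LINT_const_Icc) (auto simp: algebra_simps)
    finally show ?thesis by simp
  qed
  have "\<bar>euler (bn n) ?h \<omega> k - y (real k * ?h)\<bar> \<le> (\<Sum>j<k. \<bar>?r j\<bar>)"
    by (rule euler_comparison[where y = "\<lambda>k. y (real k * ?h)" and r = ?r, OF anti bn_lip h small _ step order_refl]) (simp_all add: y)
  also have "\<dots> \<le> (\<Sum>j<k. (LINT u:?cell j|lborel. \<bar>\<beta> u - bn n (y u)\<bar>) + ?L * (?C j + B * ?h * ?h))"
    by (intro sum_mono r) simp
  also have "\<dots> = (\<Sum>j<k. LINT u:?cell j|lborel. \<bar>\<beta> u - bn n (y u)\<bar>) + ?L * ((\<Sum>j<k. ?C j) + B * ?h * (real k * ?h))"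
    by (simp add: sum.distrib sum_distrib_left[symmetric] algebra_simps)
  also have "(\<Sum>j<k. LINT u:?cell j|lborel. \<bar>\<beta> u - bn n (y u)\<bar>) = (LINT u:{0..real k * ?h}|lborel. \<bar>\<beta> u - bn n (y u)\<bar>)"
    by (rule set_integral_cells[symmetric, OF h], rule set_integrable_subset[OF int]) (use kT in auto)
  also have "(LINT u:{0..real k * ?h}|lborel. \<bar>\<beta> u - bn n (y u)\<bar>) \<le> (LINT u:{0..\<tau>}|lborel. \<bar>\<beta> u - bn n (y u)\<bar>)"
  proof -
    have s2: "set_integrable lborel {0..\<tau>} (\<lambda>u. \<bar>\<beta> u - bn n (y u)\<bar>)" by (rule set_integrable_subset[OF int]) (use \<tau> in auto)
    have "(LINT u:{0..\<tau>}|lborel. \<bar>\<beta> u - bn n (y u)\<bar>) = (LINT u:{0..real k * ?h}|lborel. \<bar>\<beta> u - bn n (y u)\<bar>)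
        + (LINT u:{real k * ?h..\<tau>}|lborel. \<bar>\<beta> u - bn n (y u)\<bar>)"
      by (rule set_integral_Icc_split[OF _ k s2]) simp
    moreover have "(LINT u:{real k * ?h..\<tau>}|lborel. \<bar>\<beta> u - bn n (y u)\<bar>) \<ge> 0"
      unfolding set_lebesgue_integral_def by (intro integral_nonneg_AE) auto
    ultimately show ?thesis by simp
  qed
  also have "(\<Sum>j<k. ?C j) = cerr ?h k \<omega>" by (simp add: cerr_def)
  also have "?L * (cerr ?h k \<omega> + B * ?h * (real k * ?h)) \<le> ?L * (cerr ?h (mesh n) \<omega> + B * ?h * T)"
    by (intro mult_left_mono L add_mono cerr_mono km kT mult_nonneg_nonneg B h)
  finally show ?thesis by simp
qed

end

subsection \<open>Limits of grid functionals\<close>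

lemma grid_point_tendsto:
  assumes y: "continuous_on {0..T} y" and T: "T > 0" and N: "filterlim N at_top sequentially" "\<And>n. N n > 0"
    and \<delta>: "\<delta> \<longlonglongrightarrow> 0" and \<tau>: "\<tau> \<le> T"
    and b: "\<forall>\<^sub>F n in sequentially. \<forall>k. real k * T / real (N n) \<le> \<tau> \<longrightarrow> \<bar>x n k - y (real k * T / real (N n))\<bar> \<le> (\<delta> n :: real)"
    and u: "0 \<le> u" "u \<le> \<tau>"
  shows "(\<lambda>n. x n (gidx (N n) T u)) \<longlonglongrightarrow> (y u :: real)"
proof -
  have "(\<lambda>n. x n (gidx (N n) T u) - y (real (gidx (N n) T u) * T / real (N n))) \<longlonglongrightarrow> 0"
  proof (rule Lim_null_comparison[OF _ \<delta>])
    show "\<forall>\<^sub>F n in sequentially. norm (x n (gidx (N n) T u) - y (real (gidx (N n) T u) * T / real (N n))) \<le> \<delta> n"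
      using b
    proof eventually_elim
      case (elim n)
      have "real (gidx (N n) T u) * T / real (N n) \<le> \<tau>" using gidx(1)[OF T N(2) u(1), of n] u by linarith
      then show ?case using elim by simp
    qed
  qed
  from tendsto_add[OF this path_gidx_tendsto[OF y T u(1) _ N]] show ?thesis using u \<tau> by simp
qed

text \<open>Bounded below by the sample next to a point where the supremum is attained, and above by
  the uniform closeness of all samples.\<close>

lemma grid_max_tendsto:
  assumes y: "continuous_on {0..T} y" and T: "T > 0" and N: "filterlim N at_top sequentially" "\<And>n. N n > 0"
    and \<delta>: "\<delta> \<longlonglongrightarrow> 0"
    and b: "\<forall>\<^sub>F n in sequentially. \<forall>k. real k * T / real (N n) \<le> T \<longrightarrow> \<bar>x n k - y (real k * T / real (N n))\<bar> \<le> (\<delta> n :: real)"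
  shows "(\<lambda>n. Max (x n ` {..N n})) \<longlonglongrightarrow> sup_proc T y"
proof -
  obtain u where u: "u \<in> {0..T}" "sup_proc T y = y u" using sup_proc_attained[OF y] T by auto
  have lo: "(\<lambda>n. x n (gidx (N n) T u)) \<longlonglongrightarrow> sup_proc T y"
    unfolding u(2) by (rule grid_point_tendsto[OF y T N \<delta> order_refl b]) (use u in auto)
  have hi: "(\<lambda>n. sup_proc T y + \<delta> n) \<longlonglongrightarrow> sup_proc T y" using tendsto_add[OF tendsto_const \<delta>] by simp
  show ?thesis
  proof (rule tendsto_sandwich[OF _ _ lo hi])
    show "\<forall>\<^sub>F n in sequentially. x n (gidx (N n) T u) \<le> Max (x n ` {..N n})"
      using gidx(3)[OF T N(2)] u by (intro always_eventually allI Max_ge) auto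
    show "\<forall>\<^sub>F n in sequentially. Max (x n ` {..N n}) \<le> sup_proc T y + \<delta> n"
      using b
    proof eventually_elim
      case (elim n)
      show ?case
      proof (rule Max.boundedI)
        fix a assume "a \<in> x n ` {..N n}"
        then obtain k where k: "a = x n k" "k \<le> N n" by auto
        have "real k * T \<le> real (N n) * T" using k T by (intro mult_right_mono) auto
        then have kT: "real k * T / real (N n) \<le> T" using N(2)[of n] by (simp add: divide_le_eq mult.commute)
        have "y (real k * T / real (N n)) \<le> sup_proc T y"
          using kT T by (intro sup_proc_ge[OF y]) auto
        then show "a \<le> sup_proc T y + \<delta> n" using elim kT k by fastforce
      qed auto
    qed
  qed
qed

definition cl :: "real \<Rightarrow> real" where "cl z = max 0 (min 1 z)"

lemma cl_01: "0 \<le> cl z" "cl z \<le> 1" by (auto simp: cl_def)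
lemma cl_cont: "continuous_on UNIV cl" unfolding cl_def[abs_def] by (intro continuous_intros)
lemma cl_measurable [measurable]: "cl \<in> borel_measurable borel"
  by (rule borel_measurable_continuous_onI[OF cl_cont])
lemma cl_tendsto: "(f \<longlongrightarrow> l) F \<Longrightarrow> ((\<lambda>x. cl (f x)) \<longlongrightarrow> cl l) F"
  using cl_cont by (auto simp: continuous_on_def intro: tendsto_compose)
lemma cl_0: "z \<le> 0 \<Longrightarrow> cl z = 0" by (simp add: cl_def)

text \<open>A product of continuous cutoffs that is 1 on the cylinder given by J and decreases to
  its indicator as m tends to infinity. Continuity lets the functional pass through the limit of the
  scheme.\<close>

definition lev :: "real \<Rightarrow> (real \<times> real) set \<Rightarrow> (real \<Rightarrow> real) \<Rightarrow> real" where
  "lev m J y = (\<Prod>p\<in>J. cl (1 - m * (y (fst p) - snd p)))"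

lemma lev_01: "0 \<le> lev m J y" "lev m J y \<le> 1"
  unfolding lev_def by (auto intro!: prod_nonneg prod_le_1 simp: cl_01)

text \<open>Vanishes as soon as the path comes within 2 d of an end, and equals 1 if it stays at
  distance 3 d. The potential is altered only within distance d, so the approximating paths have a
  margin of d.\<close>

definition cut :: "real \<Rightarrow> real \<Rightarrow> real \<Rightarrow> real \<Rightarrow> (real \<Rightarrow> real) \<Rightarrow> real" where
  "cut s i d T y = cl ((s - 2 * d - sup_proc T y) / d) * cl ((i - 2 * d - inf_proc T y) / d)"

lemma cut_01: "0 \<le> cut s i d T y" "cut s i d T y \<le> 1"
  unfolding cut_def by (auto intro!: mult_le_one simp: cl_01)

text \<open>The counterpart of the product of \<open>lev\<close> and \<open>cut\<close> for sampled
  sequences, with coordinates read at the last grid point not after the given time.\<close>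

definition Gfun :: "real \<Rightarrow> (real \<times> real) set \<Rightarrow> real \<Rightarrow> real \<Rightarrow> real \<Rightarrow> real \<Rightarrow> nat \<Rightarrow> (nat \<Rightarrow> real) \<Rightarrow> real" where
  "Gfun m J s i d T N x = (\<Prod>p\<in>J. cl (1 - m * (x (gidx N T (fst p)) - snd p))) *
     (cl ((s - 2 * d - Max (x ` {..N})) / d) * cl ((i - 2 * d - Max ((\<lambda>k. - x k) ` {..N})) / d))"

lemma Gfun_01: "0 \<le> Gfun m J s i d T N x" "Gfun m J s i d T N x \<le> 1"
  unfolding Gfun_def
  by (auto intro!: mult_nonneg_nonneg mult_le_one prod_nonneg prod_le_1 simp: cl_01)

lemma Gfun_measurable:
  assumes "finite J"
  shows "Gfun m J s i d T N \<in> borel_measurable seqM"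
proof -
  have 1: "(\<lambda>x. Max ((\<lambda>k. x k) ` {..N})) \<in> borel_measurable seqM" for N :: nat
    by (rule borel_measurable_Max) auto
  have 2: "(\<lambda>x. Max ((\<lambda>k. - x k) ` {..N})) \<in> borel_measurable seqM" for N :: nat
    by (rule borel_measurable_Max) auto
  show ?thesis unfolding Gfun_def
    by (intro borel_measurable_times borel_measurable_prod measurable_compose[OF _ cl_measurable]
        borel_measurable_diff borel_measurable_divide borel_measurable_const seq_coord 1 2)
qed

lemma Gfun_tendsto:
  assumes y: "continuous_on {0..T} y" and T: "T > 0" and N: "filterlim N at_top sequentially" "\<And>n. N n > 0"
    and \<delta>: "\<delta> \<longlonglongrightarrow> 0" and d: "d > 0" and J: "fst ` J \<subseteq> {0..T}"
    and b: "\<forall>\<^sub>F n in sequentially. \<forall>k. real k * T / real (N n) \<le> T \<longrightarrow> \<bar>x n k - y (real k * T / real (N n))\<bar> \<le> (\<delta> n :: real)"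
  shows "(\<lambda>n. Gfun m J s i d T (N n) (x n)) \<longlonglongrightarrow> lev m J y * cut s i d T y"
proof -
  have b': "\<forall>\<^sub>F n in sequentially. \<forall>k. real k * T / real (N n) \<le> T \<longrightarrow> \<bar>- x n k - - y (real k * T / real (N n))\<bar> \<le> \<delta> n"
    using b by eventually_elim (auto simp: abs_minus_commute)
  have M: "(\<lambda>n. Max (x n ` {..N n})) \<longlonglongrightarrow> sup_proc T y" by (rule grid_max_tendsto[OF y T N \<delta> b])
  have M': "(\<lambda>n. Max ((\<lambda>k. - x n k) ` {..N n})) \<longlonglongrightarrow> inf_proc T y"
    unfolding inf_proc_eq by (rule grid_max_tendsto[OF _ T N \<delta> b']) (intro continuous_intros y)
  have P: "(\<lambda>n. x n (gidx (N n) T (fst p))) \<longlonglongrightarrow> y (fst p)" if "p \<in> J" for p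
    by (rule grid_point_tendsto[OF y T N \<delta> order_refl b]) (use J that in auto)
  show ?thesis unfolding Gfun_def lev_def cut_def
    by (intro tendsto_mult tendsto_prod cl_tendsto tendsto_diff tendsto_divide tendsto_const P M M') (use d in auto)
qed

text \<open>Closeness is known only up to the exit time \<tau>. This is enough: there the limit is
  within d of an end, so the samples eventually come within 2 d of it, and the cutoff is 0 whatever
  happens later.\<close>

lemma Gfun_tendsto_0:
  assumes y: "continuous_on {0..T} y" and T: "T > 0" and N: "filterlim N at_top sequentially" "\<And>n. N n > 0"
    and \<delta>: "\<delta> \<longlonglongrightarrow> 0" and d: "d > 0" and \<tau>: "0 \<le> \<tau>" "\<tau> \<le> T"
    and b: "\<forall>\<^sub>F n in sequentially. \<forall>k. real k * T / real (N n) \<le> \<tau> \<longrightarrow> \<bar>x n k - y (real k * T / real (N n))\<bar> \<le> (\<delta> n :: real)"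
    and exit: "y \<tau> \<ge> s - d \<or> y \<tau> \<le> - (i - d)"
  shows "\<forall>\<^sub>F n in sequentially. Gfun m J s i d T (N n) (x n) = 0"
proof -
  have lim: "(\<lambda>n. x n (gidx (N n) T \<tau>)) \<longlonglongrightarrow> y \<tau>"
    by (rule grid_point_tendsto[OF y T N \<delta> \<tau>(2) b]) (use \<tau> in auto)
  have g: "gidx (N n) T \<tau> \<le> N n" for n by (rule gidx(3)[OF T N(2)]) (use \<tau> in auto)
  from exit show ?thesis
  proof
    assume "y \<tau> \<ge> s - d"
    then have "\<forall>\<^sub>F n in sequentially. x n (gidx (N n) T \<tau>) > s - 2 * d" using d by (intro order_tendstoD(1)[OF lim]) simp
    then show ?thesis
    proof eventually_elim
      case (elim n)
      have "x n (gidx (N n) T \<tau>) \<le> Max (x n ` {..N n})" using g by (intro Max_ge) auto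
      then have "(s - 2 * d - Max (x n ` {..N n})) / d \<le> 0" using elim d by (simp add: divide_le_0_iff)
      then show ?case by (simp add: Gfun_def cl_0)
    qed
  next
    assume "y \<tau> \<le> - (i - d)"
    then have "\<forall>\<^sub>F n in sequentially. x n (gidx (N n) T \<tau>) < - (i - 2 * d)" using d by (intro order_tendstoD(2)[OF lim]) simp
    then show ?thesis
    proof eventually_elim
      case (elim n)
      have "- x n (gidx (N n) T \<tau>) \<le> Max ((\<lambda>k. - x n k) ` {..N n})" using g by (intro Max_ge) auto
      then have "(i - 2 * d - Max ((\<lambda>k. - x n k) ` {..N n})) / d \<le> 0" using elim d by (simp add: divide_le_0_iff)
      then show ?case by (simp add: Gfun_def cl_0)
    qed
  qed
qed

lemma cut_0:
  assumes y: "continuous_on {0..T} y" and d: "d > 0" and u: "u \<in> {0..T}" and exit: "y u \<ge> s - d \<or> y u \<le> - (i - d)"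
  shows "cut s i d T y = 0"
  using exit
proof
  assume "y u \<ge> s - d"
  then have "sup_proc T y \<ge> s - d" using sup_proc_ge[OF y u] by linarith
  then have "(s - 2 * d - sup_proc T y) / d \<le> 0" using d by (simp add: divide_le_0_iff)
  then show ?thesis by (simp add: cut_def cl_0)
next
  assume "y u \<le> - (i - d)"
  moreover have "- y u \<le> sup_proc T (\<lambda>u. - y u)" by (rule sup_proc_ge[OF _ u]) (intro continuous_intros y)
  ultimately have "inf_proc T y \<ge> i - d" unfolding inf_proc_eq by linarith
  then have "(i - 2 * d - inf_proc T y) / d \<le> 0" using d by (simp add: divide_le_0_iff)
  then show ?thesis by (simp add: cut_def cl_0)
qed

text \<open>The least element of the closed set of exit times; the intermediate value theorem
  excludes that the path has already jumped beyond the boundary at that time.\<close>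

lemma first_exit:
  fixes y :: "real \<Rightarrow> real"
  assumes y: "continuous_on {0..T} y" and T: "T \<ge> 0" and y0: "lo < y 0" "y 0 < hi"
  shows "\<exists>\<tau>. 0 \<le> \<tau> \<and> \<tau> \<le> T \<and> (\<forall>u. 0 \<le> u \<longrightarrow> u \<le> \<tau> \<longrightarrow> lo \<le> y u \<and> y u \<le> hi) \<and>
    ((y \<tau> \<ge> hi \<or> y \<tau> \<le> lo) \<or> \<tau> = T)"
proof -
  define A where "A = {u \<in> {0..T}. y u \<ge> hi \<or> y u \<le> lo}"
  show ?thesis
  proof (cases "A = {}")
    case True
    have "lo \<le> y u \<and> y u \<le> hi" if "0 \<le> u" "u \<le> T" for u
    proof -
      have "u \<notin> A" using True by simp
      then show ?thesis using that unfolding A_def by force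
    qed
    then show ?thesis using T by blast
  next
    case False
    have "A = {0..T} \<inter> y -` ({hi..} \<union> {..lo})" by (auto simp: A_def)
    moreover have "closed ({0..T} \<inter> y -` ({hi..} \<union> {..lo}))"
      by (intro continuous_closed_preimage y closed_Un) auto
    ultimately have "compact A" by (auto simp: compact_eq_bounded_closed intro: bounded_subset[of "{0..T}"])
    then obtain \<tau> where \<tau>: "\<tau> \<in> A" "\<And>u. u \<in> A \<Longrightarrow> \<tau> \<le> u" using compact_attains_inf[of A] False by auto
    have \<tau>T: "0 \<le> \<tau>" "\<tau> \<le> T" using \<tau>(1) by (auto simp: A_def)
    have before: "lo < y u \<and> y u < hi" if "0 \<le> u" "u < \<tau>" for u
    proof -
      have "u \<notin> A" using \<tau>(2)[of u] that by auto
      then show ?thesis using that \<tau>T unfolding A_def by force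
    qed
    have c: "continuous_on {0..\<tau>} y" by (rule continuous_on_subset[OF y]) (use \<tau>T in auto)
    have hi: "y \<tau> \<le> hi"
    proof (rule ccontr)
      assume n: "\<not> ?thesis"
      obtain u where "0 \<le> u" "u \<le> \<tau>" "y u = hi" using IVT'[of y 0 hi \<tau>] c \<tau>T y0 n by auto
      then show False using before[of u] n by (cases "u = \<tau>") auto
    qed
    have lo: "lo \<le> y \<tau>"
    proof (rule ccontr)
      assume n: "\<not> ?thesis"
      obtain u where "0 \<le> u" "u \<le> \<tau>" "y u = lo" using IVT2'[of y \<tau> lo 0] c \<tau>T y0 n by auto
      then show False using before[of u] n by (cases "u = \<tau>") auto
    qed
    have "lo \<le> y u \<and> y u \<le> hi" if "0 \<le> u" "u \<le> \<tau>" for u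
      using before[of u] hi lo that by (cases "u = \<tau>") auto
    then show ?thesis using \<tau>T \<tau>(1) by (auto simp: A_def)
  qed
qed

lemma (in potential) drift_measurable [measurable]: "drift \<in> borel_measurable borel"
  unfolding drift_def[abs_def] by measurable

section \<open>Solutions path by path\<close>

text \<open>The drift of the diffusion, stated independently of any truncation distance.\<close>

definition bdrift :: "real \<Rightarrow> real \<Rightarrow> real \<Rightarrow> real" where
  "bdrift s i x = - (1 / (s - x) * of_bool (x > 0)) + 1 / (i + x) * of_bool (x < 0)"

lemma (in potential) drift_eq: "drift = bdrift s i"
  by (simp add: fun_eq_iff drift_def bdrift_def)

lemma bdrift_measurable [measurable]: "bdrift s i \<in> borel_measurable borel"
  unfolding bdrift_def[abs_def] by measurable

lemma bdrift_abs:
  assumes "x \<le> s - d" "- (i - d) \<le> x" "d > 0"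
  shows "\<bar>1 / (s - x) * of_bool (x > 0)\<bar> \<le> 1 / d" "\<bar>1 / (i + x) * of_bool (x < 0)\<bar> \<le> 1 / d" "\<bar>bdrift s i x\<bar> \<le> 1 / d"
  using assms by (auto simp: bdrift_def abs_divide intro!: divide_left_mono mult_pos_pos)

lemma set_integrable_bounded_comp:
  fixes y f :: "real \<Rightarrow> real"
  assumes y: "continuous_on {a..b} y" and [measurable]: "f \<in> borel_measurable borel"
    and bd: "\<And>u. u \<in> {a..b} \<Longrightarrow> \<bar>f (y u)\<bar> \<le> C"
  shows "set_integrable lborel {a..b} (\<lambda>u. f (y u))"
proof -
  define z where "z = (\<lambda>u. indicator {a..b} u *\<^sub>R y u)"
  have z[measurable]: "z \<in> borel_measurable borel"
    unfolding z_def by (rule borel_measurable_continuous_on_indicator) (use y in auto)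
  have fz: "(\<lambda>u. f (z u)) \<in> borel_measurable borel" by measurable
  have z_eq: "z u = y u" if "a \<le> u" "u \<le> b" for u using that by (simp add: z_def)
  have "integrable lborel (\<lambda>u. indicator {a..b} u *\<^sub>R f (z u))"
    by (rule integrableI_bounded_set_indicator[where B = C])
      (use fz bd in \<open>auto simp: z_eq emeasure_lborel_Icc_eq less_top[symmetric]\<close>)
  moreover have "(\<lambda>u. indicator {a..b} u *\<^sub>R f (z u)) = (\<lambda>u. indicator {a..b} u *\<^sub>R f (y u))"
    by (auto simp: fun_eq_iff z_def indicator_def)
  ultimately show ?thesis by (simp add: set_integrable_def)
qed

text \<open>On a finite horizon a path in the open interval keeps a positive distance from its ends,
  so the singular drift is bounded and integrable along it.\<close>

lemma path_in_open_interval: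
  fixes y :: "real \<Rightarrow> real"
  assumes y: "continuous_on {0..T} y" and T: "T \<ge> 0" and r: "\<And>u. u \<in> {0..T} \<Longrightarrow> - i < y u \<and> y u < s"
  shows "\<exists>d>0. \<forall>u\<in>{0..T}. - (i - d) \<le> y u \<and> y u \<le> s - d"
proof -
  obtain u where u: "u \<in> {0..T}" "\<And>v. v \<in> {0..T} \<Longrightarrow> y v \<le> y u" using continuous_attains_sup[OF _ _ y] T by auto
  obtain w where w: "w \<in> {0..T}" "\<And>v. v \<in> {0..T} \<Longrightarrow> y w \<le> y v" using continuous_attains_inf[OF _ _ y] T by auto
  define d where "d = min (s - y u) (i + y w)"
  have "d > 0" using r[OF u(1)] r[OF w(1)] by (simp add: d_def)
  moreover have "- (i - d) \<le> y v \<and> y v \<le> s - d" if "v \<in> {0..T}" for v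
    using u(2)[OF that] w(2)[OF that] by (auto simp: d_def min_def)
  ultimately show ?thesis by blast
qed

text \<open>A single drift integral with its integrability recorded. Without integrability a Bochner
  integral would take the value 0 by convention and could be neither split nor compared.\<close>

definition is_solution :: "real \<Rightarrow> real \<Rightarrow> (real \<Rightarrow> real) \<Rightarrow> (real \<Rightarrow> real) \<Rightarrow> bool" where
  "is_solution s i \<omega> y \<longleftrightarrow> y \<in> \<Omega> \<and> y 0 = 0 \<and> \<omega> 0 = 0 \<and>
    (\<forall>T\<ge>0. set_integrable lborel {0..T} (\<lambda>u. bdrift s i (y u)) \<and> - i < y T \<and> y T < s \<and>
      y T = \<omega> T + (LINT u:{0..T}|lborel. bdrift s i (y u)))"

context wiener
begin

lemma AE_is_solution:
  assumes Y: "sde_solution P s i Y"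
  shows "AE \<omega> in P. is_solution s i \<omega> (Y \<omega>)"
proof -
  have "AE \<omega> in P. \<forall>t\<ge>0. - i < Y \<omega> t \<and> Y \<omega> t < s \<and>
        Y \<omega> t = \<omega> t
          - (LINT u:{0..t}|lborel. 1 / (s - Y \<omega> u) * of_bool (Y \<omega> u > 0))
          + (LINT u:{0..t}|lborel. 1 / (i + Y \<omega> u) * of_bool (Y \<omega> u < 0))"
    using Y unfolding sde_solution_def by blast
  then show ?thesis using AE_start AE_space
  proof eventually_elim
    case (elim \<omega>)
    let ?y = "Y \<omega>"
    have y: "?y \<in> \<Omega>" using Y elim(3) unfolding sde_solution_def by (auto dest: measurable_space)
    have *: "set_integrable lborel {0..T} (\<lambda>u. bdrift s i (?y u)) \<and> - i < ?y T \<and> ?y T < s \<and>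
      ?y T = \<omega> T + (LINT u:{0..T}|lborel. bdrift s i (?y u))" if T: "T \<ge> 0" for T
    proof -
      have r: "- i < ?y u \<and> ?y u < s" if "u \<in> {0..T}" for u
      proof -
        have "0 \<le> u" using that by simp
        from elim(1)[rule_format, OF this] show ?thesis by blast
      qed
      obtain d where d: "d > 0" "\<And>u. u \<in> {0..T} \<Longrightarrow> - (i - d) \<le> ?y u \<and> ?y u \<le> s - d"
        using path_in_open_interval[OF path_continuous[OF y] T r] by blast
      have 1: "set_integrable lborel {0..T} (\<lambda>u. 1 / (s - ?y u) * of_bool (?y u > 0))"
        by (rule set_integrable_bounded_comp[OF path_continuous[OF y], where f = "\<lambda>x. 1 / (s - x) * of_bool (x > 0)"])
          (measurable, use d bdrift_abs(1) in blast)
      have 2: "set_integrable lborel {0..T} (\<lambda>u. 1 / (i + ?y u) * of_bool (?y u < 0))"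
        by (rule set_integrable_bounded_comp[OF path_continuous[OF y], where f = "\<lambda>x. 1 / (i + x) * of_bool (x < 0)"])
          (measurable, use d bdrift_abs(2) in blast)
      have b: "(\<lambda>u. bdrift s i (?y u)) = (\<lambda>u. 1 / (i + ?y u) * of_bool (?y u < 0) - 1 / (s - ?y u) * of_bool (?y u > 0))"
        by (simp add: fun_eq_iff bdrift_def)
      show ?thesis unfolding b set_integral_diff(2)[OF 2 1] using set_integral_diff(1)[OF 2 1] elim(1)[rule_format, OF T] by linarith
    qed
    have "(LINT u:{0..0}|lborel. bdrift s i (?y u)) = 0"
      using set_integral_cells[of 0 0 "\<lambda>u. bdrift s i (?y u)"] *[of 0] by simp
    then have "?y 0 = 0" using *[of 0] elim(2) by simp
    then show ?case unfolding is_solution_def using * y elim(2) by blast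
  qed
qed

text \<open>If Y is 0 at time u, the drift is bounded by C shortly before u, so the value at time u
  - e plus the Wiener increment lies within C e of 0. Given the past, this has probability at most C
  sqrt e. How small e must be depends on the path, so the limit e to 0 is taken with Fatou's
  lemma.\<close>

lemma Y_nonzero:
  assumes Y: "sde_solution P s i Y" and si: "s > 0" "i > 0" and u: "u > 0"
  shows "AE \<omega> in P. Y \<omega> u \<noteq> 0"
proof -
  \<comment> \<open>Half the distance from 0 to the nearer end: while |Y| is below it, both
    denominators of the drift exceed \<open>m0\<close>.\<close>
  define m0 where "m0 = min s i / 2"
  have m0: "m0 > 0" using si by (simp add: m0_def)
  define C where "C = 1 / m0"
  have C: "C > 0" using m0 by (simp add: C_def)
  \<comment> \<open>The offset 2 keeps every \<open>e j\<close> strictly below u, so that u - e j is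
    an admissible time.\<close>
  define e where "e j = u / real (Suc (Suc j))" for j
  have e: "e j > 0" "e j < u" for j using u by (auto simp: e_def divide_less_eq)
  have elim0: "e \<longlonglongrightarrow> 0"
    unfolding e_def by (rule LIMSEQ_Suc, rule LIMSEQ_Suc) (rule lim_const_over_n)
  define A where "A j = {\<omega> \<in> space P. \<bar>Y \<omega> (u - e j) + (\<omega> u - \<omega> (u - e j))\<bar> \<le> C * e j}" for j
  have Yad: "(\<lambda>\<omega>. Y \<omega> t) \<in> borel_measurable (\<F> t)" if "t \<ge> 0" for t
    using Y that unfolding sde_solution_def adapted_def by blast
  have YP[measurable]: "(\<lambda>\<omega>. Y \<omega> t) \<in> borel_measurable P" if "t \<ge> 0" for t by (rule meas_F[OF Yad[OF that]])
  have A[measurable]: "A j \<in> sets P" for j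
  proof -
    have [measurable]: "(\<lambda>\<omega>. Y \<omega> (u - e j)) \<in> borel_measurable P" "(\<lambda>\<omega>. \<omega> (u - e j)) \<in> borel_measurable P"
      "(\<lambda>\<omega>. \<omega> u) \<in> borel_measurable P" using e[of j] u by (auto intro!: YP coord_measurable_P)
    show ?thesis unfolding A_def by measurable
  qed
  have PA: "emeasure P (A j) \<le> ennreal (C * sqrt (e j))" for j
  proof -
    have t: "0 \<le> u - e j" "u - e j < u" "u - (u - e j) = e j" using e[of j] by auto
    have [measurable]: "(\<lambda>\<omega>. Y \<omega> (u - e j)) \<in> borel_measurable (\<F> (u - e j))" by (rule Yad[OF t(1)])
    let ?H = "\<lambda>p. indicator {y. \<bar>Y (fst p) (u - e j) + y\<bar> \<le> C * e j} (snd p) :: ennreal"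
    have Hm: "?H \<in> borel_measurable (\<F> (u - e j) \<Otimes>\<^sub>M borel)"
    proof -
      have "?H = indicator {p. \<bar>Y (fst p) (u - e j) + snd p\<bar> \<le> C * e j}" by (auto simp: indicator_def fun_eq_iff)
      moreover have "indicator {p. \<bar>Y (fst p) (u - e j) + snd p\<bar> \<le> C * e j} \<in> borel_measurable (\<F> (u - e j) \<Otimes>\<^sub>M borel)"
        by (rule borel_measurable_indicator') measurable
      ultimately show ?thesis by simp
    qed
    have "emeasure P (A j) = (\<integral>\<^sup>+\<omega>. indicator (A j) \<omega> \<partial>P)" by (subst nn_integral_indicator) (rule A, simp)
    also have "\<dots> = (\<integral>\<^sup>+\<omega>. ?H (\<omega>, \<omega> u - \<omega> (u - e j)) \<partial>P)"
      by (intro nn_integral_cong) (auto simp: A_def indicator_def)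
    also have "\<dots> = (\<integral>\<^sup>+\<omega>. (\<integral>\<^sup>+y. ?H (\<omega>, y) \<partial>gauss (e j)) \<partial>P)" using step[OF t(1,2) Hm] unfolding t(3) .
    also have "\<dots> \<le> (\<integral>\<^sup>+\<omega>. ennreal (C * e j / sqrt (e j)) \<partial>P)"
    proof (intro nn_integral_mono)
      fix \<omega>
      have "(\<integral>\<^sup>+y. ?H (\<omega>, y) \<partial>gauss (e j)) = emeasure (gauss (e j)) {y. \<bar>Y \<omega> (u - e j) + y\<bar> \<le> C * e j}" by simp
      also have "\<dots> \<le> ennreal (C * e j / sqrt (e j))"
        using e[of j] C by (intro gauss_small_ball) auto
      finally show "(\<integral>\<^sup>+y. ?H (\<omega>, y) \<partial>gauss (e j)) \<le> ennreal (C * e j / sqrt (e j))" .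
    qed
    also have "\<dots> = ennreal (C * sqrt (e j))"
      using e[of j] real_div_sqrt[of "e j"] by (simp flip: times_divide_eq_right)
    finally show ?thesis .
  qed
  have ev: "AE \<omega> in P. Y \<omega> u = 0 \<longrightarrow> (\<forall>\<^sub>F j in sequentially. \<omega> \<in> A j)"
    using AE_is_solution[OF Y] AE_space
  proof eventually_elim
    case (elim \<omega>)
    show ?case
    proof
      assume z: "Y \<omega> u = 0"
      let ?y = "Y \<omega>"
      have yO: "?y \<in> \<Omega>" and yI: "\<And>T. T \<ge> 0 \<Longrightarrow> set_integrable lborel {0..T} (\<lambda>u. bdrift s i (?y u)) \<and>
        ?y T = \<omega> T + (LINT u:{0..T}|lborel. bdrift s i (?y u))" using elim(1) unfolding is_solution_def by auto
      have yc: "continuous_on {0..u} ?y" by (rule path_continuous[OF yO])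
      have "\<exists>\<delta>>0. \<forall>v\<in>{0..u}. dist v u < \<delta> \<longrightarrow> dist (?y v) (?y u) < m0"
        by (rule yc[unfolded continuous_on_iff, rule_format]) (use u m0 in auto)
      then obtain \<delta> where \<delta>: "\<delta> > 0" "\<And>v. v \<in> {0..u} \<Longrightarrow> \<bar>v - u\<bar> < \<delta> \<Longrightarrow> \<bar>?y v\<bar> < m0"
        using z unfolding dist_real_def by auto
      have "\<forall>\<^sub>F j in sequentially. e j < \<delta>" using order_tendstoD(2)[OF elim0 \<delta>(1)] .
      then show "\<forall>\<^sub>F j in sequentially. \<omega> \<in> A j"
      proof eventually_elim
        case (elim j)
        let ?t = "u - e j"
        have t: "0 \<le> ?t" "?t \<le> u" using e[of j] by auto
        have i: "set_integrable lborel {0..u} (\<lambda>u. bdrift s i (?y u))" using yI[of u] u by simp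
        have i': "set_integrable lborel {?t..u} (\<lambda>u. bdrift s i (?y u))" by (rule set_integrable_subset[OF i]) (use t in auto)
        have "?y u = ?y ?t + (\<omega> u - \<omega> ?t) + (LINT v:{?t..u}|lborel. bdrift s i (?y v))"
          using yI[of u] yI[of ?t] t set_integral_Icc_split[OF t i] by simp
        moreover have "\<bar>LINT v:{?t..u}|lborel. bdrift s i (?y v)\<bar> \<le> C * e j"
        proof -
          have "\<bar>LINT v:{?t..u}|lborel. bdrift s i (?y v)\<bar> \<le> (LINT v:{?t..u}|lborel. \<bar>bdrift s i (?y v)\<bar>)"
            by (rule set_integral_abs_le[OF i'])
          also have "\<dots> \<le> (LINT v:{?t..u}|lborel. C)"
          proof (rule set_integral_mono)
            fix v assume v: "v \<in> {?t..u}"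
            have "\<bar>?y v\<bar> < m0" by (rule \<delta>(2)) (use v t elim e[of j] in auto)
            then show "\<bar>bdrift s i (?y v)\<bar> \<le> C"
              unfolding C_def using m0 by (intro bdrift_abs(3)) (auto simp: m0_def min_def split: if_splits)
          qed (intro set_integrable_abs i' set_integrable_const_Icc)+
          also have "\<dots> = C * e j" using t by (simp add: LINT_const_Icc)
          finally show ?thesis .
        qed
        ultimately show ?case using z \<open>\<omega> \<in> space P\<close> unfolding A_def by auto
      qed
    qed
  qed
  have [measurable]: "(\<lambda>\<omega>. Y \<omega> u) \<in> borel_measurable P" using u by (intro YP) simp
  have m: "{\<omega> \<in> space P. \<not> Y \<omega> u \<noteq> 0} \<in> sets P" by measurable
  have "emeasure P {\<omega> \<in> space P. \<not> Y \<omega> u \<noteq> 0} = (\<integral>\<^sup>+\<omega>. indicator {\<omega> \<in> space P. \<not> Y \<omega> u \<noteq> 0} \<omega> \<partial>P)"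
    by (rule nn_integral_indicator[OF m, symmetric])
  also have "\<dots> \<le> (\<integral>\<^sup>+\<omega>. liminf (\<lambda>j. indicator (A j) \<omega>) \<partial>P)"
  proof (rule nn_integral_mono_AE)
    show "AE \<omega> in P. indicator {\<omega> \<in> space P. \<not> Y \<omega> u \<noteq> 0} \<omega> \<le> (liminf (\<lambda>j. indicator (A j) \<omega>) :: ennreal)"
      using ev
    proof eventually_elim
      case (elim \<omega>)
      show ?case
      proof (cases "Y \<omega> u = 0")
        case True
        then have "\<forall>\<^sub>F j in sequentially. (1 :: ennreal) \<le> indicator (A j) \<omega>"
          using elim by (auto elim: eventually_mono)
        then have "(1 :: ennreal) \<le> liminf (\<lambda>j. indicator (A j) \<omega>)" by (rule Liminf_bounded)
        then show ?thesis by (auto simp: indicator_def)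
      qed simp
    qed
  qed
  also have "\<dots> \<le> liminf (\<lambda>j. \<integral>\<^sup>+\<omega>. indicator (A j) \<omega> \<partial>P)"
    by (rule nn_integral_liminf) (rule borel_measurable_indicator[OF A])
  also have "\<dots> = liminf (\<lambda>j. emeasure P (A j))" by (simp only: nn_integral_indicator[OF A])
  also have "\<dots> \<le> liminf (\<lambda>j. ennreal (C * sqrt (e j)))"
    by (rule Liminf_mono) (use PA in simp)
  also have "\<dots> = ennreal (C * sqrt 0)"
    by (intro lim_imp_Liminf tendsto_ennrealI tendsto_mult tendsto_const tendsto_real_sqrt elim0) simp
  finally have "emeasure P {\<omega> \<in> space P. \<not> Y \<omega> u \<noteq> 0} = 0" by simp
  then show ?thesis by (intro AE_I[OF order_refl _ m])
qed

end

context euler_limit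
begin

lemma hh_Suc_lim: "(\<lambda>n. real (Suc n) * hh n) \<longlonglongrightarrow> 0"
proof (rule Lim_null_comparison)
  show "\<forall>\<^sub>F n in sequentially. norm (real (Suc n) * hh n) \<le> T / real (Suc n)"
  proof (intro always_eventually allI)
    fix n
    have "real (Suc n) * real (Suc n) \<le> real (Suc n) ^ 8"
      using power_increasing[of 2 8 "real (Suc n)"] by (simp add: power2_eq_square)
    then have "T * (real (Suc n) * real (Suc n)) \<le> T * real (Suc n) ^ 8" using T by (intro mult_left_mono) auto
    then have "real (Suc n) * (T / real (Suc n) ^ 8) \<le> T / real (Suc n)" by (simp add: field_simps del: of_nat_Suc)
    then show "norm (real (Suc n) * hh n) \<le> T / real (Suc n)" unfolding hh_eq using T by simp
  qed
  show "(\<lambda>n. T / real (Suc n)) \<longlonglongrightarrow> 0" by (rule LIMSEQ_Suc) (rule lim_const_over_n)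
qed

text \<open>Dominated convergence in time: the mollified drift converges at every point where f is
  differentiable, that is off 0, and y visits 0 only on a null set of times.\<close>

lemma drift_error_lim:
  assumes y: "continuous_on {0..T} y" and \<beta>: "set_integrable lborel {0..T} (\<lambda>u. b (y u))"
    and \<tau>: "0 \<le> \<tau>" "\<tau> \<le> T" and bB: "\<And>u. 0 \<le> u \<Longrightarrow> u \<le> \<tau> \<Longrightarrow> \<bar>b (y u)\<bar> \<le> B"
    and nz: "AE u in lborel. u \<ge> 0 \<longrightarrow> y u \<noteq> 0"
    and der: "\<And>u. 0 \<le> u \<Longrightarrow> u \<le> \<tau> \<Longrightarrow> y u \<noteq> 0 \<Longrightarrow> (f has_real_derivative b (y u)) (at (y u))"
  shows "(\<lambda>n. LINT u:{0..\<tau>}|lborel. \<bar>b (y u) - bn n (y u)\<bar>) \<longlonglongrightarrow> 0"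
proof -
  have i: "set_integrable lborel {0..\<tau>} (\<lambda>u. \<bar>b (y u) - bn n (y u)\<bar>)" for n
  proof -
    have bc: "continuous_on UNIV (bn n)" by (auto intro!: DERIV_isCont[OF bn'] continuous_at_imp_continuous_on)
    have "continuous_on {0..\<tau>} (\<lambda>u. bn n (y u))"
      by (rule continuous_on_compose2[OF bc continuous_on_subset[OF y]]) (use \<tau> in auto)
    moreover have "set_integrable lborel {0..\<tau>} (\<lambda>u. b (y u))" by (rule set_integrable_subset[OF \<beta>]) (use \<tau> in auto)
    ultimately show ?thesis
      by (intro set_integrable_abs set_integral_diff(1)) (auto intro: set_integrable_continuous)
  qed
  have "(\<lambda>n. LINT u:{0..\<tau>}|lborel. \<bar>b (y u) - bn n (y u)\<bar>) \<longlonglongrightarrow> (LINT u|(lborel :: real measure). (0::real))"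
    unfolding set_lebesgue_integral_def
  proof (rule integral_dominated_convergence[where w = "\<lambda>u. indicator {0..\<tau>} u *\<^sub>R (2 * B)"])
    show "integrable lborel (\<lambda>u. indicator {0..\<tau>} u *\<^sub>R (2 * B))"
      using set_integrable_const_Icc[of 0 \<tau> "2 * B"] by (simp only: set_integrable_def)
    show "(\<lambda>u. indicator {0..\<tau>} u *\<^sub>R \<bar>b (y u) - bn n (y u)\<bar>) \<in> borel_measurable lborel" for n
      using i[of n] unfolding set_integrable_def by (rule borel_measurable_integrable)
    show "AE u in lborel. norm (indicator {0..\<tau>} u *\<^sub>R \<bar>b (y u) - bn n (y u)\<bar>) \<le> indicator {0..\<tau>} u *\<^sub>R (2 * B)" for n
    proof (rule AE_I2)
      fix u
      have "\<bar>b (y u) - bn n (y u)\<bar> \<le> 2 * B" if "0 \<le> u" "u \<le> \<tau>"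
        using bB[OF that] bn_bound[of n "y u"] by linarith
      then show "norm (indicator {0..\<tau>} u *\<^sub>R \<bar>b (y u) - bn n (y u)\<bar>) \<le> indicator {0..\<tau>} u *\<^sub>R (2 * B)"
        by (auto simp: indicator_def)
    qed
    show "AE u in lborel. (\<lambda>n. indicator {0..\<tau>} u *\<^sub>R \<bar>b (y u) - bn n (y u)\<bar>) \<longlonglongrightarrow> 0"
      using nz
    proof eventually_elim
      case (elim u)
      show ?case
      proof (cases "u \<in> {0..\<tau>}")
        case True
        have "(\<lambda>n. bn n (y u)) \<longlonglongrightarrow> b (y u)" using True elim by (intro bn_lim der) auto
        then have "(\<lambda>n. \<bar>b (y u) - bn n (y u)\<bar>) \<longlonglongrightarrow> \<bar>b (y u) - b (y u)\<bar>" by (intro tendsto_intros)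
        then show ?thesis using True by simp
      qed simp
    qed
  qed simp
  then show ?thesis by simp
qed

lemma mesh_form: "real k * hh n = real k * T / real (mesh n)"
  by (simp add: hh_def)

end

lemma lev_measurable:
  assumes "finite J" "fst ` J \<subseteq> {0..T}"
  shows "lev m J \<in> borel_measurable (\<F> T)"
  unfolding lev_def using assms
  by (intro borel_measurable_prod measurable_compose[OF _ cl_measurable] borel_measurable_diff
      borel_measurable_times borel_measurable_const F_coord) auto

lemma cut_measurable:
  assumes "T \<ge> 0"
  shows "cut s i d T \<in> borel_measurable (\<F> T)"
  unfolding cut_def
  by (intro borel_measurable_times measurable_compose[OF _ cl_measurable] borel_measurable_diff
      borel_measurable_divide borel_measurable_const sup_proc_measurable assms)

lemma measurable_F_infty: "f \<in> measurable (\<F> t) N \<Longrightarrow> f \<in> measurable \<F>\<^sub>\<infinity> N"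
  using F_sub_infty[of t] by (auto simp: measurable_def)

context wiener_local_time
begin

text \<open>Convergence is checked path by path. On the Wiener side, a path coming within d of an
  end makes both the functionals and their limit vanish; along all others the truncated potential is
  exact and \<open>J_lim\<close> applies with r = 0. On the side of the diffusion, the scheme
  follows Y up to the first time within d of an end, and if there is such a time before T the cutoff
  vanishes.\<close>

lemma truncated_identity:
  assumes Y: "sde_solution P s i Y" and T: "T > 0" and pt: "potential s i d" and J: "finite J" "fst ` J \<subseteq> {0..T}"
  shows "(\<integral>\<^sup>+\<omega>. ennreal (lev m J \<omega> * cut s i d T \<omega> * exp (potential.pot s i d (\<omega> T) + potential.\<kappa> s i * L T \<omega>)) \<partial>P)
    = (\<integral>\<^sup>+\<omega>. ennreal (lev m J (Y \<omega>) * cut s i d T (Y \<omega>)) \<partial>P)"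
proof -
  interpret Pt: potential s i d by (rule pt)
  have d: "d > 0" by (rule Pt.d(1))
  obtain F \<Phi> where "euler_limit P Pt.pot F \<Phi> (1 / d) T"
    using euler_limit_exists[OF T Pt.pot_lip Pt.pot_0] by blast
  then interpret E: euler_limit P Pt.pot F \<Phi> "1 / d" T .
  have YM: "Y \<in> measurable P \<F>\<^sub>\<infinity>"
    using Y unfolding sde_solution_def measurable_cong_sets[OF sets_P refl] by blast
  have lcm: "(\<lambda>y. lev m J y * cut s i d T y) \<in> borel_measurable (\<F> T)"
    using T by (intro borel_measurable_times lev_measurable[OF J] cut_measurable) simp
  have pot_c: "continuous_on UNIV Pt.pot" by (rule lipschitz_continuous[OF Pt.pot_lip])
  \<comment> \<open>Both - \<kappa> |x| and \<open>gp\<close> are concave, so the mollified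
    potential has a nonpositive second derivative.\<close>
  have anti: "antimono (E.bn n)" for n
  proof (rule antimonoI)
    fix x y :: real assume "x \<le> y"
    have "E.dn n x \<le> 0" for x
    proof -
      have "E.dn n x = - Pt.\<kappa> * sdiff (E.eps n) abs x + sdiff (E.eps n) Pt.gp x"
        unfolding E.dn_def sdiff_linear[symmetric] using Pt.pot_eq by presburger
      moreover have "sdiff (E.eps n) Pt.gp x \<le> 0" by (rule sdiff_nonpos[OF Pt.gp_deriv E.eps_pos Pt.gp'_anti])
      moreover have "Pt.\<kappa> * sdiff (E.eps n) abs x \<ge> 0"
        unfolding sdiff_abs[OF E.eps_pos] using Pt.ds by (simp add: Pt.\<kappa>_def)
      ultimately show ?thesis by simp
    qed
    then show "E.bn n y \<le> E.bn n x"
      using DERIV_nonpos_imp_nonincreasing[OF \<open>x \<le> y\<close>, of "E.bn n"] E.bn' by blast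
  qed
  show ?thesis
  proof (rule E.girsanov_limit[where G = "\<lambda>n. Gfun m J s i d T (E.mesh n)"])
    show "Gfun m J s i d T (E.mesh n) \<in> borel_measurable seqM" for n by (rule Gfun_measurable[OF J(1)])
    show "0 \<le> Gfun m J s i d T (E.mesh n) x" "Gfun m J s i d T (E.mesh n) x \<le> 1" for n x by (rule Gfun_01)+
    show "(\<lambda>\<omega>. lev m J \<omega> * cut s i d T \<omega> * exp (Pt.pot (\<omega> T) + Pt.\<kappa> * L T \<omega>)) \<in> borel_measurable P"
    proof -
      have [measurable]: "Pt.pot \<in> borel_measurable borel" by (rule borel_measurable_continuous_onI[OF pot_c])
      have [measurable]: "L T \<in> borel_measurable P" "(\<lambda>\<omega>. \<omega> T) \<in> borel_measurable P" using T by (auto intro: coord_measurable_P)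
      note [measurable] = meas_F[OF lcm]
      show ?thesis by measurable
    qed
    show "0 \<le> lev m J \<omega> * cut s i d T \<omega> * exp (Pt.pot (\<omega> T) + Pt.\<kappa> * L T \<omega>)" for \<omega>
      by (simp add: lev_01 cut_01)
    show "(\<lambda>\<omega>. lev m J (Y \<omega>) * cut s i d T (Y \<omega>)) \<in> borel_measurable P"
      by (rule measurable_compose[OF YM measurable_F_infty[OF lcm]])
    show "AE \<omega> in P. (\<lambda>n. Gfun m J s i d T (E.mesh n) (gseq (\<lambda>j. real j * E.hh n) (E.mesh n) \<omega>) * E.dens n \<omega>)
        \<longlonglongrightarrow> lev m J \<omega> * cut s i d T \<omega> * exp (Pt.pot (\<omega> T) + Pt.\<kappa> * L T \<omega>)"
      using E.dens_lim occupation[OF less_imp_le[OF T]] AE_nonzero AE_space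
    proof eventually_elim
      case (elim \<omega>)
      have wO: "\<omega> \<in> \<Omega>" using elim(4) by simp
      have wc: "continuous_on {0..T} \<omega>" by (rule path_continuous[OF wO])
      let ?x = "\<lambda>n. gseq (\<lambda>j. real j * E.hh n) (E.mesh n) \<omega>"
      \<comment> \<open>A sampled path agrees with the path at the grid points, so its error bound
        is 0.\<close>
      have ex: "\<forall>\<^sub>F n in sequentially. \<forall>k. real k * T / real (E.mesh n) \<le> T \<longrightarrow> \<bar>?x n k - \<omega> (real k * T / real (E.mesh n))\<bar> \<le> 0"
      proof (intro always_eventually allI impI)
        fix n k assume "real k * T / real (E.mesh n) \<le> T"
        then have "real k \<le> real (E.mesh n)" using T E.mesh_pos[of n] by (simp add: divide_le_eq)
        then show "\<bar>?x n k - \<omega> (real k * T / real (E.mesh n))\<bar> \<le> 0" by (simp add: gseq_def E.mesh_form min_absorb1)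
      qed
      show ?case
      proof (cases "\<exists>u\<in>{0..T}. \<omega> u \<ge> s - d \<or> \<omega> u \<le> - (i - d)")
        case True
        then obtain u where u: "u \<in> {0..T}" "\<omega> u \<ge> s - d \<or> \<omega> u \<le> - (i - d)" by blast
        have "\<forall>\<^sub>F n in sequentially. Gfun m J s i d T (E.mesh n) (?x n) = 0"
        proof (rule Gfun_tendsto_0[OF wc T E.mesh_top E.mesh_pos tendsto_const d _ _ _ u(2)])
          show "\<forall>\<^sub>F n in sequentially. \<forall>k. real k * T / real (E.mesh n) \<le> u \<longrightarrow> \<bar>?x n k - \<omega> (real k * T / real (E.mesh n))\<bar> \<le> 0"
            by (rule eventually_mono[OF ex]) (use u(1) in auto)
        qed (use u in auto)
        then have "\<forall>\<^sub>F n in sequentially. Gfun m J s i d T (E.mesh n) (?x n) * E.dens n \<omega> = 0"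
          by eventually_elim simp
        then have "(\<lambda>n. Gfun m J s i d T (E.mesh n) (?x n) * E.dens n \<omega>) \<longlonglongrightarrow> 0" by (rule tendsto_eventually)
        then show ?thesis using cut_0[OF wc d u] by simp
      next
        case False
        \<comment> \<open>The kink has coefficient - \<kappa> and the occupation constant is 1 / 2,
          so the limit is - 2 \<kappa> L, and the exponent gains \<kappa> L.\<close>
        have "(\<lambda>n. E.J n \<omega>) \<longlonglongrightarrow> - Pt.\<kappa> * (L T \<omega> / (1 / 2)) + 0 * T"
        proof (rule E.J_lim[OF wO elim(3) Pt.pot_eq Pt.gp_deriv Pt.gp'_lip])
          fix u assume u: "u \<in> {0..T}" "\<omega> u \<noteq> 0"
          have "- (i - d) < \<omega> u" "\<omega> u < s - d" using False u(1) by (auto simp: not_le)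
          then show "\<exists>d' b. (Pt.gp' has_real_derivative d') (at (\<omega> u)) \<and> (Pt.pot has_real_derivative b) (at (\<omega> u)) \<and> d' + b\<^sup>2 = 0"
            using Pt.gp'_deriv[OF u(2)] Pt.pot_deriv[OF u(2)]
            by (intro exI[of _ "- (Pt.drift (\<omega> u))\<^sup>2"] exI[of _ "Pt.drift (\<omega> u)"]) auto
        qed (use elim(2) in auto)
        then have "(\<lambda>n. E.dens n \<omega>) \<longlonglongrightarrow> exp (Pt.pot (\<omega> T) - (- Pt.\<kappa> * (L T \<omega> / (1 / 2)) + 0 * T) / 2)"
          using elim(1) by blast
        moreover have "Pt.pot (\<omega> T) - (- Pt.\<kappa> * (L T \<omega> / (1 / 2)) + 0 * T) / 2 = Pt.pot (\<omega> T) + Pt.\<kappa> * L T \<omega>" by simp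
        ultimately have D: "(\<lambda>n. E.dens n \<omega>) \<longlonglongrightarrow> exp (Pt.pot (\<omega> T) + Pt.\<kappa> * L T \<omega>)" by simp
        show ?thesis
          by (intro tendsto_mult[OF _ D] Gfun_tendsto[OF wc T E.mesh_top E.mesh_pos tendsto_const d J(2) ex])
      qed
    qed
    have Ynz: "AE \<omega> in P. AE u in lborel. u \<ge> 0 \<longrightarrow> Y \<omega> u \<noteq> 0"
      by (rule AE_nonzero_path[OF YM Y_nonzero[OF Y]]) (use Pt.ds in auto)
    show "AE \<omega> in P. (\<lambda>n. Gfun m J s i d T (E.mesh n) (eseq (E.bn n) (E.hh n) (E.mesh n) \<omega>))
        \<longlonglongrightarrow> lev m J (Y \<omega>) * cut s i d T (Y \<omega>)"
      using AE_is_solution[OF Y] Ynz E.cell_err[of "2 / d", OF less_imp_le[OF divide_pos_pos[OF zero_less_numeral d]]] AE_space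
    proof eventually_elim
      case (elim \<omega>)
      let ?y = "Y \<omega>" and ?x = "\<lambda>n. eseq (E.bn n) (E.hh n) (E.mesh n) \<omega>"
      have wO: "\<omega> \<in> \<Omega>" using elim(4) by simp
      have yO: "?y \<in> \<Omega>" and y0: "?y 0 = 0" "\<omega> 0 = 0"
        and sol: "\<And>t. t \<ge> 0 \<Longrightarrow> set_integrable lborel {0..t} (\<lambda>u. Pt.drift (?y u)) \<and> ?y t = \<omega> t + (LINT u:{0..t}|lborel. Pt.drift (?y u))"
        using elim(1) unfolding is_solution_def Pt.drift_eq by auto
      have yc: "continuous_on {0..T} ?y" by (rule path_continuous[OF yO])
      obtain \<tau> where \<tau>: "0 \<le> \<tau>" "\<tau> \<le> T" and ins: "\<And>u. 0 \<le> u \<Longrightarrow> u \<le> \<tau> \<Longrightarrow> - (i - d) \<le> ?y u \<and> ?y u \<le> s - d"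
        and ex: "(?y \<tau> \<ge> s - d \<or> ?y \<tau> \<le> - (i - d)) \<or> \<tau> = T"
        using first_exit[OF yc less_imp_le[OF T], of "- (i - d)" "s - d"] y0 Pt.ds by auto
      define \<delta> where "\<delta> n = (LINT u:{0..\<tau>}|lborel. \<bar>Pt.drift (?y u) - E.bn n (?y u)\<bar>)
          + 2 * (1 / d) * real (Suc n) * (cerr (E.hh n) (E.mesh n) \<omega> + 1 / d * E.hh n * T)" for n
      have \<delta>0: "\<delta> \<longlonglongrightarrow> 0"
      proof -
        have a: "(\<lambda>n. LINT u:{0..\<tau>}|lborel. \<bar>Pt.drift (?y u) - E.bn n (?y u)\<bar>) \<longlonglongrightarrow> 0"
          by (rule E.drift_error_lim[OF yc _ \<tau> _ elim(2)])
            (use sol[of T] T ins Pt.drift_abs Pt.pot_deriv in auto)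
        have b: "(\<lambda>n. 2 / d * real (Suc n) * cerr (E.hh n) (E.mesh n) \<omega>) \<longlonglongrightarrow> 0"
        proof (rule Lim_null_comparison[OF _ elim(3)], intro always_eventually allI)
          fix n
          have "real (Suc n) \<le> (real (Suc n))\<^sup>2" by (simp add: power2_eq_square)
          then show "norm (2 / d * real (Suc n) * cerr (E.hh n) (E.mesh n) \<omega>) \<le> 2 / d * (real (Suc n))\<^sup>2 * cerr (E.hh n) (E.mesh n) \<omega>"
            using cerr_nonneg d by (auto simp: abs_mult intro!: mult_right_mono divide_right_mono)
        qed
        have c: "(\<lambda>n. 2 / d * (1 / d) * T * (real (Suc n) * E.hh n)) \<longlonglongrightarrow> 0"
          using tendsto_mult_left[OF E.hh_Suc_lim, of "2 / d * (1 / d) * T"] by simp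
        show ?thesis
          using tendsto_add[OF a tendsto_add[OF b c]] unfolding \<delta>_def by (simp add: algebra_simps del: of_nat_Suc)
      qed
      have small: "\<forall>\<^sub>F n in sequentially. E.hh n * (2 * (1 / d) * real (Suc n)) \<le> 1"
      proof -
        have "(\<lambda>n. 2 * (1 / d) * (real (Suc n) * E.hh n)) \<longlonglongrightarrow> 2 * (1 / d) * 0" by (intro tendsto_mult_left E.hh_Suc_lim)
        then have "\<forall>\<^sub>F n in sequentially. 2 * (1 / d) * (real (Suc n) * E.hh n) < 1" by (rule order_tendstoD) simp
        then show ?thesis by eventually_elim (simp add: mult_ac del: of_nat_Suc)
      qed
      have b: "\<forall>\<^sub>F n in sequentially. \<forall>k. real k * T / real (E.mesh n) \<le> \<tau> \<longrightarrow> \<bar>?x n k - ?y (real k * T / real (E.mesh n))\<bar> \<le> \<delta> n"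
        using small
      proof eventually_elim
        case (elim n)
        show ?case
        proof (intro allI impI)
          fix k assume k: "real k * T / real (E.mesh n) \<le> \<tau>"
          then have "real k * T / real (E.mesh n) \<le> T" using \<tau> by linarith
          then have "real k \<le> real (E.mesh n)" using T E.mesh_pos[of n] by (simp add: divide_le_eq)
          then have xk: "?x n k = euler (E.bn n) (E.hh n) \<omega> k" by (simp add: eseq_def min_absorb1)
          have "\<bar>euler (E.bn n) (E.hh n) \<omega> k - ?y (real k * E.hh n)\<bar> \<le> \<delta> n"
            unfolding \<delta>_def
          proof (rule E.comparison[OF wO yc _ _ _ \<tau> _ anti elim])
            show "?y 0 = \<omega> 0" using y0 by simp
            show "set_integrable lborel {0..T} (\<lambda>u. Pt.drift (?y u))" using sol[of T] T by simp
            show "?y t = \<omega> t + (LINT u:{0..t}|lborel. Pt.drift (?y u))" if "0 \<le> t" "t \<le> T" for t using sol[of t] that by blast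
            show "\<bar>Pt.drift (?y u)\<bar> \<le> 1 / d" if "0 \<le> u" "u \<le> \<tau>" for u using ins[OF that] Pt.drift_abs by blast
            show "real k * E.hh n \<le> \<tau>" using k unfolding E.mesh_form .
          qed
          then show "\<bar>?x n k - ?y (real k * T / real (E.mesh n))\<bar> \<le> \<delta> n" unfolding xk E.mesh_form .
        qed
      qed
      show ?case
      proof (cases "?y \<tau> \<ge> s - d \<or> ?y \<tau> \<le> - (i - d)")
        case True
        have "\<forall>\<^sub>F n in sequentially. Gfun m J s i d T (E.mesh n) (?x n) = 0"
          by (rule Gfun_tendsto_0[OF yc T E.mesh_top E.mesh_pos \<delta>0 d \<tau> b True])
        then have "(\<lambda>n. Gfun m J s i d T (E.mesh n) (?x n)) \<longlonglongrightarrow> 0" by (rule tendsto_eventually)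
        then show ?thesis using cut_0[OF yc d _ True] \<tau> by simp
      next
        case False
        then have \<tau>T: "\<tau> = T" using ex by blast
        show ?thesis by (rule Gfun_tendsto[OF yc T E.mesh_top E.mesh_pos \<delta>0 d J(2) b[unfolded \<tau>T]])
      qed
    qed
  qed
qed

end

section \<open>Removing the truncation: the density of the diffusion\<close>

text \<open>With d isolated in one denominator, monotonicity and the limit as d tends to 0 can be
  read off for each distance to an end.\<close>

lemma cut_alt:
  assumes "d > 0"
  shows "cut s i d T y = cl ((s - sup_proc T y) / d - 2) * cl ((i - inf_proc T y) / d - 2)"
proof -
  have "(r - 2 * d - x) / d = (r - x) / d - 2" for r x using assms by (simp add: field_simps)
  then show ?thesis by (simp only: cut_def)
qed

lemma cl_scaled_mono: "0 < d' \<Longrightarrow> d' \<le> d \<Longrightarrow> cl (r / d - 2) \<le> cl (r / d' - 2)"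
proof -
  assume d: "0 < d'" "d' \<le> d"
  show ?thesis
  proof (cases "r \<ge> 0")
    case True
    then have "r / d \<le> r / d'" using d by (intro divide_left_mono mult_pos_pos) auto
    then show ?thesis by (simp add: cl_def)
  next
    case False
    then have "r / d \<le> 0" using d by (simp add: divide_le_0_iff)
    then have "cl (r / d - 2) = 0" by (intro cl_0) simp
    then show ?thesis using cl_01 by simp
  qed
qed

text \<open>The cutoff is 1 once 3 d is at most r, and it is 0 for every d if r is at most 0. The
  limit therefore carries a strict inequality.\<close>

lemma cl_scaled_lim:
  assumes d: "d \<longlonglongrightarrow> 0" "\<And>n. d n > 0"
  shows "(\<lambda>n. cl (r / d n - 2)) \<longlonglongrightarrow> of_bool (r > 0)"
proof (cases "r > 0")
  case True
  have "\<forall>\<^sub>F n in sequentially. d n < r / 3" using order_tendstoD(2)[OF d(1), of "r / 3"] True by simp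
  then have "\<forall>\<^sub>F n in sequentially. cl (r / d n - 2) = of_bool (r > 0)"
  proof eventually_elim
    case (elim n)
    have "3 \<le> r / d n" using elim d(2)[of n] by (simp add: le_divide_eq)
    then show ?case using True by (simp add: cl_def)
  qed
  then show ?thesis by (rule tendsto_eventually)
next
  case False
  have "cl (r / d n - 2) = 0" for n
  proof (rule cl_0)
    have "r / d n \<le> 0" using False d(2)[of n] by (simp add: divide_le_0_iff)
    then show "r / d n - 2 \<le> 0" by simp
  qed
  then show ?thesis using False by simp
qed

lemma lev_lim:
  assumes "finite J"
  shows "(\<lambda>n. lev (real n) J y) \<longlonglongrightarrow> of_bool (\<forall>p\<in>J. y (fst p) \<le> snd p)"
proof -
  have 1: "(\<lambda>n. cl (1 - real n * (a - b))) \<longlonglongrightarrow> of_bool (a \<le> b)" for a b :: real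
  proof (cases "a \<le> b")
    case True
    then have "real n * (a - b) \<le> 0" for n by (simp add: mult_le_0_iff)
    then have "cl (1 - real n * (a - b)) = 1" for n using cl_def by (smt (verit))
    then show ?thesis using True by simp
  next
    case False
    obtain N where N: "1 / (a - b) \<le> real N" using real_arch_simple by blast
    have "\<forall>\<^sub>F n in sequentially. cl (1 - real n * (a - b)) = 0"
      using eventually_ge_at_top[of N]
    proof eventually_elim
      case (elim n)
      have "1 / (a - b) \<le> real n" using N elim by linarith
      then have "1 \<le> real n * (a - b)" using False by (simp add: divide_le_eq)
      then show ?case by (intro cl_0) simp
    qed
    then show ?thesis using False by (simp add: tendsto_eventually)
  qed
  have "(\<lambda>n. lev (real n) J y) \<longlonglongrightarrow> (\<Prod>p\<in>J. of_bool (y (fst p) \<le> snd p))"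
    unfolding lev_def by (intro tendsto_prod 1)
  also have "(\<Prod>p\<in>J. of_bool (y (fst p) \<le> snd p)) = (of_bool (\<forall>p\<in>J. y (fst p) \<le> snd p) :: real)"
    using assms by (induction J rule: finite_induct) auto
  finally show ?thesis .
qed

lemma sets_cylD: "A \<in> cyl T \<Longrightarrow> A \<in> sets (coord_sigma T)"
  unfolding sets_coord_sigma_cyl by (rule sigma_sets.Basic)

lemma Omega_in_cyl: "\<Omega> \<in> cyl T"
  unfolding cyl_def by (intro CollectI exI[of _ "{}"]) auto

lemma coord_sigma_measure_eqI:
  assumes "sets M = sets (coord_sigma T)" "sets N = sets (coord_sigma T)"
    and "\<And>A. A \<in> cyl T \<Longrightarrow> emeasure M A = emeasure N A" and "emeasure M \<Omega> < \<infinity>"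
  shows "M = N"
proof (rule measure_eqI_generator_eq[where E = "cyl T" and \<Omega> = \<Omega> and A = "\<lambda>_. \<Omega>"])
  show "Int_stable (cyl T)" by (rule Int_stable_cyl)
  show "cyl T \<subseteq> Pow \<Omega>" by (auto simp: cyl_def)
  show "sets M = sigma_sets \<Omega> (cyl T)" "sets N = sigma_sets \<Omega> (cyl T)"
    using assms by (simp_all add: sets_coord_sigma_cyl)
qed (use assms Omega_in_cyl in \<open>auto simp: less_top\<close>)

context wiener_local_time
begin

definition Mfac :: "real \<Rightarrow> real \<Rightarrow> real \<Rightarrow> (real \<Rightarrow> real) \<Rightarrow> real" where
  "Mfac s i T \<omega> = (1 - max (\<omega> T) 0 / s) * (1 - max (- \<omega> T) 0 / i) * exp (1 / 2 * (1 / s + 1 / i) * L T \<omega>)"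

text \<open>The strict inequalities discard the paths whose maximum is exactly \<open>s\<close>. This makes
  \<open>Ms s i T\<close> the density of the diffusion without knowing that \<open>S\<^sub>T\<close> has no atoms.\<close>

definition Ms :: "real \<Rightarrow> real \<Rightarrow> real \<Rightarrow> (real \<Rightarrow> real) \<Rightarrow> real" where
  "Ms s i T \<omega> = Mfac s i T \<omega> * of_bool (sup_proc T \<omega> < s \<and> inf_proc T \<omega> < i)"

lemma end_bounds:
  assumes "\<omega> \<in> \<Omega>" "T \<ge> 0"
  shows "\<omega> T \<le> sup_proc T \<omega>" "- \<omega> T \<le> inf_proc T \<omega>"
  using sup_proc_ge[OF path_continuous[OF assms(1)], of T T] assms(2)
    sup_proc_ge[of T "\<lambda>u. - \<omega> u" T] path_continuous[OF assms(1), of T]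
  by (auto simp: inf_proc_eq intro!: continuous_intros)

lemma Mfac_nonneg:
  assumes "\<omega> \<in> \<Omega>" "T \<ge> 0" "s > 0" "i > 0" "sup_proc T \<omega> \<le> s" "inf_proc T \<omega> \<le> i"
  shows "Mfac s i T \<omega> \<ge> 0"
proof -
  have "max (\<omega> T) 0 / s \<le> 1" "max (- \<omega> T) 0 / i \<le> 1"
    using end_bounds[OF assms(1,2)] assms by auto
  then show ?thesis unfolding Mfac_def by simp
qed

lemma Ms_nonneg: "\<omega> \<in> \<Omega> \<Longrightarrow> T \<ge> 0 \<Longrightarrow> s > 0 \<Longrightarrow> i > 0 \<Longrightarrow> Ms s i T \<omega> \<ge> 0"
  using Mfac_nonneg[of \<omega> T s i] by (auto simp: Ms_def)

lemma Ms_measurable_pair: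
  assumes "T \<ge> 0"
  shows "(\<lambda>q. Ms (fst (fst q)) (snd (fst q)) T (snd q)) \<in> borel_measurable (borel \<Otimes>\<^sub>M P)"
    and "(\<lambda>q. Mfac (fst (fst q)) (snd (fst q)) T (snd q) * of_bool (sup_proc T (snd q) \<le> fst (fst q) \<and> inf_proc T (snd q) \<le> snd (fst q)))
      \<in> borel_measurable (borel \<Otimes>\<^sub>M P)"
proof -
  have f: "(\<lambda>q. fst (fst q)) \<in> borel_measurable ((borel :: (real \<times> real) measure) \<Otimes>\<^sub>M P)"
    "(\<lambda>q. snd (fst q)) \<in> borel_measurable ((borel :: (real \<times> real) measure) \<Otimes>\<^sub>M P)"
    by (auto intro!: measurable_compose[OF measurable_fst] borel_measurable_continuous_onI continuous_intros)
  have X: "(\<lambda>\<omega>. \<omega> T) \<in> borel_measurable P" using assms by (rule coord_measurable_P)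
  have L: "L T \<in> borel_measurable P" using assms by (rule L_measurable_P)
  have S: "sup_proc T \<in> borel_measurable P" "inf_proc T \<in> borel_measurable P"
    using meas_F[OF sup_proc_measurable(1)[OF assms]] meas_F[OF sup_proc_measurable(2)[OF assms]] by auto
  note [measurable] = f measurable_compose[OF measurable_snd X] measurable_compose[OF measurable_snd L]
    measurable_compose[OF measurable_snd S(1)] measurable_compose[OF measurable_snd S(2)]
  show "(\<lambda>q. Ms (fst (fst q)) (snd (fst q)) T (snd q)) \<in> borel_measurable (borel \<Otimes>\<^sub>M P)"
    unfolding Ms_def Mfac_def by measurable
  show "(\<lambda>q. Mfac (fst (fst q)) (snd (fst q)) T (snd q) * of_bool (sup_proc T (snd q) \<le> fst (fst q) \<and> inf_proc T (snd q) \<le> snd (fst q)))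
      \<in> borel_measurable (borel \<Otimes>\<^sub>M P)"
    unfolding Mfac_def by measurable
qed

lemma Ms_measurable: "T \<ge> 0 \<Longrightarrow> Ms s i T \<in> borel_measurable P"
proof -
  assume "T \<ge> 0"
  then have [measurable]: "L T \<in> borel_measurable P" "(\<lambda>\<omega>. \<omega> T) \<in> borel_measurable P"
    "sup_proc T \<in> borel_measurable P" "inf_proc T \<in> borel_measurable P"
    using meas_F[OF sup_proc_measurable(1)] meas_F[OF sup_proc_measurable(2)] by (auto intro: coord_measurable_P)
  show ?thesis unfolding Ms_def[abs_def] Mfac_def by measurable
qed

text \<open>The truncation distance tends to 0. On the Wiener side the convergence is monotone, so
  integrability of \<open>Ms\<close> need not be known beforehand. On the side of the diffusion the
  cutoffs are bounded by 1 and tend to 1 because Y stays in the open interval.\<close>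

lemma lev_identity:
  assumes Y: "sde_solution P s i Y" and T: "T > 0" and si: "s > 0" "i > 0" and J: "finite J" "fst ` J \<subseteq> {0..T}"
  shows "(\<integral>\<^sup>+\<omega>. ennreal (lev m J \<omega>) * ennreal (Ms s i T \<omega>) \<partial>P) = (\<integral>\<^sup>+\<omega>. ennreal (lev m J (Y \<omega>)) \<partial>P)"
proof -
  \<comment> \<open>The offset 3 ensures 2 d n < min s i already for n = 0.\<close>
  define d where "d n = min s i / real (n + 3)" for n
  have d: "d n > 0" for n using si by (simp add: d_def)
  have d2: "2 * d n < s" "2 * d n < i" for n
  proof -
    have "min s i * 2 < min s i * real (n + 3)" using si by (intro mult_strict_left_mono) auto
    then have "min s i * 2 / real (n + 3) < min s i" by (subst pos_divide_less_eq, simp)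
    then have "2 * d n < min s i" unfolding d_def by (simp only: times_divide_eq_right mult.commute)
    then show "2 * d n < s" "2 * d n < i" by auto
  qed
  have pt: "potential s i (d n)" for n using d d2 by unfold_locales auto
  have dmono: "d n \<le> d m" if "m \<le> n" for m n
    unfolding d_def using that si by (intro divide_left_mono) auto
  have dlim: "d \<longlonglongrightarrow> 0"
    unfolding d_def using LIMSEQ_ignore_initial_segment[OF lim_const_over_n, of "min s i" 3] by simp
  have cutmono: "incseq (\<lambda>n. cut s i (d n) T y)" for y
    unfolding cut_alt[OF d] by (intro incseq_SucI mult_mono cl_scaled_mono d dmono cl_01) auto
  have cutlim: "(\<lambda>n. cut s i (d n) T y) \<longlonglongrightarrow> of_bool (sup_proc T y < s \<and> inf_proc T y < i)" for y
  proof -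
    have "(\<lambda>n. cut s i (d n) T y) \<longlonglongrightarrow> of_bool (s - sup_proc T y > 0) * of_bool (i - inf_proc T y > 0)"
      unfolding cut_alt[OF d] by (intro tendsto_mult cl_scaled_lim dlim d)
    then show ?thesis by (simp add: of_bool_conj)
  qed
  have YM: "Y \<in> measurable P \<F>\<^sub>\<infinity>"
    using Y unfolding sde_solution_def measurable_cong_sets[OF sets_P refl] by blast
  have lm: "lev m J \<in> borel_measurable (\<F> T)" by (rule lev_measurable[OF J])
  have cm: "cut s i (d n) T \<in> borel_measurable (\<F> T)" for n using T by (intro cut_measurable) simp
  \<comment> \<open>Where the cutoff is positive the final position is farther than
    \<open>d n\<close> from both ends, so the truncated potential is exact there.\<close>
  have eq: "ennreal (lev m J \<omega> * cut s i (d n) T \<omega> * exp (potential.pot s i (d n) (\<omega> T) + potential.\<kappa> s i * L T \<omega>))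
      = ennreal (lev m J \<omega> * cut s i (d n) T \<omega>) * ennreal (Ms s i T \<omega>)" if w: "\<omega> \<in> \<Omega>" for \<omega> n
  proof (cases "cut s i (d n) T \<omega> = 0")
    case False
    interpret Pt: potential s i "d n" by (rule pt)
    have nl: "\<not> s - 2 * d n \<le> sup_proc T \<omega>" "\<not> i - 2 * d n \<le> inf_proc T \<omega>"
      using False d[of n] cl_0[of "(s - 2 * d n - sup_proc T \<omega>) / d n"] cl_0[of "(i - 2 * d n - inf_proc T \<omega>) / d n"]
      unfolding cut_def by (auto simp: divide_le_0_iff)
    have "sup_proc T \<omega> < s - d n" "inf_proc T \<omega> < i - d n"
      using nl d[of n] by linarith+
    then have b: "- (i - d n) \<le> \<omega> T" "\<omega> T \<le> s - d n" "sup_proc T \<omega> < s" "inf_proc T \<omega> < i"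
      using end_bounds[OF w, of T] T d[of n] by linarith+
    have "exp (Pt.pot (\<omega> T) + Pt.\<kappa> * L T \<omega>) = Ms s i T \<omega>"
      unfolding exp_add Pt.exp_pot[OF b(1,2)] Ms_def Mfac_def Pt.\<kappa>_def using b(3,4) by (simp add: mult.commute)
    then show ?thesis using Ms_nonneg[OF w _ si, of T] T by (simp add: ennreal_mult lev_01 cut_01)
  qed simp
  have lhs: "(\<lambda>n. \<integral>\<^sup>+\<omega>. ennreal (lev m J \<omega> * cut s i (d n) T \<omega>) * ennreal (Ms s i T \<omega>) \<partial>P)
      \<longlonglongrightarrow> (\<integral>\<^sup>+\<omega>. ennreal (lev m J \<omega>) * ennreal (Ms s i T \<omega>) \<partial>P)"
  proof (rule nn_integral_LIMSEQ)
    show "incseq (\<lambda>n \<omega>. ennreal (lev m J \<omega> * cut s i (d n) T \<omega>) * ennreal (Ms s i T \<omega>))"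
      by (intro incseq_SucI le_funI mult_right_mono ennreal_leI mult_left_mono incseq_SucD[OF cutmono] lev_01) simp
    show "(\<lambda>\<omega>. ennreal (lev m J \<omega> * cut s i (d n) T \<omega>) * ennreal (Ms s i T \<omega>)) \<in> borel_measurable P" for n
      using meas_F[OF lm] meas_F[OF cm] Ms_measurable[of T] T
      by (intro borel_measurable_times_ennreal measurable_compose[OF _ measurable_ennreal] borel_measurable_times) auto
    fix \<omega>
    show "(\<lambda>n. ennreal (lev m J \<omega> * cut s i (d n) T \<omega>) * ennreal (Ms s i T \<omega>)) \<longlonglongrightarrow> ennreal (lev m J \<omega>) * ennreal (Ms s i T \<omega>)"
    proof (cases "sup_proc T \<omega> < s \<and> inf_proc T \<omega> < i")
      case True
      have "(\<lambda>n. lev m J \<omega> * cut s i (d n) T \<omega>) \<longlonglongrightarrow> lev m J \<omega> * 1"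
        using cutlim[of \<omega>] True by (intro tendsto_mult tendsto_const) auto
      then have "(\<lambda>n. ennreal (lev m J \<omega> * cut s i (d n) T \<omega>)) \<longlonglongrightarrow> ennreal (lev m J \<omega>)"
        by (intro tendsto_ennrealI) simp
      from ennreal_tendsto_cmult[OF _ this, of "ennreal (Ms s i T \<omega>)"] show ?thesis by (simp add: mult.commute)
    next
      case False
      then have "Ms s i T \<omega> = 0" by (auto simp: Ms_def)
      then show ?thesis by simp
    qed
  qed
  have rhs: "(\<lambda>n. \<integral>\<^sup>+\<omega>. ennreal (lev m J (Y \<omega>) * cut s i (d n) T (Y \<omega>)) \<partial>P) \<longlonglongrightarrow> (\<integral>\<^sup>+\<omega>. ennreal (lev m J (Y \<omega>)) \<partial>P)"
  proof (rule nn_integral_dominated_convergence[where w = "\<lambda>_. 1"])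
    show "(\<lambda>\<omega>. ennreal (lev m J (Y \<omega>) * cut s i (d n) T (Y \<omega>))) \<in> borel_measurable P" for n
      using measurable_compose[OF YM measurable_F_infty[OF lm]] measurable_compose[OF YM measurable_F_infty[OF cm]]
      by (intro measurable_compose[OF _ measurable_ennreal] borel_measurable_times)
    show "(\<lambda>\<omega>. ennreal (lev m J (Y \<omega>))) \<in> borel_measurable P"
      using measurable_compose[OF YM measurable_F_infty[OF lm]] by (intro measurable_compose[OF _ measurable_ennreal])
    show "AE \<omega> in P. ennreal (lev m J (Y \<omega>) * cut s i (d n) T (Y \<omega>)) \<le> 1" for n
      by (intro AE_I2) (simp add: mult_le_one lev_01 cut_01)
    show "AE \<omega> in P. (\<lambda>n. ennreal (lev m J (Y \<omega>) * cut s i (d n) T (Y \<omega>))) \<longlonglongrightarrow> ennreal (lev m J (Y \<omega>))"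
      using AE_is_solution[OF Y]
    proof eventually_elim
      case (elim \<omega>)
      have y: "Y \<omega> \<in> \<Omega>" "\<And>u. u \<ge> 0 \<Longrightarrow> - i < Y \<omega> u \<and> Y \<omega> u < s" using elim unfolding is_solution_def by auto
      have yc: "continuous_on {0..T} (Y \<omega>)" by (rule path_continuous[OF y(1)])
      obtain u where "u \<in> {0..T}" "sup_proc T (Y \<omega>) = Y \<omega> u"
        using sup_proc_attained[OF yc less_imp_le[OF T]] by blast
      then have "sup_proc T (Y \<omega>) < s" using y(2)[of u] by auto
      moreover have "inf_proc T (Y \<omega>) < i"
      proof -
        have "continuous_on {0..T} (\<lambda>u. - Y \<omega> u)" by (intro continuous_intros yc)
        from sup_proc_attained[OF this less_imp_le[OF T]]
        obtain u where "u \<in> {0..T}" "sup_proc T (\<lambda>u. - Y \<omega> u) = - Y \<omega> u" by blast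
        then show ?thesis unfolding inf_proc_eq using y(2)[of u] by auto
      qed
      ultimately have "(\<lambda>n. lev m J (Y \<omega>) * cut s i (d n) T (Y \<omega>)) \<longlonglongrightarrow> lev m J (Y \<omega>) * 1"
        using cutlim[of "Y \<omega>"] by (intro tendsto_mult tendsto_const) auto
      then show ?case by (intro tendsto_ennrealI) simp
    qed
  qed (simp_all add: emeasure_space_1)
  have lr: "(\<integral>\<^sup>+\<omega>. ennreal (lev m J \<omega> * cut s i (d n) T \<omega>) * ennreal (Ms s i T \<omega>) \<partial>P)
      = (\<integral>\<^sup>+\<omega>. ennreal (lev m J (Y \<omega>) * cut s i (d n) T (Y \<omega>)) \<partial>P)" for n
    unfolding truncated_identity[OF Y T pt J, symmetric] by (rule nn_integral_cong) (simp add: eq)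
  show ?thesis by (rule LIMSEQ_unique[OF lhs[unfolded lr] rhs])
qed

text \<open>\<open>lev_identity\<close> without constraints shows that \<open>Ms s i T\<close> has
  mean 1, so it serves as dominating function when m tends to infinity. The two sides are then
  finite measures on \<open>\<F> T\<close> that agree on cylinders.\<close>

theorem diffusion_density:
  assumes Y: "sde_solution P s i Y" and T: "T > 0" and si: "s > 0" "i > 0" and \<Gamma>: "\<Gamma> \<in> sets (\<F> T)"
  shows "emeasure (distr P \<F>\<^sub>\<infinity> Y) \<Gamma> = (\<integral>\<^sup>+\<omega>. ennreal (Ms s i T \<omega>) * indicator \<Gamma> \<omega> \<partial>P)"
proof -
  have YM: "Y \<in> measurable P \<F>\<^sub>\<infinity>"
    using Y unfolding sde_solution_def measurable_cong_sets[OF sets_P refl] by blast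
  have YT: "Y \<in> measurable P (\<F> T)"
    using YM F_sub_infty[of T] by (auto simp: measurable_def)
  have idm: "(\<lambda>\<omega>. \<omega>) \<in> measurable (density P (\<lambda>\<omega>. ennreal (Ms s i T \<omega>))) (\<F> T)"
    using F_sub_infty[of T] sets.sets_into_space[of _ "\<F> T"] by (auto simp: measurable_def Int_absorb2)
  have Mm: "(\<lambda>\<omega>. ennreal (Ms s i T \<omega>)) \<in> borel_measurable P"
    using Ms_measurable[of T] T by (intro measurable_compose[OF _ measurable_ennreal]) auto
  let ?N = "distr (density P (\<lambda>\<omega>. ennreal (Ms s i T \<omega>))) (\<F> T) (\<lambda>\<omega>. \<omega>)"
  have N: "emeasure ?N A = (\<integral>\<^sup>+\<omega>. ennreal (Ms s i T \<omega>) * indicator A \<omega> \<partial>P)" if A: "A \<in> sets (\<F> T)" for A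
  proof -
    have AP: "A \<in> sets P" using A F_sub_infty[of T] by auto
    have A\<Omega>: "A \<subseteq> \<Omega>" using sets.sets_into_space[OF A] by simp
    have "emeasure ?N A = emeasure (density P (\<lambda>\<omega>. ennreal (Ms s i T \<omega>))) ((\<lambda>\<omega>. \<omega>) -` A \<inter> space (density P (\<lambda>\<omega>. ennreal (Ms s i T \<omega>))))"
      by (rule emeasure_distr[OF idm A])
    also have "(\<lambda>\<omega>. \<omega>) -` A \<inter> space (density P (\<lambda>\<omega>. ennreal (Ms s i T \<omega>))) = A" using A\<Omega> by auto
    finally show ?thesis using emeasure_density[OF Mm AP] by simp
  qed
  have one: "(\<integral>\<^sup>+\<omega>. ennreal (Ms s i T \<omega>) \<partial>P) = 1"
    using lev_identity[OF Y T si, of "{}" 0] by (simp add: lev_def emeasure_space_1)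
  have "distr P (\<F> T) Y = ?N"
  proof (rule coord_sigma_measure_eqI[where T = "{0..T}"])
    show "sets (distr P (\<F> T) Y) = sets (coord_sigma {0..T})" "sets ?N = sets (coord_sigma {0..T})"
      by (simp_all add: coord_filt_def)
    show "emeasure (distr P (\<F> T) Y) \<Omega> < \<infinity>"
      using prob_space.emeasure_space_1[OF prob_space_distr[OF YT]] by simp
    fix A assume A: "A \<in> cyl {0..T}"
    then have AF: "A \<in> sets (\<F> T)" unfolding coord_filt_def by (rule sets_cylD)
    obtain J where J: "A = {\<omega> \<in> \<Omega>. \<forall>p\<in>J. \<omega> (fst p) \<le> snd p}" "finite J" "fst ` J \<subseteq> {0..T}"
      using A unfolding cyl_def by auto
    have lm: "lev (real n) J \<in> borel_measurable (\<F> T)" for n by (rule lev_measurable[OF J(2,3)])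
    have 1: "(\<lambda>n. \<integral>\<^sup>+\<omega>. ennreal (lev (real n) J \<omega>) * ennreal (Ms s i T \<omega>) \<partial>P) \<longlonglongrightarrow> (\<integral>\<^sup>+\<omega>. ennreal (Ms s i T \<omega>) * indicator A \<omega> \<partial>P)"
    proof (rule nn_integral_dominated_convergence[where w = "\<lambda>\<omega>. ennreal (Ms s i T \<omega>)"])
      show "(\<lambda>\<omega>. ennreal (lev (real n) J \<omega>) * ennreal (Ms s i T \<omega>)) \<in> borel_measurable P" for n
        using meas_F[OF lm] Ms_measurable[of T s i] T
        by (intro borel_measurable_times_ennreal measurable_compose[OF _ measurable_ennreal]) auto
      show "(\<lambda>\<omega>. ennreal (Ms s i T \<omega>) * indicator A \<omega>) \<in> borel_measurable P"
        using Mm AF F_sub_infty[of T] by (intro borel_measurable_times_ennreal borel_measurable_indicator) auto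
      show "AE \<omega> in P. ennreal (lev (real n) J \<omega>) * ennreal (Ms s i T \<omega>) \<le> ennreal (Ms s i T \<omega>)" for n
      proof (rule AE_I2)
        fix \<omega>
        have "ennreal (lev (real n) J \<omega>) * ennreal (Ms s i T \<omega>) \<le> 1 * ennreal (Ms s i T \<omega>)"
          by (rule mult_right_mono) (simp_all add: lev_01)
        then show "ennreal (lev (real n) J \<omega>) * ennreal (Ms s i T \<omega>) \<le> ennreal (Ms s i T \<omega>)" by simp
      qed
      show "AE \<omega> in P. (\<lambda>n. ennreal (lev (real n) J \<omega>) * ennreal (Ms s i T \<omega>)) \<longlonglongrightarrow> ennreal (Ms s i T \<omega>) * indicator A \<omega>"
        using AE_space
      proof eventually_elim
        case (elim \<omega>)
        have "(\<lambda>n. ennreal (lev (real n) J \<omega>)) \<longlonglongrightarrow> ennreal (of_bool (\<forall>p\<in>J. \<omega> (fst p) \<le> snd p))"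
          by (rule tendsto_ennrealI[OF lev_lim[OF J(2)]])
        from ennreal_tendsto_cmult[OF _ this, of "ennreal (Ms s i T \<omega>)"]
        have "(\<lambda>n. ennreal (lev (real n) J \<omega>) * ennreal (Ms s i T \<omega>)) \<longlonglongrightarrow> ennreal (Ms s i T \<omega>) * ennreal (of_bool (\<forall>p\<in>J. \<omega> (fst p) \<le> snd p))"
          by (simp add: mult.commute)
        moreover have "ennreal (of_bool (\<forall>p\<in>J. \<omega> (fst p) \<le> snd p)) = indicator A \<omega>"
          using elim J(1) by (auto simp: indicator_def)
        ultimately show ?case by simp
      qed
    qed (use Mm one in auto)
    have 2: "(\<lambda>n. \<integral>\<^sup>+\<omega>. ennreal (lev (real n) J (Y \<omega>)) \<partial>P) \<longlonglongrightarrow> (\<integral>\<^sup>+\<omega>. indicator (Y -` A \<inter> space P) \<omega> \<partial>P)"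
    proof (rule nn_integral_dominated_convergence[where w = "\<lambda>_. 1"])
      show "(\<lambda>\<omega>. ennreal (lev (real n) J (Y \<omega>))) \<in> borel_measurable P" for n
        using measurable_compose[OF YT lm] by (intro measurable_compose[OF _ measurable_ennreal])
      show "(\<lambda>\<omega>. indicator (Y -` A \<inter> space P) \<omega>) \<in> borel_measurable P"
        by (rule borel_measurable_indicator[OF measurable_sets[OF YT AF]])
      show "AE \<omega> in P. (\<lambda>n. ennreal (lev (real n) J (Y \<omega>))) \<longlonglongrightarrow> indicator (Y -` A \<inter> space P) \<omega>"
        using AE_space
      proof eventually_elim
        case (elim \<omega>)
        have "Y \<omega> \<in> \<Omega>" using measurable_space[OF YT elim] by simp
        then have "ennreal (of_bool (\<forall>p\<in>J. Y \<omega> (fst p) \<le> snd p)) = indicator (Y -` A \<inter> space P) \<omega>"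
          using elim J(1) by (auto simp: indicator_def)
        then show ?case using tendsto_ennrealI[OF lev_lim[OF J(2), of "Y \<omega>"]] by simp
      qed
    qed (auto simp: emeasure_space_1 lev_01)
    have "(\<integral>\<^sup>+\<omega>. ennreal (Ms s i T \<omega>) * indicator A \<omega> \<partial>P) = (\<integral>\<^sup>+\<omega>. indicator (Y -` A \<inter> space P) \<omega> \<partial>P)"
      using LIMSEQ_unique[OF 1] 2 unfolding lev_identity[OF Y T si J(2,3)] by blast
    also have "\<dots> = emeasure P (Y -` A \<inter> space P)" by (rule nn_integral_indicator[OF measurable_sets[OF YT AF]])
    also have "\<dots> = emeasure (distr P (\<F> T) Y) A" by (rule emeasure_distr[OF YT AF, symmetric])
    finally show "emeasure (distr P (\<F> T) Y) A = emeasure ?N A" using N[OF AF] by simp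
  qed
  moreover have "emeasure (distr P \<F>\<^sub>\<infinity> Y) \<Gamma> = emeasure (distr P (\<F> T) Y) \<Gamma>"
    using \<Gamma> F_sub_infty[of T] by (subst emeasure_distr[OF YM], blast) (simp add: emeasure_distr[OF YT])
  ultimately show ?thesis using N[OF \<Gamma>] by simp
qed

end

subsection \<open>Gluing independent Wiener paths\<close>

lemma glue_coord_measurable:
  assumes "n \<ge> 0" "u \<ge> 0" "\<omega> \<in> \<Omega>" "max n u \<le> t"
  shows "(\<lambda>\<omega>'. glue n \<omega> \<omega>' u) \<in> borel_measurable (\<F> t)"
proof -
  have [measurable]: "(\<lambda>\<omega>'. \<omega>' u) \<in> borel_measurable (\<F> t)" "(\<lambda>\<omega>'. \<omega>' n) \<in> borel_measurable (\<F> t)"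
    using assms by (auto intro!: F_coord)
  show ?thesis unfolding glue_def using assms by (cases "u \<le> n") simp_all
qed

lemma glue_measurable_pair:
  assumes "n \<ge> 0"
  shows "(\<lambda>q. glue n (fst q) (snd q)) \<in> measurable (\<F> n \<Otimes>\<^sub>M \<F>\<^sub>\<infinity>) \<F>\<^sub>\<infinity>"
  unfolding coord_filt_infty_def 
proof (rule measurable_coord_sigmaI)
  fix q assume "q \<in> space (\<F> n \<Otimes>\<^sub>M coord_sigma {0..})"
  then show "glue n (fst q) (snd q) \<in> \<Omega>" using assms by (intro glue_path) (auto simp: space_pair_measure)
next
  fix u :: real assume u: "u \<in> {0..}"
  have 1: "(\<lambda>q. fst q v) \<in> borel_measurable (\<F> n \<Otimes>\<^sub>M coord_sigma {0..})" if "0 \<le> v" "v \<le> n" for v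
    by (rule measurable_compose[OF measurable_fst F_coord[OF that]])
  have 2: "(\<lambda>q. snd q v) \<in> borel_measurable (\<F> n \<Otimes>\<^sub>M coord_sigma {0..})" if "0 \<le> v" for v
    by (rule measurable_compose[OF measurable_snd coord_measurable]) (use that in auto)
  show "(\<lambda>q. glue n (fst q) (snd q) u) \<in> borel_measurable (\<F> n \<Otimes>\<^sub>M coord_sigma {0..})"
    unfolding glue_def using 1[of u] 1[of n] 2[of u] 2[of n] u assms by (cases "u \<le> n") auto
qed

lemma glue_measurable_fst:
  assumes "n \<ge> 0" "\<omega>' \<in> \<Omega>"
  shows "(\<lambda>\<omega>. glue n \<omega> \<omega>') \<in> measurable (\<F> n) \<F>\<^sub>\<infinity>"
proof -
  have "(\<lambda>\<omega>. (\<omega>, \<omega>')) \<in> measurable (\<F> n) (\<F> n \<Otimes>\<^sub>M \<F>\<^sub>\<infinity>)" by (rule measurable_Pair2') (use assms in simp)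
  from measurable_compose[OF this glue_measurable_pair[OF assms(1)]] show ?thesis by simp
qed

context wiener
begin

text \<open>Up to index m the pasted path is the first path; beyond it every new increment comes
  from the second path and is a fresh Gaussian variable. The pasting time is itself a sampling time,
  so no increment straddles it.\<close>

lemma glue_seq_law:
  assumes t: "strict_mono t" "t 0 = 0" "t m = n" and "G \<in> borel_measurable seqM"
  shows "(\<integral>\<^sup>+\<omega>. (\<integral>\<^sup>+\<omega>'. G (gseq t k (glue n \<omega> \<omega>')) \<partial>P) \<partial>P) = (\<integral>\<^sup>+\<omega>. G (gseq t k \<omega>) \<partial>P)"
  using assms(4)
proof (induction k arbitrary: G)
  case 0
  have "0 \<le> n" using t strict_mono_less_eq[OF t(1), of 0 m] by simp
  then show ?case using t by (simp add: gseq_def glue_def emeasure_space_1)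
next
  case (Suc k)
  note [measurable] = Suc.prems
  have tm: "mono t" using t(1) by (rule strict_mono_mono)
  have t0: "t j \<ge> 0" for j using monoD[OF tm, of 0 j] t(2) by simp
  have n0: "n \<ge> 0" using t0[of m] t(3) by simp
  show ?case
  proof (cases "Suc k \<le> m")
    case True
    have "gseq t (Suc k) (glue n \<omega> \<omega>') = gseq t (Suc k) \<omega>" for \<omega> \<omega>'
    proof
      fix j
      have "t (min j (Suc k)) \<le> n" using True monoD[OF tm, of "min j (Suc k)" m] t(3) by auto
      then show "gseq t (Suc k) (glue n \<omega> \<omega>') j = gseq t (Suc k) \<omega> j"
        using t0[of "min j (Suc k)"] by (simp add: gseq_def glue_def)
    qed
    then show ?thesis by (simp add: emeasure_space_1)
  next
    case False
    then have mk: "n \<le> t k" using monoD[OF tm, of m k] t(3) by simp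
    let ?g = "gauss (t (Suc k) - t k)"
    have s: "0 \<le> t k" "t k < t (Suc k)" using t0 t(1) by (auto simp: strict_mono_less)
    interpret G: prob_space ?g using s by (intro prob_space_gauss) simp
    have G1[measurable]: "(\<lambda>x. \<integral>\<^sup>+y. G (ext k x (x k + y)) \<partial>?g) \<in> borel_measurable seqM" by measurable
    have [measurable]: "gseq t k \<in> measurable (\<F> (t k)) seqM" by (intro gseq_measurable tm) (auto simp: t)
    have inner: "(\<integral>\<^sup>+\<omega>'. G (gseq t (Suc k) (glue n \<omega> \<omega>')) \<partial>P)
        = (\<integral>\<^sup>+\<omega>'. (\<integral>\<^sup>+y. G (ext k (gseq t k (glue n \<omega> \<omega>')) (gseq t k (glue n \<omega> \<omega>') k + y)) \<partial>?g) \<partial>P)" if w: "\<omega> \<in> \<Omega>" for \<omega>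
    proof -
      have [measurable]: "(\<lambda>\<omega>'. gseq t k (glue n \<omega> \<omega>')) \<in> measurable (\<F> (t k)) seqM"
      proof (rule measurable_seqI)
        fix j
        have "t (min j k) \<le> t k" by (rule monoD[OF tm]) simp
        then show "(\<lambda>\<omega>'. gseq t k (glue n \<omega> \<omega>') j) \<in> borel_measurable (\<F> (t k))"
          unfolding gseq_def using n0 t0 w mk by (intro glue_coord_measurable) auto
      qed
      have d: "glue n \<omega> \<omega>' (t (Suc k)) - glue n \<omega> \<omega>' (t k) = \<omega>' (t (Suc k)) - \<omega>' (t k)" for \<omega>'
        using mk s n0 by (cases "t k = n") (auto simp: glue_def)
      show ?thesis
        unfolding gseq_Suc d
        using step[OF s, of "\<lambda>p. G (ext k (gseq t k (glue n \<omega> (fst p))) (gseq t k (glue n \<omega> (fst p)) k + snd p))"]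
        by simp
    qed
    have "(\<integral>\<^sup>+\<omega>. (\<integral>\<^sup>+\<omega>'. G (gseq t (Suc k) (glue n \<omega> \<omega>')) \<partial>P) \<partial>P)
        = (\<integral>\<^sup>+\<omega>. (\<integral>\<^sup>+\<omega>'. (\<integral>\<^sup>+y. G (ext k (gseq t k (glue n \<omega> \<omega>')) (gseq t k (glue n \<omega> \<omega>') k + y)) \<partial>?g) \<partial>P) \<partial>P)"
      by (intro nn_integral_cong inner) simp
    also have "\<dots> = (\<integral>\<^sup>+\<omega>. (\<integral>\<^sup>+y. G (ext k (gseq t k \<omega>) (gseq t k \<omega> k + y)) \<partial>?g) \<partial>P)"
      by (rule Suc.IH[OF G1])
    also have "\<dots> = (\<integral>\<^sup>+\<omega>. G (gseq t (Suc k) \<omega>) \<partial>P)"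
      unfolding gseq_Suc using step[OF s, of "\<lambda>p. G (ext k (gseq t k (fst p)) (gseq t k (fst p) k + snd p))"] by simp
    finally show ?thesis .
  qed
qed

lemma glue_law:
  assumes n: "n \<ge> 0"
  shows "distr (P \<Otimes>\<^sub>M P) \<F>\<^sub>\<infinity> (\<lambda>q. glue n (fst q) (snd q)) = P"
proof (rule coord_sigma_measure_eqI[where T = "{0..}"])
  have setsP: "sets (P \<Otimes>\<^sub>M P) = sets (\<F>\<^sub>\<infinity> \<Otimes>\<^sub>M \<F>\<^sub>\<infinity>)" by (rule sets_pair_measure_cong) simp_all
  have gm: "(\<lambda>q. glue n (fst q) (snd q)) \<in> measurable (P \<Otimes>\<^sub>M P) \<F>\<^sub>\<infinity>"
  proof -
    have id: "(\<lambda>q. (fst q, snd q)) \<in> measurable (P \<Otimes>\<^sub>M P) (\<F> n \<Otimes>\<^sub>M \<F>\<^sub>\<infinity>)"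
      by (intro measurable_Pair measurable_compose[OF measurable_fst meas_F[of _ n]] measurable_compose[OF measurable_snd]
          measurable_ident_sets sets_P measurable_ident) auto
    from measurable_compose[OF id glue_measurable_pair[OF n]] show ?thesis by simp
  qed
  show "sets (distr (P \<Otimes>\<^sub>M P) \<F>\<^sub>\<infinity> (\<lambda>q. glue n (fst q) (snd q))) = sets (coord_sigma {0..})"
    "sets P = sets (coord_sigma {0..})" by (simp_all add: coord_filt_infty_def)
  interpret PP: pair_prob_space P P ..
  show "emeasure (distr (P \<Otimes>\<^sub>M P) \<F>\<^sub>\<infinity> (\<lambda>q. glue n (fst q) (snd q))) \<Omega> < \<infinity>"
    using prob_space.emeasure_space_1[OF PP.prob_space_distr[OF gm]] by simp
  fix A assume A: "A \<in> cyl {0..}"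
  then have AF: "A \<in> sets \<F>\<^sub>\<infinity>" unfolding coord_filt_infty_def by (rule sets_cylD)
  obtain J where J: "A = {\<omega> \<in> \<Omega>. \<forall>p\<in>J. \<omega> (fst p) \<le> snd p}" "finite J" "fst ` J \<subseteq> {0..}"
    using A unfolding cyl_def by auto
  \<comment> \<open>The times 0 and n are added to those of the constraints because
    \<open>glue_seq_law\<close> needs both on the grid.\<close>
  have "finite (insert 0 (insert n (fst ` J)))" "0 \<in> insert 0 (insert n (fst ` J))" "insert 0 (insert n (fst ` J)) \<subseteq> {0..}"
    using J n by auto
  from finite_times_grid[OF this]
  obtain t :: "nat \<Rightarrow> real" and k where t: "strict_mono t" "t 0 = 0" "insert 0 (insert n (fst ` J)) = t ` {..k}"
    by blast
  have "n \<in> t ` {..k}" unfolding t(3)[symmetric] by simp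
  then obtain m where m: "t m = n" by auto
  have "\<forall>p\<in>J. \<exists>j\<le>k. t j = fst p"
  proof
    fix p assume "p \<in> J"
    then have "fst p \<in> t ` {..k}" unfolding t(3)[symmetric] by simp
    then show "\<exists>j\<le>k. t j = fst p" by auto
  qed
  then obtain r where r: "\<And>p. p \<in> J \<Longrightarrow> r p \<le> k \<and> t (r p) = fst p" by metis
  define B where "B = {x \<in> space seqM. \<forall>p\<in>J. x (r p) \<le> snd p}"
  have B: "B \<in> sets seqM"
    unfolding B_def
  proof (rule sets.sets_Collect_finite_All[OF _ J(2)])
    fix p assume "p \<in> J"
    have [measurable]: "(\<lambda>x. x (r p)) \<in> borel_measurable seqM" by (rule seq_coord)
    show "{x \<in> space seqM. x (r p) \<le> snd p} \<in> sets seqM" by measurable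
  qed
  have AB: "(indicator A \<omega> :: ennreal) = indicator B (gseq t k \<omega>)" if "\<omega> \<in> \<Omega>" for \<omega>
    using that r by (auto simp: indicator_def J(1) B_def gseq_def space_PiM min_absorb1)
  have "emeasure (distr (P \<Otimes>\<^sub>M P) \<F>\<^sub>\<infinity> (\<lambda>q. glue n (fst q) (snd q))) A
      = (\<integral>\<^sup>+q. indicator A q \<partial>distr (P \<Otimes>\<^sub>M P) \<F>\<^sub>\<infinity> (\<lambda>q. glue n (fst q) (snd q)))"
    using AF by (subst nn_integral_indicator) auto
  also have "\<dots> = (\<integral>\<^sup>+q. indicator A (glue n (fst q) (snd q)) \<partial>(P \<Otimes>\<^sub>M P))"
    by (rule nn_integral_distr[OF gm]) (use AF in \<open>simp add: borel_measurable_indicator\<close>)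
  also have "\<dots> = (\<integral>\<^sup>+\<omega>. (\<integral>\<^sup>+\<omega>'. indicator A (glue n \<omega> \<omega>') \<partial>P) \<partial>P)"
    by (subst nn_integral_fst[symmetric]) (use measurable_compose[OF gm borel_measurable_indicator[OF AF]] in auto)
  also have "\<dots> = (\<integral>\<^sup>+\<omega>. (\<integral>\<^sup>+\<omega>'. indicator B (gseq t k (glue n \<omega> \<omega>')) \<partial>P) \<partial>P)"
    by (intro nn_integral_cong AB glue_path n) auto
  also have "\<dots> = (\<integral>\<^sup>+\<omega>. indicator B (gseq t k \<omega>) \<partial>P)"
    by (rule glue_seq_law[OF t(1,2) m borel_measurable_indicator[OF B]])
  also have "\<dots> = (\<integral>\<^sup>+\<omega>. indicator A \<omega> \<partial>P)" by (intro nn_integral_cong AB[symmetric]) simp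
  also have "\<dots> = emeasure P A" using AF by (subst nn_integral_indicator) auto
  finally show "emeasure (distr (P \<Otimes>\<^sub>M P) \<F>\<^sub>\<infinity> (\<lambda>q. glue n (fst q) (snd q))) A = emeasure P A" .
qed

text \<open>The filtration is not completed, so a null set that only depends on the path up to time
  \<open>n\<close> has to be covered by a null set in \<open>\<F> n\<close>. Replacing the path after time \<open>n\<close> by a fixed
  typical one does this.\<close>

lemma saturated_null:
  assumes n: "n \<ge> 0" and N: "N \<in> null_sets P" "B \<subseteq> N" "B \<subseteq> \<Omega>"
    and sat: "\<And>\<omega> \<omega>'. \<omega> \<in> B \<Longrightarrow> \<omega>' \<in> \<Omega> \<Longrightarrow> (\<And>u. 0 \<le> u \<Longrightarrow> u \<le> n \<Longrightarrow> \<omega>' u = \<omega> u) \<Longrightarrow> \<omega>' \<in> B"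
  shows "\<exists>N'\<in>sets (\<F> n). emeasure P N' = 0 \<and> B \<subseteq> N'"
proof -
  interpret PP: pair_prob_space P P ..
  have NF: "N \<in> sets \<F>\<^sub>\<infinity>" using N(1) by (auto simp: null_sets_def)
  have gm: "(\<lambda>q. glue n (fst q) (snd q)) \<in> measurable (P \<Otimes>\<^sub>M P) \<F>\<^sub>\<infinity>"
  proof -
    have id: "(\<lambda>q. (fst q, snd q)) \<in> measurable (P \<Otimes>\<^sub>M P) (\<F> n \<Otimes>\<^sub>M \<F>\<^sub>\<infinity>)"
      by (intro measurable_Pair measurable_compose[OF measurable_fst meas_F[of _ n]] measurable_compose[OF measurable_snd]
          measurable_ident_sets sets_P measurable_ident) auto
    from measurable_compose[OF id glue_measurable_pair[OF n]] show ?thesis by simp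
  qed
  have im: "(\<lambda>q. indicator N (glue n (fst q) (snd q)) :: ennreal) \<in> borel_measurable (P \<Otimes>\<^sub>M P)"
    by (rule measurable_compose[OF gm borel_measurable_indicator[OF NF]])
  have "0 = (\<integral>\<^sup>+q. indicator N q \<partial>distr (P \<Otimes>\<^sub>M P) \<F>\<^sub>\<infinity> (\<lambda>q. glue n (fst q) (snd q)))"
    unfolding glue_law[OF n] using N(1) by (simp add: null_sets_def)
  also have "\<dots> = (\<integral>\<^sup>+q. indicator N (glue n (fst q) (snd q)) \<partial>(P \<Otimes>\<^sub>M P))"
    by (rule nn_integral_distr[OF gm]) (use NF in \<open>simp add: borel_measurable_indicator\<close>)
  also have "\<dots> = (\<integral>\<^sup>+\<omega>'. (\<integral>\<^sup>+\<omega>. indicator N (glue n \<omega> \<omega>') \<partial>P) \<partial>P)"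
    by (subst PP.nn_integral_snd[symmetric]) (use im in \<open>auto simp: split_beta'\<close>)
  finally have z: "(\<integral>\<^sup>+\<omega>'. (\<integral>\<^sup>+\<omega>. indicator N (glue n \<omega> \<omega>') \<partial>P) \<partial>P) = 0" by simp
  have "(\<lambda>\<omega>'. \<integral>\<^sup>+\<omega>. indicator N (glue n \<omega> \<omega>') \<partial>P) \<in> borel_measurable P"
    using borel_measurable_nn_integral_fst[OF measurable_pair_swap[OF im]] by simp
  then have "AE \<omega>' in P. (\<integral>\<^sup>+\<omega>. indicator N (glue n \<omega> \<omega>') \<partial>P) = 0" using z by (simp add: nn_integral_0_iff_AE)
  then have ae: "AE \<omega>' in P. \<omega>' \<in> \<Omega> \<and> (\<integral>\<^sup>+\<omega>. indicator N (glue n \<omega> \<omega>') \<partial>P) = 0" using AE_space by eventually_elim simp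
  have "\<exists>\<omega>'. \<omega>' \<in> \<Omega> \<and> (\<integral>\<^sup>+\<omega>. indicator N (glue n \<omega> \<omega>') \<partial>P) = 0"
  proof (rule ccontr)
    assume no: "\<not> ?thesis"
    have "AE \<omega>' in P. False" using ae by eventually_elim (use no in blast)
    then show False by simp
  qed
  then obtain \<omega>' where w': "\<omega>' \<in> \<Omega>" "(\<integral>\<^sup>+\<omega>. indicator N (glue n \<omega> \<omega>') \<partial>P) = 0" by blast
  let ?N' = "(\<lambda>\<omega>. glue n \<omega> \<omega>') -` N \<inter> space (\<F> n)"
  have N': "?N' \<in> sets (\<F> n)" by (rule measurable_sets[OF glue_measurable_fst[OF n w'(1)] NF])
  have "emeasure P ?N' = (\<integral>\<^sup>+\<omega>. indicator ?N' \<omega> \<partial>P)"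
    using N' F_sub_infty[of n] by (subst nn_integral_indicator) auto
  also have "\<dots> = (\<integral>\<^sup>+\<omega>. indicator N (glue n \<omega> \<omega>') \<partial>P)"
    by (intro nn_integral_cong) (auto simp: indicator_def)
  finally have "emeasure P ?N' = 0" using w' by simp
  moreover have "B \<subseteq> ?N'"
  proof
    fix \<omega> assume w: "\<omega> \<in> B"
    then have wO: "\<omega> \<in> \<Omega>" using N by auto
    have "glue n \<omega> \<omega>' \<in> B" by (rule sat[OF w glue_path[OF n wO w'(1)]]) (simp add: glue_def)
    then show "\<omega> \<in> ?N'" using N wO by auto
  qed
  ultimately show ?thesis using N' by blast
qed

end

text \<open>The sets that depend only on the path up to time t form a sigma-algebra containing the
  generators.\<close>

lemma F_saturated:
  assumes "A \<in> sets (\<F> t)" "\<omega> \<in> \<Omega>" "\<omega>' \<in> \<Omega>" and eq: "\<And>u. 0 \<le> u \<Longrightarrow> u \<le> t \<Longrightarrow> \<omega>' u = \<omega> u"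
  shows "\<omega>' \<in> A \<longleftrightarrow> \<omega> \<in> A"
proof -
  have "A \<in> sigma_sets \<Omega> {(\<lambda>\<omega>. \<omega> s) -` B \<inter> \<Omega> | s B. s \<in> {0..t} \<and> B \<in> sets borel}"
    using assms(1) by (simp add: coord_filt_def sets_coord_sigma)
  then show ?thesis
    by induction (use assms(2,3) eq in auto)
qed

lemma F_measurable_saturated:
  assumes "f \<in> borel_measurable (\<F> t)" "\<omega> \<in> \<Omega>" "\<omega>' \<in> \<Omega>" "\<And>u. 0 \<le> u \<Longrightarrow> u \<le> t \<Longrightarrow> \<omega>' u = \<omega> u"
  shows "f \<omega>' = (f \<omega> :: real)"
proof -
  have "f -` {f \<omega>} \<inter> space (\<F> t) \<in> sets (\<F> t)" by (rule measurable_sets[OF assms(1)]) simp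
  from F_saturated[OF this assms(2-4)] show ?thesis using assms(2,3) by auto
qed

subsection \<open>Total suprema of paths\<close>

text \<open>Integer horizons keep the supremum countable; running suprema increase, so it is also
  their limit in continuous time.\<close>

definition sup_all :: "(real \<Rightarrow> real) \<Rightarrow> ereal" where
  "sup_all y = (SUP n. ereal (sup_proc (real (Suc n)) y))"

lemma sup_proc_mono:
  assumes "continuous_on {0..t} y" "0 \<le> s" "s \<le> t"
  shows "sup_proc s y \<le> sup_proc t y"
proof -
  have "continuous_on {0..s} y" by (rule continuous_on_subset[OF assms(1)]) (use assms in auto)
  then show ?thesis using assms by (subst sup_proc_le_iff) (auto intro: sup_proc_ge)
qed

lemma sup_proc_tendsto:
  assumes y: "\<And>t. continuous_on {0..t} y"
  shows "((\<lambda>t. ereal (sup_proc t y)) \<longlongrightarrow> sup_all y) at_top"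
proof (rule order_tendstoI)
  fix a assume "a < sup_all y"
  then obtain n where n: "a < ereal (sup_proc (real (Suc n)) y)" unfolding sup_all_def less_SUP_iff by auto
  show "\<forall>\<^sub>F t in at_top. a < ereal (sup_proc t y)"
    using eventually_ge_at_top[of "real (Suc n)"]
  proof eventually_elim
    case (elim t)
    then have "sup_proc (real (Suc n)) y \<le> sup_proc t y" by (intro sup_proc_mono y) auto
    then show ?case using n less_le_trans ereal_less_eq(3) by blast
  qed
next
  fix a assume a: "sup_all y < a"
  show "\<forall>\<^sub>F t in at_top. ereal (sup_proc t y) < a"
    using eventually_ge_at_top[of "0::real"]
  proof eventually_elim
    case (elim t)
    obtain n where "t \<le> real n" using real_arch_simple by blast
    then have "sup_proc t y \<le> sup_proc (real (Suc n)) y" using elim by (intro sup_proc_mono y) auto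
    also have "ereal (sup_proc (real (Suc n)) y) \<le> sup_all y" unfolding sup_all_def by (rule SUP_upper) simp
    finally show ?case using a by (simp add: le_less_trans)
  qed
qed

lemma limit_infty_eq:
  assumes "\<omega> \<in> \<Omega>"
  shows "limit_infty sup_proc \<omega> = sup_all \<omega>" "limit_infty inf_proc \<omega> = sup_all (\<lambda>u. - \<omega> u)"
proof -
  have y: "continuous_on {0..t} \<omega>" "continuous_on {0..t} (\<lambda>u. - \<omega> u)" for t
    using path_continuous[OF assms] by (auto intro!: continuous_intros)
  show "limit_infty sup_proc \<omega> = sup_all \<omega>"
    unfolding limit_infty_def by (rule tendsto_Lim[OF _ sup_proc_tendsto[OF y(1)]]) simp
  show "limit_infty inf_proc \<omega> = sup_all (\<lambda>u. - \<omega> u)"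
    unfolding limit_infty_def inf_proc_eq by (rule tendsto_Lim[OF _ sup_proc_tendsto[OF y(2)]]) simp
qed

lemma limit_infty_measurable:
  "limit_infty sup_proc \<in> borel_measurable \<F>\<^sub>\<infinity>" "limit_infty inf_proc \<in> borel_measurable \<F>\<^sub>\<infinity>"
proof -
  have S: "sup_proc (real (Suc n)) \<in> borel_measurable \<F>\<^sub>\<infinity>" "inf_proc (real (Suc n)) \<in> borel_measurable \<F>\<^sub>\<infinity>" for n
    by (rule measurable_F_infty, rule sup_proc_measurable, simp)+
  have "(\<lambda>\<omega>. SUP n. ereal (sup_proc (real (Suc n)) \<omega>)) \<in> borel_measurable \<F>\<^sub>\<infinity>"
    "(\<lambda>\<omega>. SUP n. ereal (inf_proc (real (Suc n)) \<omega>)) \<in> borel_measurable \<F>\<^sub>\<infinity>"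
    using S by (auto intro!: borel_measurable_SUP borel_measurable_ereal)
  moreover have "limit_infty sup_proc \<in> borel_measurable \<F>\<^sub>\<infinity> \<longleftrightarrow> (\<lambda>\<omega>. SUP n. ereal (sup_proc (real (Suc n)) \<omega>)) \<in> borel_measurable \<F>\<^sub>\<infinity>"
    by (rule measurable_cong) (simp add: limit_infty_eq sup_all_def)
  moreover have "limit_infty inf_proc \<in> borel_measurable \<F>\<^sub>\<infinity> \<longleftrightarrow> (\<lambda>\<omega>. SUP n. ereal (inf_proc (real (Suc n)) \<omega>)) \<in> borel_measurable \<F>\<^sub>\<infinity>"
    by (rule measurable_cong) (simp add: limit_infty_eq sup_all_def inf_proc_eq)
  ultimately show "limit_infty sup_proc \<in> borel_measurable \<F>\<^sub>\<infinity>" "limit_infty inf_proc \<in> borel_measurable \<F>\<^sub>\<infinity>" by auto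
qed

section \<open>Behaviour of the diffusions at infinity\<close>

locale diffusion_family = wiener_local_time +
  fixes Q :: "real \<Rightarrow> real \<Rightarrow> (real \<Rightarrow> real) measure"
  assumes Q_law: "\<And>s i. s > 0 \<Longrightarrow> i > 0 \<Longrightarrow> sde_law P s i (Q s i)"
begin

lemma Q_density:
  assumes "s > 0" "i > 0" "T > 0" "\<Gamma> \<in> sets (\<F> T)"
  shows "emeasure (Q s i) \<Gamma> = (\<integral>\<^sup>+\<omega>. ennreal (Ms s i T \<omega>) * indicator \<Gamma> \<omega> \<partial>P)"
proof -
  obtain Y where "sde_solution P s i Y" "Q s i = distr P \<F>\<^sub>\<infinity> Y" using Q_law[OF assms(1,2)] unfolding sde_law_def by blast
  then show ?thesis using diffusion_density[of s i Y T \<Gamma>] assms by simp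
qed

lemma Q_prob: "s > 0 \<Longrightarrow> i > 0 \<Longrightarrow> prob_space (Q s i)"
  and Q_sets: "s > 0 \<Longrightarrow> i > 0 \<Longrightarrow> sets (Q s i) = sets \<F>\<^sub>\<infinity>"
proof -
  assume si: "s > 0" "i > 0"
  obtain Y where Y: "sde_solution P s i Y" "Q s i = distr P \<F>\<^sub>\<infinity> Y" using Q_law[OF si] unfolding sde_law_def by blast
  have "Y \<in> measurable P \<F>\<^sub>\<infinity>" using Y unfolding sde_solution_def measurable_cong_sets[OF sets_P refl] by blast
  then show "prob_space (Q s i)" "sets (Q s i) = sets \<F>\<^sub>\<infinity>" unfolding Y(2) by (auto intro: prob_space_distr)
qed

lemma Q_space: "s > 0 \<Longrightarrow> i > 0 \<Longrightarrow> space (Q s i) = \<Omega>"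
  using sets_eq_imp_space_eq[OF Q_sets] by simp

lemma Omega_in_F: "\<Omega> \<in> sets (\<F> T)"
  using sets.top[of "\<F> T"] by simp

lemma Q_Omega: "s > 0 \<Longrightarrow> i > 0 \<Longrightarrow> emeasure (Q s i) \<Omega> = 1"
  using prob_space.emeasure_space_1[OF Q_prob] Q_space by metis

lemma Ms_total:
  assumes "s > 0" "i > 0" "T > 0"
  shows "(\<integral>\<^sup>+\<omega>. ennreal (Ms s i T \<omega>) \<partial>P) = 1"
proof -
  have "(\<integral>\<^sup>+\<omega>. ennreal (Ms s i T \<omega>) \<partial>P) = (\<integral>\<^sup>+\<omega>. ennreal (Ms s i T \<omega>) * indicator \<Omega> \<omega> \<partial>P)"
    by (intro nn_integral_cong) simp
  then show ?thesis using Q_density[OF assms Omega_in_F] Q_Omega[OF assms(1,2)] by simp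
qed

lemma L_mono_AE: "AE \<omega> in P. mono_on {0..} (\<lambda>t. L t \<omega>)"
  using L unfolding local_time_zero_def by (auto elim: AE_mp)

lemma L_nonneg: "t \<ge> 0 \<Longrightarrow> AE \<omega> in P. L t \<omega> \<ge> 0"
  using L_mono_AE L_zero by eventually_elim (auto dest: mono_onD[of _ _ 0 t])

definition low :: "real \<Rightarrow> nat \<Rightarrow> (real \<Rightarrow> real) set" where
  "low K n = {\<omega> \<in> \<Omega>. L (real (Suc n)) \<omega> \<le> K}"

lemma low_in_F: "low K n \<in> sets (\<F> (real (Suc n)))"
proof -
  have [measurable]: "L (real (Suc n)) \<in> borel_measurable (\<F> (real (Suc n)))" by (rule L_measurable) simp
  have "{\<omega> \<in> space (\<F> (real (Suc n))). L (real (Suc n)) \<omega> \<le> K} \<in> sets (\<F> (real (Suc n)))" by measurable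
  then show ?thesis by (simp add: low_def)
qed

text \<open>Where L is at most K the density is bounded by the constant \<open>?c\<close>, and it
  vanishes unless the position at time T is at most s + i in absolute value. Under the Wiener
  measure the latter has probability of order 1 / sqrt T.\<close>

lemma Q_low_lim:
  assumes si: "s > 0" "i > 0" and K: "K \<ge> 0"
  shows "(\<lambda>n. emeasure (Q s i) (low K n)) \<longlonglongrightarrow> 0"
proof (rule tendsto_sandwich[OF _ _ tendsto_const])
  let ?c = "exp (1 / 2 * (1 / s + 1 / i) * K)"
  show "\<forall>\<^sub>F n in sequentially. emeasure (Q s i) (low K n) \<le> ennreal (?c * ((s + i) / sqrt (real (Suc n))))"
  proof (intro always_eventually allI)
    fix n
    let ?T = "real (Suc n)"
    have T: "?T > 0" by simp
    have m: "{\<omega> \<in> space P. \<bar>\<omega> ?T\<bar> \<le> s + i} \<in> sets P"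
    proof -
      have [measurable]: "(\<lambda>\<omega>. \<omega> ?T) \<in> borel_measurable P" by (rule coord_measurable_P) simp
      show ?thesis by measurable
    qed
    have "emeasure (Q s i) (low K n) = (\<integral>\<^sup>+\<omega>. ennreal (Ms s i ?T \<omega>) * indicator (low K n) \<omega> \<partial>P)"
      by (rule Q_density[OF si T low_in_F])
    also have "\<dots> \<le> (\<integral>\<^sup>+\<omega>. ennreal ?c * indicator {\<omega> \<in> space P. \<bar>\<omega> ?T\<bar> \<le> s + i} \<omega> \<partial>P)"
    proof (intro nn_integral_mono)
      fix \<omega> assume "\<omega> \<in> space P"
      then have w: "\<omega> \<in> \<Omega>" by simp
      show "ennreal (Ms s i ?T \<omega>) * indicator (low K n) \<omega> \<le> ennreal ?c * indicator {\<omega> \<in> space P. \<bar>\<omega> ?T\<bar> \<le> s + i} \<omega>"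
      proof (cases "\<omega> \<in> low K n \<and> sup_proc ?T \<omega> < s \<and> inf_proc ?T \<omega> < i")
        case True
        have b: "\<omega> ?T < s" "- \<omega> ?T < i" using end_bounds[OF w, of ?T] True by auto
        have f: "0 \<le> 1 - max (\<omega> ?T) 0 / s" "1 - max (\<omega> ?T) 0 / s \<le> 1" "0 \<le> 1 - max (- \<omega> ?T) 0 / i" "1 - max (- \<omega> ?T) 0 / i \<le> 1"
          using b si by auto
        have "L ?T \<omega> \<le> K" using True by (auto simp: low_def)
        then have "exp (1 / 2 * (1 / s + 1 / i) * L ?T \<omega>) \<le> ?c" using si by (simp add: mult_left_mono)
        moreover have "(1 - max (\<omega> ?T) 0 / s) * (1 - max (- \<omega> ?T) 0 / i) \<le> 1" using f by (intro mult_le_one) auto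
        ultimately have "(1 - max (\<omega> ?T) 0 / s) * (1 - max (- \<omega> ?T) 0 / i) * exp (1 / 2 * (1 / s + 1 / i) * L ?T \<omega>) \<le> 1 * ?c"
          using f by (intro mult_mono) auto
        then have "Ms s i ?T \<omega> \<le> ?c" using True by (simp add: Ms_def Mfac_def)
        moreover have "\<bar>\<omega> ?T\<bar> \<le> s + i" using b si by (simp add: abs_if)
        ultimately show ?thesis using True w by (simp add: ennreal_leI del: of_nat_Suc)
      next
        case False
        then have z: "ennreal (Ms s i ?T \<omega>) * indicator (low K n) \<omega> = 0" by (auto simp: Ms_def indicator_def)
        show ?thesis unfolding z by (rule zero_le)
      qed
    qed
    also have "\<dots> = ennreal ?c * emeasure P {\<omega> \<in> space P. \<bar>\<omega> ?T\<bar> \<le> s + i}" by (rule nn_integral_cmult_indicator[OF m])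
    also have "\<dots> \<le> ennreal ?c * ennreal ((s + i) / sqrt ?T)"
      using small_ball[OF T, of "s + i"] si by (intro mult_left_mono) auto
    also have "\<dots> = ennreal (?c * ((s + i) / sqrt ?T))" using si by (intro ennreal_mult[symmetric]) auto
    finally show "emeasure (Q s i) (low K n) \<le> ennreal (?c * ((s + i) / sqrt ?T))" .
  qed
  have "(\<lambda>n. ?c * ((s + i) / sqrt (real n))) \<longlonglongrightarrow> 0"
    by (intro tendsto_mult_right_zero real_tendsto_divide_at_top[OF tendsto_const]
        filterlim_compose[OF sqrt_at_top filterlim_real_sequentially])
  from tendsto_ennrealI[OF LIMSEQ_Suc[OF this]]
  show "(\<lambda>n. ennreal (?c * ((s + i) / sqrt (real (Suc n))))) \<longlonglongrightarrow> 0" by simp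
qed auto

text \<open>Comparison of two densities: the diffusion for \<open>(s', i')\<close> forces \<open>L\<close> to infinity, so an event on
  which the density for \<open>(s, i)\<close> is smaller by a factor \<open>exp (- \<delta> L)\<close> is null.\<close>

lemma dominated_null:
  assumes si: "s > 0" "i > 0" and si': "s' > 0" "i' > 0" and \<delta>: "\<delta> > 0" and C: "C \<ge> 0"
    and A: "\<And>n. A n \<in> sets (\<F> (real (Suc n)))"
    and dom: "\<And>n \<omega>. \<omega> \<in> A n \<Longrightarrow> \<omega> \<in> \<Omega> \<Longrightarrow> Ms s i (real (Suc n)) \<omega> \<le> C * Ms s' i' (real (Suc n)) \<omega> * exp (- \<delta> * L (real (Suc n)) \<omega>)"
    and B: "B \<in> sets \<F>\<^sub>\<infinity>" "\<And>n. B \<subseteq> A n"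
  shows "emeasure (Q s i) B = 0"
proof -
  \<comment> \<open>Split at L = K: above K the exponential is at most exp (- \<delta> K), and the
    paths with L at most K lose their mass under the diffusion for (s', i'). First n tends to
    infinity, then K.\<close>
  have 1: "emeasure (Q s i) B \<le> ennreal C * (ennreal (exp (- \<delta> * K)) + emeasure (Q s' i') (low K n))" for K n
  proof -
    let ?T = "real (Suc n)"
    let ?M = "\<lambda>\<omega>. ennreal (Ms s' i' ?T \<omega>)"
    have T: "?T > 0" "?T \<ge> 0" by simp_all
    have Mm: "?M \<in> borel_measurable P" using Ms_measurable[OF T(2)] by (intro measurable_compose[OF _ measurable_ennreal])
    have lm: "indicator (low K n) \<in> borel_measurable P"
      using low_in_F[of K n] F_sub_infty[of ?T] by (intro borel_measurable_indicator) auto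
    have "emeasure (Q s i) B \<le> emeasure (Q s i) (A n)"
      using B A[of n] F_sub_infty[of ?T] Q_sets[OF si] by (intro emeasure_mono) auto
    also have "\<dots> = (\<integral>\<^sup>+\<omega>. ennreal (Ms s i ?T \<omega>) * indicator (A n) \<omega> \<partial>P)" by (rule Q_density[OF si T(1) A])
    also have "\<dots> \<le> (\<integral>\<^sup>+\<omega>. ennreal C * (ennreal (exp (- \<delta> * K)) * ?M \<omega> + ?M \<omega> * indicator (low K n) \<omega>) \<partial>P)"
    proof (rule nn_integral_mono_AE)
      show "AE \<omega> in P. ennreal (Ms s i ?T \<omega>) * indicator (A n) \<omega>
          \<le> ennreal C * (ennreal (exp (- \<delta> * K)) * ?M \<omega> + ?M \<omega> * indicator (low K n) \<omega>)"
        using L_nonneg[OF T(2)] AE_space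
      proof eventually_elim
        case (elim \<omega>)
        then have w: "\<omega> \<in> \<Omega>" by simp
        have M0: "Ms s' i' ?T \<omega> \<ge> 0" by (rule Ms_nonneg[OF w T(2) si'])
        show ?case
        proof (cases "\<omega> \<in> A n")
          case True
          have e: "exp (- \<delta> * L ?T \<omega>) \<le> exp (- \<delta> * K) + indicator (low K n) \<omega>"
          proof (cases "L ?T \<omega> \<le> K")
            case True
            have "exp (- \<delta> * L ?T \<omega>) \<le> 1" using \<delta> elim(1) by (auto simp: mult_nonneg_nonneg less_imp_le)
            then show ?thesis using True w by (auto simp: low_def intro: order_trans[of _ 1])
          next
            case False
            then have "- \<delta> * L ?T \<omega> \<le> - \<delta> * K" using \<delta> by simp
            then show ?thesis by (simp add: add_increasing2 del: of_nat_Suc)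
          qed
          have "Ms s i ?T \<omega> \<le> C * Ms s' i' ?T \<omega> * exp (- \<delta> * L ?T \<omega>)" by (rule dom[OF True w])
          also have "\<dots> \<le> C * Ms s' i' ?T \<omega> * (exp (- \<delta> * K) + indicator (low K n) \<omega>)"
            using C M0 by (intro mult_left_mono e) auto
          also have "\<dots> = C * (exp (- \<delta> * K) * Ms s' i' ?T \<omega> + Ms s' i' ?T \<omega> * indicator (low K n) \<omega>)"
            by (simp add: algebra_simps)
          finally have "ennreal (Ms s i ?T \<omega>) \<le> ennreal (C * (exp (- \<delta> * K) * Ms s' i' ?T \<omega> + Ms s' i' ?T \<omega> * indicator (low K n) \<omega>))"
            by (rule ennreal_leI)
          also have "\<dots> = ennreal C * (ennreal (exp (- \<delta> * K)) * ?M \<omega> + ?M \<omega> * indicator (low K n) \<omega>)"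
            using C M0 by (simp add: ennreal_mult ennreal_plus ennreal_indicator del: of_nat_Suc)
          finally show ?thesis using True by simp
        qed simp
      qed
    qed
    also have "\<dots> = ennreal C * (ennreal (exp (- \<delta> * K)) * (\<integral>\<^sup>+\<omega>. ?M \<omega> \<partial>P) + (\<integral>\<^sup>+\<omega>. ?M \<omega> * indicator (low K n) \<omega> \<partial>P))"
    proof -
      have m1: "(\<lambda>\<omega>. ennreal (exp (- \<delta> * K)) * ?M \<omega>) \<in> borel_measurable P"
        by (intro borel_measurable_times_ennreal borel_measurable_const Mm)
      have m2: "(\<lambda>\<omega>. ?M \<omega> * indicator (low K n) \<omega>) \<in> borel_measurable P"
        by (intro borel_measurable_times_ennreal Mm lm)
      show ?thesis
        by (subst nn_integral_cmult[OF borel_measurable_add[OF m1 m2]], subst nn_integral_add[OF m1 m2], subst nn_integral_cmult[OF Mm]) simp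
    qed
    also have "(\<integral>\<^sup>+\<omega>. ?M \<omega> \<partial>P) = 1" by (rule Ms_total[OF si' T(1)])
    also have "(\<integral>\<^sup>+\<omega>. ?M \<omega> * indicator (low K n) \<omega> \<partial>P) = emeasure (Q s' i') (low K n)"
      by (rule Q_density[OF si' T(1) low_in_F, symmetric])
    finally show ?thesis by simp
  qed
  have 2: "emeasure (Q s i) B \<le> ennreal (C * exp (- \<delta> * K))" if K: "K \<ge> 0" for K
  proof -
    have "(\<lambda>n. ennreal C * (ennreal (exp (- \<delta> * K)) + emeasure (Q s' i') (low K n))) \<longlonglongrightarrow> ennreal C * (ennreal (exp (- \<delta> * K)) + 0)"
      by (intro ennreal_tendsto_cmult tendsto_add tendsto_const Q_low_lim si' K) (simp add: less_top[symmetric])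
    from LIMSEQ_le_const[OF this] have "emeasure (Q s i) B \<le> ennreal C * (ennreal (exp (- \<delta> * K)) + 0)"
      using 1[of K] by blast
    then show ?thesis using C by (simp add: ennreal_mult)
  qed
  have "(\<lambda>k. ennreal (C * exp (- \<delta> * real k))) \<longlonglongrightarrow> ennreal (C * 0)"
  proof (intro tendsto_ennrealI tendsto_mult tendsto_const)
    have "filterlim (\<lambda>k. \<delta> * real k) at_top sequentially"
      by (rule filterlim_tendsto_pos_mult_at_top[OF tendsto_const \<delta> filterlim_real_sequentially])
    then have "filterlim (\<lambda>k. - (\<delta> * real k)) at_bot sequentially" by (simp add: filterlim_uminus_at_bot)
    from filterlim_compose[OF exp_at_bot this] show "(\<lambda>k. exp (- \<delta> * real k)) \<longlonglongrightarrow> 0" by simp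
  qed
  from LIMSEQ_le_const[OF this] have "emeasure (Q s i) B \<le> ennreal (C * 0)" using 2 by auto
  then show ?thesis by simp
qed

lemma sup_in_F:
  "{\<omega> \<in> \<Omega>. sup_proc (real (Suc n)) \<omega> \<le> a} \<in> sets (\<F> (real (Suc n)))"
  "{\<omega> \<in> \<Omega>. inf_proc (real (Suc n)) \<omega> \<le> a} \<in> sets (\<F> (real (Suc n)))"
  "{\<omega> \<in> \<Omega>. a \<le> sup_proc (real (Suc n)) \<omega>} \<in> sets (\<F> (real (Suc n)))"
  "{\<omega> \<in> \<Omega>. a \<le> inf_proc (real (Suc n)) \<omega>} \<in> sets (\<F> (real (Suc n)))"
proof -
  have [measurable]: "sup_proc (real (Suc n)) \<in> borel_measurable (\<F> (real (Suc n)))" "inf_proc (real (Suc n)) \<in> borel_measurable (\<F> (real (Suc n)))"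
    by (rule sup_proc_measurable, simp)+
  have "{\<omega> \<in> space (\<F> (real (Suc n))). sup_proc (real (Suc n)) \<omega> \<le> a} \<in> sets (\<F> (real (Suc n)))"
    "{\<omega> \<in> space (\<F> (real (Suc n))). inf_proc (real (Suc n)) \<omega> \<le> a} \<in> sets (\<F> (real (Suc n)))"
    "{\<omega> \<in> space (\<F> (real (Suc n))). a \<le> sup_proc (real (Suc n)) \<omega>} \<in> sets (\<F> (real (Suc n)))"
    "{\<omega> \<in> space (\<F> (real (Suc n))). a \<le> inf_proc (real (Suc n)) \<omega>} \<in> sets (\<F> (real (Suc n)))"
    by measurable
  then show "{\<omega> \<in> \<Omega>. sup_proc (real (Suc n)) \<omega> \<le> a} \<in> sets (\<F> (real (Suc n)))"
    "{\<omega> \<in> \<Omega>. inf_proc (real (Suc n)) \<omega> \<le> a} \<in> sets (\<F> (real (Suc n)))"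
    "{\<omega> \<in> \<Omega>. a \<le> sup_proc (real (Suc n)) \<omega>} \<in> sets (\<F> (real (Suc n)))"
    "{\<omega> \<in> \<Omega>. a \<le> inf_proc (real (Suc n)) \<omega>} \<in> sets (\<F> (real (Suc n)))"
    by (simp_all only: space_F)
qed

lemma all_in_F_infty:
  assumes "\<And>n. {\<omega> \<in> \<Omega>. R n \<omega>} \<in> sets (\<F> (real (Suc n)))"
  shows "{\<omega> \<in> \<Omega>. \<forall>n. R n \<omega>} \<in> sets \<F>\<^sub>\<infinity>"
proof -
  have "{\<omega> \<in> space \<F>\<^sub>\<infinity>. \<forall>n. R n \<omega>} \<in> sets \<F>\<^sub>\<infinity>"
    by (rule sets.sets_Collect_countable_All) (use assms F_sub_infty in auto)
  then show ?thesis by simp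
qed

lemma exponent_split: "1 / 2 * (p + r) * l = 1 / 2 * (q + r) * l + - ((q - p) / 2) * l" for p q r l :: real
  by (simp add: field_simps)

lemma exponent_split': "1 / 2 * (r + p) * l = 1 / 2 * (r + q) * l + - ((q - p) / 2) * l" for p q r l :: real
  by (simp add: field_simps)

text \<open>The comparison is with an endpoint b strictly between a and s. On paths staying below a
  the factor 1 - x / b is at least 1 - a / b > 0, so the affine factors are comparable, while the
  exponents differ by (1 / b - 1 / s) L / 2 in favour of b.\<close>

lemma Q_sup_low:
  assumes si: "s > 0" "i > 0" and a: "0 < a" "a < s"
  shows "emeasure (Q s i) {\<omega> \<in> \<Omega>. \<forall>n. sup_proc (real (Suc n)) \<omega> \<le> a} = 0"
proof -
  define b where "b = (a + s) / 2"
  have b: "0 < b" "a < b" "b < s" using a by (auto simp: b_def)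
  show ?thesis
  proof (rule dominated_null[where A = "\<lambda>n. {\<omega> \<in> \<Omega>. sup_proc (real (Suc n)) \<omega> \<le> a}" and C = "1 / (1 - a / b)"
        and \<delta> = "(1 / b - 1 / s) / 2", OF si b(1) si(2) _ _ sup_in_F(1)])
    show "(1 / b - 1 / s) / 2 > 0" using b by (simp add: frac_less2)
    show "1 / (1 - a / b) \<ge> 0" using b by simp
    show "{\<omega> \<in> \<Omega>. \<forall>n. sup_proc (real (Suc n)) \<omega> \<le> a} \<in> sets \<F>\<^sub>\<infinity>" by (rule all_in_F_infty[OF sup_in_F(1)])
    fix n \<omega> assume w: "\<omega> \<in> {\<omega> \<in> \<Omega>. sup_proc (real (Suc n)) \<omega> \<le> a}" "\<omega> \<in> \<Omega>"
    let ?T = "real (Suc n)"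
    have S: "sup_proc ?T \<omega> \<le> a" using w by auto
    show "Ms s i ?T \<omega> \<le> 1 / (1 - a / b) * Ms b i ?T \<omega> * exp (- ((1 / b - 1 / s) / 2) * L ?T \<omega>)"
    proof (cases "inf_proc ?T \<omega> < i")
      case True
      have x: "\<omega> ?T \<le> a" "- \<omega> ?T < i" using end_bounds[OF w(2), of ?T] S True by auto
      let ?x = "max (\<omega> ?T) 0" and ?v = "1 - max (- \<omega> ?T) 0 / i"
      have v: "?v \<ge> 0" using x si by auto
      have "1 - a / b \<le> 1 - ?x / b" using x a b by (auto intro!: divide_right_mono)
      moreover have "1 - a / b > 0" using b by simp
      ultimately have "1 \<le> 1 / (1 - a / b) * (1 - ?x / b)" by (simp add: pos_le_divide_eq)
      moreover have "1 - ?x / s \<le> 1" using si by simp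
      ultimately have u: "1 - ?x / s \<le> 1 / (1 - a / b) * (1 - ?x / b)" by linarith
      have e: "exp (1 / 2 * (1 / s + 1 / i) * L ?T \<omega>) = exp (1 / 2 * (1 / b + 1 / i) * L ?T \<omega>) * exp (- ((1 / b - 1 / s) / 2) * L ?T \<omega>)"
        unfolding exp_add[symmetric] by (rule arg_cong[where f = exp], rule exponent_split)
      have "(1 - ?x / s) * (?v * exp (1 / 2 * (1 / s + 1 / i) * L ?T \<omega>)) \<le> 1 / (1 - a / b) * (1 - ?x / b) * (?v * exp (1 / 2 * (1 / s + 1 / i) * L ?T \<omega>))"
        by (rule mult_right_mono[OF u]) (use v in simp)
      moreover have "Ms s i ?T \<omega> = (1 - ?x / s) * (?v * exp (1 / 2 * (1 / s + 1 / i) * L ?T \<omega>))"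
        using S True a unfolding Ms_def Mfac_def by (simp add: mult_ac)
      moreover have "Ms b i ?T \<omega> = (1 - ?x / b) * (?v * exp (1 / 2 * (1 / b + 1 / i) * L ?T \<omega>))"
        using S True b unfolding Ms_def Mfac_def by (simp add: mult_ac)
      ultimately show ?thesis unfolding e by (simp only: mult_ac)
    qed (simp add: Ms_def)
  qed auto
qed

lemma Q_inf_low:
  assumes si: "s > 0" "i > 0" and a: "0 < a" "a < i"
  shows "emeasure (Q s i) {\<omega> \<in> \<Omega>. \<forall>n. inf_proc (real (Suc n)) \<omega> \<le> a} = 0"
proof -
  define b where "b = (a + i) / 2"
  have b: "0 < b" "a < b" "b < i" using a by (auto simp: b_def)
  show ?thesis
  proof (rule dominated_null[where A = "\<lambda>n. {\<omega> \<in> \<Omega>. inf_proc (real (Suc n)) \<omega> \<le> a}" and C = "1 / (1 - a / b)"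
        and \<delta> = "(1 / b - 1 / i) / 2", OF si si(1) b(1) _ _ sup_in_F(2)])
    show "(1 / b - 1 / i) / 2 > 0" using b by (simp add: frac_less2)
    show "1 / (1 - a / b) \<ge> 0" using b by simp
    show "{\<omega> \<in> \<Omega>. \<forall>n. inf_proc (real (Suc n)) \<omega> \<le> a} \<in> sets \<F>\<^sub>\<infinity>" by (rule all_in_F_infty[OF sup_in_F(2)])
    fix n \<omega> assume w: "\<omega> \<in> {\<omega> \<in> \<Omega>. inf_proc (real (Suc n)) \<omega> \<le> a}" "\<omega> \<in> \<Omega>"
    let ?T = "real (Suc n)"
    have S: "inf_proc ?T \<omega> \<le> a" using w by auto
    show "Ms s i ?T \<omega> \<le> 1 / (1 - a / b) * Ms s b ?T \<omega> * exp (- ((1 / b - 1 / i) / 2) * L ?T \<omega>)"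
    proof (cases "sup_proc ?T \<omega> < s")
      case True
      have x: "- \<omega> ?T \<le> a" "\<omega> ?T < s" using end_bounds[OF w(2), of ?T] S True by auto
      let ?x = "max (- \<omega> ?T) 0" and ?v = "1 - max (\<omega> ?T) 0 / s"
      have v: "?v \<ge> 0" using x si by auto
      have "1 - a / b \<le> 1 - ?x / b" using x a b by (auto intro!: divide_right_mono)
      moreover have "1 - a / b > 0" using b by simp
      ultimately have "1 \<le> 1 / (1 - a / b) * (1 - ?x / b)" by (simp add: pos_le_divide_eq)
      moreover have "1 - ?x / i \<le> 1" using si by simp
      ultimately have u: "1 - ?x / i \<le> 1 / (1 - a / b) * (1 - ?x / b)" by linarith
      have e: "exp (1 / 2 * (1 / s + 1 / i) * L ?T \<omega>) = exp (1 / 2 * (1 / s + 1 / b) * L ?T \<omega>) * exp (- ((1 / b - 1 / i) / 2) * L ?T \<omega>)"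
        unfolding exp_add[symmetric] by (rule arg_cong[where f = exp], rule exponent_split')
      have "(1 - ?x / i) * (?v * exp (1 / 2 * (1 / s + 1 / i) * L ?T \<omega>)) \<le> 1 / (1 - a / b) * (1 - ?x / b) * (?v * exp (1 / 2 * (1 / s + 1 / i) * L ?T \<omega>))"
        by (rule mult_right_mono[OF u]) (use v in simp)
      moreover have "Ms s i ?T \<omega> = (1 - ?x / i) * (?v * exp (1 / 2 * (1 / s + 1 / i) * L ?T \<omega>))"
        using S True a unfolding Ms_def Mfac_def by (simp add: mult_ac)
      moreover have "Ms s b ?T \<omega> = (1 - ?x / b) * (?v * exp (1 / 2 * (1 / s + 1 / b) * L ?T \<omega>))"
        using S True b unfolding Ms_def Mfac_def by (simp add: mult_ac)
      ultimately show ?thesis unfolding e by (simp only: mult_ac)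
    qed (simp add: Ms_def)
  qed auto
qed

text \<open>The strict inequalities in \<open>Ms\<close> make the density vanish on these
  events.\<close>

lemma Q_high:
  assumes si: "s > 0" "i > 0"
  shows "emeasure (Q s i) {\<omega> \<in> \<Omega>. s \<le> sup_proc (real (Suc n)) \<omega>} = 0"
    "emeasure (Q s i) {\<omega> \<in> \<Omega>. i \<le> inf_proc (real (Suc n)) \<omega>} = 0"
proof -
  have T: "real (Suc n) > 0" by simp
  have z: "(\<integral>\<^sup>+\<omega>. ennreal (Ms s i (real (Suc n)) \<omega>) * indicator {\<omega> \<in> \<Omega>. R \<omega>} \<omega> \<partial>P) = 0"
    if "\<And>\<omega>. R \<omega> \<Longrightarrow> Ms s i (real (Suc n)) \<omega> = 0" for R
  proof -
    have "ennreal (Ms s i (real (Suc n)) \<omega>) * indicator {\<omega> \<in> \<Omega>. R \<omega>} \<omega> = 0" for \<omega>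
      using that by (auto simp: indicator_def simp del: of_nat_Suc)
    then have "(\<integral>\<^sup>+\<omega>. ennreal (Ms s i (real (Suc n)) \<omega>) * indicator {\<omega> \<in> \<Omega>. R \<omega>} \<omega> \<partial>P) = (\<integral>\<^sup>+\<omega>. 0 \<partial>P)"
      by (intro nn_integral_cong)
    then show ?thesis by (simp only: nn_integral_const mult_zero_left)
  qed
  show "emeasure (Q s i) {\<omega> \<in> \<Omega>. s \<le> sup_proc (real (Suc n)) \<omega>} = 0"
    unfolding Q_density[OF si T sup_in_F(3)] by (rule z) (simp add: Ms_def)
  show "emeasure (Q s i) {\<omega> \<in> \<Omega>. i \<le> inf_proc (real (Suc n)) \<omega>} = 0"
    unfolding Q_density[OF si T sup_in_F(4)] by (rule z) (simp add: Ms_def)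
qed

lemma Q_AE_not:
  assumes si: "s > 0" "i > 0" and "emeasure (Q s i) {\<omega> \<in> \<Omega>. R \<omega>} = 0" "{\<omega> \<in> \<Omega>. R \<omega>} \<in> sets \<F>\<^sub>\<infinity>"
  shows "AE \<omega> in Q s i. \<not> R \<omega>"
proof (rule AE_I)
  show "{\<omega> \<in> space (Q s i). \<not> \<not> R \<omega>} \<subseteq> {\<omega> \<in> \<Omega>. R \<omega>}" using Q_space[OF si] by auto
qed (use assms Q_sets[OF si] in auto)

lemma SUP_eq_of_approx:
  fixes f :: "nat \<Rightarrow> real"
  assumes s: "s > 0" and up: "\<And>n. f n < s" and lo: "\<And>j. \<exists>n. f n > s * (1 - 1 / real (j + 2))"
  shows "(SUP n. ereal (f n)) = ereal s"
proof (rule antisym)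
  show "(SUP n. ereal (f n)) \<le> ereal s" using up by (intro SUP_least) (auto intro: less_imp_le)
  have lim: "(\<lambda>j. ereal (s * (1 - 1 / real (j + 2)))) \<longlonglongrightarrow> ereal (s * (1 - 0))"
    by (intro tendsto_ereal tendsto_mult tendsto_diff tendsto_const LIMSEQ_ignore_initial_segment[OF lim_const_over_n])
  show "ereal s \<le> (SUP n. ereal (f n))"
  proof (rule LIMSEQ_le_const2[of _ "ereal s"])
    show "(\<lambda>j. ereal (s * (1 - 1 / real (j + 2)))) \<longlonglongrightarrow> ereal s" using lim by simp
    have "ereal (s * (1 - 1 / real (j + 2))) \<le> (SUP n. ereal (f n))" for j
    proof -
      obtain n where "f n > s * (1 - 1 / real (j + 2))" using lo by blast
      then have "ereal (s * (1 - 1 / real (j + 2))) \<le> ereal (f n)" by simp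
      also have "\<dots> \<le> (SUP n. ereal (f n))" by (rule SUP_upper) simp
      finally show ?thesis .
    qed
    then show "\<exists>N. \<forall>j\<ge>N. ereal (s * (1 - 1 / real (j + 2))) \<le> (SUP n. ereal (f n))" by blast
  qed
qed

lemma Q_limits:
  assumes si: "s > 0" "i > 0"
  shows "AE \<omega> in Q s i. limit_infty sup_proc \<omega> = ereal s \<and> limit_infty inf_proc \<omega> = ereal i"
proof -
  \<comment> \<open>The levels c (1 - 1 / (j + 2)) increase to c and lie strictly between 0 and c,
    already for j = 0, as \<open>Q_sup_low\<close> and \<open>Q_inf_low\<close> require.\<close>
  have fr: "0 < c * (1 - 1 / real (j + 2))" "c * (1 - 1 / real (j + 2)) < c" if "c > 0" for c j
  proof -
    have "0 < 1 / real (j + 2)" "1 / real (j + 2) < 1" by auto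
    then have "0 < 1 - 1 / real (j + 2)" "1 - 1 / real (j + 2) < 1" by linarith+
    then show "0 < c * (1 - 1 / real (j + 2))" "c * (1 - 1 / real (j + 2)) < c"
      using that mult_strict_left_mono[of "1 - 1 / real (j + 2)" 1 c] by auto
  qed
  have in1: "{\<omega> \<in> \<Omega>. s \<le> sup_proc (real (Suc n)) \<omega>} \<in> sets \<F>\<^sub>\<infinity>" "{\<omega> \<in> \<Omega>. i \<le> inf_proc (real (Suc n)) \<omega>} \<in> sets \<F>\<^sub>\<infinity>" for n
    using sup_in_F(3)[of s n] sup_in_F(4)[of i n] F_sub_infty by blast+
  have "AE \<omega> in Q s i. \<forall>n. \<not> s \<le> sup_proc (real (Suc n)) \<omega>"
    unfolding AE_all_countable by (intro allI Q_AE_not si Q_high in1)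
  moreover have "AE \<omega> in Q s i. \<forall>n. \<not> i \<le> inf_proc (real (Suc n)) \<omega>"
    unfolding AE_all_countable by (intro allI Q_AE_not si Q_high in1)
  moreover have "AE \<omega> in Q s i. \<forall>j. \<not> (\<forall>n. sup_proc (real (Suc n)) \<omega> \<le> s * (1 - 1 / real (j + 2)))"
    unfolding AE_all_countable by (intro allI Q_AE_not si Q_sup_low all_in_F_infty sup_in_F fr)
  moreover have "AE \<omega> in Q s i. \<forall>j. \<not> (\<forall>n. inf_proc (real (Suc n)) \<omega> \<le> i * (1 - 1 / real (j + 2)))"
    unfolding AE_all_countable by (intro allI Q_AE_not si Q_inf_low all_in_F_infty sup_in_F fr)
  ultimately show ?thesis using AE_space
  proof eventually_elim
    case (elim \<omega>)
    have w: "\<omega> \<in> \<Omega>" using elim(5) Q_space[OF si] by simp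
    have "sup_all \<omega> = ereal s"
      unfolding sup_all_def by (rule SUP_eq_of_approx[OF si(1)]) (use elim(1,3) in \<open>auto simp: not_le\<close>)
    moreover have "sup_all (\<lambda>u. - \<omega> u) = ereal i"
      unfolding sup_all_def inf_proc_eq[symmetric] by (rule SUP_eq_of_approx[OF si(2)]) (use elim(2,4) in \<open>auto simp: not_le\<close>)
    ultimately show ?case by (simp add: limit_infty_eq[OF w])
  qed
qed

lemma Q_L_bounded: 
  assumes si: "s > 0" "i > 0"
  shows "emeasure (Q s i) {\<omega> \<in> \<Omega>. \<forall>n. L (real (Suc n)) \<omega> \<le> real k} = 0"
proof -
  have m: "{\<omega> \<in> \<Omega>. \<forall>n. L (real (Suc n)) \<omega> \<le> real k} \<in> sets \<F>\<^sub>\<infinity>"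
    by (rule all_in_F_infty[OF low_in_F[unfolded low_def]])
  have "emeasure (Q s i) {\<omega> \<in> \<Omega>. \<forall>n. L (real (Suc n)) \<omega> \<le> real k} \<le> emeasure (Q s i) (low (real k) n)" for n
    using low_in_F[of "real k" n] F_sub_infty[of "real (Suc n)"] Q_sets[OF si] by (intro emeasure_mono) (auto simp: low_def)
  then have "emeasure (Q s i) {\<omega> \<in> \<Omega>. \<forall>n. L (real (Suc n)) \<omega> \<le> real k} \<le> 0"
    using LIMSEQ_le_const[OF Q_low_lim[OF si, of "real k"]] by auto
  then show ?thesis by simp
qed

lemma L_bounded_in_F: "{\<omega> \<in> \<Omega>. \<forall>n. L (real (Suc n)) \<omega> \<le> real k} \<in> sets \<F>\<^sub>\<infinity>"
  by (rule all_in_F_infty[OF low_in_F[unfolded low_def]])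

text \<open>Monotonicity of L is known almost surely under \<open>P\<close>, but the mixture has a
  density with respect to \<open>P\<close> only on each \<open>\<F> n\<close>. Since L is adapted,
  failure on [0, n] depends on the path up to time n alone, and \<open>saturated_null\<close> places
  it in a null set of \<open>\<F> n\<close>.\<close>

lemma L_not_mono_null:
  "\<exists>N\<in>sets (\<F> (real n)). emeasure P N = 0 \<and> {\<omega> \<in> \<Omega>. \<not> mono_on {0..real n} (\<lambda>t. L t \<omega>)} \<subseteq> N"
proof -
  obtain N where N: "{\<omega> \<in> space P. \<not> mono_on {0..} (\<lambda>t. L t \<omega>)} \<subseteq> N" "N \<in> null_sets P"
    using L_mono_AE unfolding eventually_ae_filter by auto
  show ?thesis
  proof (rule saturated_null[OF _ N(2)])
    have "{\<omega> \<in> \<Omega>. \<not> mono_on {0..real n} (\<lambda>t. L t \<omega>)} \<subseteq> {\<omega> \<in> space P. \<not> mono_on {0..} (\<lambda>t. L t \<omega>)}"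
      by (auto intro: mono_on_subset)
    then show "{\<omega> \<in> \<Omega>. \<not> mono_on {0..real n} (\<lambda>t. L t \<omega>)} \<subseteq> N" using N(1) by (rule subset_trans)
    fix \<omega> \<omega>' assume w: "\<omega> \<in> {\<omega> \<in> \<Omega>. \<not> mono_on {0..real n} (\<lambda>t. L t \<omega>)}" "\<omega>' \<in> \<Omega>" and eq: "\<And>u. 0 \<le> u \<Longrightarrow> u \<le> real n \<Longrightarrow> \<omega>' u = \<omega> u"
    have "L t \<omega>' = L t \<omega>" if "t \<in> {0..real n}" for t
      by (rule F_measurable_saturated[OF L_measurable]) (use that w eq in auto)
    then have "mono_on {0..real n} (\<lambda>t. L t \<omega>') \<longleftrightarrow> mono_on {0..real n} (\<lambda>t. L t \<omega>)"
      unfolding mono_on_def by auto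
    then show "\<omega>' \<in> {\<omega> \<in> \<Omega>. \<not> mono_on {0..real n} (\<lambda>t. L t \<omega>)}" using w by auto
  qed auto
qed

end

lemma nn_integral_eq_imp_AE_eq:
  assumes [measurable]: "f \<in> borel_measurable M" "g \<in> borel_measurable M"
    and le: "AE x in M. f x \<le> g x" and eq: "(\<integral>\<^sup>+x. f x \<partial>M) = (\<integral>\<^sup>+x. g x \<partial>M)" and fin: "(\<integral>\<^sup>+x. f x \<partial>M) \<noteq> \<infinity>"
  shows "AE x in M. f x = g x"
proof -
  have "(\<integral>\<^sup>+x. g x - f x \<partial>M) = (\<integral>\<^sup>+x. g x \<partial>M) - (\<integral>\<^sup>+x. f x \<partial>M)"
    by (rule nn_integral_diff) (use le fin in auto)
  also have "\<dots> = 0" using eq fin by simp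
  finally have "AE x in M. g x - f x = 0" by (subst (asm) nn_integral_0_iff_AE) auto
  then show ?thesis using le by eventually_elim (auto simp: diff_eq_0_iff_ennreal intro: antisym)
qed

section \<open>The mixture of the diffusion laws\<close>

locale mixture = diffusion_family +
  fixes \<alpha> :: real and \<nu> :: "(real \<times> real) measure" and Q\<nu> :: "(real \<Rightarrow> real) measure"
  assumes alpha: "\<alpha> > 0" and nu: "prob_space \<nu>" "sets \<nu> = sets borel" "emeasure \<nu> ({\<alpha>..} \<times> {\<alpha>..}) = 1"
    and Qnu: "prob_space Q\<nu>" "sets Q\<nu> = sets \<F>\<^sub>\<infinity>"
      "\<And>t \<Gamma>. t \<ge> 0 \<Longrightarrow> \<Gamma> \<in> sets (\<F> t) \<Longrightarrow>
         measure Q\<nu> \<Gamma> = (LINT \<omega>|P. indicator \<Gamma> \<omega> * M_proc \<nu> L t \<omega>)"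
begin

sublocale N: prob_space \<nu> by (rule nu(1))
sublocale QN: prob_space Q\<nu> by (rule Qnu(1))
sublocale NP: pair_sigma_finite \<nu> P by unfold_locales

text \<open>The integrand of \<open>M_proc\<close>. Its constraints are closed, so it dominates
  \<open>Ms\<close> for positive parameters.\<close>

definition W :: "real \<Rightarrow> real \<times> real \<Rightarrow> (real \<Rightarrow> real) \<Rightarrow> real" where
  "W T p \<omega> = Mfac (fst p) (snd p) T \<omega> * of_bool (sup_proc T \<omega> \<le> fst p \<and> inf_proc T \<omega> \<le> snd p)"

lemma space_Qnu: "space Q\<nu> = \<Omega>"
  using sets_eq_imp_space_eq[OF Qnu(2)] by simp

lemma space_nu: "space \<nu> = UNIV"
  using sets_eq_imp_space_eq[OF nu(2)] by simp

lemma AE_alpha: "AE p in \<nu>. \<alpha> \<le> fst p \<and> \<alpha> \<le> snd p"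
proof -
  have m: "{\<alpha>..} \<times> {\<alpha>..} \<in> sets \<nu>" unfolding nu(2) by (intro borel_closed closed_Times) auto
  have "N.prob ({\<alpha>..} \<times> {\<alpha>..}) = 1" using nu(3) by (simp add: N.emeasure_eq_measure)
  then have "AE p in \<nu>. p \<in> {\<alpha>..} \<times> {\<alpha>..}" by (subst N.AE_in_set_eq_1[OF m])
  then show ?thesis by eventually_elim auto
qed

lemma W_nonneg: "\<omega> \<in> \<Omega> \<Longrightarrow> T \<ge> 0 \<Longrightarrow> 0 < fst p \<Longrightarrow> 0 < snd p \<Longrightarrow> W T p \<omega> \<ge> 0"
  using Mfac_nonneg[of \<omega> T "fst p" "snd p"] by (auto simp: W_def)

lemma sets_nuP: "sets (\<nu> \<Otimes>\<^sub>M P) = sets (borel \<Otimes>\<^sub>M P)"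
  by (rule sets_pair_measure_cong) (simp_all add: nu)

lemma W_pair_measurable:
  assumes "T \<ge> 0"
  shows "(\<lambda>q. W T (fst q) (snd q)) \<in> borel_measurable (\<nu> \<Otimes>\<^sub>M P)"
    and "(\<lambda>q. Ms (fst (fst q)) (snd (fst q)) T (snd q)) \<in> borel_measurable (\<nu> \<Otimes>\<^sub>M P)"
  using Ms_measurable_pair[OF assms] unfolding W_def measurable_cong_sets[OF sets_nuP refl] by auto

lemma W_measurable:
  assumes "T \<ge> 0"
  shows "\<omega> \<in> \<Omega> \<Longrightarrow> (\<lambda>p. W T p \<omega>) \<in> borel_measurable \<nu>" and "W T p \<in> borel_measurable P"
proof -
  show "(\<lambda>p. W T p \<omega>) \<in> borel_measurable \<nu>" if "\<omega> \<in> \<Omega>"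
  proof -
    have "(\<lambda>p. (p, \<omega>)) \<in> measurable \<nu> (\<nu> \<Otimes>\<^sub>M P)" by (rule measurable_Pair2') (use that in simp)
    from measurable_compose[OF this W_pair_measurable(1)[OF assms]] show ?thesis by simp
  qed
  have "Pair p \<in> measurable P (\<nu> \<Otimes>\<^sub>M P)" by (rule measurable_Pair1') (simp add: space_nu)
  from measurable_compose[OF this W_pair_measurable(1)[OF assms]] show "W T p \<in> borel_measurable P" by simp
qed

text \<open>Both parameters are at least \<alpha> almost surely, so for each path the integrand is
  bounded by exp (|L| / \<alpha>) and the Bochner integral is a genuine one. The constraints on the
  suprema bound the final position and make the affine factors nonnegative.\<close>

lemma M_proc_eq:
  assumes w: "\<omega> \<in> \<Omega>" and T: "T \<ge> 0"
  shows "M_proc \<nu> L T \<omega> \<ge> 0" "ennreal (M_proc \<nu> L T \<omega>) = (\<integral>\<^sup>+p. ennreal (W T p \<omega>) \<partial>\<nu>)"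
proof -
  let ?f = "\<lambda>p. indicator ({0..} \<times> {0..}) p *\<^sub>R W T p \<omega>"
  have M: "M_proc \<nu> L T \<omega> = (\<integral>p. ?f p \<partial>\<nu>)"
    unfolding M_proc_def set_lebesgue_integral_def W_def Mfac_def by (simp add: split_beta')
  have ind: "AE p in \<nu>. ?f p = W T p \<omega>"
    using AE_alpha by eventually_elim (use alpha in \<open>auto simp: indicator_def mem_Times_iff\<close>)
  have nn: "AE p in \<nu>. 0 \<le> ?f p"
    using AE_alpha by eventually_elim (use alpha in \<open>auto intro!: mult_nonneg_nonneg W_nonneg[OF w T]\<close>)
  have fm: "?f \<in> borel_measurable \<nu>"
    by (intro borel_measurable_scaleR borel_measurable_indicator W_measurable(1)[OF T w])
      (simp add: nu borel_closed closed_Times)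
  have bd: "AE p in \<nu>. norm (?f p) \<le> exp (1 / \<alpha> * \<bar>L T \<omega>\<bar>)"
    using AE_alpha ind
  proof eventually_elim
    case (elim p)
    have p: "0 < fst p" "0 < snd p" using elim(1) alpha by auto
    show ?case
    proof (cases "sup_proc T \<omega> \<le> fst p \<and> inf_proc T \<omega> \<le> snd p")
      case True
      have b: "\<omega> T \<le> fst p" "- \<omega> T \<le> snd p" using end_bounds[OF w T] True by auto
      have f: "0 \<le> 1 - max (\<omega> T) 0 / fst p" "1 - max (\<omega> T) 0 / fst p \<le> 1"
        "0 \<le> 1 - max (- \<omega> T) 0 / snd p" "1 - max (- \<omega> T) 0 / snd p \<le> 1"
        using b p by auto
      have k: "0 \<le> 1 / 2 * (1 / fst p + 1 / snd p)" "1 / 2 * (1 / fst p + 1 / snd p) \<le> 1 / \<alpha>"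
        using elim(1) alpha p divide_left_mono[of \<alpha> "fst p" 1] divide_left_mono[of \<alpha> "snd p" 1] by auto
      have "1 / 2 * (1 / fst p + 1 / snd p) * L T \<omega> \<le> 1 / 2 * (1 / fst p + 1 / snd p) * \<bar>L T \<omega>\<bar>"
        using k by (intro mult_left_mono) auto
      also have "\<dots> \<le> 1 / \<alpha> * \<bar>L T \<omega>\<bar>" by (rule mult_right_mono[OF k(2)]) simp
      finally have "exp (1 / 2 * (1 / fst p + 1 / snd p) * L T \<omega>) \<le> exp (1 / \<alpha> * \<bar>L T \<omega>\<bar>)" by simp
      moreover have "(1 - max (\<omega> T) 0 / fst p) * (1 - max (- \<omega> T) 0 / snd p) \<le> 1" using f by (intro mult_le_one) auto
      ultimately have "(1 - max (\<omega> T) 0 / fst p) * (1 - max (- \<omega> T) 0 / snd p) * exp (1 / 2 * (1 / fst p + 1 / snd p) * L T \<omega>)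
          \<le> 1 * exp (1 / \<alpha> * \<bar>L T \<omega>\<bar>)" using f by (intro mult_mono) auto
      then have "W T p \<omega> \<le> exp (1 / \<alpha> * \<bar>L T \<omega>\<bar>)" using True by (simp add: W_def Mfac_def)
      then show ?thesis unfolding elim(2) using W_nonneg[OF w T p] by simp
    next
      case False
      then have "W T p \<omega> = 0" by (auto simp: W_def)
      then show ?thesis unfolding elim(2) by simp
    qed
  qed
  have i: "integrable \<nu> ?f" by (rule N.integrable_const_bound[OF bd fm])
  show "M_proc \<nu> L T \<omega> \<ge> 0" unfolding M by (rule integral_nonneg_AE[OF nn])
  have "ennreal (M_proc \<nu> L T \<omega>) = (\<integral>\<^sup>+p. ennreal (?f p) \<partial>\<nu>)"
    unfolding M by (rule nn_integral_eq_integral[OF i nn, symmetric])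
  also have "\<dots> = (\<integral>\<^sup>+p. ennreal (W T p \<omega>) \<partial>\<nu>)"
    by (rule nn_integral_cong_AE, rule eventually_mono[OF ind], rule arg_cong[where f = ennreal])
  finally show "ennreal (M_proc \<nu> L T \<omega>) = (\<integral>\<^sup>+p. ennreal (W T p \<omega>) \<partial>\<nu>)" .
qed

lemma Qnu_emeasure:
  assumes T: "T \<ge> 0" and A: "A \<in> sets (\<F> T)"
  shows "emeasure Q\<nu> A = (\<integral>\<^sup>+\<omega>. ennreal (M_proc \<nu> L T \<omega>) * indicator A \<omega> \<partial>P)"
proof -
  have "(LINT \<omega>|P. indicator \<Omega> \<omega> * M_proc \<nu> L T \<omega>) = 1"
    using Qnu(3)[OF T Omega_in_F] QN.prob_space space_Qnu by simp
  \<comment> \<open>The value 1 rules out non-integrability, for which the integral would be 0 by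
    convention.\<close>
  then have i: "integrable P (\<lambda>\<omega>. indicator \<Omega> \<omega> * M_proc \<nu> L T \<omega>)"
    using not_integrable_integral_eq by fastforce
  have AP: "A \<in> sets P" using A F_sub_infty[of T] by auto
  have A\<Omega>: "A \<subseteq> \<Omega>" using sets.sets_into_space[OF A] by simp
  have "integrable P (\<lambda>\<omega>. indicator A \<omega> *\<^sub>R (indicator \<Omega> \<omega> * M_proc \<nu> L T \<omega>))"
    by (rule integrable_mult_indicator[OF AP i])
  moreover have "(\<lambda>\<omega>. indicator A \<omega> *\<^sub>R (indicator \<Omega> \<omega> * M_proc \<nu> L T \<omega>)) = (\<lambda>\<omega>. indicator A \<omega> * M_proc \<nu> L T \<omega>)"
    using A\<Omega> by (auto simp: fun_eq_iff indicator_def)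
  ultimately have iA: "integrable P (\<lambda>\<omega>. indicator A \<omega> * M_proc \<nu> L T \<omega>)" by simp
  have "emeasure Q\<nu> A = ennreal (LINT \<omega>|P. indicator A \<omega> * M_proc \<nu> L T \<omega>)"
    unfolding QN.emeasure_eq_measure Qnu(3)[OF T A] ..
  also have "\<dots> = (\<integral>\<^sup>+\<omega>. ennreal (indicator A \<omega> * M_proc \<nu> L T \<omega>) \<partial>P)"
    by (rule nn_integral_eq_integral[OF iA, symmetric]) (auto intro!: AE_I2 simp: M_proc_eq(1)[OF _ T])
  also have "\<dots> = (\<integral>\<^sup>+\<omega>. ennreal (M_proc \<nu> L T \<omega>) * indicator A \<omega> \<partial>P)"
    by (intro nn_integral_cong) (auto simp: indicator_def)
  finally show ?thesis .
qed

lemma Qnu_fubini: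
  assumes T: "T \<ge> 0" and A: "A \<in> sets (\<F> T)"
  shows "emeasure Q\<nu> A = (\<integral>\<^sup>+p. (\<integral>\<^sup>+\<omega>. ennreal (W T p \<omega>) * indicator A \<omega> \<partial>P) \<partial>\<nu>)"
    and "(\<lambda>p. \<integral>\<^sup>+\<omega>. ennreal (W T p \<omega>) * indicator A \<omega> \<partial>P) \<in> borel_measurable \<nu>"
proof -
  have AP: "A \<in> sets P" using A F_sub_infty[of T] by auto
  let ?f = "\<lambda>q. ennreal (W T (fst q) (snd q)) * indicator A (snd q)"
  have fm: "?f \<in> borel_measurable (\<nu> \<Otimes>\<^sub>M P)"
    by (intro borel_measurable_times_ennreal measurable_compose[OF W_pair_measurable(1)[OF T] measurable_ennreal]
        measurable_compose[OF measurable_snd borel_measurable_indicator[OF AP]])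
  show "(\<lambda>p. \<integral>\<^sup>+\<omega>. ennreal (W T p \<omega>) * indicator A \<omega> \<partial>P) \<in> borel_measurable \<nu>"
    using borel_measurable_nn_integral_fst[OF fm] by simp
  have "emeasure Q\<nu> A = (\<integral>\<^sup>+\<omega>. (\<integral>\<^sup>+p. ennreal (W T p \<omega>) \<partial>\<nu>) * indicator A \<omega> \<partial>P)"
    unfolding Qnu_emeasure[OF assms] by (intro nn_integral_cong) (simp add: M_proc_eq(2)[OF _ T])
  also have "\<dots> = (\<integral>\<^sup>+\<omega>. (\<integral>\<^sup>+p. ?f (p, \<omega>) \<partial>\<nu>) \<partial>P)"
  proof (rule nn_integral_cong)
    fix \<omega> assume "\<omega> \<in> space P"
    then have "(\<lambda>p. ennreal (W T p \<omega>)) \<in> borel_measurable \<nu>"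
      using W_measurable(1)[OF T] by (intro measurable_compose[OF _ measurable_ennreal]) simp
    from nn_integral_multc[OF this] show "(\<integral>\<^sup>+p. ennreal (W T p \<omega>) \<partial>\<nu>) * indicator A \<omega> = (\<integral>\<^sup>+p. ?f (p, \<omega>) \<partial>\<nu>)" by simp
  qed
  also have "\<dots> = (\<integral>\<^sup>+p. (\<integral>\<^sup>+\<omega>. ?f (p, \<omega>) \<partial>P) \<partial>\<nu>)" by (rule NP.Fubini[OF fm])
  finally show "emeasure Q\<nu> A = (\<integral>\<^sup>+p. (\<integral>\<^sup>+\<omega>. ennreal (W T p \<omega>) * indicator A \<omega> \<partial>P) \<partial>\<nu>)" by simp
qed

text \<open>\<open>W\<close> is at least \<open>Ms\<close>, which has mean 1 for each p, while the
  double integral of \<open>W\<close> is the total mass 1 of \<open>Q\<nu>\<close>. Equality of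
  integrals of ordered functions forces equality, first for almost every p and then for almost every
  path. The boundary events are thus discarded without computing the law of the supremum.\<close>

lemma W_eq_Ms_AE:
  assumes T: "T > 0"
  shows "AE p in \<nu>. AE \<omega> in P. ennreal (W T p \<omega>) = ennreal (Ms (fst p) (snd p) T \<omega>)"
proof -
  have T0: "T \<ge> 0" using T by simp
  have le: "ennreal (Ms (fst p) (snd p) T \<omega>) \<le> ennreal (W T p \<omega>)" if "\<omega> \<in> \<Omega>" "0 < fst p" "0 < snd p" for p \<omega>
    using W_nonneg[OF that(1) T0 that(2,3)] by (intro ennreal_leI) (auto simp: W_def Ms_def)
  let ?g = "\<lambda>p. \<integral>\<^sup>+\<omega>. ennreal (W T p \<omega>) * indicator \<Omega> \<omega> \<partial>P"
  have g: "?g p = (\<integral>\<^sup>+\<omega>. ennreal (W T p \<omega>) \<partial>P)" for p by (intro nn_integral_cong) simp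
  have tot: "(\<integral>\<^sup>+p. ?g p \<partial>\<nu>) = 1"
    using Qnu_fubini(1)[OF T0 Omega_in_F] QN.emeasure_space_1 space_Qnu by simp
  have ge: "AE p in \<nu>. 1 \<le> ?g p"
    using AE_alpha
  proof eventually_elim
    case (elim p)
    then have p: "0 < fst p" "0 < snd p" using alpha by auto
    have "(\<integral>\<^sup>+\<omega>. ennreal (Ms (fst p) (snd p) T \<omega>) \<partial>P) \<le> (\<integral>\<^sup>+\<omega>. ennreal (W T p \<omega>) \<partial>P)"
      by (intro nn_integral_mono le p) simp
    then show ?case unfolding g Ms_total[OF p T] .
  qed
  have "AE p in \<nu>. 1 = ?g p"
    by (rule nn_integral_eq_imp_AE_eq[OF _ Qnu_fubini(2)[OF T0 Omega_in_F] ge]) (simp_all add: tot N.emeasure_space_1)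
  then show ?thesis using AE_alpha
  proof eventually_elim
    case (elim p)
    then have p: "0 < fst p" "0 < snd p" using alpha by auto
    have "AE \<omega> in P. ennreal (Ms (fst p) (snd p) T \<omega>) = ennreal (W T p \<omega>)"
    proof (rule nn_integral_eq_imp_AE_eq)
      show "AE \<omega> in P. ennreal (Ms (fst p) (snd p) T \<omega>) \<le> ennreal (W T p \<omega>)" by (rule AE_I2) (simp add: le p)
      show "(\<integral>\<^sup>+\<omega>. ennreal (Ms (fst p) (snd p) T \<omega>) \<partial>P) = (\<integral>\<^sup>+\<omega>. ennreal (W T p \<omega>) \<partial>P)"
        unfolding Ms_total[OF p T] using elim(1) unfolding g .
      show "(\<integral>\<^sup>+\<omega>. ennreal (Ms (fst p) (snd p) T \<omega>) \<partial>P) \<noteq> \<infinity>" unfolding Ms_total[OF p T] by simp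
    qed (use Ms_measurable[OF T0] W_measurable(2)[OF T0] in \<open>auto intro: measurable_compose[OF _ measurable_ennreal]\<close>)
    then show ?case by eventually_elim simp
  qed
qed

lemma Qnu_mixture_F:
  assumes T: "T > 0" and A: "A \<in> sets (\<F> T)"
  shows "emeasure Q\<nu> A = (\<integral>\<^sup>+p. emeasure (Q (fst p) (snd p)) A \<partial>\<nu>)"
  unfolding Qnu_fubini(1)[OF less_imp_le[OF T] A]
proof (rule nn_integral_cong_AE)
  show "AE p in \<nu>. (\<integral>\<^sup>+\<omega>. ennreal (W T p \<omega>) * indicator A \<omega> \<partial>P) = emeasure (Q (fst p) (snd p)) A"
    using W_eq_Ms_AE[OF T] AE_alpha
  proof eventually_elim
    case (elim p)
    then have p: "0 < fst p" "0 < snd p" using alpha by auto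
    show ?case unfolding Q_density[OF p T A]
      by (rule nn_integral_cong_AE) (use elim(1) in \<open>eventually_elim, simp\<close>)
  qed
qed

abbreviation quadrant :: "(real \<times> real) set" where
  "quadrant \<equiv> {0<..} \<times> {0<..}"

lemma cyl_in_F: "A \<in> cyl {0..} \<Longrightarrow> \<exists>T>0. A \<in> sets (\<F> T)"
proof -
  assume "A \<in> cyl {0..}"
  then obtain J where J: "A = {\<omega> \<in> \<Omega>. \<forall>p\<in>J. \<omega> (fst p) \<le> snd p}" "finite J" "fst ` J \<subseteq> {0..}"
    unfolding cyl_def by auto
  define T where "T = Max (insert 1 (fst ` J))"
  have "1 \<le> T" unfolding T_def using J by (intro Max_ge) auto
  then have "T > 0" by linarith
  have "fst p \<le> T" if "p \<in> J" for p unfolding T_def using J that by (intro Max_ge) auto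
  then have "fst ` J \<subseteq> {0..T}" using J by auto
  then have "A \<in> cyl {0..T}" unfolding cyl_def using J by blast
  then have "A \<in> sets (\<F> T)" unfolding coord_filt_def by (rule sets_cylD)
  then show ?thesis using \<open>T > 0\<close> by blast
qed

text \<open>Measurability in p is checked on cylinders. Each of them lies in some
  \<open>\<F> T\<close>, where the density formula turns the probability into a parameter integral.
  The domain is the open quadrant because Q is specified for positive parameters.\<close>

lemma kernel:
  "(\<lambda>p. Q (fst p) (snd p)) \<in> measurable (restrict_space borel quadrant) (prob_algebra \<F>\<^sub>\<infinity>)"
proof (rule measurable_prob_algebra_generated[where G = "cyl {0..}" and \<Omega> = \<Omega>])
  show "sets \<F>\<^sub>\<infinity> = sigma_sets \<Omega> (cyl {0..})" unfolding coord_filt_infty_def by (rule sets_coord_sigma_cyl)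
  show "Int_stable (cyl {0..})" by (rule Int_stable_cyl)
  show "cyl {0..} \<subseteq> Pow \<Omega>" by (auto simp: cyl_def)
  have sp: "0 < fst p \<and> 0 < snd p" if "p \<in> space (restrict_space borel quadrant)" for p
    using that by (auto simp: space_restrict_space)
  show "prob_space (Q (fst p) (snd p))" if "p \<in> space (restrict_space borel quadrant)" for p
    using sp[OF that] by (intro Q_prob) auto
  show "sets (Q (fst p) (snd p)) = sets \<F>\<^sub>\<infinity>" if "p \<in> space (restrict_space borel quadrant)" for p
    using sp[OF that] by (intro Q_sets) auto
  fix A assume "A \<in> cyl {0..}"
  then obtain T where T: "T > 0" "A \<in> sets (\<F> T)" using cyl_in_F by blast
  have AP: "A \<in> sets P" using T F_sub_infty[of T] by auto
  have fm: "(\<lambda>q. ennreal (Ms (fst (fst q)) (snd (fst q)) T (snd q)) * indicator A (snd q)) \<in> borel_measurable (borel \<Otimes>\<^sub>M P)"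
    using T by (intro borel_measurable_times_ennreal measurable_compose[OF Ms_measurable_pair(1) measurable_ennreal]
        measurable_compose[OF measurable_snd borel_measurable_indicator[OF AP]]) simp
  have "(\<lambda>p. \<integral>\<^sup>+\<omega>. ennreal (Ms (fst p) (snd p) T \<omega>) * indicator A \<omega> \<partial>P) \<in> borel_measurable borel"
    using borel_measurable_nn_integral_fst[OF fm] by simp
  then have "(\<lambda>p. \<integral>\<^sup>+\<omega>. ennreal (Ms (fst p) (snd p) T \<omega>) * indicator A \<omega> \<partial>P) \<in> borel_measurable (restrict_space borel quadrant)"
    by (rule measurable_restrict_space1)
  moreover have "(\<lambda>p. emeasure (Q (fst p) (snd p)) A) \<in> borel_measurable (restrict_space borel quadrant) \<longleftrightarrow>
     (\<lambda>p. \<integral>\<^sup>+\<omega>. ennreal (Ms (fst p) (snd p) T \<omega>) * indicator A \<omega> \<partial>P) \<in> borel_measurable (restrict_space borel quadrant)"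
    by (rule measurable_cong) (use sp Q_density[OF _ _ T] in blast)
  ultimately show "(\<lambda>p. emeasure (Q (fst p) (snd p)) A) \<in> borel_measurable (restrict_space borel quadrant)" by simp
qed

lemma kernel_emeasure:
  "\<Gamma> \<in> sets \<F>\<^sub>\<infinity> \<Longrightarrow> (\<lambda>p. emeasure (Q (fst p) (snd p)) \<Gamma>) \<in> borel_measurable (restrict_space borel quadrant)"
  by (rule measurable_emeasure_kernel[OF measurable_prob_algebraD[OF kernel]])

lemma quadrant_borel: "quadrant \<in> sets \<nu>"
  unfolding nu(2) by (intro borel_open open_Times) auto

lemma AE_quadrant: "AE p in \<nu>. p \<in> quadrant"
  using AE_alpha by eventually_elim (use alpha in \<open>auto simp: mem_Times_iff\<close>)

lemma mixture_restrict:
  "(\<integral>\<^sup>+p. f p \<partial>restrict_space \<nu> quadrant) = (\<integral>\<^sup>+p. f p \<partial>\<nu>)"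
proof -
  have "(\<integral>\<^sup>+p. f p \<partial>restrict_space \<nu> quadrant) = (\<integral>\<^sup>+p. f p * indicator quadrant p \<partial>\<nu>)"
    by (rule nn_integral_restrict_space) (simp add: space_nu quadrant_borel)
  also have "\<dots> = (\<integral>\<^sup>+p. f p \<partial>\<nu>)"
    by (rule nn_integral_cong_AE) (use AE_quadrant in \<open>eventually_elim, simp\<close>)
  finally show ?thesis .
qed

text \<open>The right-hand side is the composition of \<nu> with the kernel, hence a measure, so
  agreement on cylinders suffices. The restriction to the open quadrant costs nothing because its
  complement is \<nu>-null.\<close>

lemma Qnu_mixture:
  assumes "\<Gamma> \<in> sets \<F>\<^sub>\<infinity>"
  shows "emeasure Q\<nu> \<Gamma> = (\<integral>\<^sup>+p. emeasure (Q (fst p) (snd p)) \<Gamma> \<partial>\<nu>)"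
proof -
  let ?K = "\<lambda>p. Q (fst p) (snd p)" and ?R = "restrict_space \<nu> quadrant"
  have "sets ?R = sets (restrict_space borel quadrant)" by (rule sets_restrict_space_cong[OF nu(2)])
  then have K: "?K \<in> measurable ?R (subprob_algebra \<F>\<^sub>\<infinity>)"
    using measurable_prob_algebraD[OF kernel] measurable_cong_sets by blast
  have sR: "space ?R \<noteq> {}"
  proof -
    have "(1, 1) \<in> space ?R" by (simp add: space_restrict_space space_nu)
    then show ?thesis by blast
  qed
  have b: "emeasure (?R \<bind> ?K) A = (\<integral>\<^sup>+p. emeasure (?K p) A \<partial>\<nu>)" if "A \<in> sets \<F>\<^sub>\<infinity>" for A
    unfolding emeasure_bind[OF sR K that] by (rule mixture_restrict)
  have "Q\<nu> = ?R \<bind> ?K"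
  proof (rule coord_sigma_measure_eqI[where T = "{0..}"])
    show "sets Q\<nu> = sets (coord_sigma {0..})" using Qnu(2) by (simp add: coord_filt_infty_def)
    show "sets (?R \<bind> ?K) = sets (coord_sigma {0..})"
      using sets_bind[OF sets_kernel[OF K] sR] by (simp add: coord_filt_infty_def)
    show "emeasure Q\<nu> \<Omega> < \<infinity>" using QN.emeasure_space_1 space_Qnu by simp
    fix A assume "A \<in> cyl {0..}"
    then obtain T where T: "T > 0" "A \<in> sets (\<F> T)" using cyl_in_F by blast
    then have "A \<in> sets \<F>\<^sub>\<infinity>" using F_sub_infty[of T] by auto
    then show "emeasure Q\<nu> A = emeasure (?R \<bind> ?K) A" using Qnu_mixture_F[OF T] b by simp
  qed
  then show ?thesis using b[OF assms] by simp
qed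

lemma Qnu_null:
  assumes "\<Gamma> \<in> sets \<F>\<^sub>\<infinity>" and z: "\<And>s i. s > 0 \<Longrightarrow> i > 0 \<Longrightarrow> emeasure (Q s i) \<Gamma> = 0"
  shows "emeasure Q\<nu> \<Gamma> = 0"
proof -
  have "emeasure Q\<nu> \<Gamma> = (\<integral>\<^sup>+p. 0 \<partial>\<nu>)"
    unfolding Qnu_mixture[OF assms(1)]
    by (rule nn_integral_cong_AE) (use AE_quadrant in \<open>eventually_elim, auto simp: z\<close>)
  then show ?thesis by simp
qed

lemma Qnu_AE_not:
  assumes "{\<omega> \<in> \<Omega>. R \<omega>} \<in> sets \<F>\<^sub>\<infinity>" "\<And>s i. s > 0 \<Longrightarrow> i > 0 \<Longrightarrow> emeasure (Q s i) {\<omega> \<in> \<Omega>. R \<omega>} = 0"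
  shows "AE \<omega> in Q\<nu>. \<not> R \<omega>"
proof (rule AE_I)
  show "{\<omega> \<in> space Q\<nu>. \<not> \<not> R \<omega>} \<subseteq> {\<omega> \<in> \<Omega>. R \<omega>}" using space_Qnu by auto
  show "emeasure Q\<nu> {\<omega> \<in> \<Omega>. R \<omega>} = 0" by (rule Qnu_null[OF assms])
qed (use assms Qnu(2) in simp)

text \<open>On \<open>\<F> n\<close> the mixture has a density with respect to \<open>P\<close>, so
  the null set of \<open>\<F> n\<close> that covers the failure remains null.\<close>

lemma Qnu_L_mono: "AE \<omega> in Q\<nu>. \<forall>n. mono_on {0..real n} (\<lambda>t. L t \<omega>)"
  unfolding AE_all_countable
proof
  fix n
  obtain N where N: "N \<in> sets (\<F> (real n))" "emeasure P N = 0" "{\<omega> \<in> \<Omega>. \<not> mono_on {0..real n} (\<lambda>t. L t \<omega>)} \<subseteq> N"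
    using L_not_mono_null by blast
  have "N \<in> null_sets P" using N F_sub_infty[of "real n"] by (auto simp: null_sets_def)
  then have "emeasure Q\<nu> N = 0" unfolding Qnu_emeasure[OF of_nat_0_le_iff N(1)] by (rule nn_integral_null_set)
  then show "AE \<omega> in Q\<nu>. mono_on {0..real n} (\<lambda>t. L t \<omega>)"
    by (intro AE_I[where N = N]) (use N F_sub_infty[of "real n"] Qnu(2) space_Qnu in auto)
qed

text \<open>Unboundedness along integer times becomes a limit in continuous time through
  monotonicity on each [0, m].\<close>

lemma Qnu_L_tendsto: "AE \<omega> in Q\<nu>. ((\<lambda>t. ereal (L t \<omega>)) \<longlongrightarrow> \<infinity>) at_top"
proof -
  have "AE \<omega> in Q\<nu>. \<forall>k. \<not> (\<forall>n. L (real (Suc n)) \<omega> \<le> real k)"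
    unfolding AE_all_countable by (intro allI Qnu_AE_not L_bounded_in_F Q_L_bounded)
  then show ?thesis using Qnu_L_mono
  proof eventually_elim
    case (elim \<omega>)
    show ?case
    proof (rule tendsto_PInfty[THEN iffD2], intro allI)
      fix r :: real
      obtain k where k: "r \<le> real k" using real_arch_simple by blast
      obtain n where n: "L (real (Suc n)) \<omega> > real k" using elim(1) by (auto simp: not_le)
      show "\<forall>\<^sub>F t in at_top. ereal r < ereal (L t \<omega>)"
        using eventually_ge_at_top[of "real (Suc n)"]
      proof eventually_elim
        case t: (elim t)
        obtain m where m: "t \<le> real m" using real_arch_simple by blast
        have "L (real (Suc n)) \<omega> \<le> L t \<omega>"
          by (rule mono_onD[OF elim(2)[rule_format, of m]]) (use t m in auto)
        then show ?case using n k by simp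
      qed
    qed
  qed
qed

lemma Qnu_limits_measurable:
  "limit_infty sup_proc \<in> borel_measurable Q\<nu>" "limit_infty inf_proc \<in> borel_measurable Q\<nu>"
  unfolding measurable_cong_sets[OF Qnu(2) refl] by (rule limit_infty_measurable)+

lemma Qnu_limits_finite: "AE \<omega> in Q\<nu>. \<bar>limit_infty sup_proc \<omega>\<bar> \<noteq> \<infinity> \<and> \<bar>limit_infty inf_proc \<omega>\<bar> \<noteq> \<infinity>"
proof -
  let ?R = "\<lambda>\<omega>. \<not> (\<bar>limit_infty sup_proc \<omega>\<bar> \<noteq> \<infinity> \<and> \<bar>limit_infty inf_proc \<omega>\<bar> \<noteq> \<infinity>)"
  note [measurable] = limit_infty_measurable
  have "{\<omega> \<in> space \<F>\<^sub>\<infinity>. ?R \<omega>} \<in> sets \<F>\<^sub>\<infinity>" by measurable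
  then have m: "{\<omega> \<in> \<Omega>. ?R \<omega>} \<in> sets \<F>\<^sub>\<infinity>" by simp
  have "AE \<omega> in Q\<nu>. \<not> ?R \<omega>"
  proof (rule Qnu_AE_not[OF m])
    fix s i :: real assume si: "s > 0" "i > 0"
    have "AE \<omega> in Q s i. \<not> ?R \<omega>" using Q_limits[OF si] by eventually_elim simp
    then show "emeasure (Q s i) {\<omega> \<in> \<Omega>. ?R \<omega>} = 0"
      using m Q_sets[OF si] Q_space[OF si] by (subst (asm) AE_iff_measurable[of "{\<omega> \<in> \<Omega>. ?R \<omega>}"]) auto
  qed
  then show ?thesis by simp
qed

text \<open>Under each diffusion law the pair of limits is almost surely the constant p, so the
  event that the pair lies in B has probability \<open>indicator B p\<close>; integration over p
  gives the \<nu>-measure of B.\<close>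

lemma Qnu_limits_law:
  "distr Q\<nu> borel (\<lambda>\<omega>. (real_of_ereal (limit_infty sup_proc \<omega>), real_of_ereal (limit_infty inf_proc \<omega>))) = \<nu>"
proof (rule measure_eqI)
  let ?h = "\<lambda>\<omega>. (real_of_ereal (limit_infty sup_proc \<omega>), real_of_ereal (limit_infty inf_proc \<omega>))"
  have hF: "?h \<in> borel_measurable \<F>\<^sub>\<infinity>"
    by (intro borel_measurable_Pair borel_measurable_real_of_ereal limit_infty_measurable)
  have hQ: "?h \<in> borel_measurable Q\<nu>" unfolding measurable_cong_sets[OF Qnu(2) refl] by (rule hF)
  show "sets (distr Q\<nu> borel ?h) = sets \<nu>" by (simp add: nu)
  fix B assume "B \<in> sets (distr Q\<nu> borel ?h)"
  then have B: "B \<in> sets borel" by simp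
  let ?E = "?h -` B \<inter> \<Omega>"
  have E: "?E \<in> sets \<F>\<^sub>\<infinity>" using measurable_sets[OF hF B] by simp
  have one: "emeasure (Q (fst p) (snd p)) ?E = indicator B p" if p: "p \<in> quadrant" for p
  proof -
    have si: "fst p > 0" "snd p > 0" using p by (auto simp: mem_Times_iff)
    interpret Qp: prob_space "Q (fst p) (snd p)" by (rule Q_prob[OF si])
    have EQ: "?E \<in> sets (Q (fst p) (snd p))" using E Q_sets[OF si] by simp
    have h: "AE \<omega> in Q (fst p) (snd p). ?h \<omega> = p" using Q_limits[OF si] by eventually_elim simp
    show ?thesis
    proof (cases "p \<in> B")
      case True
      have "AE \<omega> in Q (fst p) (snd p). \<omega> \<in> ?E"
        using h AE_space by eventually_elim (use True Q_space[OF si] in auto)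
      then have "emeasure (Q (fst p) (snd p)) ?E = 1" by (subst Qp.emeasure_eq_1_AE[OF EQ]) auto
      then show ?thesis using True by simp
    next
      case False
      have "AE \<omega> in Q (fst p) (snd p). \<omega> \<notin> ?E" using h by eventually_elim (use False in auto)
      then have "emeasure (Q (fst p) (snd p)) ?E = 0"
        using EQ by (subst (asm) AE_iff_measurable[of ?E]) (auto simp: Q_space[OF si])
      then show ?thesis using False by simp
    qed
  qed
  have "emeasure (distr Q\<nu> borel ?h) B = emeasure Q\<nu> ?E" using emeasure_distr[OF hQ B] space_Qnu by simp
  also have "\<dots> = (\<integral>\<^sup>+p. indicator B p \<partial>\<nu>)"
    unfolding Qnu_mixture[OF E] by (rule nn_integral_cong_AE, rule eventually_mono[OF AE_quadrant one])
  also have "\<dots> = emeasure \<nu> B" by (rule nn_integral_indicator) (simp add: nu B)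
  finally show "emeasure (distr Q\<nu> borel ?h) B = emeasure \<nu> B" .
qed

end

theorem theorem5p3:
  fixes \<alpha> :: real
    and \<nu> :: "(real \<times> real) measure"
    and P\<^sub>0 Q\<^sub>\<nu> :: "(real \<Rightarrow> real) measure"
    and L :: "real \<Rightarrow> (real \<Rightarrow> real) \<Rightarrow> real"
    and Q :: "real \<Rightarrow> real \<Rightarrow> (real \<Rightarrow> real) measure"
  assumes P0: "wiener_measure 0 P\<^sub>0"
    and L: "local_time_zero P\<^sub>0 L"
    and Q: "\<And>s i. s > 0 \<Longrightarrow> i > 0 \<Longrightarrow> sde_law P\<^sub>0 s i (Q s i)"
    and alpha: "\<alpha> > 0"
    and nu: "prob_space \<nu>" "sets \<nu> = sets borel" "emeasure \<nu> ({\<alpha>..} \<times> {\<alpha>..}) = 1"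
    and Qnu: "prob_space Q\<^sub>\<nu>" "sets Q\<^sub>\<nu> = sets \<F>\<^sub>\<infinity>"
      "\<And>t \<Gamma>. t \<ge> 0 \<Longrightarrow> \<Gamma> \<in> sets (\<F> t) \<Longrightarrow>
         measure Q\<^sub>\<nu> \<Gamma> = (LINT \<omega>|P\<^sub>0. indicator \<Gamma> \<omega> * M_proc \<nu> L t \<omega>)"
  shows
    "((AE \<omega> in Q\<^sub>\<nu>. ((\<lambda>t. ereal (L t \<omega>)) \<longlongrightarrow> \<infinity>) at_top) \<and>
      limit_infty sup_proc \<in> borel_measurable Q\<^sub>\<nu> \<and>
      limit_infty inf_proc \<in> borel_measurable Q\<^sub>\<nu> \<and>
      (AE \<omega> in Q\<^sub>\<nu>. \<bar>limit_infty sup_proc \<omega>\<bar> \<noteq> \<infinity> \<and> \<bar>limit_infty inf_proc \<omega>\<bar> \<noteq> \<infinity>) \<and>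
      distr Q\<^sub>\<nu> borel
        (\<lambda>\<omega>. (real_of_ereal (limit_infty sup_proc \<omega>), real_of_ereal (limit_infty inf_proc \<omega>)))
        = \<nu>) \<and>
     (\<forall>\<Gamma> \<in> sets \<F>\<^sub>\<infinity>.
        (\<lambda>(s, i). emeasure (Q s i) \<Gamma>) \<in> borel_measurable (restrict_space borel ({0<..} \<times> {0<..})) \<and>
        emeasure Q\<^sub>\<nu> \<Gamma> = (\<integral>\<^sup>+p\<in>{0..} \<times> {0..}. (case p of (s, i) \<Rightarrow> emeasure (Q s i) \<Gamma>) \<partial>\<nu>))"
proof -
  have "prob_space P\<^sub>0" using P0 by (simp add: wiener_measure_def)
  then interpret mixture P\<^sub>0 L Q \<alpha> \<nu> Q\<^sub>\<nu>
    using P0 L Q alpha nu Qnu by (intro mixture.intro diffusion_family.intro wiener_local_time.intro wiener.intro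
        wiener_axioms.intro wiener_local_time_axioms.intro diffusion_family_axioms.intro mixture_axioms.intro)
  have "(\<lambda>(s, i). emeasure (Q s i) \<Gamma>) \<in> borel_measurable (restrict_space borel ({0<..} \<times> {0<..})) \<and>
      emeasure Q\<^sub>\<nu> \<Gamma> = (\<integral>\<^sup>+p\<in>{0..} \<times> {0..}. (case p of (s, i) \<Rightarrow> emeasure (Q s i) \<Gamma>) \<partial>\<nu>)"
    if \<Gamma>: "\<Gamma> \<in> sets \<F>\<^sub>\<infinity>" for \<Gamma>
  proof
    show "(\<lambda>(s, i). emeasure (Q s i) \<Gamma>) \<in> borel_measurable (restrict_space borel ({0<..} \<times> {0<..}))"
      using kernel_emeasure[OF \<Gamma>] by (simp add: split_beta')
    \<comment> \<open>Almost every pair lies in the open quadrant, so the indicator of the closed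
      quadrant is 1 under \<nu>.\<close>
    show "emeasure Q\<^sub>\<nu> \<Gamma> = (\<integral>\<^sup>+p\<in>{0..} \<times> {0..}. (case p of (s, i) \<Rightarrow> emeasure (Q s i) \<Gamma>) \<partial>\<nu>)"
      unfolding Qnu_mixture[OF \<Gamma>]
      by (rule nn_integral_cong_AE) (use AE_quadrant in \<open>eventually_elim, auto simp: split_beta' indicator_def\<close>)
  qed
  then show ?thesis
    using Qnu_L_tendsto Qnu_limits_measurable Qnu_limits_finite Qnu_limits_law by blast
qed

end
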